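(* Let $(M,\Pi)$ be a smooth Poisson manifold of dimension $n=2r+s$, and let $\rho:G\times M\to M$ be a smooth action of a compact Lie group $G$ preserving the Poisson structure $\Pi$. Let $m\in M$ be a fixed point of the $G$-action, and let $p_1,\dots,p_r$ be smooth $G$-invariant functions defined on a ($G$-invariant) neighborhood of $m$, vanishing at $m$, pairwise in involution ($\{p_i,p_j\}=0$ for all $i,j$), and whose Hamiltonian vector fields are linearly independent at $m$. Then there exist a ($G$-invariant) neighborhood $U$ of $m$ and smooth functions $q_1,\dots,q_r,z_1,\dots,z_s$ on $U$ such that: (1) the $n$ functions $(p_1,q_1,\dots,p_r,q_r,z_1,\dots,z_s)$ form a system of local coordinates on $U$, centered at $m$; (2) in these coordinates $$\Pi=\sum_{i=1}^r\frac{\partial}{\partial q_i}\wedge\frac{\partial}{\partial p_i}+\sum_{i,j=1}^s g_{ij}(z)\,\frac{\partial}{\partial z_i}\wedge\frac{\partial}{\partial z_j},$$ where each $g_{ij}$ is a smooth function of $z=(z_1,\dots,z_s)$ only, i.e. independent of $p_1,\dots,p_r,q_1,\dots,q_r$; (3) there exists a group homomorphism $g\mapsto A(g)$ from $G$ to the group of invertible real $s\times s$ matrices such that, in these coordinates, the $G$-action on $U$ is given for all $g\in G$ by $$\rho\big(g,(p_1,q_1,\dots,p_r,q_r,z_1,\dots,z_s)\big)=\Big(p_1,q_1,\dots,p_r,q_r,\sum_{i=1}^s m_{i,1}(g)z_i,\dots,\sum_{i=1}^s m_{i,s}(g)z_i\Big),$$ where the numbers $m_{i,j}(g)$ are the entries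 of $A(g)$, indexed so that $m_{i,j}(g)$ is the entry of $A(g)$ in row $j$ and column $i$ (i.e. $z\mapsto A(g)z$). Moreover, the rank of $\Pi$ at $m$ is $2r$ if and only if the matrix $(g_{ij}(z))_{i,j=1}^s$ vanishes at $z=0$.
   Context: All objects are smooth ($C^\infty$). $\{\cdot,\cdot\}$ is the Poisson bracket associated with the bivector $\Pi$; the term $\sum_i \frac{\partial}{\partial q_i}\wedge\frac{\partial}{\partial p_i}$ corresponds to $\{q_i,p_j\}=\delta_{ij}$, $\{q_i,q_j\}=\{p_i,p_j\}=0$. The matrix $(g_{ij})$ of coefficients is taken skew-symmetric. A function $f$ is $G$-invariant if $f(\rho(g,x))=f(x)$ for all $g\in G$ and all $x$ in its domain. The rank of $\Pi$ at $m$ is the rank of the linear map $\Pi_m^\#:T_m^*M\to T_mM$. Coordinates are centered at $m$ if they all vanish at $m$. *)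

theory Defs
  imports "HOL-Analysis.Analysis" "HOL-Algebra.Group_Action" "Jordan_Normal_Form.Matrix"
begin

section \<open>Smooth maps between normed spaces\<close>

text \<open>
  For an open set \<open>S\<close> of a finite-dimensional space, \<open>Ck_on k f S\<close> says that \<open>f\<close> is
  \<open>k\<close> times continuously differentiable on \<open>S\<close>: the derivative of \<open>f\<close> in every fixed direction
  has one order of regularity less. All uses below are with open \<open>S\<close>.
\<close>

primrec Ck_on :: "nat \<Rightarrow> ('a::real_normed_vector \<Rightarrow> 'b::real_normed_vector) \<Rightarrow> 'a set \<Rightarrow> bool"
where
  "Ck_on 0 f S \<longleftrightarrow> continuous_on S f"
| "Ck_on (Suc k) f S \<longleftrightarrow> (\<forall>x\<in>S. f differentiable (at x)) \<and>
     (\<forall>v. Ck_on k (\<lambda>x. frechet_derivative f (at x) v) S)"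

definition smooth_on :: "('a::real_normed_vector \<Rightarrow> 'b::real_normed_vector) \<Rightarrow> 'a set \<Rightarrow> bool" where
  "smooth_on f S \<longleftrightarrow> (\<forall>k. Ck_on k f S)"


section \<open>Smooth manifolds\<close>

text \<open>
  A chart on a topological space is a pair of an open set \<open>U\<close> and a map that is, on \<open>U\<close>, a
  homeomorphism onto an open subset of the model space \<open>'e\<close>; its values outside \<open>U\<close> are
  irrelevant.
\<close>

type_synonym ('m, 'e) chart = "'m set \<times> ('m \<Rightarrow> 'e)"

definition is_chart :: "'m topology \<Rightarrow> ('m, 'e::real_normed_vector) chart \<Rightarrow> bool" where
  "is_chart X c \<longleftrightarrow> openin X (fst c) \<and> open (snd c ` fst c) \<and>
     homeomorphic_map (subtopology X (fst c)) (top_of_set (snd c ` fst c)) (snd c)"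

abbreviation chart_inv :: "('m, 'e) chart \<Rightarrow> 'e \<Rightarrow> 'm" where
  "chart_inv c \<equiv> inv_into (fst c) (snd c)"

definition compatible_charts ::
  "('m, 'e::real_normed_vector) chart \<Rightarrow> ('m, 'e) chart \<Rightarrow> bool" where
  "compatible_charts c d \<longleftrightarrow>
     smooth_on (snd d \<circ> chart_inv c) (snd c ` (fst c \<inter> fst d)) \<and>
     smooth_on (snd c \<circ> chart_inv d) (snd d ` (fst c \<inter> fst d))"

text \<open>
  The smooth structure is the maximal atlas. The model space is only required to be a
  finite-dimensional \<open>real_normed_vector\<close>, because \<open>euclidean_space\<close> types have positive
  dimension: a one-element model space gives the zero-dimensional manifolds, hence among the
  compact Lie groups below the finite groups.
\<close>

definition smooth_manifold ::
  "'m topology \<Rightarrow> ('m, 'e::real_normed_vector) chart set \<Rightarrow> bool" where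
  "smooth_manifold X \<A> \<longleftrightarrow>
     Hausdorff_space X \<and> second_countable X \<and>
     (\<exists>B::'e set. finite B \<and> span B = UNIV) \<and>
     (\<forall>c\<in>\<A>. is_chart X c) \<and>
     (\<Union>c\<in>\<A>. fst c) = topspace X \<and>
     (\<forall>c\<in>\<A>. \<forall>d\<in>\<A>. compatible_charts c d) \<and>
     (\<forall>c. is_chart X c \<and> (\<forall>d\<in>\<A>. compatible_charts c d) \<longrightarrow> c \<in> \<A>)"

definition smooth_fun_on ::
  "('m, 'e::real_normed_vector) chart set \<Rightarrow> 'm set \<Rightarrow> ('m \<Rightarrow> 'b::real_normed_vector) \<Rightarrow> bool" where
  "smooth_fun_on \<A> W f \<longleftrightarrow> (\<forall>c\<in>\<A>. smooth_on (f \<circ> chart_inv c) (snd c ` (fst c \<inter> W)))"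

definition smooth_map ::
  "'m topology \<Rightarrow> ('m, 'e::real_normed_vector) chart set \<Rightarrow>
   'k topology \<Rightarrow> ('k, 'f::real_normed_vector) chart set \<Rightarrow> ('m \<Rightarrow> 'k) \<Rightarrow> bool" where
  "smooth_map X \<A> Y \<B> F \<longleftrightarrow> continuous_map X Y F \<and>
     (\<forall>c\<in>\<A>. \<forall>d\<in>\<B>. smooth_on (snd d \<circ> F \<circ> chart_inv c) (snd c ` (fst c \<inter> F -` fst d)))"

text \<open>
  The product charts form an atlas (not a maximal one) of the product manifold, which is all
  that \<open>smooth_map\<close> needs.
\<close>

definition prod_atlas ::
  "('m, 'e) chart set \<Rightarrow> ('k, 'f) chart set \<Rightarrow> ('m \<times> 'k, 'e \<times> 'f) chart set" where
  "prod_atlas \<A> \<B> = {(fst c \<times> fst d, map_prod (snd c) (snd d)) |c d. c \<in> \<A> \<and> d \<in> \<B>}"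


section \<open>Compact Lie groups and smooth actions\<close>

definition lie_group ::
  "('g, 'b) monoid_scheme \<Rightarrow> 'g topology \<Rightarrow> ('g, 'e::real_normed_vector) chart set \<Rightarrow> bool" where
  "lie_group G T \<G> \<longleftrightarrow> group G \<and> carrier G = topspace T \<and> smooth_manifold T \<G> \<and>
     smooth_map (prod_topology T T) (prod_atlas \<G> \<G>) T \<G> (\<lambda>(g, h). g \<otimes>\<^bsub>G\<^esub> h) \<and>
     smooth_map T \<G> T \<G> (\<lambda>g. inv\<^bsub>G\<^esub> g)"

definition compact_lie_group ::
  "('g, 'b) monoid_scheme \<Rightarrow> 'g topology \<Rightarrow> ('g, 'e::real_normed_vector) chart set \<Rightarrow> bool" where
  "compact_lie_group G T \<G> \<longleftrightarrow> lie_group G T \<G> \<and> compact_space T"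

definition smooth_action ::
  "('g, 'b) monoid_scheme \<Rightarrow> 'g topology \<Rightarrow> ('g, 'e::real_normed_vector) chart set \<Rightarrow>
   'm topology \<Rightarrow> ('m, 'f::real_normed_vector) chart set \<Rightarrow> ('g \<Rightarrow> 'm \<Rightarrow> 'm) \<Rightarrow> bool" where
  "smooth_action G T \<G> X \<A> \<rho> \<longleftrightarrow> group_action G (topspace X) \<rho> \<and>
     smooth_map (prod_topology T X) (prod_atlas \<G> \<A>) X \<A> (\<lambda>(g, x). \<rho> g x)"


section \<open>Bivector fields\<close>

text \<open>
  From here on manifolds are modelled on \<open>real ^ 'n\<close>. Tangent vectors \<open>\<Sum>\<^sub>k v $ k \<partial>\<^sub>k\<close> and
  covectors \<open>\<Sum>\<^sub>k \<xi> $ k dx\<^sub>k\<close> at a point are represented by their components in a chart around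
  that point.

  \<open>tangent_matrix c d F x\<close> is the matrix of the tangent map of \<open>F\<close> at \<open>x\<close> with respect to the
  chart \<open>c\<close> at \<open>x\<close> and the chart \<open>d\<close> at \<open>F x\<close>.
\<close>

definition tangent_matrix ::
  "('m, real ^ 'n) chart \<Rightarrow> ('m, real ^ 'n) chart \<Rightarrow> ('m \<Rightarrow> 'm) \<Rightarrow> 'm \<Rightarrow> real ^ 'n ^ 'n" where
  "tangent_matrix c d F x = jacobian (snd d \<circ> F \<circ> chart_inv c) (at (snd c x))"

definition differential ::
  "('m, real ^ 'n) chart \<Rightarrow> ('m \<Rightarrow> real) \<Rightarrow> 'm \<Rightarrow> real ^ 'n" where
  "differential c f x = (\<chi> k. frechet_derivative (f \<circ> chart_inv c) (at (snd c x)) (axis k 1))"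

text \<open>
  A bivector field \<open>\<pi>\<close> assigns to each chart \<open>c\<close> of the smooth structure its component matrix
  \<open>\<pi> c x $ k $ l = \<pi>\<^sub>x(dx\<^sub>k, dx\<^sub>l)\<close>, for \<open>x\<close> in the domain of \<open>c\<close>. The components are smooth,
  skew-symmetric and obey the transformation law of contravariant 2-tensors.
\<close>

type_synonym ('m, 'n) bivector_field = "('m, real ^ 'n) chart \<Rightarrow> 'm \<Rightarrow> real ^ 'n ^ 'n"

definition bivector_field ::
  "('m, real ^ 'n) chart set \<Rightarrow> ('m, 'n) bivector_field \<Rightarrow> bool" where
  "bivector_field \<A> \<pi> \<longleftrightarrow>
     (\<forall>c\<in>\<A>. smooth_fun_on \<A> (fst c) (\<pi> c)) \<and>
     (\<forall>c\<in>\<A>. \<forall>x\<in>fst c. transpose (\<pi> c x) = - \<pi> c x) \<and>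
     (\<forall>c\<in>\<A>. \<forall>d\<in>\<A>. \<forall>x\<in>fst c \<inter> fst d.
        \<pi> d x = tangent_matrix c d id x ** \<pi> c x ** transpose (tangent_matrix c d id x))"

text \<open>The components of \<open>v \<and> w = v \<otimes> w - w \<otimes> v\<close>.\<close>

definition wedge :: "real ^ 'n \<Rightarrow> real ^ 'n \<Rightarrow> real ^ 'n ^ 'n" where
  "wedge v w = (\<chi> k l. v $ k * w $ l - w $ k * v $ l)"

text \<open>
  \<open>sharp \<pi> c x\<close> is \<open>\<pi>\<^sub>x\<^sup>#\<close> in the dual bases of the cotangent and the tangent space at \<open>x\<close> given
  by \<open>c\<close>, with the convention \<open>\<eta>(\<pi>\<^sup>#(\<xi>)) = \<pi>(\<xi>, \<eta>)\<close>.
\<close>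

definition sharp ::
  "('m, 'n) bivector_field \<Rightarrow> ('m, real ^ 'n) chart \<Rightarrow> 'm \<Rightarrow> real ^ 'n \<Rightarrow> real ^ 'n" where
  "sharp \<pi> c x \<xi> = \<xi> v* \<pi> c x"

text \<open>
  Intrinsic objects at \<open>x\<close> are computed in an arbitrarily selected chart around \<open>x\<close>; the results
  do not depend on the selection (see \<open>poisson_bracket_chart\<close> and \<open>bivector_rank_chart\<close>).
\<close>

definition chart_at :: "('m, 'e) chart set \<Rightarrow> 'm \<Rightarrow> ('m, 'e) chart" where
  "chart_at \<A> x = (SOME c. c \<in> \<A> \<and> x \<in> fst c)"

definition hamiltonian_vf ::
  "('m, real ^ 'n) chart set \<Rightarrow> ('m, 'n) bivector_field \<Rightarrow> ('m \<Rightarrow> real) \<Rightarrow> 'm \<Rightarrow> real ^ 'n" where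
  "hamiltonian_vf \<A> \<pi> f x =
     sharp \<pi> (chart_at \<A> x) x (differential (chart_at \<A> x) f x)"

text \<open>\<open>{f, h} = \<pi>(df, dh) = dh(\<pi>\<^sup>#(df))\<close>\<close>

definition poisson_bracket ::
  "('m, real ^ 'n) chart set \<Rightarrow> ('m, 'n) bivector_field \<Rightarrow>
   ('m \<Rightarrow> real) \<Rightarrow> ('m \<Rightarrow> real) \<Rightarrow> 'm \<Rightarrow> real" where
  "poisson_bracket \<A> \<pi> f h x =
     inner (differential (chart_at \<A> x) h x) (hamiltonian_vf \<A> \<pi> f x)"

definition bivector_rank ::
  "('m, real ^ 'n) chart set \<Rightarrow> ('m, 'n) bivector_field \<Rightarrow> 'm \<Rightarrow> nat" where
  "bivector_rank \<A> \<pi> x = dim (range (sharp \<pi> (chart_at \<A> x) x))"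

lemma open_chart_image:
  assumes "is_chart X c" "openin X W"
  shows "open (snd c ` (fst c \<inter> W))"
proof -
  have "openin (subtopology X (fst c)) (fst c \<inter> W)"
    using assms by (auto simp: openin_subtopology)
  then have "openin (top_of_set (snd c ` fst c)) (snd c ` (fst c \<inter> W))"
    using assms homeomorphic_map_openness_eq unfolding is_chart_def by blast
  then show ?thesis
    using assms openin_open_trans unfolding is_chart_def by blast
qed

lemma chart_inv_chart:
  assumes "is_chart X c" "x \<in> fst c"
  shows "chart_inv c (snd c x) = x"
proof -
  have "fst c \<subseteq> topspace X"
    using assms openin_subset unfolding is_chart_def by blast
  then have "inj_on (snd c) (fst c)"
    using assms unfolding is_chart_def homeomorphic_eq_everything_map
    by (simp add: Int_absorb1)
  then show ?thesis using assms by simp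
qed

lemma smooth_on_differentiable: "smooth_on f S \<Longrightarrow> x \<in> S \<Longrightarrow> f differentiable (at x)"
  unfolding smooth_on_def by (metis Ck_on.simps(2))

lemma transition_differentiable:
  assumes "smooth_manifold X \<A>" "c \<in> \<A>" "d \<in> \<A>" "x \<in> fst c" "x \<in> fst d"
  shows "(snd d \<circ> chart_inv c) differentiable (at (snd c x))"
  using assms unfolding smooth_manifold_def compatible_charts_def
  by (blast intro: smooth_on_differentiable)

lemma chart_change_derivative:
  fixes c d :: "('m, 'e::real_normed_vector) chart" and f :: "'m \<Rightarrow> 'b::real_normed_vector"
  assumes M: "smooth_manifold X \<A>" and c: "c \<in> \<A>" "x \<in> fst c" and d: "d \<in> \<A>" "x \<in> fst d"
    and f: "(f \<circ> chart_inv d) differentiable (at (snd d x))"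
  shows "frechet_derivative (f \<circ> chart_inv c) (at (snd c x)) =
           frechet_derivative (f \<circ> chart_inv d) (at (snd d x)) \<circ>
           frechet_derivative (snd d \<circ> chart_inv c) (at (snd c x))"
proof -
  have ch: "is_chart X c" "is_chart X d"
    using M c d unfolding smooth_manifold_def by auto
  define S where "S = snd c ` (fst c \<inter> fst d)"
  have "open S"
    unfolding S_def using ch open_chart_image is_chart_def by blast
  have eq: "((f \<circ> chart_inv d) \<circ> (snd d \<circ> chart_inv c)) y = (f \<circ> chart_inv c) y"
    if "y \<in> S" for y
    using that ch by (auto simp: S_def chart_inv_chart)
  have x: "(snd d \<circ> chart_inv c) (snd c x) = snd d x"
    using chart_inv_chart[OF ch(1)] c by simp
  have D: "((f \<circ> chart_inv d) \<circ> (snd d \<circ> chart_inv c) has_derivative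
       frechet_derivative (f \<circ> chart_inv d) (at (snd d x)) \<circ>
       frechet_derivative (snd d \<circ> chart_inv c) (at (snd c x))) (at (snd c x))"
    using diff_chain_at[of "snd d \<circ> chart_inv c" _ "snd c x" "f \<circ> chart_inv d"]
      transition_differentiable[OF M c(1) d(1) c(2) d(2)] f
    by (metis x frechet_derivative_works)
  have "snd c x \<in> S" using c d by (auto simp: S_def)
  have "(f \<circ> chart_inv c has_derivative
       frechet_derivative (f \<circ> chart_inv d) (at (snd d x)) \<circ>
       frechet_derivative (snd d \<circ> chart_inv c) (at (snd c x))) (at (snd c x))"
    by (rule has_derivative_transform_within_open[OF D \<open>open S\<close> \<open>snd c x \<in> S\<close> eq])
  then show ?thesis
    using frechet_derivative_at by metis
qed

lemma differential_change:
  assumes M: "smooth_manifold X \<A>" and c: "c \<in> \<A>" "x \<in> fst c" and d: "d \<in> \<A>" "x \<in> fst d"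
    and f: "smooth_fun_on \<A> W f" "x \<in> W"
  shows "differential c f x = differential d f x v* tangent_matrix c d id x"
proof -
  have fd: "(f \<circ> chart_inv d) differentiable (at (snd d x))"
    using f d unfolding smooth_fun_on_def by (blast intro: smooth_on_differentiable)
  let ?J = "tangent_matrix c d id x"
  let ?F = "frechet_derivative (f \<circ> chart_inv d) (at (snd d x))"
  have lF: "linear ?F"
    using fd by (simp add: linear_frechet_derivative)
  have lin: "linear (frechet_derivative (snd d \<circ> chart_inv c) (at (snd c x)))"
    using transition_differentiable[OF M c(1) d(1) c(2) d(2)] by (simp add: linear_frechet_derivative)
  have J: "frechet_derivative (snd d \<circ> chart_inv c) (at (snd c x)) v = ?J *v v" for v
    using lin by (simp add: tangent_matrix_def jacobian_def matrix_works)
  have F: "?F v = (\<Sum>l\<in>UNIV. v $ l * differential d f x $ l)" for v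
  proof -
    have "?F v = ?F (\<Sum>l\<in>UNIV. v $ l *s axis l 1)"
      by (simp add: basis_expansion)
    also have "\<dots> = (\<Sum>l\<in>UNIV. v $ l * ?F (axis l 1))"
      using lF by (simp add: linear_sum linear_scale scalar_mult_eq_scaleR)
    finally show ?thesis by (simp add: differential_def)
  qed
  have "differential c f x $ k = (differential d f x v* ?J) $ k" for k
  proof -
    have "differential c f x $ k = ?F (?J *v axis k 1)"
      unfolding differential_def using chart_change_derivative[OF M c d fd] J by simp
    also have "\<dots> = (\<Sum>l\<in>UNIV. ?J $ l $ k * differential d f x $ l)"
      unfolding F by (simp add: matrix_vector_mult_basis column_def)
    finally show ?thesis
      by (simp add: vector_matrix_mult_def mult.commute)
  qed
  then show ?thesis by (simp add: Finite_Cartesian_Product.vec_eq_iff)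
qed

lemma chart_at:
  assumes "c \<in> \<A>" "x \<in> fst c"
  shows "chart_at \<A> x \<in> \<A>" "x \<in> fst (chart_at \<A> x)"
  using someI[of "\<lambda>c. c \<in> \<A> \<and> x \<in> fst c" c] assms unfolding chart_at_def by auto

lemma sharp_change:
  assumes B: "bivector_field \<A> \<pi>" and c: "c \<in> \<A>" "x \<in> fst c" and d: "d \<in> \<A>" "x \<in> fst d"
  shows "sharp \<pi> d x \<xi> =
    tangent_matrix c d id x *v sharp \<pi> c x (\<xi> v* tangent_matrix c d id x)"
proof -
  let ?J = "tangent_matrix c d id x"
  have "\<pi> d x = ?J ** \<pi> c x ** transpose ?J"
    using B c d unfolding bivector_field_def by blast
  then show ?thesis
    unfolding sharp_def
    by (metis vector_matrix_mul_assoc vector_transpose_matrix)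
qed

lemma poisson_bracket_chart:
  assumes M: "smooth_manifold X \<A>" and B: "bivector_field \<A> \<pi>"
    and c: "c \<in> \<A>" "x \<in> fst c"
    and f: "smooth_fun_on \<A> W f" and h: "smooth_fun_on \<A> W h" and x: "x \<in> W"
  shows "poisson_bracket \<A> \<pi> f h x =
    inner (differential c h x) (sharp \<pi> c x (differential c f x))"
proof -
  let ?d = "chart_at \<A> x"
  let ?J = "tangent_matrix c ?d id x"
  have d: "?d \<in> \<A>" "x \<in> fst ?d" using chart_at[OF c] by auto
  have "poisson_bracket \<A> \<pi> f h x =
    inner (differential ?d h x) (?J *v sharp \<pi> c x (differential ?d f x v* ?J))"
    unfolding poisson_bracket_def hamiltonian_vf_def sharp_change[OF B c d] ..
  also have "\<dots> = inner (differential ?d h x v* ?J) (sharp \<pi> c x (differential ?d f x v* ?J))"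
    by (metis dot_lmul_matrix)
  finally show ?thesis
    using differential_change[OF M c d f x] differential_change[OF M c d h x] by simp
qed

lemma bivector_rank_chart:
  fixes c :: "('m, real ^ 'n) chart"
  assumes M: "smooth_manifold X \<A>" and B: "bivector_field \<A> \<pi>"
    and c: "c \<in> \<A>" "x \<in> fst c"
  shows "bivector_rank \<A> \<pi> x = dim (range (sharp \<pi> c x))"
proof -
  have le: "dim (range (sharp \<pi> b x)) \<le> dim (range (sharp \<pi> a x))"
    if "a \<in> \<A>" "x \<in> fst a" "b \<in> \<A>" "x \<in> fst b" for a b
  proof -
    let ?J = "tangent_matrix a b id x"
    have "range (sharp \<pi> b x) \<subseteq> (\<lambda>v. ?J *v v) ` range (sharp \<pi> a x)"
      using sharp_change[OF B that] by auto
    then have "dim (range (sharp \<pi> b x)) \<le> dim ((\<lambda>v. ?J *v v) ` range (sharp \<pi> a x))"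
      by (rule dim_subset)
    also have "\<dots> \<le> dim (range (sharp \<pi> a x))"
      by (rule dim_image_le) simp
    finally show ?thesis .
  qed
  then show ?thesis
    unfolding bivector_rank_def using chart_at[OF c] c by (meson le_antisym)
qed

definition poisson_manifold ::
  "'m topology \<Rightarrow> ('m, real ^ 'n) chart set \<Rightarrow> ('m, 'n) bivector_field \<Rightarrow> bool" where
  "poisson_manifold X \<A> \<pi> \<longleftrightarrow> smooth_manifold X \<A> \<and> bivector_field \<A> \<pi> \<and>
     (\<forall>W f g h. openin X W \<and> smooth_fun_on \<A> W f \<and> smooth_fun_on \<A> W g \<and> smooth_fun_on \<A> W h \<longrightarrow>
        (\<forall>x\<in>W. poisson_bracket \<A> \<pi> f (poisson_bracket \<A> \<pi> g h) x +
               poisson_bracket \<A> \<pi> g (poisson_bracket \<A> \<pi> h f) x +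
               poisson_bracket \<A> \<pi> h (poisson_bracket \<A> \<pi> f g) x = 0))"

text \<open>\<open>F\<^sub>* \<pi> = \<pi>\<close> for a diffeomorphism \<open>F\<close> of the manifold\<close>

definition preserves_bivector ::
  "('m, real ^ 'n) chart set \<Rightarrow> ('m, 'n) bivector_field \<Rightarrow> ('m \<Rightarrow> 'm) \<Rightarrow> bool" where
  "preserves_bivector \<A> \<pi> F \<longleftrightarrow>
     (\<forall>c\<in>\<A>. \<forall>d\<in>\<A>. \<forall>x\<in>fst c \<inter> F -` fst d.
        \<pi> d (F x) = tangent_matrix c d F x ** \<pi> c x ** transpose (tangent_matrix c d F x))"

definition invariant_nbhd ::
  "('g, 'b) monoid_scheme \<Rightarrow> ('g \<Rightarrow> 'm \<Rightarrow> 'm) \<Rightarrow> 'm topology \<Rightarrow> 'm \<Rightarrow> 'm set \<Rightarrow> bool" where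
  "invariant_nbhd G \<rho> X m U \<longleftrightarrow> openin X U \<and> m \<in> U \<and> (\<forall>g\<in>carrier G. \<rho> g ` U \<subseteq> U)"


section \<open>Adapted coordinates\<close>

text \<open>Names of the coordinates \<open>p\<^sub>i\<close>, \<open>q\<^sub>i\<close> and \<open>z\<^sub>j\<close>, numbered from 0.\<close>

datatype coord = P nat | Q nat | Z nat

definition coords :: "nat \<Rightarrow> nat \<Rightarrow> coord set" where
  "coords r s = P ` {..<r} \<union> Q ` {..<r} \<union> Z ` {..<s}"

text \<open>
  The functions \<open>p\<^sub>i\<close>, \<open>q\<^sub>i\<close>, \<open>z\<^sub>j\<close> are the components of a chart \<open>(U, \<phi>)\<close> of the manifold, the
  bijection \<open>e\<close> telling which component carries which name.
\<close>

definition local_coordinates ::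
  "('m, real ^ 'n) chart set \<Rightarrow> nat \<Rightarrow> nat \<Rightarrow> (nat \<Rightarrow> 'm \<Rightarrow> real) \<Rightarrow> (nat \<Rightarrow> 'm \<Rightarrow> real) \<Rightarrow>
   (nat \<Rightarrow> 'm \<Rightarrow> real) \<Rightarrow> 'm set \<Rightarrow> ('m \<Rightarrow> real ^ 'n) \<Rightarrow> (coord \<Rightarrow> 'n) \<Rightarrow> bool" where
  "local_coordinates \<A> r s p q z U \<phi> e \<longleftrightarrow>
     (U, \<phi>) \<in> \<A> \<and> bij_betw e (coords r s) UNIV \<and>
     (\<forall>x\<in>U. (\<forall>i<r. \<phi> x $ e (P i) = p i x \<and> \<phi> x $ e (Q i) = q i x) \<and>
            (\<forall>j<s. \<phi> x $ e (Z j) = z j x))"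

text \<open>The coordinate vector field \<open>\<partial>/\<partial>a\<close> of the coordinate named \<open>a\<close>, in its own chart.\<close>

abbreviation coord_vf :: "(coord \<Rightarrow> 'n::finite) \<Rightarrow> coord \<Rightarrow> real ^ 'n" where
  "coord_vf e a \<equiv> axis (e a) 1"

definition z_vec :: "nat \<Rightarrow> (nat \<Rightarrow> 'm \<Rightarrow> real) \<Rightarrow> 'm \<Rightarrow> real Matrix.vec" where
  "z_vec s z x = Matrix.vec s (\<lambda>j. z j x)"

text \<open>
  Smoothness of a function \<open>\<gamma>\<close> of \<open>z \<in> \<real>\<^sup>s\<close>, defined for \<open>z \<in> D\<close>. As \<open>s\<close> is a number and not a
  type (and may be 0), \<open>\<gamma>\<close> is viewed as a function on coordinate space \<open>real ^ 'n\<close> that does not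
  depend on the \<open>p\<close> and \<open>q\<close> components.
\<close>

definition smooth_in_z ::
  "nat \<Rightarrow> (coord \<Rightarrow> 'n::finite) \<Rightarrow> real Matrix.vec set \<Rightarrow> (real Matrix.vec \<Rightarrow> real) \<Rightarrow> bool" where
  "smooth_in_z s e D \<gamma> \<longleftrightarrow>
     smooth_on (\<lambda>y::real ^ 'n. \<gamma> (Matrix.vec s (\<lambda>j. y $ e (Z j))))
       {y. Matrix.vec s (\<lambda>j. y $ e (Z j)) \<in> D}"

text \<open>The group of invertible real \<open>s \<times> s\<close> matrices.\<close>

abbreviation GL :: "nat \<Rightarrow> real mat monoid" where
  "GL s \<equiv> units_of (ring_mat TYPE(real) s ())"

end

theory Submission
  imports Defs
begin

text \<open>
  By averaging over \<open>G\<close> there is a chart centred at \<open>m\<close> in which \<open>G\<close> acts by orthogonal maps, so balls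
  are invariant and everything takes place on a ball of Euclidean space.

  If functions \<open>f\<^sub>1, \<dots>, f\<^sub>k\<close> are invariant, have constant brackets and independent Hamiltonian fields,
  then by the Jacobi identity these fields commute. They can be straightened by a \<open>G\<close>-equivariant
  diffeomorphism \<open>\<Psi>\<close> with \<open>D\<Psi>(0) = id\<close>, and they are fixed by \<open>G\<close> at the origin. Hence a linear
  combination of components of \<open>\<Psi>\<close> is an invariant function having prescribed constant brackets with
  the \<open>f\<^sub>i\<close>. Starting from the \<open>p\<^sub>i\<close>, this produces the \<open>q\<^sub>i\<close> one after the other.

  Straightening the \<open>2r\<close> fields of all \<open>p\<^sub>i\<close>, \<open>q\<^sub>i\<close> and taking for \<open>z\<^sub>j\<close> the components of \<open>\<Psi>\<close> along an
  orthonormal basis of the orthogonal complement of their span at \<open>0\<close>, which is \<open>G\<close>-stable, one gets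
  functions on which \<open>G\<close> acts linearly and which commute with the \<open>p\<^sub>i\<close> and \<open>q\<^sub>i\<close>. Again by the Jacobi
  identity the brackets \<open>{z\<^sub>i, z\<^sub>j}\<close> commute with all \<open>p\<^sub>i\<close>, \<open>q\<^sub>i\<close>, so they are functions of \<open>z\<close> alone; the
  coefficients \<open>g\<^sub>i\<^sub>j\<close> are half of them, because both orders of \<open>i, j\<close> are summed.
\<close>

section \<open>Differentiability with parameters\<close>

text \<open>The overview leaves open why everything can be arranged equivariantly. Orthogonality is
  what makes it work: the straightening map is built from the vectors b_i fixed by the group and
  from a dual family inside their span, and an orthogonal map fixing the b_i fixes the dual vectors
  too. The same orthogonality yields the stable complement on which the matrices A(g) act, and makes
  the norm in the final coordinates invariant, so that the final domain may be chosen with a ball as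
  its coordinate image. Flows are avoided in favour of one family of Volterra equations on the fixed
  interval [0, 1], depending on a small parameter w: smallness of w instead of smallness of time
  provides the contraction constant 1/2, and the linearised equations in the induction for smooth
  dependence inherit this constant. Regularity is measured by \<open>Cp\<close>, which allows a
  merely topological parameter; it covers time as well as the group variable, over which smooth
  families are averaged. Of the mean over the group only linearity, normalisation, positivity and
  right invariance enter.\<close>

lemma continuous_map_binop:
  assumes "continuous_map X euclidean f" "continuous_map X euclidean g"
    and "continuous_on UNIV (\<lambda>(u, v). h u v)"
  shows "continuous_map X euclidean (\<lambda>x. h (f x) (g x))"
proof -
  have "continuous_map X (prod_topology euclidean euclidean) (\<lambda>x. (f x, g x))"
    using assms unfolding continuous_map_pairwise by (simp add: o_def)
  then have "continuous_map X euclidean (\<lambda>x. (f x, g x))"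
    unfolding prod_topology_euclidean .
  from continuous_map_compose[OF this, of euclidean "\<lambda>(u, v). h u v"] show ?thesis
    using assms(3) by (simp add: o_def)
qed

lemma continuous_map_unop:
  assumes "continuous_map X euclidean f" "continuous_on UNIV h"
  shows "continuous_map X euclidean (\<lambda>x. h (f x))"
  using continuous_map_compose[OF assms(1), of euclidean h] assms(2) by (simp add: o_def)

abbreviation param_top :: "'p topology \<Rightarrow> 'a::topological_space set \<Rightarrow> ('p \<times> 'a) topology" where
  "param_top A S \<equiv> prod_topology A (top_of_set S)"

lemma param_unop:
  assumes "continuous_map (param_top A S) euclidean (\<lambda>(a, x). f a x)" "continuous_on UNIV h"
  shows "continuous_map (param_top A S) euclidean (\<lambda>(a, x). h (f a x))"
  using continuous_map_unop[OF assms] by (simp add: case_prod_unfold)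

lemma param_binop:
  assumes "continuous_map (param_top A S) euclidean (\<lambda>(a, x). f a x)"
    and "continuous_map (param_top A S) euclidean (\<lambda>(a, x). g a x)"
    and "continuous_on UNIV (\<lambda>(u, v). h u v)"
  shows "continuous_map (param_top A S) euclidean (\<lambda>(a, x). h (f a x) (g a x))"
  using continuous_map_binop[OF assms] by (simp add: case_prod_unfold)

text \<open>Class \<open>k\<close> in \<open>x\<close>, with all iterated directional derivatives
  jointly continuous in \<open>(a, x)\<close>; nothing is differentiated in the parameter
  \<open>a\<close>, so \<open>A\<close> may be any topological space. Joint continuity is demanded
  at each order, since differentiability in \<open>x\<close> for each fixed \<open>a\<close> does
  not imply it. The instances used are a compact group, the time interval and a one-point space, the
  last giving \<open>Ck_on\<close>.\<close>

primrec Cp :: "'p topology \<Rightarrow> nat \<Rightarrow> ('p \<Rightarrow> 'a::real_normed_vector \<Rightarrow> 'b::real_normed_vector) \<Rightarrow> 'a set \<Rightarrow> bool"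
where
  "Cp A 0 f S \<longleftrightarrow> continuous_map (param_top A S) euclidean (\<lambda>(a, x). f a x)"
| "Cp A (Suc k) f S \<longleftrightarrow> continuous_map (param_top A S) euclidean (\<lambda>(a, x). f a x) \<and>
     (\<forall>a\<in>topspace A. \<forall>x\<in>S. f a differentiable (at x)) \<and>
     (\<forall>v. Cp A k (\<lambda>a x. frechet_derivative (f a) (at x) v) S)"

lemma Cp_continuous: "Cp A k f S \<Longrightarrow> continuous_map (param_top A S) euclidean (\<lambda>(a, x). f a x)"
  by (cases k) auto

lemma continuous_map_param_cong:
  assumes "continuous_map (param_top A S) Y (\<lambda>(a, x). f a x)"
    and "\<And>a x. a \<in> topspace A \<Longrightarrow> x \<in> S \<Longrightarrow> f a x = g a x"
  shows "continuous_map (param_top A S) Y (\<lambda>(a, x). g a x)"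
  by (rule continuous_map_eq[OF assms(1)]) (auto simp: assms(2))

lemma Cp_cong:
  assumes "open S" "\<And>a x. a \<in> topspace A \<Longrightarrow> x \<in> S \<Longrightarrow> f a x = g a x" "Cp A k f S"
  shows "Cp A k g S"
  using assms(2,3)
proof (induction k arbitrary: f g)
  case 0
  then show ?case
    using continuous_map_param_cong[of A S euclidean f g] by simp
next
  case (Suc k)
  have d: "(g a has_derivative frechet_derivative (f a) (at x)) (at x)"
    if "a \<in> topspace A" "x \<in> S" for a x
  proof (rule has_derivative_transform_within_open[OF _ \<open>open S\<close> that(2)])
    show "(f a has_derivative frechet_derivative (f a) (at x)) (at x)"
      using Suc.prems(2) that frechet_derivative_works by auto
  qed (use Suc.prems(1) that in auto)
  have "frechet_derivative (f a) (at x) = frechet_derivative (g a) (at x)"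
    if "a \<in> topspace A" "x \<in> S" for a x
    using d[OF that] frechet_derivative_at by blast
  then have "Cp A k (\<lambda>a x. frechet_derivative (g a) (at x) v) S" for v
    using Suc.IH[of "\<lambda>a x. frechet_derivative (f a) (at x) v" "\<lambda>a x. frechet_derivative (g a) (at x) v"]
      Suc.prems by auto
  moreover have "continuous_map (param_top A S) euclidean (\<lambda>(a, x). g a x)"
    using Suc.prems continuous_map_param_cong[of A S euclidean f g] by simp
  ultimately show ?case using d by (auto simp: differentiable_def)
qed

lemma Cp_SucI:
  assumes "open S" "continuous_map (param_top A S) euclidean (\<lambda>(a, x). f a x)"
    and d: "\<And>a x. a \<in> topspace A \<Longrightarrow> x \<in> S \<Longrightarrow> (f a has_derivative f' a x) (at x)"
    and "\<And>v. Cp A k (\<lambda>a x. f' a x v) S"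
  shows "Cp A (Suc k) f S"
proof -
  have "frechet_derivative (f a) (at x) = f' a x" if "a \<in> topspace A" "x \<in> S" for a x
    using d[OF that] frechet_derivative_at by metis
  then have "Cp A k (\<lambda>a x. frechet_derivative (f a) (at x) v) S" for v
    using Cp_cong[OF \<open>open S\<close> _ assms(4)[of v], of "\<lambda>a x. frechet_derivative (f a) (at x) v"] by auto
  then show ?thesis using assms by (auto simp: differentiable_def)
qed

lemma Cp_SucD:
  assumes "Cp A (Suc k) f S"
  shows "\<And>v. Cp A k (\<lambda>a x. frechet_derivative (f a) (at x) v) S"
    and "\<And>a x. a \<in> topspace A \<Longrightarrow> x \<in> S \<Longrightarrow>
      (f a has_derivative frechet_derivative (f a) (at x)) (at x)"
  using assms by (auto simp: frechet_derivative_works[symmetric])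

lemma Cp_Suc_lower: "Cp A (Suc k) f S \<Longrightarrow> Cp A k f S"
proof (induction k arbitrary: f)
  case (Suc k)
  have "Cp A k (\<lambda>a x. frechet_derivative (f a) (at x) v) S" for v
    by (rule Suc.IH, rule Cp_SucD(1)[OF Suc.prems])
  then show ?case using Suc.prems by simp
qed simp

lemma Cp_mono: "Cp A k f S \<Longrightarrow> j \<le> k \<Longrightarrow> Cp A j f S"
  by (induction k) (auto simp: le_Suc_eq simp del: Cp.simps dest: Cp_Suc_lower)

lemma Cp_param_const:
  assumes "open S" "continuous_map A euclidean c"
  shows "Cp A k (\<lambda>a x. c a) S"
  using assms(2)
proof (induction k arbitrary: c)
  case 0
  then show ?case
    using continuous_map_compose[OF continuous_map_fst, of A euclidean c] by (simp add: o_def case_prod_unfold)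
next
  case (Suc k)
  have "continuous_map (param_top A S) euclidean (\<lambda>(a, x). c a)"
    using continuous_map_compose[OF continuous_map_fst Suc.prems] by (simp add: o_def case_prod_unfold)
  then show ?case
    by (intro Cp_SucI[OF assms(1), where f'="\<lambda>a x v. 0"]) (auto intro: Suc.IH[of "\<lambda>_. 0"])
qed

lemmas Cp_const = Cp_param_const[OF _ continuous_map_const[THEN iffD2], simplified]

lemma Cp_bounded_linear:
  assumes "open S" "bounded_linear L" "Cp A k f S"
  shows "Cp A k (\<lambda>a x. L (f a x)) S"
  using assms(3)
proof (induction k arbitrary: f)
  case 0
  then show ?case
    using param_unop[of A S f L] linear_continuous_on[OF assms(2)] by simp
next
  case (Suc k)
  have "continuous_map (param_top A S) euclidean (\<lambda>(a, x). L (f a x))"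
    using param_unop[of A S f L] linear_continuous_on[OF assms(2)] Suc.prems by simp
  moreover note Cp_SucD(2)[OF Suc.prems]
  ultimately show ?case
    by (intro Cp_SucI[OF assms(1), where f'="\<lambda>a x v. L (frechet_derivative (f a) (at x) v)"])
       (auto intro!: Suc.IH bounded_linear.has_derivative[OF assms(2)] Cp_SucD(1)[OF Suc.prems])
qed

lemma Cp_id: "open S \<Longrightarrow> Cp A k (\<lambda>a x. x) S"
proof (cases k)
  case 0
  have "continuous_map (param_top A S) euclidean snd"
    using continuous_map_snd[of A "top_of_set S"] continuous_map_in_subtopology by blast
  then show ?thesis using 0 by (simp add: case_prod_unfold)
next
  case (Suc j)
  assume "open S"
  have "continuous_map (param_top A S) euclidean snd"
    using continuous_map_snd[of A "top_of_set S"] continuous_map_in_subtopology by blast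
  then show ?thesis unfolding Suc
    using \<open>open S\<close> by (intro Cp_SucI[where f'="\<lambda>a x v. v"]) (auto simp: case_prod_unfold intro: Cp_const)
qed

lemma Cp_linear_fun: "open S \<Longrightarrow> bounded_linear L \<Longrightarrow> Cp A k (\<lambda>a x. L x) S"
  by (rule Cp_bounded_linear[OF _ _ Cp_id])

lemma Cp_add:
  assumes "open S" "Cp A k f S" "Cp A k g S"
  shows "Cp A k (\<lambda>a x. f a x + g a x) S"
  using assms(2,3)
proof (induction k arbitrary: f g)
  case 0
  have "continuous_on UNIV (\<lambda>(u::'c, v). u + v)"
    by (auto intro!: continuous_intros simp: case_prod_unfold)
  then show ?case using 0 param_binop[of A S f g "(+)"] by simp
next
  case (Suc k)
  have "continuous_on UNIV (\<lambda>(u::'c, v). u + v)"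
    by (auto intro!: continuous_intros simp: case_prod_unfold)
  then have c: "continuous_map (param_top A S) euclidean (\<lambda>(a, x). f a x + g a x)"
    using Suc.prems param_binop[of A S f g "(+)"] by simp
  show ?case
    using Cp_SucD(2)[OF Suc.prems(1)] Cp_SucD(2)[OF Suc.prems(2)]
    by (intro Cp_SucI[OF assms(1) c, where f'="\<lambda>a x v. frechet_derivative (f a) (at x) v + frechet_derivative (g a) (at x) v"])
       (auto intro!: Suc.IH has_derivative_add Cp_SucD(1)[OF Suc.prems(1)] Cp_SucD(1)[OF Suc.prems(2)])
qed

lemma Cp_sum:
  assumes "open S" "\<And>i. i \<in> I \<Longrightarrow> Cp A k (f i) S"
  shows "Cp A k (\<lambda>a x. \<Sum>i\<in>I. f i a x) S"
  using assms(2)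
proof (induction I rule: infinite_finite_induct)
  case (insert i I)
  then have "Cp A k (\<lambda>a x. f i a x + (\<Sum>i\<in>I. f i a x)) S"
    by (intro Cp_add assms(1)) auto
  then show ?case using insert by simp
qed (auto intro: Cp_const assms(1))

lemma Cp_bilinear:
  assumes "open S" "bounded_bilinear B" "Cp A k f S" "Cp A k g S"
  shows "Cp A k (\<lambda>a x. B (f a x) (g a x)) S"
proof -
  interpret bounded_bilinear B by fact
  have B: "continuous_on UNIV (\<lambda>(u, v). B u v)"
    by (auto intro!: continuous_on continuous_intros simp: case_prod_unfold)
  show ?thesis using assms(3,4)
proof (induction k arbitrary: f g)
  case 0
  then show ?case using B param_binop[of A S f g B] by simp
next
  case (Suc k)
  have c: "continuous_map (param_top A S) euclidean (\<lambda>(a, x). B (f a x) (g a x))"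
    using B Suc.prems param_binop[of A S f g B] by simp
  show ?case
    using Suc.prems Cp_SucD[OF Suc.prems(1)] Cp_SucD[OF Suc.prems(2)]
    by (intro Cp_SucI[OF assms(1) c, where f'="\<lambda>a x v. B (f a x) (frechet_derivative (g a) (at x) v) + B (frechet_derivative (f a) (at x) v) (g a x)"]
        Cp_add assms(1) Suc.IH FDERIV)
       (auto simp del: Cp.simps intro: Cp_Suc_lower)
qed
qed

lemmas Cp_scaleR = Cp_bilinear[OF _ bounded_bilinear_scaleR]
lemmas Cp_mult = Cp_bilinear[OF _ bounded_bilinear_mult]
lemmas Cp_inner = Cp_bilinear[OF _ bounded_bilinear_inner]

lemma Cp_minus: "open S \<Longrightarrow> Cp A k f S \<Longrightarrow> Cp A k (\<lambda>a x. - f a x) S"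
  by (rule Cp_bounded_linear[OF _ bounded_linear_minus[OF bounded_linear_ident]])

lemma Cp_diff: "open S \<Longrightarrow> Cp A k f S \<Longrightarrow> Cp A k g S \<Longrightarrow> Cp A k (\<lambda>a x. f a x - g a x) S"
  using Cp_add[of S A k f "\<lambda>a x. - g a x"] Cp_minus[of S A k g] by simp

lemma Cp_prod:
  fixes f :: "'i \<Rightarrow> 'p \<Rightarrow> 'a::real_normed_vector \<Rightarrow> 'b::{real_normed_algebra, comm_ring_1}"
  assumes "open S" "\<And>i. i \<in> I \<Longrightarrow> Cp A k (f i) S"
  shows "Cp A k (\<lambda>a x. \<Prod>i\<in>I. f i a x) S"
  using assms(2)
proof (induction I rule: infinite_finite_induct)
  case (insert i I)
  then have "Cp A k (\<lambda>a x. f i a x * (\<Prod>i\<in>I. f i a x)) S"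
    by (intro Cp_mult assms(1)) auto
  then show ?case using insert by simp
qed (auto intro: Cp_const assms(1))

lemma Cp_Pair:
  assumes "open S" "Cp A k f S" "Cp A k g S"
  shows "Cp A k (\<lambda>a x. (f a x, g a x)) S"
proof -
  have "Cp A k (\<lambda>a x. (f a x, 0) + (0, g a x)) S"
    using assms by (intro Cp_add Cp_bounded_linear[of S "\<lambda>u. (u, 0)"] Cp_bounded_linear[of S "\<lambda>u. (0, u)"])
      (auto intro!: bounded_linear_intros bounded_linear_Pair)
  then show ?thesis by simp
qed

lemma continuous_map_compose_param:
  assumes "continuous_map (param_top A S) euclidean (\<lambda>(a, x). f a x)"
    and "continuous_map (param_top A R) Y (\<lambda>(a, y). h a y)"
    and "\<And>a x. a \<in> topspace A \<Longrightarrow> x \<in> S \<Longrightarrow> f a x \<in> R"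
  shows "continuous_map (param_top A S) Y (\<lambda>(a, x). h a (f a x))"
proof -
  have "continuous_map (param_top A S) (top_of_set R) (\<lambda>(a, x). f a x)"
    using assms by (auto simp: continuous_map_in_subtopology)
  then have "continuous_map (param_top A S) (param_top A R) (\<lambda>p. (fst p, (\<lambda>(a, x). f a x) p))"
    by (simp add: continuous_map_pairwise o_def continuous_map_fst)
  from continuous_map_compose[OF this assms(2)] show ?thesis
    by (simp add: o_def case_prod_unfold)
qed

text \<open>The chain rule differentiates \<open>h a\<close> in the direction
  \<open>?f' a x v\<close>, which moves with \<open>x\<close>, while \<open>Cp\<close> only controls
  derivatives in fixed directions. Expanding this direction in \<open>Basis\<close> turns the
  derivative into a finite sum of products of \<open>Cp\<close> functions; this is why the middle
  space is Euclidean.\<close>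

lemma Cp_compose:
  fixes f :: "'p \<Rightarrow> 'a::real_normed_vector \<Rightarrow> 'b::euclidean_space"
  assumes S: "open S" and R: "open R" and h: "Cp A k h R" and f: "Cp A k f S"
    and sub: "\<And>a x. a \<in> topspace A \<Longrightarrow> x \<in> S \<Longrightarrow> f a x \<in> R"
  shows "Cp A k (\<lambda>a x. h a (f a x)) S"
  using h f sub
proof (induction k arbitrary: f h)
  case 0
  then show ?case using continuous_map_compose_param[of A S f R euclidean h] by simp
next
  case (Suc k)
  let ?f' = "\<lambda>a x. frechet_derivative (f a) (at x)" and ?h' = "\<lambda>a y. frechet_derivative (h a) (at y)"
  have c: "continuous_map (param_top A S) euclidean (\<lambda>(a, x). h a (f a x))"
    using Suc.prems continuous_map_compose_param[of A S f R euclidean h] by simp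
  have eq: "?h' a (f a x) (?f' a x v) = (\<Sum>b\<in>Basis. (?f' a x v \<bullet> b) *\<^sub>R ?h' a (f a x) b)"
    if "a \<in> topspace A" "x \<in> S" for a x v
  proof -
    have "linear (?h' a (f a x))"
      using Suc.prems(1,3) that by (simp add: linear_frechet_derivative)
    then have "?h' a (f a x) (\<Sum>b\<in>Basis. (?f' a x v \<bullet> b) *\<^sub>R b) = (\<Sum>b\<in>Basis. (?f' a x v \<bullet> b) *\<^sub>R ?h' a (f a x) b)"
      by (simp add: linear_sum linear_scale)
    then show ?thesis by (simp add: euclidean_representation)
  qed
  have "Cp A k (\<lambda>a x. \<Sum>b\<in>Basis. (?f' a x v \<bullet> b) *\<^sub>R ?h' a (f a x) b) S" for v
  proof (rule Cp_sum[OF S], rule Cp_scaleR[OF S])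
    fix b :: 'b
    show "Cp A k (\<lambda>a x. ?f' a x v \<bullet> b) S"
      by (rule Cp_inner[OF S Cp_SucD(1)[OF Suc.prems(2)] Cp_const[OF S]])
    show "Cp A k (\<lambda>a x. ?h' a (f a x) b) S"
      by (rule Suc.IH[OF Cp_SucD(1)[OF Suc.prems(1)] Cp_Suc_lower[OF Suc.prems(2)] Suc.prems(3)])
  qed
  then have "Cp A k (\<lambda>a x. ?h' a (f a x) (?f' a x v)) S" for v
    by (rule Cp_cong[OF S, rotated]) (simp add: eq)
  then show ?case
    using Cp_SucD(2)[OF Suc.prems(1)] Cp_SucD(2)[OF Suc.prems(2)] Suc.prems(3)
    by (intro Cp_SucI[OF S c, where f'="\<lambda>a x v. ?h' a (f a x) (?f' a x v)"])
       (auto intro: has_derivative_compose)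
qed

lemma Cp_reparam:
  assumes "Cp A k f S" "continuous_map C A \<phi>"
  shows "Cp C k (\<lambda>b. f (\<phi> b)) S"
proof -
  have ph: "\<phi> b \<in> topspace A" if "b \<in> topspace C" for b
    using assms(2) that by (auto simp: continuous_map_def)
  have c: "continuous_map (param_top C S) euclidean (\<lambda>(b, x). g (\<phi> b) x)"
    if "continuous_map (param_top A S) euclidean (\<lambda>(a, x). g a x)" for g :: "'a \<Rightarrow> 'b \<Rightarrow> 'c"
  proof -
    have "continuous_map (param_top C S) (param_top A S) (\<lambda>p. (\<phi> (fst p), snd p))"
      using continuous_map_compose[OF continuous_map_fst assms(2)]
      by (simp add: continuous_map_pairwise o_def continuous_map_snd)
    from continuous_map_compose[OF this that] show ?thesis by (simp add: o_def case_prod_unfold)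
  qed
  show ?thesis using assms(1)
  proof (induction k arbitrary: f)
    case (Suc k)
    show ?case using Suc.prems ph c Suc.IH[OF Cp_SucD(1)[OF Suc.prems]] by auto
  qed (use c in auto)
qed

lemma Cp_inverse:
  fixes f :: "'p \<Rightarrow> 'a::real_normed_vector \<Rightarrow> real"
  assumes S: "open S" and f: "Cp A k f S" and nz: "\<And>a x. a \<in> topspace A \<Longrightarrow> x \<in> S \<Longrightarrow> f a x \<noteq> 0"
  shows "Cp A k (\<lambda>a x. inverse (f a x)) S"
  using f
proof (induction k)
  case 0
  have "continuous_map (param_top A S) euclideanreal (\<lambda>p. inverse ((\<lambda>(a, x). f a x) p))"
    using 0 nz by (intro continuous_map_real_inverse) auto
  then show ?case by (simp add: case_prod_unfold)
next
  case (Suc k)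
  let ?f' = "\<lambda>a x. frechet_derivative (f a) (at x)"
  have "continuous_map (param_top A S) euclideanreal (\<lambda>p. inverse ((\<lambda>(a, x). f a x) p))"
    using Suc.prems nz by (intro continuous_map_real_inverse) auto
  then have c: "continuous_map (param_top A S) euclidean (\<lambda>(a, x). inverse (f a x))"
    by (simp add: case_prod_unfold)
  have IH: "Cp A k (\<lambda>a x. inverse (f a x)) S"
    using Suc Cp_Suc_lower by blast
  show ?case
    using Cp_SucD(2)[OF Suc.prems] nz
    by (intro Cp_SucI[OF S c, where f'="\<lambda>a x v. - (inverse (f a x) * ?f' a x v * inverse (f a x))"]
        Cp_minus Cp_mult S IH Cp_SucD(1)[OF Suc.prems]) (auto intro!: has_derivative_inverse)
qed

subsection \<open>Smoothness without parameters\<close>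

text \<open>\<open>Ck_on\<close> omits continuity at positive orders, but differentiability supplies
  it. The closure properties of smooth functions below are read off from those of \<open>Cp\<close>
  through this equivalence.\<close>

lemma Ck_on_iff_Cp:
  assumes "open S"
  shows "Ck_on k f S \<longleftrightarrow> Cp (discrete_topology {()}) k (\<lambda>_. f) S"
proof -
  have c: "continuous_map (param_top (discrete_topology {()}) S) euclidean (\<lambda>(a, x). f x) \<longleftrightarrow> continuous_on S f"
    for f :: "'a \<Rightarrow> 'b"
  proof
    assume "continuous_on S f"
    then have "continuous_map (top_of_set S) euclidean f" by simp
    from continuous_map_compose[OF continuous_map_snd this]
    show "continuous_map (param_top (discrete_topology {()}) S) euclidean (\<lambda>(a, x). f x)"
      by (simp add: o_def case_prod_unfold)
  next
    assume a: "continuous_map (param_top (discrete_topology {()}) S) euclidean (\<lambda>(a, x). f x)"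
    have "continuous_map (top_of_set S) (param_top (discrete_topology {()}) S) (\<lambda>x. ((), x))"
      by (auto simp: continuous_map_pairwise o_def continuous_map_in_subtopology)
    from continuous_map_compose[OF this a] show "continuous_on S f"
      by (simp add: o_def)
  qed
  have d: "continuous_on S f" if "\<forall>x\<in>S. f differentiable at x" for f :: "'a \<Rightarrow> 'b"
    using that by (intro differentiable_imp_continuous_on) (auto simp: differentiable_on_def intro: differentiable_at_withinI)
  show ?thesis
    by (induction k arbitrary: f) (auto simp: c intro: d)
qed

lemma Cp_of_Ck_on:
  assumes "open S" "Ck_on k f S"
  shows "Cp A k (\<lambda>_. f) S"
  using Cp_reparam[of "discrete_topology {()}" k "\<lambda>_. f" S A "\<lambda>_. ()"] assms by (simp add: Ck_on_iff_Cp)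

lemma Ck_on_of_Cp:
  assumes "open S" "Cp A k f S" "a \<in> topspace A"
  shows "Ck_on k (f a) S"
  using Cp_reparam[of A k f S "discrete_topology {()}" "\<lambda>_. a"] assms by (simp add: Ck_on_iff_Cp)

section \<open>Uniformity over a compact parameter space\<close>

lemma compact_tube:
  fixes x0 :: "'a::metric_space"
  assumes "compact_space A" "openin (param_top A S) W" "x0 \<in> S" "\<And>a. a \<in> topspace A \<Longrightarrow> (a, x0) \<in> W"
  obtains d where "d > 0" "\<And>a x. a \<in> topspace A \<Longrightarrow> x \<in> S \<Longrightarrow> dist x x0 < d \<Longrightarrow> (a, x) \<in> W"
proof -
  have "\<exists>U V. openin A U \<and> openin (top_of_set S) V \<and> topspace A \<subseteq> U \<and> x0 \<in> V \<and> U \<times> V \<subseteq> W"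
    using assms by (intro tube_lemma_left) (auto simp: compact_space_def)
  then obtain U V where UV: "openin (top_of_set S) V" "topspace A \<subseteq> U" "x0 \<in> V" "U \<times> V \<subseteq> W"
    by blast
  then obtain d where "d > 0" "\<forall>x\<in>S. dist x x0 < d \<longrightarrow> x \<in> V"
    unfolding openin_euclidean_subtopology_iff by blast
  with UV show ?thesis by (intro that[of d]) auto
qed

text \<open>The tube lemma, applied to the open set where the increment from \<open>x0\<close> is
  small, makes continuity at \<open>x0\<close> uniform in the parameter.\<close>

lemma compact_param_uniform:
  fixes f :: "'p \<Rightarrow> 'a::real_normed_vector \<Rightarrow> 'b::real_normed_vector"
  assumes A: "compact_space A" and c: "continuous_map (param_top A S) euclidean (\<lambda>(a, x). f a x)"
    and x0: "x0 \<in> S" and e: "e > 0"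
  obtains d where "d > 0"
    "\<And>a x. a \<in> topspace A \<Longrightarrow> x \<in> S \<Longrightarrow> dist x x0 < d \<Longrightarrow> norm (f a x - f a x0) < e"
proof -
  have "continuous_map (param_top A S) euclidean (\<lambda>(a, x). f a x0)"
    by (rule continuous_map_compose_param[OF _ c]) (use x0 in \<open>auto simp: case_prod_unfold\<close>)
  then have "continuous_map (param_top A S) euclidean (\<lambda>(a, x). f a x - f a x0)"
    by (rule param_binop[OF c]) (auto intro!: continuous_intros simp: case_prod_unfold)
  then have n: "continuous_map (param_top A S) euclideanreal (\<lambda>(a, x). norm (f a x - f a x0))"
    by (rule param_unop) (auto intro!: continuous_intros)
  let ?W = "{p \<in> topspace (param_top A S). (\<lambda>(a, x). norm (f a x - f a x0)) p \<in> {..<e}}"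
  have W: "openin (param_top A S) ?W"
    by (rule openin_continuous_map_preimage[OF n]) auto
  obtain d where d: "d > 0" "\<And>a x. a \<in> topspace A \<Longrightarrow> x \<in> S \<Longrightarrow> dist x x0 < d \<Longrightarrow> (a, x) \<in> ?W"
    by (rule compact_tube[OF A W x0]) (use x0 e in auto)
  show ?thesis
    by (rule that[OF d(1)]) (use d(2) in auto)
qed

text \<open>Near \<open>x0\<close> the derivatives along basis vectors are close to their values at
  \<open>x0\<close>, uniformly in \<open>a\<close> by compactness. The mean value inequality on a
  ball turns this into a remainder estimate with one \<open>d\<close> for all parameters.\<close>

lemma Cp_uniformly_differentiable:
  fixes f :: "'p \<Rightarrow> 'a::euclidean_space \<Rightarrow> 'b::real_normed_vector"
  assumes A: "compact_space A" and S: "open S" and f: "Cp A (Suc 0) f S"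
    and x0: "x0 \<in> S" and e: "e > 0"
  obtains d where "d > 0"
    "\<And>a y. a \<in> topspace A \<Longrightarrow> norm y < d \<Longrightarrow>
       norm (f a (x0 + y) - f a x0 - frechet_derivative (f a) (at x0) y) \<le> e * norm y"
proof -
  define f' where "f' a x = frechet_derivative (f a) (at x)" for a x
  \<comment> \<open>Each of the \<open>DIM('a)\<close> basis directions contributes at most
    \<open>norm v * e'\<close>, so together they contribute \<open>e * norm v\<close>.\<close>
  define e' where "e' = e / real DIM('a)"
  have e': "e' > 0" using e by (simp add: e'_def)
  have c: "continuous_map (param_top A S) euclidean (\<lambda>(a, x). f' a x b)" for b
    using f by (simp add: f'_def)
  have "\<exists>d>0. \<forall>a\<in>topspace A. \<forall>x\<in>S. dist x x0 < d \<longrightarrow> norm (f' a x b - f' a x0 b) < e'" for b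
    by (rule compact_param_uniform[OF A c[of b] x0 e']) blast
  then obtain D where D: "\<And>b. D b > 0"
    "\<And>b a x. a \<in> topspace A \<Longrightarrow> x \<in> S \<Longrightarrow> dist x x0 < D b \<Longrightarrow> norm (f' a x b - f' a x0 b) < e'"
    by metis
  obtain r where r: "r > 0" "ball x0 r \<subseteq> S" using S x0 open_contains_ball by blast
  define d where "d = Min (insert r (D ` Basis))"
  have d: "d > 0" "d \<le> r" "\<And>b. b \<in> Basis \<Longrightarrow> d \<le> D b"
    using D(1) r(1) by (auto simp: d_def intro: min.coboundedI2)
  have der: "(f a has_derivative f' a x) (at x)" if "a \<in> topspace A" "x \<in> S" for a x
    using f that by (auto simp: f'_def frechet_derivative_works)
  have bd: "norm (f' a x v - f' a x0 v) \<le> e * norm v" if "a \<in> topspace A" "x \<in> ball x0 d" for a x v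
  proof -
    have xS: "x \<in> S" using that d r by auto
    have lin: "linear (f' a x)" "linear (f' a x0)"
      using der[OF that(1) xS] der[OF that(1) x0] has_derivative_linear by blast+
    have exp: "f' a y v = (\<Sum>b\<in>Basis. (v \<bullet> b) *\<^sub>R f' a y b)" if "linear (f' a y)" for y
      using linear_sum[OF that, of "\<lambda>b. (v \<bullet> b) *\<^sub>R b" Basis] that
      by (simp add: euclidean_representation linear_scale)
    have "norm (f' a x v - f' a x0 v) = norm (\<Sum>b\<in>Basis. (v \<bullet> b) *\<^sub>R (f' a x b - f' a x0 b))"
      using exp[OF lin(1)] exp[OF lin(2)] by (simp add: sum_subtractf scaleR_diff_right)
    also have "\<dots> \<le> (\<Sum>b\<in>(Basis::'a set). norm v * e')"
    proof (rule sum_norm_le)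
      fix b :: 'a assume b: "b \<in> Basis"
      have "dist x x0 < D b"
        using that(2) d(3)[OF b] by (auto simp: dist_commute)
      then have "norm (f' a x b - f' a x0 b) \<le> e'"
        using D(2)[OF that(1) xS, of b] by simp
      then show "norm ((v \<bullet> b) *\<^sub>R (f' a x b - f' a x0 b)) \<le> norm v * e'"
        using Basis_le_norm[OF b, of v] e' by (simp add: mult_mono)
    qed
    also have "\<dots> = e * norm v" by (simp add: e'_def)
    finally show ?thesis .
  qed
  show ?thesis
  proof (rule that[OF d(1)])
    fix a :: 'p and y :: 'a assume a: "a \<in> topspace A" and y: "norm y < d"
    have on: "onorm (\<lambda>v. f' a x v - f' a x0 v) \<le> e" if "x \<in> ball x0 d" for x
      using bd[OF a that] e by (intro onorm_bound) auto
    have seg: "x0 + t *\<^sub>R y \<in> ball x0 d" if "t \<in> {0..1}" for t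
    proof -
      have "norm (t *\<^sub>R y) \<le> norm y" using that by (simp add: mult_left_le_one_le)
      then show ?thesis using y by (simp add: dist_norm)
    qed
    have "norm (f a (x0 + y) - f a x0 - f' a x0 ((x0 + y) - x0)) \<le> norm ((x0 + y) - x0) * e"
    proof (rule differentiable_bound_linearization[where S="ball x0 d"])
      show "(f a has_derivative f' a x) (at x within ball x0 d)" if "x \<in> ball x0 d" for x
      proof -
        have "x \<in> S" using that d(2) r(2) by auto
        then show ?thesis using der[OF a] has_derivative_at_withinI by blast
      qed
    qed (use seg on d(1) in \<open>auto simp: fun_diff_def\<close>)
    then show "norm (f a (x0 + y) - f a x0 - frechet_derivative (f a) (at x0) y) \<le> e * norm y"
      by (simp add: f'_def mult.commute)
  qed
qed

text \<open>The base point travels with the parameter: in the application it is the point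
  \<open>(w, c s w)\<close> on a solution curve and the parameter is the time \<open>s\<close>.
  Translating by \<open>b a\<close> moves all base points to the origin.\<close>

lemma Cp_uniformly_differentiable_moving:
  fixes f :: "'p \<Rightarrow> 'a::euclidean_space \<Rightarrow> 'b::real_normed_vector"
  assumes A: "compact_space A" and S: "open S" and f: "Cp A (Suc 0) f S"
    and b: "continuous_map A euclidean b" "\<And>a. a \<in> topspace A \<Longrightarrow> b a \<in> S" and e: "e > 0"
  obtains d where "d > 0"
    "\<And>a y. a \<in> topspace A \<Longrightarrow> norm y < d \<Longrightarrow> b a + y \<in> S"
    "\<And>a y. a \<in> topspace A \<Longrightarrow> norm y < d \<Longrightarrow>
       norm (f a (b a + y) - f a (b a) - frechet_derivative (f a) (at (b a)) y) \<le> e * norm y"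
proof -
  have sh: "Cp A k (\<lambda>a y. b a + y) R" if "open R" for k and R :: "'a set"
    using that by (intro Cp_add Cp_param_const b Cp_id) auto
  let ?W = "{p \<in> topspace (param_top A (UNIV::'a set)). (\<lambda>(a, y). b a + y) p \<in> S}"
  have W: "openin (param_top A UNIV) ?W"
    by (rule openin_continuous_map_preimage[OF Cp_continuous[OF sh[OF open_UNIV, of 0]]]) (use S in auto)
  obtain r where r: "r > 0" "\<And>a y. a \<in> topspace A \<Longrightarrow> y \<in> UNIV \<Longrightarrow> dist y 0 < r \<Longrightarrow> (a, y) \<in> ?W"
    by (rule compact_tube[OF A W, of 0]) (use b in auto)
  have inS: "b a + y \<in> S" if "a \<in> topspace A" "norm y < r" for a y
    using r(2)[of a y] that by simp
  let ?h = "\<lambda>a y. f a (b a + y)"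
  have h: "Cp A (Suc 0) ?h (ball 0 r)"
    by (rule Cp_compose[OF open_ball S f sh[OF open_ball]]) (use inS in auto)
  obtain d where d: "d > 0"
    "\<And>a y. a \<in> topspace A \<Longrightarrow> norm y < d \<Longrightarrow>
       norm (?h a (0 + y) - ?h a 0 - frechet_derivative (?h a) (at 0) y) \<le> e * norm y"
    by (rule Cp_uniformly_differentiable[OF A open_ball h _ e, of 0]) (use r(1) in auto)
  have fd: "frechet_derivative (?h a) (at 0) = frechet_derivative (f a) (at (b a))" if "a \<in> topspace A" for a
  proof -
    have "(f a has_derivative frechet_derivative (f a) (at (b a))) (at (b a + 0))"
      using Cp_SucD(2)[OF f that b(2)[OF that]] by simp
    then have "(?h a has_derivative frechet_derivative (f a) (at (b a))) (at 0)"
      by (rule has_derivative_compose[rotated]) (auto intro!: derivative_eq_intros)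
    then show ?thesis using frechet_derivative_at by metis
  qed
  show ?thesis
    by (rule that[of "min d r"]) (use d r(1) inS fd in auto)
qed

section \<open>Volterra equations\<close>

text \<open>Integral form of the initial value problem \<open>c' = K t c\<close>,
  \<open>c 0 = b\<close> over a fixed unit of time. In this form the linearised equation is again an
  instance, with a kernel that is affine in the unknown.\<close>

definition volterra_sol :: "(real \<Rightarrow> 'x \<Rightarrow> 'x) \<Rightarrow> 'x \<Rightarrow> (real \<Rightarrow> 'x::euclidean_space) \<Rightarrow> bool" where
  "volterra_sol K b c \<longleftrightarrow> continuous_on {0..1} c \<and>
     (\<forall>t\<in>{0..1}. c t = b + integral {0..t} (\<lambda>s. K s (c s)))"

text \<open>A substitute for Gronwall's inequality: at the time \<open>T\<close> where
  \<open>norm (u t)\<close> is largest, the equation gives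
  \<open>norm (u T) \<le> norm b + m + 3/4 * norm (u T)\<close>, and 4 is
  \<open>1 / (1 - 3/4)\<close>. The kernels have Lipschitz constant 1/2; the remaining 1/4 is room
  for the error term when solutions are differentiated in their parameter.\<close>

lemma volterra_bound:
  fixes u :: "real \<Rightarrow> 'x::euclidean_space"
  assumes u: "continuous_on {0..1} u" and k: "continuous_on {0..1} k"
    and eq: "\<And>t. t \<in> {0..1} \<Longrightarrow> u t = b + integral {0..t} k"
    and bd: "\<And>s. s \<in> {0..1} \<Longrightarrow> norm (k s) \<le> m + 3/4 * norm (u s)"
    and t: "t \<in> {0..1}"
  shows "norm (u t) \<le> 4 * (norm b + m)"
proof -
  have "continuous_on {0..1} (\<lambda>t. norm (u t))" using u by (intro continuous_intros)
  then obtain T where T: "T \<in> {0..1}" "\<And>t. t \<in> {0..1} \<Longrightarrow> norm (u t) \<le> norm (u T)"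
    using continuous_attains_sup[of "{0..1::real}" "\<lambda>t. norm (u t)"] by auto
  have "0 \<le> m + 3/4 * norm (u T)" using bd[OF T(1)] norm_ge_zero[of "k T"] by linarith
  moreover have "norm (integral {0..T} k) \<le> (m + 3/4 * norm (u T)) * (T - 0)"
  proof (rule integral_bound)
    fix s assume "s \<in> {0..T}"
    then have s: "s \<in> {0..1}" using T(1) by auto
    then show "norm (k s) \<le> m + 3/4 * norm (u T)" using bd[OF s] T(2)[OF s] by linarith
  qed (use T(1) k in \<open>auto intro: continuous_on_subset\<close>)
  ultimately have "norm (integral {0..T} k) \<le> m + 3/4 * norm (u T)"
    using T(1) mult_left_le[of T "m + 3/4 * norm (u T)"] by (auto intro: order_trans)
  moreover have "norm (u T) \<le> norm b + norm (integral {0..T} k)"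
    using eq[OF T(1)] norm_triangle_ineq by simp
  ultimately have "norm (u T) \<le> 4 * (norm b + m)" by simp
  then show ?thesis using T(2)[OF t] by simp
qed

lemma volterra_unique:
  assumes c: "volterra_sol K b c" and d: "volterra_sol K b d"
    and k: "continuous_on {0..1} (\<lambda>s. K s (c s))" "continuous_on {0..1} (\<lambda>s. K s (d s))"
    and L: "\<And>s. s \<in> {0..1} \<Longrightarrow> norm (K s (c s) - K s (d s)) \<le> 1/2 * norm (c s - d s)"
    and t: "t \<in> {0..1}"
  shows "c t = d t"
proof -
  have "norm (c t - d t) \<le> 4 * (norm (0::'a) + 0)"
  proof (rule volterra_bound[where u="\<lambda>t. c t - d t" and k="\<lambda>s. K s (c s) - K s (d s)", OF _ _ _ _ t])
    fix t :: real assume t: "t \<in> {0..1}"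
    have sub: "{0..t} \<subseteq> {0..1}" using t by auto
    have "integral {0..t} (\<lambda>s. K s (c s) - K s (d s)) = integral {0..t} (\<lambda>s. K s (c s)) - integral {0..t} (\<lambda>s. K s (d s))"
      by (intro integral_diff integrable_continuous_interval continuous_on_subset[OF k(1) sub] continuous_on_subset[OF k(2) sub])
    moreover have "c t = b + integral {0..t} (\<lambda>s. K s (c s))" "d t = b + integral {0..t} (\<lambda>s. K s (d s))"
      using c d t unfolding volterra_sol_def by blast+
    ultimately show "c t - d t = 0 + integral {0..t} (\<lambda>s. K s (c s) - K s (d s))" by simp
  next
    fix s :: real assume "s \<in> {0..1}"
    from L[OF this] show "norm (K s (c s) - K s (d s)) \<le> 0 + 3/4 * norm (c s - d s)"
      using norm_ge_zero[of "c s - d s"] by linarith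
  qed (use c d k in \<open>auto simp: volterra_sol_def intro!: continuous_intros\<close>)
  then show ?thesis by simp
qed

text \<open>Picard iteration contracts by 1/2 in the supremum norm without shrinking time, because
  the interval has length 1. The closed set \<open>C\<close> confines the iterates to the region
  where the Lipschitz bound holds.\<close>

lemma volterra_exists:
  fixes K :: "real \<Rightarrow> 'x \<Rightarrow> 'x::euclidean_space"
  assumes C: "closed C" "C \<noteq> {}"
    and k: "\<And>\<gamma>. continuous_on {0..1} \<gamma> \<Longrightarrow> \<gamma> ` {0..1} \<subseteq> C \<Longrightarrow> continuous_on {0..1} (\<lambda>s. K s (\<gamma> s))"
    and inv: "\<And>\<gamma> t. continuous_on {0..1} \<gamma> \<Longrightarrow> \<gamma> ` {0..1} \<subseteq> C \<Longrightarrow> t \<in> {0..1} \<Longrightarrow>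
      b + integral {0..t} (\<lambda>s. K s (\<gamma> s)) \<in> C"
    and L: "\<And>s x y. s \<in> {0..1} \<Longrightarrow> x \<in> C \<Longrightarrow> y \<in> C \<Longrightarrow> norm (K s x - K s y) \<le> 1/2 * norm (x - y)"
  obtains c where "volterra_sol K b c" "c ` {0..1} \<subseteq> C"
proof -
  \<comment> \<open>Bounded continuous functions have the whole line as their domain, so time is
    clamped to \<open>[0, 1]\<close>, outside of which the iterates are extended by
    constants.\<close>
  define cl :: "real \<Rightarrow> real" where "cl t = max 0 (min 1 t)" for t
  have cl: "cl t \<in> {0..1}" "continuous_on UNIV cl" for t
    unfolding cl_def by (auto intro!: continuous_intros)
  have cl_id: "cl t = t" if "t \<in> {0..1}" for t using that by (auto simp: cl_def)
  define J where "J \<gamma> t = b + integral {0..t} (\<lambda>s. K s (\<gamma> s))" for \<gamma> and t :: real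
  have J: "continuous_on {0..1} (J \<gamma>)" if "continuous_on {0..1} \<gamma>" "\<gamma> ` {0..1} \<subseteq> C" for \<gamma>
    unfolding J_def
    by (intro continuous_intros indefinite_integral_continuous_1 integrable_continuous_interval k that)
  define X where "X = PiC (UNIV::real set) (\<lambda>_. C)"
  have X: "f \<in> X \<longleftrightarrow> (\<forall>t. apply_bcontfun f t \<in> C)" for f
    by (auto simp: X_def mem_PiC_iff)
  define \<Phi> where "\<Phi> f = Bcontfun (\<lambda>t. J (apply_bcontfun f) (cl t))" for f
  have cont: "continuous_on S (apply_bcontfun f)" for S f
    using continuous_on_apply_bcontfun continuous_on_subset by blast
  have XJ: "continuous_on {0..1} (J (apply_bcontfun f))" if "f \<in> X" for f
    using that X by (intro J cont) auto
  have \<Phi>: "apply_bcontfun (\<Phi> f) t = J (apply_bcontfun f) (cl t)" if "f \<in> X" for f t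
  proof -
    have "continuous_on UNIV (\<lambda>t. J (apply_bcontfun f) (cl t))"
      by (rule continuous_on_compose2[OF XJ[OF that] cl(2)]) (use cl(1) in auto)
    moreover have "bounded (J (apply_bcontfun f) ` {0..1})"
      by (intro compact_imp_bounded compact_continuous_image XJ that) auto
    then have "bounded (range (\<lambda>t. J (apply_bcontfun f) (cl t)))"
      by (rule bounded_subset) (use cl(1) in auto)
    ultimately have "(\<lambda>t. J (apply_bcontfun f) (cl t)) \<in> bcontfun" by (simp add: bcontfun_def)
    then show ?thesis by (simp add: \<Phi>_def Bcontfun_inverse)
  qed
  have "\<exists>!f\<in>X. \<Phi> f = f"
  proof (rule Banach_fix[where c="1/2"])
    show "complete X" unfolding X_def complete_eq_closed by (intro closed_PiC C)
    obtain x0 where "x0 \<in> C" using C by auto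
    then have "const_bcontfun x0 \<in> X" by (auto simp: X)
    then show "X \<noteq> {}" by auto
    show "\<Phi> ` X \<subseteq> X"
    proof clarify
      fix f assume f: "f \<in> X"
      then have "apply_bcontfun f ` {0..1} \<subseteq> C" using X by auto
      from inv[OF cont this cl(1)] show "\<Phi> f \<in> X"
        unfolding X[of "\<Phi> f"] \<Phi>[OF f] J_def by blast
    qed
    show "dist (\<Phi> f) (\<Phi> g) \<le> 1/2 * dist f g" if fg: "f \<in> X" "g \<in> X" for f g
    proof (rule dist_bound)
      fix t
      let ?f = "apply_bcontfun f" and ?g = "apply_bcontfun g"
      have ci: "continuous_on {0..cl t} (\<lambda>s. K s (?f s))" "continuous_on {0..cl t} (\<lambda>s. K s (?g s))"
        using cl(1)[of t] fg X by (auto intro!: continuous_on_subset[OF k[OF cont]])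
      have "norm (integral {0..cl t} (\<lambda>s. K s (?f s) - K s (?g s))) \<le> (1/2 * dist f g) * (cl t - 0)"
      proof (rule integral_bound)
        fix s assume "s \<in> {0..cl t}"
        then have s: "s \<in> {0..1}" using cl(1)[of t] by auto
        have "norm (K s (?f s) - K s (?g s)) \<le> 1/2 * norm (?f s - ?g s)"
          using fg X by (intro L s) auto
        also have "\<dots> \<le> 1/2 * dist f g" using dist_bounded[of f s g] by (simp add: dist_norm)
        finally show "norm (K s (?f s) - K s (?g s)) \<le> 1/2 * dist f g" .
      qed (use cl(1) ci in \<open>auto intro!: continuous_intros\<close>)
      also have "\<dots> \<le> 1/2 * dist f g" using cl(1)[of t] by (auto intro!: mult_left_le)
      finally show "dist (apply_bcontfun (\<Phi> f) t) (apply_bcontfun (\<Phi> g) t) \<le> 1/2 * dist f g"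
        unfolding \<Phi>[OF fg(1)] \<Phi>[OF fg(2)] J_def
        using integral_diff[OF integrable_continuous_interval[OF ci(1)] integrable_continuous_interval[OF ci(2)]]
        by (simp add: dist_norm)
    qed
  qed auto
  then obtain f where f: "f \<in> X" "\<Phi> f = f" by blast
  show ?thesis
  proof (rule that[of "apply_bcontfun f"])
    show "volterra_sol K b (apply_bcontfun f)"
      unfolding volterra_sol_def using cont \<Phi>[OF f(1)] f(2) cl_id by (metis J_def)
    show "apply_bcontfun f ` {0..1} \<subseteq> C" using f(1) X by auto
  qed
qed

subsection \<open>Smooth dependence on parameters\<close>

abbreviation unit_time :: "real topology" where
  "unit_time \<equiv> top_of_set {0..1}"

lemma param_top_euclidean: "param_top (top_of_set S) R = top_of_set (S \<times> R)"
  by (rule prod_topology_subtopology_eu)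

lemma compact_unit_time: "compact_space unit_time"
  by (simp add: compact_space_subtopology)

text \<open>Difference quotients in the direction \<open>v\<close> are bounded by
  \<open>L * norm v\<close> near \<open>x\<close>, and so is their limit. The lemma passes the
  contraction constant of a kernel on to its derivative in the state variable, so that the
  linearised equation is covered by the same results.\<close>

lemma Lipschitz_derivative_bound:
  fixes f :: "'a::real_normed_vector \<Rightarrow> 'b::real_normed_vector"
  assumes d: "(f has_derivative f') (at x)" and S: "open S" "x \<in> S"
    and L: "\<And>y. y \<in> S \<Longrightarrow> norm (f y - f x) \<le> L * norm (y - x)"
  shows "norm (f' v) \<le> L * norm v"
proof -
  have lin: "linear f'" using d has_derivative_linear by blast
  show ?thesis
  proof (cases "v = 0")
    case True
    then show ?thesis using linear_0[OF lin] by simp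
  next
    case False
    show ?thesis
    proof (rule field_le_epsilon)
      fix e :: real assume "e > 0"
      then have "e / norm v > 0" using False by simp
      then obtain \<delta> where \<delta>: "\<delta> > 0"
        "\<And>y. norm (y - x) < \<delta> \<Longrightarrow> norm (f y - f x - f' (y - x)) \<le> e / norm v * norm (y - x)"
        using d unfolding has_derivative_at_alt by blast
      obtain r where r: "r > 0" "ball x r \<subseteq> S" using S open_contains_ball by blast
      define t where "t = min \<delta> r / (2 * norm v)"
      have t: "t > 0" using \<delta>(1) r(1) False by (simp add: t_def)
      have "t * norm v = min \<delta> r / 2" using False by (simp add: t_def)
      then have tv: "t * norm v < \<delta>" "t * norm v < r" using \<delta>(1) r(1) by auto
      define y where "y = x + t *\<^sub>R v"
      have n: "norm (y - x) = t * norm v" using t by (simp add: y_def)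
      have "y \<in> S" using r(2) tv n by (auto simp: dist_norm norm_minus_commute)
      then have "norm (f y - f x) \<le> L * (t * norm v)" using L n by metis
      moreover have "norm (f y - f x - f' (y - x)) \<le> e / norm v * (t * norm v)" using \<delta>(2)[of y] tv n by simp
      moreover have "norm (f' (y - x)) \<le> norm (f y - f x) + norm (f y - f x - f' (y - x))"
        by (metis norm_triangle_sub norm_minus_commute add.commute)
      moreover have "norm (f' (y - x)) = t * norm (f' v)"
        using t by (simp add: y_def linear_scale[OF lin])
      ultimately have "t * norm (f' v) \<le> t * (L * norm v + e)"
        using False by (simp add: algebra_simps)
      then show "norm (f' v) \<le> L * norm v + e" using t by simp
    qed
  qed
qed

lemma Cp_fun_comp_continuous:
  assumes K: "Cp unit_time k (\<lambda>s p. K s (fst p) (snd p)) (W \<times> \<Omega>)"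
    and \<gamma>: "continuous_on {0..1} \<gamma>" "\<And>s. s \<in> {0..1} \<Longrightarrow> \<gamma> s \<in> \<Omega>" and w: "w \<in> W"
  shows "continuous_on {0..1} (\<lambda>s. K s w (\<gamma> s))"
proof -
  have c: "continuous_on ({0..1} \<times> (W \<times> \<Omega>)) (\<lambda>(s, p). K s (fst p) (snd p))"
    using Cp_continuous[OF K] unfolding param_top_euclidean by simp
  have "continuous_on {0..1} (\<lambda>s. (s, (w, \<gamma> s)))"
    using \<gamma>(1) by (intro continuous_intros)
  then have "continuous_on {0..1} (\<lambda>s. (\<lambda>(s, p). K s (fst p) (snd p)) (s, (w, \<gamma> s)))"
    by (rule continuous_on_compose2[OF c]) (use \<gamma> w in auto)
  then show ?thesis by simp
qed

text \<open>The integrand of the difference is split at \<open>K s w (c s w0)\<close>: the first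
  part is contracted by 1/2, the second is small for all \<open>s\<close> at once by compactness of
  the time interval. \<open>volterra_bound\<close> then yields
  \<open>4 * (e / 8 + e / 8) = e\<close>.\<close>

lemma volterra_uniform_continuity:
  fixes K :: "real \<Rightarrow> 'w::euclidean_space \<Rightarrow> 'x::euclidean_space \<Rightarrow> 'x"
  assumes W: "open W" and K: "Cp unit_time 0 (\<lambda>s p. K s (fst p) (snd p)) (W \<times> \<Omega>)"
    and \<beta>: "continuous_on W \<beta>"
    and sol: "\<And>w. w \<in> W \<Longrightarrow> volterra_sol (\<lambda>s. K s w) (\<beta> w) (\<lambda>t. c t w)"
    and c\<Omega>: "\<And>t w. t \<in> {0..1} \<Longrightarrow> w \<in> W \<Longrightarrow> c t w \<in> \<Omega>"
    and L: "\<And>s w x y. s \<in> {0..1} \<Longrightarrow> w \<in> W \<Longrightarrow> x \<in> \<Omega> \<Longrightarrow> y \<in> \<Omega> \<Longrightarrow> norm (K s w x - K s w y) \<le> 1/2 * norm (x - y)"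
    and w0: "w0 \<in> W" and e: "e > 0"
  obtains d where "d > 0" "\<And>t w. t \<in> {0..1} \<Longrightarrow> w \<in> W \<Longrightarrow> dist w w0 < d \<Longrightarrow> norm (c t w - c t w0) \<le> e"
proof -
  have cc: "continuous_on {0..1} (\<lambda>t. c t w)" if "w \<in> W" for w
    using sol[OF that] by (simp add: volterra_sol_def)
  have "continuous_on ({0..1} \<times> W) (\<lambda>(s, w). (w, c s w0))"
    unfolding case_prod_unfold
    by (intro continuous_intros continuous_on_compose2[OF cc[OF w0]]) auto
  then have "continuous_map (param_top unit_time W) euclidean (\<lambda>(s, w). (w, c s w0))"
    unfolding param_top_euclidean by simp
  from continuous_map_compose_param[OF this, of "W \<times> \<Omega>" euclidean "\<lambda>s p. K s (fst p) (snd p)"]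
  have j: "continuous_map (param_top unit_time W) euclidean (\<lambda>(s, w). K s w (c s w0))"
    using Cp_continuous[OF K] c\<Omega> w0 by simp
  have e4: "e / 8 > 0" using e by simp
  obtain d1 where d1: "d1 > 0" "\<And>s w. s \<in> topspace unit_time \<Longrightarrow> w \<in> W \<Longrightarrow> dist w w0 < d1 \<Longrightarrow>
      norm (K s w (c s w0) - K s w0 (c s w0)) < e / 8"
    by (rule compact_param_uniform[OF compact_unit_time j w0 e4]) blast
  obtain d2 where d2: "d2 > 0" "\<And>w. w \<in> W \<Longrightarrow> dist w w0 < d2 \<Longrightarrow> norm (\<beta> w - \<beta> w0) < e / 8"
    using \<beta> w0 e4 unfolding continuous_on_iff dist_norm by metis
  have kc: "continuous_on {0..1} (\<lambda>s. K s w (c s w))" if "w \<in> W" for w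
    by (rule Cp_fun_comp_continuous[OF K cc[OF that] c\<Omega>[OF _ that] that])
  show ?thesis
  proof (rule that[of "min d1 d2"])
    fix t w assume t: "t \<in> {0..1::real}" and w: "w \<in> W" "dist w w0 < min d1 d2"
    have "norm (c t w - c t w0) \<le> 4 * (norm (\<beta> w - \<beta> w0) + e / 8)"
    proof (rule volterra_bound[where u="\<lambda>t. c t w - c t w0" and k="\<lambda>s. K s w (c s w) - K s w0 (c s w0)", OF _ _ _ _ t])
      fix t :: real assume t: "t \<in> {0..1}"
      have sub: "{0..t} \<subseteq> {0..1}" using t by auto
      have "integral {0..t} (\<lambda>s. K s w (c s w) - K s w0 (c s w0)) = integral {0..t} (\<lambda>s. K s w (c s w)) - integral {0..t} (\<lambda>s. K s w0 (c s w0))"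
        by (intro integral_diff integrable_continuous_interval continuous_on_subset[OF kc sub] w w0)
      moreover have "c t w = \<beta> w + integral {0..t} (\<lambda>s. K s w (c s w))" "c t w0 = \<beta> w0 + integral {0..t} (\<lambda>s. K s w0 (c s w0))"
        using sol[OF w(1)] sol[OF w0] t unfolding volterra_sol_def by blast+
      ultimately show "c t w - c t w0 = \<beta> w - \<beta> w0 + integral {0..t} (\<lambda>s. K s w (c s w) - K s w0 (c s w0))" by simp
    next
      fix s :: real assume s: "s \<in> {0..1}"
      have "norm (K s w (c s w) - K s w0 (c s w0)) \<le> norm (K s w (c s w) - K s w (c s w0)) + norm (K s w (c s w0) - K s w0 (c s w0))"
        using norm_triangle_ineq[of "K s w (c s w) - K s w (c s w0)" "K s w (c s w0) - K s w0 (c s w0)"] by simp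
      moreover have "norm (K s w (c s w) - K s w (c s w0)) \<le> 1/2 * norm (c s w - c s w0)"
        using s w w0 by (intro L c\<Omega>) auto
      moreover have "norm (K s w (c s w0) - K s w0 (c s w0)) < e / 8"
        using s w by (intro d1(2)) auto
      ultimately show "norm (K s w (c s w) - K s w0 (c s w0)) \<le> e / 8 + 3/4 * norm (c s w - c s w0)"
        using norm_ge_zero[of "c s w - c s w0"] by linarith
    qed (use cc kc w w0 in \<open>auto intro!: continuous_intros\<close>)
    also have "\<dots> \<le> 4 * (e / 8 + e / 8)" using d2(2)[OF w(1)] w(2) by simp
    finally show "norm (c t w - c t w0) \<le> e" by simp
  qed (use d1(1) d2(1) in auto)
qed

lemma volterra_continuous:
  fixes K :: "real \<Rightarrow> 'w::euclidean_space \<Rightarrow> 'x::euclidean_space \<Rightarrow> 'x"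
  assumes W: "open W" and K: "Cp unit_time 0 (\<lambda>s p. K s (fst p) (snd p)) (W \<times> \<Omega>)"
    and \<beta>: "continuous_on W \<beta>"
    and sol: "\<And>w. w \<in> W \<Longrightarrow> volterra_sol (\<lambda>s. K s w) (\<beta> w) (\<lambda>t. c t w)"
    and c\<Omega>: "\<And>t w. t \<in> {0..1} \<Longrightarrow> w \<in> W \<Longrightarrow> c t w \<in> \<Omega>"
    and L: "\<And>s w x y. s \<in> {0..1} \<Longrightarrow> w \<in> W \<Longrightarrow> x \<in> \<Omega> \<Longrightarrow> y \<in> \<Omega> \<Longrightarrow> norm (K s w x - K s w y) \<le> 1/2 * norm (x - y)"
  shows "Cp unit_time 0 c W"
proof -
  have "continuous_on ({0..1} \<times> W) (\<lambda>(t, w). c t w)"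
    unfolding continuous_on_iff
  proof (intro ballI allI impI)
    fix p :: "real \<times> 'w" and e :: real assume p: "p \<in> {0..1} \<times> W" and e: "e > 0"
    obtain t0 w0 where tw: "p = (t0, w0)" "t0 \<in> {0..1}" "w0 \<in> W" using p by auto
    have e2: "e / 2 > 0" using e by simp
    obtain d1 where d1: "d1 > 0" "\<And>t w. t \<in> {0..1} \<Longrightarrow> w \<in> W \<Longrightarrow> dist w w0 < d1 \<Longrightarrow> norm (c t w - c t w0) \<le> e / 2"
      by (rule volterra_uniform_continuity[OF W K \<beta> sol c\<Omega> L tw(3) e2]) blast+
    have "continuous_on {0..1} (\<lambda>t. c t w0)" using sol[OF tw(3)] by (simp add: volterra_sol_def)
    then obtain d2 where d2: "d2 > 0" "\<And>t. t \<in> {0..1} \<Longrightarrow> dist t t0 < d2 \<Longrightarrow> dist (c t w0) (c t0 w0) < e / 2"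
      using tw(2) e2 unfolding continuous_on_iff by metis
    show "\<exists>d>0. \<forall>x'\<in>{0..1} \<times> W. dist x' p < d \<longrightarrow> dist (case x' of (t, w) \<Rightarrow> c t w) (case p of (t, w) \<Rightarrow> c t w) < e"
    proof (intro exI[of _ "min d1 d2"] conjI ballI impI)
      fix x' assume x': "x' \<in> {0..1} \<times> W" "dist x' p < min d1 d2"
      obtain t w where x: "x' = (t, w)" by fastforce
      have "dist w w0 < d1" "dist t t0 < d2"
        using x'(2) dist_snd_le[of x' p] dist_fst_le[of x' p] by (auto simp: x tw(1))
      then have "norm (c t w - c t w0) \<le> e / 2" "dist (c t w0) (c t0 w0) < e / 2"
        using x' x d1(2) d2(2) by auto
      then have "dist (c t w) (c t0 w0) < e"
        using dist_triangle[of "c t w" "c t0 w0" "c t w0"] by (simp add: dist_norm)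
      then show "dist (case x' of (t, w) \<Rightarrow> c t w) (case p of (t, w) \<Rightarrow> c t w) < e"
        by (simp add: x tw(1))
    qed (use d1(1) d2(1) in auto)
  qed
  then show ?thesis by (simp add: param_top_euclidean)
qed

text \<open>
  The derivative of the solution with respect to the parameter solves a linear Volterra equation of
  the same type, whose coefficients are as regular as the solution; this makes the induction work.
\<close>

lemma volterra_smooth_aux:
  fixes K :: "real \<Rightarrow> 'w::euclidean_space \<Rightarrow> 'x::euclidean_space \<Rightarrow> 'x"
  assumes W: "open W" and \<Omega>: "open \<Omega>"
    and K: "Cp unit_time k (\<lambda>s p. K s (fst p) (snd p)) (W \<times> \<Omega>)"
    and \<beta>: "Cp unit_time k (\<lambda>_. \<beta>) W"
    and sol: "\<And>w. w \<in> W \<Longrightarrow> volterra_sol (\<lambda>s. K s w) (\<beta> w) (\<lambda>t. c t w)"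
    and c\<Omega>: "\<And>t w. t \<in> {0..1} \<Longrightarrow> w \<in> W \<Longrightarrow> c t w \<in> \<Omega>"
    and L: "\<And>s w x y. s \<in> {0..1} \<Longrightarrow> w \<in> W \<Longrightarrow> x \<in> \<Omega> \<Longrightarrow> y \<in> \<Omega> \<Longrightarrow> norm (K s w x - K s w y) \<le> 1/2 * norm (x - y)"
  shows "Cp unit_time k c W \<and> (k > 0 \<longrightarrow> (\<forall>w\<in>W. \<forall>v. volterra_sol
      (\<lambda>s u. frechet_derivative (\<lambda>p. K s (fst p) (snd p)) (at (w, c s w)) (v, u))
      (frechet_derivative \<beta> (at w) v) (\<lambda>t. frechet_derivative (c t) (at w) v)))"
  using \<Omega> K \<beta> sol c\<Omega> L
\<comment> \<open>\<open>\<Omega>\<close> is generalised because the linearised equation is posed on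
  the whole state space, not on the domain of the original one.\<close>
proof (induction k arbitrary: K \<beta> c \<Omega>)
  case 0
  have "continuous_on W \<beta>"
    using Ck_on_of_Cp[OF W 0(3), of 0] by simp
  then have "Cp unit_time 0 c W" by (intro volterra_continuous[OF W 0(2) _ 0(4,5,6)])
  then show ?case by simp
next
  case (Suc k)
  note \<Omega> = Suc.prems(1) and K = Suc.prems(2) and \<beta> = Suc.prems(3) and sol = Suc.prems(4)
    and c\<Omega> = Suc.prems(5) and L = Suc.prems(6)
  have \<beta>c: "continuous_on W \<beta>"
    using Ck_on_of_Cp[OF W Cp_mono[OF \<beta>], of 0 0] by simp
  have K0: "Cp unit_time 0 (\<lambda>s p. K s (fst p) (snd p)) (W \<times> \<Omega>)" by (rule Cp_mono[OF K]) simp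
  have ck: "Cp unit_time k c W"
    by (rule conjunct1[OF Suc.IH[OF \<Omega> Cp_Suc_lower[OF K] Cp_Suc_lower[OF \<beta>] sol c\<Omega> L]])
  have c0: "Cp unit_time 0 c W" by (rule Cp_mono[OF ck]) simp
  have open2: "open (W \<times> \<Omega>)" "open (W \<times> (UNIV::'x set))" using W \<Omega> by (auto intro: open_Times)
  have cc: "continuous_on {0..1} (\<lambda>t. c t w)" if "w \<in> W" for w
    using sol[OF that] by (simp add: volterra_sol_def)

  \<comment> \<open>The linearised equation\<close>
  define D where "D s p = frechet_derivative (\<lambda>p. K s (fst p) (snd p)) (at p)" for s p
  define \<beta>' where "\<beta>' w = frechet_derivative \<beta> (at w)" for w
  have D: "((\<lambda>p. K s (fst p) (snd p)) has_derivative D s p) (at p)" if "s \<in> {0..1}" "p \<in> W \<times> \<Omega>" for s p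
    unfolding D_def using Cp_SucD(2)[OF K, of s p] that by simp
  have \<beta>': "(\<beta> has_derivative \<beta>' w) (at w)" if "w \<in> W" for w
    unfolding \<beta>'_def using Cp_SucD(2)[OF \<beta>, of 0 w] that by simp
  have Dk: "Cp unit_time k (\<lambda>s p. D s p v) (W \<times> \<Omega>)" for v
    unfolding D_def by (rule Cp_SucD(1)[OF K])
  have \<beta>k: "Cp unit_time k (\<lambda>_ w. \<beta>' w v) W" for v
    unfolding \<beta>'_def by (rule Cp_SucD(1)[OF \<beta>])
  have linD: "linear (D s (w, c s w))" if "s \<in> {0..1}" "w \<in> W" for s w
    using D[of s "(w, c s w)"] that c\<Omega> has_derivative_linear by blast
  have lin\<beta>: "linear (\<beta>' w)" if "w \<in> W" for w
    using \<beta>'[OF that] has_derivative_linear by blast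
  \<comment> \<open>The derivative of the kernel is split into its part \<open>A\<close> in the
    parameter and its part \<open>B\<close> in the state; \<open>A\<close> becomes the inhomogeneity
    and \<open>B\<close> the linear part of the equation for the derivative.\<close>
  define A where "A s w v = D s (w, c s w) (v, 0)" for s w v
  define B where "B s w u = D s (w, c s w) (0, u)" for s w u
  have linA: "linear (A s w)" and linB: "linear (B s w)" if "s \<in> {0..1}" "w \<in> W" for s w
  proof -
    have "linear (D s (w, c s w) \<circ> (\<lambda>v. (v, 0)))" "linear (D s (w, c s w) \<circ> (\<lambda>v. (0, v)))"
      by (intro linear_compose linD that; rule linearI; simp)+
    then show "linear (A s w)" "linear (B s w)"
      unfolding A_def[abs_def] B_def[abs_def] by (simp_all add: o_def)
  qed
  have DAB: "D s (w, c s w) (v, u) = A s w v + B s w u" if "s \<in> {0..1}" "w \<in> W" for s w v u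
    using linear_add[OF linD[OF that], of "(v, 0)" "(0, u)"] by (simp add: A_def B_def)
  have Bexp: "B s w u = (\<Sum>b\<in>Basis. (u \<bullet> b) *\<^sub>R B s w b)" if "s \<in> {0..1}" "w \<in> W" for s w u
    using linear_sum[OF linB[OF that], of "\<lambda>b. (u \<bullet> b) *\<^sub>R b" Basis] linB[OF that]
    by (simp add: euclidean_representation linear_scale)
  have LB: "norm (B s w u) \<le> 1/2 * norm u" if s: "s \<in> {0..1}" and w: "w \<in> W" for s w u
  proof (rule Lipschitz_derivative_bound[OF _ \<Omega> c\<Omega>[OF s w]])
    have "((\<lambda>p. K s (fst p) (snd p)) has_derivative D s (w, c s w)) (at (w, c s w))"
      using D s w c\<Omega> by simp
    then have "((\<lambda>y. K s (fst (w, y)) (snd (w, y))) has_derivative (\<lambda>u. D s (w, c s w) (0, u))) (at (c s w))"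
      by (rule has_derivative_compose[rotated]) (auto intro!: derivative_eq_intros)
    then show "(K s w has_derivative B s w) (at (c s w))"
      unfolding B_def[abs_def] by simp
  qed (use L s w c\<Omega> in auto)
  have Dck: "Cp unit_time k (\<lambda>s w. D s (w, c s w) v) W" for v
  proof (rule Cp_compose[OF W open2(1) Dk])
    show "Cp unit_time k (\<lambda>s w. (w, c s w)) W" by (intro Cp_Pair W Cp_id ck)
  qed (use c\<Omega> in auto)
  define K' where "K' v s w u = A s w v + B s w u" for v s w u
  have K'k: "Cp unit_time k (\<lambda>s p. K' v s (fst p) (snd p)) (W \<times> UNIV)" for v
  proof -
    have "Cp unit_time k (\<lambda>s (p::'w \<times> 'x). D s (fst p, c s (fst p)) v) (W \<times> UNIV)" for v
      by (rule Cp_compose[OF open2(2) W Dck Cp_linear_fun[OF open2(2) bounded_linear_fst]]) auto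
    then have AB: "Cp unit_time k (\<lambda>s (p::'w \<times> 'x). A s (fst p) v) (W \<times> UNIV)"
      "Cp unit_time k (\<lambda>s (p::'w \<times> 'x). B s (fst p) b) (W \<times> UNIV)" for v b
      by (simp_all add: A_def B_def)
    have "Cp unit_time k (\<lambda>s p. A s (fst p) v + (\<Sum>b\<in>Basis. (snd p \<bullet> b) *\<^sub>R B s (fst p) b)) (W \<times> UNIV)"
      by (intro Cp_add Cp_sum Cp_scaleR Cp_inner Cp_const AB open2 Cp_linear_fun bounded_linear_snd)
    then show ?thesis
      by (rule Cp_cong[OF open2(2), rotated]) (simp add: K'_def Bexp[symmetric] mem_Times_iff)
  qed
  have LK': "norm (K' v s w x - K' v s w y) \<le> 1/2 * norm (x - y)" if "s \<in> {0..1}" "w \<in> W" for v s w x y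
    using LB[OF that, of "x - y"] linear_diff[OF linB[OF that]] by (simp add: K'_def)
  have kc: "continuous_on {0..1} (\<lambda>s. K' v s w (\<gamma> s))" if "w \<in> W" "continuous_on {0..1} \<gamma>" for v w \<gamma>
    by (rule Cp_fun_comp_continuous[OF K'k that(2) _ that(1)]) auto
  have ex: "\<exists>u. volterra_sol (\<lambda>s. K' v s w) (\<beta>' w v) u" if "w \<in> W" for v w
  proof (rule volterra_exists[of UNIV "\<lambda>s. K' v s w" "\<beta>' w v"])
    fix \<gamma> :: "real \<Rightarrow> 'x" assume "continuous_on {0..1} \<gamma>"
    from kc[OF \<open>w \<in> W\<close> this] show "continuous_on {0..1} (\<lambda>s. K' v s w (\<gamma> s))" .
  next
    show "norm (K' v s w x - K' v s w y) \<le> 1/2 * norm (x - y)" if "s \<in> {0..1}" for s x y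
      by (rule LK'[OF that \<open>w \<in> W\<close>])
  qed (rule closed_UNIV UNIV_not_empty UNIV_I exI | assumption)+
  define u where "u v t w = (SOME u. volterra_sol (\<lambda>s. K' v s w) (\<beta>' w v) u) t" for v t w
  have u: "volterra_sol (\<lambda>s. K' v s w) (\<beta>' w v) (\<lambda>t. u v t w)" if "w \<in> W" for v w
    unfolding u_def using someI_ex[OF ex[OF that]] .
  have uk: "Cp unit_time k (u v) W" for v
    by (rule conjunct1[OF Suc.IH[OF open_UNIV K'k \<beta>k u]]) (use LK' in auto)
  \<comment> \<open>\<open>U\<close> is assembled from the solutions for basis vectors, so that it
    is linear in \<open>v\<close> by construction; that it solves the equation for every
    \<open>v\<close> then follows from the linearity of \<open>A\<close>, \<open>B\<close> and
    \<open>\<beta>'\<close>.\<close>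
  define U where "U t w v = (\<Sum>b\<in>Basis. (v \<bullet> b) *\<^sub>R u b t w)" for t w v
  have Uk: "Cp unit_time k (\<lambda>t w. U t w v) W" for v
    unfolding U_def by (intro Cp_sum Cp_scaleR Cp_const W uk)
  have uc: "continuous_on {0..1} (\<lambda>t. u v t w)" if "w \<in> W" for v w
    using u[OF that] by (simp add: volterra_sol_def)
  have Uc: "continuous_on {0..1} (\<lambda>t. U t w v)" if "w \<in> W" for v w
    unfolding U_def by (intro continuous_intros uc that)
  have U: "U t w v = \<beta>' w v + integral {0..t} (\<lambda>s. A s w v + B s w (U s w v))"
    if t: "t \<in> {0..1}" and w: "w \<in> W" for t w v
  proof -
    have sub: "{0..t} \<subseteq> {0..1}" using t by auto
    have int: "(\<lambda>s. K' b s w (u b s w)) integrable_on {0..t}" for b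
      by (intro integrable_continuous_interval continuous_on_subset[OF kc sub] w uc)
    have "U t w v = (\<Sum>b\<in>Basis. (v \<bullet> b) *\<^sub>R (\<beta>' w b + integral {0..t} (\<lambda>s. K' b s w (u b s w))))"
      unfolding U_def by (intro sum.cong refl) (use u[OF w] t in \<open>auto simp: volterra_sol_def\<close>)
    also have "\<dots> = (\<Sum>b\<in>Basis. (v \<bullet> b) *\<^sub>R \<beta>' w b) + (\<Sum>b\<in>Basis. (v \<bullet> b) *\<^sub>R integral {0..t} (\<lambda>s. K' b s w (u b s w)))"
      by (simp add: scaleR_add_right sum.distrib)
    also have "(\<Sum>b\<in>Basis. (v \<bullet> b) *\<^sub>R \<beta>' w b) = \<beta>' w v"
      using linear_sum[OF lin\<beta>[OF w], of "\<lambda>b. (v \<bullet> b) *\<^sub>R b" Basis] lin\<beta>[OF w]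
      by (simp add: euclidean_representation linear_scale)
    also have "(\<Sum>b\<in>Basis. (v \<bullet> b) *\<^sub>R integral {0..t} (\<lambda>s. K' b s w (u b s w)))
        = integral {0..t} (\<lambda>s. \<Sum>b\<in>Basis. (v \<bullet> b) *\<^sub>R K' b s w (u b s w))"
      using int by (subst integral_sum) (auto intro: integrable_cmul)
    also have "\<dots> = integral {0..t} (\<lambda>s. A s w v + B s w (U s w v))"
    proof (rule integral_cong)
      fix s assume "s \<in> {0..t}"
      then have s: "s \<in> {0..1}" using sub by auto
      have "(\<Sum>b\<in>Basis. (v \<bullet> b) *\<^sub>R A s w b) = A s w v"
        using linear_sum[OF linA[OF s w], of "\<lambda>b. (v \<bullet> b) *\<^sub>R b" Basis] linA[OF s w]
        by (simp add: euclidean_representation linear_scale)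
      moreover have "(\<Sum>b\<in>Basis. (v \<bullet> b) *\<^sub>R B s w (u b s w)) = B s w (U s w v)"
        unfolding U_def using linear_sum[OF linB[OF s w], of "\<lambda>b. (v \<bullet> b) *\<^sub>R u b s w" Basis] linB[OF s w]
        by (simp add: linear_scale)
      ultimately show "(\<Sum>b\<in>Basis. (v \<bullet> b) *\<^sub>R K' b s w (u b s w)) = A s w v + B s w (U s w v)"
        by (simp add: K'_def scaleR_add_right sum.distrib)
    qed
    finally show ?thesis .
  qed
  have linU: "linear (U t w)" for t w
    by (rule linearI) (simp_all add: U_def inner_add_left scaleR_add_left sum.distrib scaleR_sum_right)

  \<comment> \<open>Differentiability in the parameter\<close>
  have der: "(c t has_derivative U t w) (at w)" if t: "t \<in> {0..1}" and w: "w \<in> W" for t w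
    unfolding has_derivative_at_alt
  proof (intro conjI allI impI)
    show "bounded_linear (U t w)" using linU linear_conv_bounded_linear by blast
    fix e :: real assume e: "e > 0"
    have "\<exists>m. \<forall>s\<in>{0..1}. norm (u b s w) \<le> m" for b
      using compact_imp_bounded[OF compact_continuous_image[OF uc[OF w, of b] compact_Icc]]
      by (auto simp: bounded_iff)
    then obtain m where m: "\<And>b s. s \<in> {0..1} \<Longrightarrow> norm (u b s w) \<le> m b" by metis
    define M where "M = (\<Sum>b\<in>Basis. m b)"
    have m0: "m b \<ge> 0" for b using order_trans[OF norm_ge_zero m[of 0 b]] by simp
    have M0: "M \<ge> 0" unfolding M_def by (intro sum_nonneg m0)
    have UM: "norm (U s w h) \<le> M * norm h" if "s \<in> {0..1}" for s h
    proof -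
      have "norm (U s w h) \<le> (\<Sum>b\<in>Basis. m b * norm h)" unfolding U_def
      proof (rule sum_norm_le)
        fix b :: 'w assume "b \<in> Basis"
        then show "norm ((h \<bullet> b) *\<^sub>R u b s w) \<le> m b * norm h"
          using Basis_le_norm[of b h] m[OF that, of b] m0 mult_mono[of "\<bar>h \<bullet> b\<bar>" "norm h" "norm (u b s w)" "m b"]
          by (simp add: mult.commute)
      qed
      then show ?thesis by (simp add: M_def sum_distrib_right)
    qed
    \<comment> \<open>The bound 1/4 keeps the total factor of \<open>norm (r s)\<close> at
      \<open>1/2 + 1/4\<close>; the bound \<open>e / (8 * (1 + M))\<close> keeps the inhomogeneous
      part at \<open>e / 8 * norm h\<close>. With the error \<open>e / 8\<close> from
      \<open>\<beta>\<close>, the factor 4 of \<open>volterra_bound\<close> gives exactly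
      \<open>e\<close>.\<close>
    define e1 where "e1 = min (1/4) (e / (8 * (1 + M)))"
    have e1: "e1 > 0" using e M0 by (simp add: e1_def)
    have e14: "e1 \<le> 1/4" unfolding e1_def by (rule min.cobounded1)
    have "e1 \<le> e / (8 * (1 + M))" by (simp add: e1_def)
    then have e1M: "e1 * (1 + M) \<le> e / 8" using M0 by (simp add: field_simps)
    have cb: "continuous_map unit_time euclidean (\<lambda>s. (w, c s w))"
      using cc[OF w] by (auto intro!: continuous_intros)
    obtain d1 where d1: "d1 > 0" "\<And>s y. s \<in> topspace unit_time \<Longrightarrow> norm y < d1 \<Longrightarrow> (w, c s w) + y \<in> W \<times> \<Omega>"
      "\<And>s y. s \<in> topspace unit_time \<Longrightarrow> norm y < d1 \<Longrightarrow>
         norm (K s (fst ((w, c s w) + y)) (snd ((w, c s w) + y)) - K s (fst (w, c s w)) (snd (w, c s w)) -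
           frechet_derivative (\<lambda>p. K s (fst p) (snd p)) (at (w, c s w)) y) \<le> e1 * norm y"
      by (rule Cp_uniformly_differentiable_moving[OF compact_unit_time open2(1) Cp_mono[OF K] cb _ e1])
         (use w c\<Omega> in auto)
    \<comment> \<open>\<open>norm h < d1 / 2\<close> and
      \<open>norm (\<Delta> s) \<le> d1 / 3\<close> together keep the increment of the base point
      below \<open>d1\<close>.\<close>
    have d13: "d1 / 3 > 0" using d1(1) by simp
    obtain d2 where d2: "d2 > 0" "\<And>t y. t \<in> {0..1} \<Longrightarrow> y \<in> W \<Longrightarrow> dist y w < d2 \<Longrightarrow> norm (c t y - c t w) \<le> d1 / 3"
      by (rule volterra_uniform_continuity[OF W K0 \<beta>c sol c\<Omega> L w d13]) blast+
    have e8: "e / 8 > 0" using e by simp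
    obtain d3 where d3: "d3 > 0" "\<And>y. norm (y - w) < d3 \<Longrightarrow> norm (\<beta> y - \<beta> w - \<beta>' w (y - w)) \<le> e / 8 * norm (y - w)"
      using \<beta>'[OF w] e8 unfolding has_derivative_at_alt by blast
    obtain d4 where d4: "d4 > 0" "ball w d4 \<subseteq> W" using W w open_contains_ball by blast
    define d where "d = min (min (d1 / 2) d2) (min d3 d4)"
    have "norm (c t y - c t w - U t w (y - w)) \<le> e * norm (y - w)" if y: "norm (y - w) < d" for y
    proof -
      define h where "h = y - w"
      have yW: "y \<in> W" using y d4(2) by (auto simp: d_def dist_norm norm_minus_commute)
      define \<Delta> where "\<Delta> s = c s y - c s w" for s
      define r where "r s = \<Delta> s - U s w h" for s
      define q where "q s = K s y (c s y) - K s w (c s w) - (A s w h + B s w (U s w h))" for s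
      have Kc: "continuous_on {0..1} (\<lambda>s. K s y (c s y))" if "y \<in> W" for y
        by (rule Cp_fun_comp_continuous[OF K0 cc[OF that] c\<Omega>[OF _ that] that])
      have ABc: "continuous_on {0..1} (\<lambda>s. A s w h + B s w (U s w h))"
        using kc[OF w Uc[OF w]] by (simp add: K'_def)
      have "norm (r t) \<le> 4 * (norm (\<beta> y - \<beta> w - \<beta>' w h) + e / 8 * norm h)"
      proof (rule volterra_bound[where u=r and k=q, OF _ _ _ _ t])
        show "continuous_on {0..1} r" unfolding r_def \<Delta>_def by (intro continuous_intros cc Uc w yW)
        show "continuous_on {0..1} q" unfolding q_def
          by (intro continuous_on_diff Kc ABc w yW)
        fix s :: real assume s: "s \<in> {0..1}"
        have sub: "{0..s} \<subseteq> {0..1}" using s by auto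
        have i: "(\<lambda>s. K s y (c s y)) integrable_on {0..s}" "(\<lambda>s. K s w (c s w)) integrable_on {0..s}"
          "(\<lambda>s. A s w h + B s w (U s w h)) integrable_on {0..s}"
          by (intro integrable_continuous_interval continuous_on_subset[OF Kc sub] continuous_on_subset[OF ABc sub] w yW)+
        have "integral {0..s} q = integral {0..s} (\<lambda>s. K s y (c s y)) - integral {0..s} (\<lambda>s. K s w (c s w))
            - integral {0..s} (\<lambda>s. A s w h + B s w (U s w h))"
          unfolding q_def by (simp add: integral_diff integrable_diff i)
        moreover have "c s y = \<beta> y + integral {0..s} (\<lambda>s. K s y (c s y))" "c s w = \<beta> w + integral {0..s} (\<lambda>s. K s w (c s w))"
          using sol[OF w] sol[OF yW] s unfolding volterra_sol_def by blast+
        ultimately show "r s = \<beta> y - \<beta> w - \<beta>' w h + integral {0..s} q"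
          using U[OF s w, of h] by (simp add: r_def \<Delta>_def algebra_simps)
        have \<Delta>1: "norm (\<Delta> s) \<le> d1 / 3"
          unfolding \<Delta>_def using y by (intro d2(2) s yW) (auto simp: d_def dist_norm)
        have hs: "norm h < d1 / 2" using y by (simp add: d_def h_def)
        have np: "norm (h, \<Delta> s) \<le> norm h + norm (\<Delta> s)" by (rule norm_Pair_le)
        have "norm (h, \<Delta> s) < d1" using np \<Delta>1 hs d1(1) by linarith
        from d1(3)[OF _ this, of s] s
        have x: "norm (K s y (c s y) - K s w (c s w) - D s (w, c s w) (h, \<Delta> s)) \<le> e1 * norm (h, \<Delta> s)"
          by (simp add: h_def \<Delta>_def D_def)
        have \<Delta>r: "\<Delta> s = U s w h + r s" by (simp add: r_def)
        \<comment> \<open>The linear terms in \<open>h\<close> and \<open>U s w h\<close> cancel,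
          which leaves the Taylor remainder of the kernel and \<open>B\<close> applied to the
          unknown remainder \<open>r\<close>.\<close>
        have "q s = (K s y (c s y) - K s w (c s w) - D s (w, c s w) (h, \<Delta> s)) + B s w (r s)"
          unfolding q_def DAB[OF s w] \<Delta>r linear_add[OF linB[OF s w]] by simp
        then have "norm (q s) \<le> e1 * norm (h, \<Delta> s) + 1/2 * norm (r s)"
          using x LB[OF s w, of "r s"] norm_triangle_le by (metis add_mono)
        also have "e1 * norm (h, \<Delta> s) \<le> e1 * (norm h + (M * norm h + norm (r s)))"
        proof (intro mult_left_mono)
          have "norm (\<Delta> s) \<le> M * norm h + norm (r s)"
            unfolding \<Delta>r using norm_triangle_ineq[of "U s w h" "r s"] UM[OF s, of h] by linarith
          then show "norm (h, \<Delta> s) \<le> norm h + (M * norm h + norm (r s))" using np by linarith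
        qed (use e1 in simp)
        also have "\<dots> = e1 * (1 + M) * norm h + e1 * norm (r s)" by (simp add: algebra_simps)
        also have "\<dots> \<le> e / 8 * norm h + 1/4 * norm (r s)"
          using e1M e14 by (intro add_mono mult_right_mono) auto
        finally show "norm (q s) \<le> e / 8 * norm h + 3/4 * norm (r s)" by simp
      qed
      also have "norm (\<beta> y - \<beta> w - \<beta>' w h) \<le> e / 8 * norm h"
        unfolding h_def using y by (intro d3(2)) (auto simp: d_def)
      finally show ?thesis by (simp add: r_def \<Delta>_def h_def)
    qed
    moreover have "d > 0" using d1(1) d2(1) d3(1) d4(1) by (simp add: d_def)
    ultimately show "\<exists>d>0. \<forall>y. norm (y - w) < d \<longrightarrow> norm (c t y - c t w - U t w (y - w)) \<le> e * norm (y - w)"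
      by blast
  qed
  have "Cp unit_time (Suc k) c W"
    by (rule Cp_SucI[OF W Cp_continuous[OF c0] der Uk]) auto
  moreover have "volterra_sol (\<lambda>s u. D s (w, c s w) (v, u)) (\<beta>' w v) (\<lambda>t. frechet_derivative (c t) (at w) v)"
    if w: "w \<in> W" for w v
  proof -
    have fd: "frechet_derivative (c t) (at w) = U t w" if "t \<in> {0..1}" for t
      using der[OF that w] frechet_derivative_at by metis
    have int: "integral {0..t} (\<lambda>s. D s (w, c s w) (v, frechet_derivative (c s) (at w) v)) =
        integral {0..t} (\<lambda>s. A s w v + B s w (U s w v))" if "t \<in> {0..1}" for t
      by (rule integral_cong) (use that w fd DAB in auto)
    have "continuous_on {0..1} (\<lambda>t. frechet_derivative (c t) (at w) v)"
      using Uc[OF w, of v] by (rule continuous_on_eq) (simp add: fd)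
    then show ?thesis
      unfolding volterra_sol_def using U[OF _ w] fd int by auto
  qed
  ultimately show ?case unfolding D_def \<beta>'_def by blast
qed

theorem volterra_smooth:
  fixes K :: "real \<Rightarrow> 'w::euclidean_space \<Rightarrow> 'x::euclidean_space \<Rightarrow> 'x"
  assumes W: "open W" and \<Omega>: "open \<Omega>"
    and K: "\<And>k. Cp unit_time k (\<lambda>s p. K s (fst p) (snd p)) (W \<times> \<Omega>)"
    and \<beta>: "\<And>k. Cp unit_time k (\<lambda>_. \<beta>) W"
    and sol: "\<And>w. w \<in> W \<Longrightarrow> volterra_sol (\<lambda>s. K s w) (\<beta> w) (\<lambda>t. c t w)"
    and c\<Omega>: "\<And>t w. t \<in> {0..1} \<Longrightarrow> w \<in> W \<Longrightarrow> c t w \<in> \<Omega>"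
    and L: "\<And>s w x y. s \<in> {0..1} \<Longrightarrow> w \<in> W \<Longrightarrow> x \<in> \<Omega> \<Longrightarrow> y \<in> \<Omega> \<Longrightarrow> norm (K s w x - K s w y) \<le> 1/2 * norm (x - y)"
  shows "Cp unit_time k c W"
    and "w \<in> W \<Longrightarrow> volterra_sol
      (\<lambda>s u. frechet_derivative (\<lambda>p. K s (fst p) (snd p)) (at (w, c s w)) (v, u))
      (frechet_derivative \<beta> (at w) v) (\<lambda>t. frechet_derivative (c t) (at w) v)"
  using volterra_smooth_aux[OF W \<Omega> K \<beta> sol c\<Omega> L, of k] volterra_smooth_aux[OF W \<Omega> K \<beta> sol c\<Omega> L, of "Suc 0"]
  by simp_all

section \<open>The invariant mean of a compact group\<close>

text \<open>Lists and not sets: the product of two families of translates is again a family of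
  translates, in which coincidences have to be counted with multiplicity.\<close>

definition avg :: "'i list \<Rightarrow> ('i \<Rightarrow> real) \<Rightarrow> real" where
  "avg as h = (\<Sum>a\<leftarrow>as. h a) / real (length as)"

lemma sum_list_upper_bound: "(\<And>a. a \<in> set as \<Longrightarrow> h a \<le> u) \<Longrightarrow> (\<Sum>a\<leftarrow>as. h a) \<le> real (length as) * (u::real)"
  by (induction as) (auto simp: algebra_simps intro!: add_mono)

lemma avg_le: "as \<noteq> [] \<Longrightarrow> (\<And>a. a \<in> set as \<Longrightarrow> h a \<le> u) \<Longrightarrow> avg as h \<le> u"
  using sum_list_upper_bound[of as h u] by (simp add: avg_def divide_simps mult.commute)

lemma avg_minus: "avg as (\<lambda>a. - h a) = - avg as h"
  by (induction as) (auto simp: avg_def divide_simps uminus_sum_list_map[symmetric, unfolded o_def])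

lemma avg_ge: "as \<noteq> [] \<Longrightarrow> (\<And>a. a \<in> set as \<Longrightarrow> l \<le> h a) \<Longrightarrow> l \<le> avg as h"
  using avg_le[of as "\<lambda>a. - h a" "- l"] by (simp add: avg_minus)

lemma avg_add: "avg as (\<lambda>a. f a + h a) = avg as f + avg as h"
  by (simp add: avg_def sum_list_addf add_divide_distrib)

lemma avg_cmult: "avg as (\<lambda>a. c * f a) = c * avg as f"
  by (simp add: avg_def sum_list_const_mult)

lemma avg_cong: "(\<And>a. a \<in> set as \<Longrightarrow> f a = h a) \<Longrightarrow> avg as f = avg as h"
  unfolding avg_def by (metis map_eq_conv)

lemma sum_list_divide: "(\<Sum>a\<leftarrow>as. h a / c) = (\<Sum>a\<leftarrow>as. h a) / (c::real)"
  by (induction as) (auto simp: add_divide_distrib)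

lemma avg_avg_eq: "avg as (\<lambda>a. avg bs (\<lambda>b. h a b)) = (\<Sum>a\<leftarrow>as. \<Sum>b\<leftarrow>bs. h a b) / (real (length as) * real (length bs))"
  by (simp add: avg_def sum_list_divide)

lemma avg_swap: "avg as (\<lambda>a. avg bs (\<lambda>b. h a b)) = avg bs (\<lambda>b. avg as (\<lambda>a. h a b))"
proof -
  have "(\<Sum>a\<leftarrow>as. \<Sum>b\<leftarrow>bs. h a b) = (\<Sum>b\<leftarrow>bs. \<Sum>a\<leftarrow>as. h a b)"
    by (induction as) (auto simp: sum_list_addf)
  then show ?thesis by (simp add: avg_avg_eq mult.commute)
qed

lemma avg_avg: "avg bs (\<lambda>b. avg as (\<lambda>a. k (f b a))) = avg (concat (map (\<lambda>b. map (f b) as) bs)) k"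
proof -
  have "length (concat (map (\<lambda>b. map (f b) as) bs)) = length bs * length as"
    by (induction bs) auto
  moreover have "(\<Sum>x\<leftarrow>concat (map (\<lambda>b. map (f b) as) bs). k x) = (\<Sum>b\<leftarrow>bs. \<Sum>a\<leftarrow>as. k (f b a))"
    by (induction bs) (auto simp: o_def)
  moreover have "(\<Sum>b\<leftarrow>bs. avg as (\<lambda>a. k (f b a))) = (\<Sum>b\<leftarrow>bs. \<Sum>a\<leftarrow>as. k (f b a)) / real (length as)"
    unfolding avg_def by (induction bs) (auto simp: add_divide_distrib)
  ultimately show ?thesis by (simp add: avg_def divide_simps)
qed

locale compact_topological_group = group G for G (structure) +
  fixes T :: "'a topology"
  assumes topspace_T: "topspace T = carrier G"
    and compact_T: "compact_space T"
    and mult_continuous: "continuous_map (prod_topology T T) T (\<lambda>(g, h). g \<otimes> h)"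
    and inv_continuous: "continuous_map T T (\<lambda>g. inv g)"
begin

definition cont :: "('a \<Rightarrow> real) \<Rightarrow> bool" where
  "cont f \<longleftrightarrow> continuous_map T euclideanreal f"

definition right_avg :: "'a list \<Rightarrow> ('a \<Rightarrow> real) \<Rightarrow> 'a \<Rightarrow> real" where
  "right_avg as f x = avg as (\<lambda>a. f (x \<otimes> a))"

definition left_avg :: "'a list \<Rightarrow> ('a \<Rightarrow> real) \<Rightarrow> 'a \<Rightarrow> real" where
  "left_avg as f x = avg as (\<lambda>a. f (a \<otimes> x))"

lemma right_mult_continuous: "a \<in> carrier G \<Longrightarrow> continuous_map T T (\<lambda>x. x \<otimes> a)"
proof -
  assume "a \<in> carrier G"
  then have "continuous_map T (prod_topology T T) (\<lambda>x. (x, a))"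
    by (auto simp: continuous_map_pairwise o_def topspace_T)
  from continuous_map_compose[OF this mult_continuous] show ?thesis by (simp add: o_def)
qed

lemma left_mult_continuous: "a \<in> carrier G \<Longrightarrow> continuous_map T T (\<lambda>x. a \<otimes> x)"
proof -
  assume "a \<in> carrier G"
  then have "continuous_map T (prod_topology T T) (\<lambda>x. (a, x))"
    by (auto simp: continuous_map_pairwise o_def topspace_T)
  from continuous_map_compose[OF this mult_continuous] show ?thesis by (simp add: o_def)
qed

lemma cont_right: "cont f \<Longrightarrow> a \<in> carrier G \<Longrightarrow> cont (\<lambda>x. f (x \<otimes> a))"
  unfolding cont_def using continuous_map_compose[OF right_mult_continuous] by (fastforce simp: o_def)

lemma cont_left: "cont f \<Longrightarrow> a \<in> carrier G \<Longrightarrow> cont (\<lambda>x. f (a \<otimes> x))"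
  unfolding cont_def using continuous_map_compose[OF left_mult_continuous] by (fastforce simp: o_def)

lemma cont_inv: "cont f \<Longrightarrow> cont (\<lambda>x. f (inv x))"
  unfolding cont_def using continuous_map_compose[OF inv_continuous] by (fastforce simp: o_def)

lemma cont_add: "cont f \<Longrightarrow> cont h \<Longrightarrow> cont (\<lambda>x. f x + h x)"
  unfolding cont_def by (rule continuous_map_add)

lemma cont_cmult: "cont f \<Longrightarrow> cont (\<lambda>x. c * f x)"
  unfolding cont_def by (intro continuous_map_real_mult) auto

lemma cont_const: "cont (\<lambda>x. c)"
  by (simp add: cont_def)

lemma cont_left_avg:
  assumes "cont f" "set as \<subseteq> carrier G"
  shows "cont (left_avg as f)"
proof -
  have "cont (\<lambda>x. \<Sum>a\<leftarrow>as. f (a \<otimes> x))"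
    using assms(2)
  proof (induction as)
    case (Cons a as)
    then show ?case using cont_add[OF cont_left[OF assms(1), of a]] by simp
  qed (simp add: cont_const)
  from cont_cmult[OF this, of "1 / real (length as)"] show ?thesis
    by (simp add: left_avg_def[abs_def] avg_def)
qed

text \<open>Left and right translations commute by associativity. This links the two kinds of
  averages and is the source of the uniqueness of the mean.\<close>

lemma left_right_avg:
  assumes "set as \<subseteq> carrier G" "set bs \<subseteq> carrier G" "x \<in> carrier G"
  shows "left_avg bs (right_avg as f) x = right_avg as (left_avg bs f) x"
proof -
  have "left_avg bs (right_avg as f) x = avg bs (\<lambda>b. avg as (\<lambda>a. f (b \<otimes> (x \<otimes> a))))"
    unfolding left_avg_def right_avg_def using assms by (intro avg_cong) (auto simp: m_assoc subset_iff)
  then show ?thesis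
    by (simp add: left_avg_def right_avg_def avg_swap[of bs])
qed

lemma cont_bounded:
  assumes "cont f"
  obtains M where "\<And>x. x \<in> carrier G \<Longrightarrow> \<bar>f x\<bar> \<le> M"
proof -
  have "compactin euclideanreal (f ` topspace T)"
    by (rule image_compactin[OF _ assms[unfolded cont_def]]) (use compact_T in \<open>simp add: compact_space_def\<close>)
  then have "bounded (f ` carrier G)" using compact_imp_bounded topspace_T by auto
  then show ?thesis using that unfolding bounded_iff by auto
qed

text \<open>Uniform continuity with respect to left translations, from the tube lemma over the
  compact group.\<close>

lemma uniform_nbhd:
  assumes f: "cont f" and e: "e > 0"
  obtains N where "openin T N" "\<one> \<in> N"
    "\<And>n x. n \<in> N \<Longrightarrow> x \<in> carrier G \<Longrightarrow> \<bar>f (n \<otimes> x) - f x\<bar> \<le> e"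
proof -
  have "continuous_map (prod_topology T T) euclideanreal (\<lambda>p. f (snd p \<otimes> fst p))"
  proof -
    have "continuous_map (prod_topology T T) (prod_topology T T) (\<lambda>p. (snd p, fst p))"
      by (simp add: continuous_map_pairwise o_def continuous_map_fst continuous_map_snd)
    from continuous_map_compose[OF continuous_map_compose[OF this mult_continuous] f[unfolded cont_def]]
    show ?thesis by (simp add: o_def)
  qed
  moreover have "continuous_map (prod_topology T T) euclideanreal (\<lambda>p. f (fst p))"
    using continuous_map_compose[OF continuous_map_fst f[unfolded cont_def]] by (simp add: o_def)
  ultimately have c: "continuous_map (prod_topology T T) euclideanreal (\<lambda>p. \<bar>f (snd p \<otimes> fst p) - f (fst p)\<bar>)"
    by (intro continuous_map_real_abs continuous_map_diff)
  let ?W = "{p \<in> topspace (prod_topology T T). \<bar>f (snd p \<otimes> fst p) - f (fst p)\<bar> \<in> {..<e}}"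
  have W: "openin (prod_topology T T) ?W"
    by (rule openin_continuous_map_preimage[OF c]) auto
  have "\<exists>U V. openin T U \<and> openin T V \<and> topspace T \<subseteq> U \<and> \<one> \<in> V \<and> U \<times> V \<subseteq> ?W"
    by (rule tube_lemma_left[OF W]) (use compact_T e in \<open>auto simp: compact_space_def topspace_T\<close>)
  then obtain U V where UV: "openin T V" "topspace T \<subseteq> U" "\<one> \<in> V" "U \<times> V \<subseteq> ?W" by blast
  show ?thesis
  proof (rule that[OF UV(1,3)])
    fix n x assume "n \<in> V" "x \<in> carrier G"
    then have "(x, n) \<in> ?W" using UV topspace_T by blast
    then show "\<bar>f (n \<otimes> x) - f x\<bar> \<le> e" by simp
  qed
qed

lemma finite_cover:
  assumes N: "openin T N" "\<one> \<in> N"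
  obtains bs where "set bs \<subseteq> carrier G" "bs \<noteq> []" "\<And>x. x \<in> carrier G \<Longrightarrow> \<exists>b\<in>set bs. x \<otimes> inv b \<in> N"
proof -
  define U where "U b = {x \<in> topspace T. x \<otimes> inv b \<in> N}" for b
  have "openin T (U b)" if "b \<in> carrier G" for b
    unfolding U_def by (rule openin_continuous_map_preimage[OF right_mult_continuous N(1)]) (use that in auto)
  moreover have "x \<in> U x" if "x \<in> carrier G" for x
    using that N(2) by (simp add: U_def topspace_T)
  ultimately have "\<exists>\<F>. finite \<F> \<and> \<F> \<subseteq> U ` carrier G \<and> topspace T \<subseteq> \<Union>\<F>"
    using compact_T unfolding compact_space_alt by (elim allE[of _ "U ` carrier G"]) (auto simp: topspace_T)
  then obtain B where B: "finite B" "B \<subseteq> carrier G" "topspace T \<subseteq> (\<Union>b\<in>B. U b)"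
    by (metis finite_subset_image)
  obtain bs where bs: "set bs = B" using finite_list B(1) by blast
  have "\<exists>b\<in>set bs. x \<otimes> inv b \<in> N" if "x \<in> carrier G" for x
    using B(3) that bs by (auto simp: topspace_T U_def)
  moreover from this[of \<one>] have "bs \<noteq> []" by auto
  ultimately show ?thesis using that B(2) bs by metis
qed

text \<open>One step shrinks an interval \<open>[l, u]\<close> enclosing the values of the current
  average. If all values exceed the midpoint, \<open>l\<close> is raised. Otherwise the value at
  some \<open>y\<close> does not exceed it; \<open>finite_cover\<close> supplies \<open>n\<close>
  elements \<open>b\<close> such that every \<open>x\<close> has one with
  \<open>x \<otimes> inv b \<in> N\<close>, and then \<open>x \<otimes> (inv b \<otimes> y)\<close>
  is a small left translate of \<open>y\<close>. Averaging over the translates by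
  \<open>inv b \<otimes> y\<close> therefore contains, for each \<open>x\<close>, one term at most
  \<open>\<epsilon>\<close> above the midpoint, which lowers \<open>u\<close> by a fixed fraction.
  The same \<open>N\<close> and \<open>n\<close> serve all steps, since right averages inherit the
  estimate of \<open>uniform_nbhd\<close>.\<close>

lemma right_avg_small_oscillation:
  assumes f: "cont f" and e: "e > 0"
  obtains as l where "set as \<subseteq> carrier G" "as \<noteq> []"
    "\<And>x. x \<in> carrier G \<Longrightarrow> l \<le> right_avg as f x \<and> right_avg as f x \<le> l + e"
proof -
  define \<epsilon> where "\<epsilon> = e / 3"
  have \<epsilon>: "\<epsilon> > 0" using e by (simp add: \<epsilon>_def)
  obtain N where N: "openin T N" "\<one> \<in> N"
    "\<And>n x. n \<in> N \<Longrightarrow> x \<in> carrier G \<Longrightarrow> \<bar>f (n \<otimes> x) - f x\<bar> \<le> \<epsilon>"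
    using uniform_nbhd[OF f \<epsilon>] by metis
  obtain bs where bs: "set bs \<subseteq> carrier G" "bs \<noteq> []" "\<And>x. x \<in> carrier G \<Longrightarrow> \<exists>b\<in>set bs. x \<otimes> inv b \<in> N"
    using finite_cover[OF N(1,2)] by metis
  obtain M where M: "\<And>x. x \<in> carrier G \<Longrightarrow> \<bar>f x\<bar> \<le> M" using cont_bounded[OF f] by metis
  define n where "n = real (length bs)"
  have n: "n \<ge> 1" using bs(2) by (cases bs) (auto simp: n_def)
  \<comment> \<open>Of \<open>n\<close> terms one is lowered by half the length of the interval, up
    to \<open>\<epsilon>\<close>; hence the new length is at most \<open>q\<close> times the old one
    plus \<open>\<epsilon> / n\<close>.\<close>
  define q where "q = 1 - 1 / (2 * n)"
  have q: "0 \<le> q" "q < 1" using n by (auto simp: q_def field_simps)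
  have NG: "N \<subseteq> carrier G" using N(1) openin_subset topspace_T by blast
  define good where "good D as l u \<longleftrightarrow> set as \<subseteq> carrier G \<and> as \<noteq> [] \<and> u - l \<le> D \<and>
      (\<forall>x\<in>carrier G. l \<le> right_avg as f x \<and> right_avg as f x \<le> u)" for D as l u
  have step: "\<exists>as l u. good (q * D + \<epsilon> / n) as l u" if g: "good D as l u" for D as l u
  proof -
    have as: "set as \<subseteq> carrier G" "as \<noteq> []" "u - l \<le> D" using g by (auto simp: good_def)
    have lu: "l \<le> right_avg as f x" "right_avg as f x \<le> u" if "x \<in> carrier G" for x
      using g that by (auto simp: good_def)
    have "l \<le> u" using lu[OF one_closed] by linarith
    then have D: "D \<ge> 0" using as(3) by linarith
    show ?thesis
    proof (cases "\<exists>y\<in>carrier G. right_avg as f y \<le> (l + u) / 2")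
      case False
      have "(u - l) / 2 \<le> q * D + \<epsilon> / n"
      proof -
        have "1 / 2 * D \<le> q * D" using D n by (intro mult_right_mono) (auto simp: q_def field_simps)
        moreover have "\<epsilon> / n \<ge> 0" using \<epsilon> n by simp
        moreover have "(u - l) / 2 \<le> 1 / 2 * D" using as(3) by simp
        ultimately have "(u - l) / 2 + 0 \<le> q * D + \<epsilon> / n"
          by (intro add_mono) (rule order_trans, assumption)
        then show ?thesis by simp
      qed
      then have "good (q * D + \<epsilon> / n) as ((l + u) / 2) u"
        using False as lu unfolding good_def by (auto simp: field_simps not_le intro: less_imp_le)
      then show ?thesis by blast
    next
      case True
      then obtain y where y: "y \<in> carrier G" "right_avg as f y \<le> (l + u) / 2" by blast
      define cs where "cs = map (\<lambda>b. inv b \<otimes> y) bs"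
      define as' where "as' = concat (map (\<lambda>c. map (\<lambda>a. c \<otimes> a) as) cs)"
      have cs: "set cs \<subseteq> carrier G" "cs \<noteq> []" using bs y by (auto simp: cs_def)
      have as': "set as' \<subseteq> carrier G" "as' \<noteq> []" using cs as by (auto simp: as'_def)
      have eq: "right_avg as' f x = avg cs (\<lambda>c. right_avg as f (x \<otimes> c))" if "x \<in> carrier G" for x
        unfolding right_avg_def as'_def avg_avg[symmetric]
        using that cs(1) as(1) by (intro avg_cong) (auto simp: m_assoc subset_iff)
      define u' where "u' = u - ((u - l) / 2 - \<epsilon>) / n"
      have up: "right_avg as' f x \<le> u'" if x: "x \<in> carrier G" for x
      proof -
        obtain b where b: "b \<in> set bs" "x \<otimes> inv b \<in> N" using bs(3)[OF x] by blast
        obtain b1 b2 where split: "bs = b1 @ b # b2" using b(1) split_list by metis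
        have bG: "b \<in> carrier G" using b(1) bs(1) by auto
        let ?h = "\<lambda>b. right_avg as f (x \<otimes> (inv b \<otimes> y))"
        have hu: "?h c \<le> u" if "c \<in> set bs" for c using that bs(1) x y by (intro lu) auto
        have "?h b \<le> right_avg as f y + \<epsilon>"
        proof -
          have "?h b = avg as (\<lambda>a. f ((x \<otimes> inv b) \<otimes> (y \<otimes> a)))"
            unfolding right_avg_def using as(1) x y bG by (intro avg_cong) (auto simp: m_assoc subset_iff)
          moreover have "\<dots> \<le> avg as (\<lambda>a. f (y \<otimes> a)) + \<epsilon>"
          proof -
            have "avg as (\<lambda>a. f ((x \<otimes> inv b) \<otimes> (y \<otimes> a)) + - 1 * f (y \<otimes> a)) \<le> \<epsilon>"
              using as(1,2) y N(3)[OF b(2)] by (intro avg_le) (auto simp: subset_iff abs_le_iff)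
            then show ?thesis unfolding avg_add avg_cmult by simp
          qed
          ultimately show ?thesis by (simp add: right_avg_def)
        qed
        then have hb: "?h b \<le> (l + u) / 2 + \<epsilon>" using y(2) by linarith
        have "(\<Sum>b\<leftarrow>bs. ?h b) = (\<Sum>b\<leftarrow>b1 @ b2. ?h b) + ?h b" by (simp add: split)
        also have "\<dots> \<le> real (length (b1 @ b2)) * u + ((l + u) / 2 + \<epsilon>)"
          by (intro add_mono sum_list_upper_bound hb hu) (auto simp: split)
        also have "real (length (b1 @ b2)) = n - 1" by (simp add: n_def split)
        finally have fin: "(\<Sum>b\<leftarrow>bs. ?h b) \<le> (n - 1) * u + ((l + u) / 2 + \<epsilon>)" .
        have "n * u' = n * u - ((u - l) / 2 - \<epsilon>)" 
        proof -
          have "n * (((u - l) / 2 - \<epsilon>) / n) = (u - l) / 2 - \<epsilon>" using n by simp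
          then show ?thesis unfolding u'_def by (simp only: right_diff_distrib)
        qed
        moreover have "(n - 1) * u = n * u - u" by (simp add: left_diff_distrib)
        ultimately have "(\<Sum>b\<leftarrow>bs. ?h b) \<le> n * u'" using fin by (simp add: field_simps)
        then have "avg bs ?h \<le> u'" using n by (simp add: avg_def n_def[symmetric] field_simps)
        moreover have "right_avg as' f x = avg bs ?h"
          unfolding eq[OF x] cs_def avg_def by (simp add: o_def)
        ultimately show ?thesis by simp
      qed
      have low: "l \<le> right_avg as' f x" if x: "x \<in> carrier G" for x
        unfolding eq[OF x] using cs x by (intro avg_ge lu) auto
      have "u' - l = q * (u - l) + \<epsilon> / n" using n by (simp add: u'_def q_def field_simps)
      also have "\<dots> \<le> q * D + \<epsilon> / n" using q as(3) by (intro add_mono mult_left_mono) auto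
      finally have "good (q * D + \<epsilon> / n) as' l u'" using as' up low by (simp add: good_def)
      then show ?thesis by blast
    qed
  qed
  \<comment> \<open>\<open>2 * \<epsilon>\<close> is the fixed point of the map from
    \<open>D\<close> to \<open>q * D + \<epsilon> / n\<close>, so the excess over it decreases
    geometrically; with \<open>\<epsilon> = e / 3\<close> the length ends below
    \<open>e\<close>.\<close>
  have iter: "\<exists>as l u. good (q ^ k * (2 * M) + 2 * \<epsilon>) as l u" for k
  proof (induction k)
    case 0
    have "good (2 * M + 2 * \<epsilon>) [\<one>] (- M) M"
      using M \<epsilon> by (auto simp: good_def right_avg_def avg_def abs_le_iff dest: minus_le_iff[THEN iffD1])
    then show ?case by auto
  next
    case (Suc k)
    then obtain as l u where "good (q ^ k * (2 * M) + 2 * \<epsilon>) as l u" by blast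
    from step[OF this] obtain as l u where "good (q * (q ^ k * (2 * M) + 2 * \<epsilon>) + \<epsilon> / n) as l u" by blast
    moreover have "q * (q ^ k * (2 * M) + 2 * \<epsilon>) + \<epsilon> / n = q ^ Suc k * (2 * M) + 2 * \<epsilon>"
      using n by (simp add: q_def field_simps)
    ultimately show ?case by metis
  qed
  have "(\<lambda>k. q ^ k * (2 * M)) \<longlonglongrightarrow> 0 * (2 * M)"
    by (intro tendsto_intros LIMSEQ_realpow_zero q)
  then have "\<forall>\<^sub>F k in sequentially. q ^ k * (2 * M) < \<epsilon>"
    using \<epsilon> by (intro order_tendstoD) auto
  then obtain k where k: "q ^ k * (2 * M) < \<epsilon>" by (meson eventually_happens sequentially_bot)
  obtain as l u where g: "good (q ^ k * (2 * M) + 2 * \<epsilon>) as l u" using iter by blast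
  then have "u \<le> l + e" using k by (auto simp: good_def \<epsilon>_def)
  then show ?thesis using g by (intro that[of as l]) (auto simp: good_def intro: order_trans)
qed

text \<open>Inversion interchanges left and right translates, so the result for right averages is
  applied to \<open>f (inv x)\<close>.\<close>

lemma left_avg_small_oscillation:
  assumes f: "cont f" and e: "e > 0"
  obtains as l where "set as \<subseteq> carrier G" "as \<noteq> []"
    "\<And>x. x \<in> carrier G \<Longrightarrow> l \<le> left_avg as f x \<and> left_avg as f x \<le> l + e"
proof -
  obtain as l where as: "set as \<subseteq> carrier G" "as \<noteq> []"
    "\<And>x. x \<in> carrier G \<Longrightarrow> l \<le> right_avg as (\<lambda>x. f (inv x)) x \<and> right_avg as (\<lambda>x. f (inv x)) x \<le> l + e"
    using right_avg_small_oscillation[OF cont_inv[OF f] e] by metis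
  have "left_avg (map (\<lambda>a. inv a) as) f x = right_avg as (\<lambda>x. f (inv x)) (inv x)" if "x \<in> carrier G" for x
  proof -
    have "left_avg (map (\<lambda>a. inv a) as) f x = avg as (\<lambda>a. f (inv a \<otimes> x))"
      by (simp add: left_avg_def avg_def o_def)
    also have "\<dots> = avg as (\<lambda>a. f (inv (inv x \<otimes> a)))"
      using that as(1) by (intro avg_cong) (auto simp: inv_mult_group subset_iff)
    finally show ?thesis by (simp add: right_avg_def)
  qed
  then show ?thesis
    using as by (intro that[of "map (\<lambda>a. inv a) as" l]) auto
qed

text \<open>
  Von Neumann's construction of the Haar integral: averages over finitely many translates of a
  continuous function come arbitrarily close to a constant, which is the same for left and for right
  translates.
\<close>

definition mean :: "('a \<Rightarrow> real) \<Rightarrow> real" where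
  "mean f = Sup {l. \<exists>as. set as \<subseteq> carrier G \<and> as \<noteq> [] \<and> (\<forall>x\<in>carrier G. l \<le> right_avg as f x)}"

text \<open>At \<open>\<one>\<close>, a left average of a right average is also a right average of
  the left average, so it lies within \<open>e\<close> of \<open>d\<close>. Hence no lower bound of
  a right average exceeds \<open>d + e\<close>, while right averages of oscillation at most
  \<open>\<delta>\<close> have lower bounds of at least \<open>d - e - \<delta>\<close>.\<close>

lemma mean_unique:
  assumes f: "cont f" and bs: "set bs \<subseteq> carrier G" "bs \<noteq> []"
    and d: "\<And>x. x \<in> carrier G \<Longrightarrow> \<bar>left_avg bs f x - d\<bar> \<le> e"
  shows "\<bar>mean f - d\<bar> \<le> e"
proof -
  let ?S = "{l. \<exists>as. set as \<subseteq> carrier G \<and> as \<noteq> [] \<and> (\<forall>x\<in>carrier G. l \<le> right_avg as f x)}"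
  have lr: "d - e \<le> left_avg bs (right_avg as f) \<one>" "left_avg bs (right_avg as f) \<one> \<le> d + e"
    if as: "set as \<subseteq> carrier G" "as \<noteq> []" for as
  proof -
    have le: "left_avg bs f (\<one> \<otimes> a) \<le> d + e" "d - e \<le> left_avg bs f (\<one> \<otimes> a)" if "a \<in> set as" for a
      using d[of "\<one> \<otimes> a"] that as by (auto simp: abs_le_iff subset_iff)
    have "d - e \<le> right_avg as (left_avg bs f) \<one>" "right_avg as (left_avg bs f) \<one> \<le> d + e"
      unfolding right_avg_def[of as "left_avg bs f"]
      by (rule avg_ge[OF as(2) le(2)], assumption) (rule avg_le[OF as(2) le(1)], assumption)
    then show "d - e \<le> left_avg bs (right_avg as f) \<one>" "left_avg bs (right_avg as f) \<one> \<le> d + e"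
      using left_right_avg[OF as(1) bs(1) one_closed, of f] by auto
  qed
  have ub: "l \<le> d + e" if l: "l \<in> ?S" for l
  proof -
    obtain as where as: "set as \<subseteq> carrier G" "as \<noteq> []" "\<forall>x\<in>carrier G. l \<le> right_avg as f x"
      using l by blast
    have "l \<le> left_avg bs (right_avg as f) \<one>"
      unfolding left_avg_def using as bs by (intro avg_ge) auto
    then show ?thesis using lr[OF as(1,2)] by linarith
  qed
  have lb: "\<exists>l\<in>?S. d - e - \<delta> \<le> l" if \<delta>: "\<delta> > 0" for \<delta>
  proof -
    obtain as l where as: "set as \<subseteq> carrier G" "as \<noteq> []"
      "\<And>x. x \<in> carrier G \<Longrightarrow> l \<le> right_avg as f x \<and> right_avg as f x \<le> l + \<delta>"
      using right_avg_small_oscillation[OF f \<delta>] by metis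
    have "left_avg bs (right_avg as f) \<one> \<le> l + \<delta>"
      unfolding left_avg_def using as bs by (intro avg_le) auto
    then show ?thesis using lr[OF as(1,2)] as by (intro bexI[of _ l]) auto
  qed
  have bdd: "bdd_above ?S" using ub by (auto simp: bdd_above_def)
  have "?S \<noteq> {}" using lb[of 1] by auto
  then have "mean f \<le> d + e" unfolding mean_def using ub by (intro cSup_least) auto
  moreover have "d - e \<le> mean f"
  proof (rule field_le_epsilon)
    fix \<delta> :: real assume "\<delta> > 0"
    then obtain l where "l \<in> ?S" "d - e - \<delta> \<le> l" using lb by blast
    then show "d - e \<le> mean f + \<delta>" unfolding mean_def using cSup_upper[OF _ bdd, of l] by linarith
  qed
  ultimately show ?thesis by (simp add: abs_le_iff)
qed

lemma mean_approx:
  assumes f: "cont f" and e: "e > 0"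
  obtains bs where "set bs \<subseteq> carrier G" "bs \<noteq> []" "\<And>x. x \<in> carrier G \<Longrightarrow> \<bar>left_avg bs f x - mean f\<bar> \<le> e"
proof -
  have e2: "e / 2 > 0" using e by simp
  obtain bs l where bs: "set bs \<subseteq> carrier G" "bs \<noteq> []"
    "\<And>x. x \<in> carrier G \<Longrightarrow> l \<le> left_avg bs f x \<and> left_avg bs f x \<le> l + e / 2"
    using left_avg_small_oscillation[OF f e2] by metis
  have d: "\<bar>left_avg bs f x - l\<bar> \<le> e / 2" if "x \<in> carrier G" for x
    using bs(3)[OF that] by (simp add: abs_le_iff)
  have "\<bar>mean f - l\<bar> \<le> e / 2" by (rule mean_unique[OF f bs(1,2) d])
  then have "\<bar>left_avg bs f x - mean f\<bar> \<le> e" if "x \<in> carrier G" for x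
    using d[OF that] by linarith
  then show ?thesis by (rule that[OF bs(1,2)])
qed

lemma mean_const: "mean (\<lambda>_. c) = c"
  using mean_unique[OF cont_const, of "[\<one>]" c c 0] by (simp add: left_avg_def avg_def)

lemma left_avg_left_avg:
  assumes "set cs \<subseteq> carrier G" "set bs \<subseteq> carrier G" "x \<in> carrier G"
  shows "left_avg cs (left_avg bs f) x = left_avg (concat (map (\<lambda>c. map (\<lambda>b. b \<otimes> c) bs) cs)) f x"
  unfolding left_avg_def avg_avg[symmetric] using assms
  by (intro avg_cong) (auto simp: m_assoc subset_iff)

text \<open>A single family of translates must approximate both means. It arises by averaging once
  more after the family \<open>bs\<close> that is good for \<open>f\<close>: the second family
  \<open>cs\<close> is chosen for the left average of \<open>h\<close>, and it cannot spoil the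
  estimate for \<open>f\<close>, as it averages values already within \<open>e / 3\<close> of the
  mean.\<close>

lemma mean_add:
  assumes f: "cont f" and h: "cont h"
  shows "mean (\<lambda>x. f x + h x) = mean f + mean h"
proof -
  have "\<bar>mean (\<lambda>x. f x + h x) - (mean f + mean h)\<bar> \<le> 0 + e" if "e > 0" for e
  proof -
    have e: "e / 3 > 0" using that by simp
    obtain bs where bs: "set bs \<subseteq> carrier G" "bs \<noteq> []" "\<And>x. x \<in> carrier G \<Longrightarrow> \<bar>left_avg bs f x - mean f\<bar> \<le> e / 3"
      using mean_approx[OF f e] by metis
    obtain cs where cs: "set cs \<subseteq> carrier G" "cs \<noteq> []"
      "\<And>x. x \<in> carrier G \<Longrightarrow> \<bar>left_avg cs (left_avg bs h) x - mean (left_avg bs h)\<bar> \<le> e / 3"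
      using mean_approx[OF cont_left_avg[OF h bs(1)] e] by metis
    define ds where "ds = concat (map (\<lambda>c. map (\<lambda>b. b \<otimes> c) bs) cs)"
    have ds: "set ds \<subseteq> carrier G" "ds \<noteq> []" using bs cs by (auto simp: ds_def)
    have dd: "left_avg ds k x = left_avg cs (left_avg bs k) x" if "x \<in> carrier G" for k x
      unfolding ds_def using left_avg_left_avg[OF cs(1) bs(1) that] by simp
    have "\<bar>mean h - mean (left_avg bs h)\<bar> \<le> e / 3"
      by (rule mean_unique[OF h ds]) (simp only: dd cs(3))
    then have hd: "\<bar>left_avg ds h x - mean h\<bar> \<le> 2 * e / 3" if "x \<in> carrier G" for x
      using cs(3)[OF that] unfolding dd[OF that] by linarith
    have fd: "\<bar>left_avg ds f x - mean f\<bar> \<le> e / 3" if x: "x \<in> carrier G" for x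
    proof -
      have c: "left_avg bs f (c \<otimes> x) \<le> mean f + e / 3" "mean f - e / 3 \<le> left_avg bs f (c \<otimes> x)"
        if "c \<in> set cs" for c
      proof -
        have "c \<otimes> x \<in> carrier G" using that cs(1) x by auto
        from bs(3)[OF this] show "left_avg bs f (c \<otimes> x) \<le> mean f + e / 3" "mean f - e / 3 \<le> left_avg bs f (c \<otimes> x)"
          by linarith+
      qed
      have "left_avg cs (left_avg bs f) x \<le> mean f + e / 3" "mean f - e / 3 \<le> left_avg cs (left_avg bs f) x"
        unfolding left_avg_def[of cs "left_avg bs f"]
        by (rule avg_le[OF cs(2) c(1)], assumption) (rule avg_ge[OF cs(2) c(2)], assumption)
      then show ?thesis unfolding dd[OF x] by linarith
    qed
    have "\<bar>mean (\<lambda>x. f x + h x) - (mean f + mean h)\<bar> \<le> e"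
    proof (rule mean_unique[OF cont_add[OF f h] ds])
      fix x assume x: "x \<in> carrier G"
      have "left_avg ds (\<lambda>x. f x + h x) x = left_avg ds f x + left_avg ds h x"
        by (simp add: left_avg_def avg_add)
      then show "\<bar>left_avg ds (\<lambda>x. f x + h x) x - (mean f + mean h)\<bar> \<le> e"
        using fd[OF x] hd[OF x] by linarith
    qed
    then show ?thesis by simp
  qed
  then have "\<bar>mean (\<lambda>x. f x + h x) - (mean f + mean h)\<bar> \<le> 0" by (rule field_le_epsilon)
  then show ?thesis by simp
qed

lemma mean_cmult:
  assumes f: "cont f"
  shows "mean (\<lambda>x. c * f x) = c * mean f"
proof -
  have "\<bar>mean (\<lambda>x. c * f x) - c * mean f\<bar> \<le> 0 + e" if "e > 0" for e
  proof -
    have "e / (1 + \<bar>c\<bar>) > 0" using that by (intro divide_pos_pos) auto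
    then obtain bs where bs: "set bs \<subseteq> carrier G" "bs \<noteq> []" "\<And>x. x \<in> carrier G \<Longrightarrow> \<bar>left_avg bs f x - mean f\<bar> \<le> e / (1 + \<bar>c\<bar>)"
      using mean_approx[OF f] by metis
    have "\<bar>mean (\<lambda>x. c * f x) - c * mean f\<bar> \<le> e"
    proof (rule mean_unique[OF cont_cmult[OF f] bs(1,2)])
      fix x assume x: "x \<in> carrier G"
      have "left_avg bs (\<lambda>x. c * f x) x - c * mean f = c * (left_avg bs f x - mean f)"
        by (simp add: left_avg_def avg_cmult right_diff_distrib)
      then have "\<bar>left_avg bs (\<lambda>x. c * f x) x - c * mean f\<bar> \<le> \<bar>c\<bar> * (e / (1 + \<bar>c\<bar>))"
        using mult_left_mono[OF bs(3)[OF x], of "\<bar>c\<bar>"] by (simp add: abs_mult)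
      also have "\<dots> \<le> e" using that by (simp add: field_simps)
      finally show "\<bar>left_avg bs (\<lambda>x. c * f x) x - c * mean f\<bar> \<le> e" .
    qed
    then show ?thesis by simp
  qed
  then have "\<bar>mean (\<lambda>x. c * f x) - c * mean f\<bar> \<le> 0" by (rule field_le_epsilon)
  then show ?thesis by simp
qed

lemma mean_ge:
  assumes f: "cont f" and M: "\<And>x. x \<in> carrier G \<Longrightarrow> M \<le> f x"
  shows "M \<le> mean f"
proof (rule field_le_epsilon)
  fix e :: real assume "e > 0"
  then obtain bs where bs: "set bs \<subseteq> carrier G" "bs \<noteq> []" "\<And>x. x \<in> carrier G \<Longrightarrow> \<bar>left_avg bs f x - mean f\<bar> \<le> e"
    using mean_approx[OF f] by metis
  have "M \<le> left_avg bs f \<one>"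
    unfolding left_avg_def using bs(1,2) by (intro avg_ge M) auto
  then show "M \<le> mean f + e" using bs(3)[OF one_closed] by linarith
qed

lemma mean_abs_le:
  assumes f: "cont f" and M: "\<And>x. x \<in> carrier G \<Longrightarrow> \<bar>f x\<bar> \<le> M"
  shows "\<bar>mean f\<bar> \<le> M"
proof -
  have "- M \<le> mean f" by (rule mean_ge[OF f]) (use M in \<open>auto simp: abs_le_iff dest: minus_le_iff[THEN iffD1]\<close>)
  moreover have "- M \<le> mean (\<lambda>x. -1 * f x)" by (rule mean_ge[OF cont_cmult[OF f]]) (use M in \<open>auto simp: abs_le_iff\<close>)
  ultimately show ?thesis using mean_cmult[OF f, of "-1"] by (simp add: abs_le_iff)
qed

lemma mean_cong:
  assumes "\<And>x. x \<in> carrier G \<Longrightarrow> f x = h x"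
  shows "mean f = mean h"
proof -
  have "right_avg as f x = right_avg as h x" if "set as \<subseteq> carrier G" "x \<in> carrier G" for as x
    unfolding right_avg_def using assms that by (intro avg_cong) auto
  then have "{l. \<exists>as. set as \<subseteq> carrier G \<and> as \<noteq> [] \<and> (\<forall>x\<in>carrier G. l \<le> right_avg as f x)} =
     {l. \<exists>as. set as \<subseteq> carrier G \<and> as \<noteq> [] \<and> (\<forall>x\<in>carrier G. l \<le> right_avg as h x)}"
    by (intro Collect_cong ex_cong1) auto
  then show ?thesis by (simp add: mean_def)
qed

text \<open>A left average of the right translate is the right translate of the left average, so the
  same elements \<open>bs\<close> approximate both means.\<close>

lemma mean_right_invariant:
  assumes f: "cont f" and h: "h \<in> carrier G"
  shows "mean (\<lambda>x. f (x \<otimes> h)) = mean f"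
proof -
  have "\<bar>mean (\<lambda>x. f (x \<otimes> h)) - mean f\<bar> \<le> 0 + e" if "e > 0" for e
  proof -
    obtain bs where bs: "set bs \<subseteq> carrier G" "bs \<noteq> []" "\<And>x. x \<in> carrier G \<Longrightarrow> \<bar>left_avg bs f x - mean f\<bar> \<le> e"
      using mean_approx[OF f \<open>e > 0\<close>] by metis
    have "\<bar>mean (\<lambda>x. f (x \<otimes> h)) - mean f\<bar> \<le> e"
    proof (rule mean_unique[OF cont_right[OF f h] bs(1,2)])
      fix x assume x: "x \<in> carrier G"
      have "left_avg bs (\<lambda>x. f (x \<otimes> h)) x = left_avg bs f (x \<otimes> h)"
        unfolding left_avg_def using bs(1) x h by (intro avg_cong) (auto simp: m_assoc subset_iff)
      then show "\<bar>left_avg bs (\<lambda>x. f (x \<otimes> h)) x - mean f\<bar> \<le> e" using bs(3)[of "x \<otimes> h"] x h by simp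
    qed
    then show ?thesis by simp
  qed
  then have "\<bar>mean (\<lambda>x. f (x \<otimes> h)) - mean f\<bar> \<le> 0" by (rule field_le_epsilon)
  then show ?thesis by simp
qed

end

subsection \<open>Averaging smooth families\<close>

lemma Ck_on_SucI:
  assumes S: "open S" and d: "\<And>x. x \<in> S \<Longrightarrow> (f has_derivative f' x) (at x)"
    and k: "\<And>v. Ck_on k (\<lambda>x. f' x v) S"
  shows "Ck_on (Suc k) f S"
proof -
  have "continuous_on S f"
    using d has_derivative_continuous continuous_at_imp_continuous_on by blast
  then have "Ck_on 0 f S" by simp
  then have "continuous_map (param_top (discrete_topology {()}) S) euclidean (\<lambda>(a, x). f x)"
    unfolding Ck_on_iff_Cp[OF S] by simp
  then show ?thesis
    unfolding Ck_on_iff_Cp[OF S] using d k[unfolded Ck_on_iff_Cp[OF S]]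
    by (intro Cp_SucI[OF S, where f'="\<lambda>_. f'"]) auto
qed

lemma Ck_on_subset: "Ck_on k f S \<Longrightarrow> S' \<subseteq> S \<Longrightarrow> Ck_on k f S'"
  by (induction k arbitrary: f) (auto intro: continuous_on_subset)

lemma Ck_on_cong:
  assumes "open S" "\<And>x. x \<in> S \<Longrightarrow> f x = g x" "Ck_on k f S"
  shows "Ck_on k g S"
  using assms Cp_cong[of S "discrete_topology {()}" "\<lambda>_. f" "\<lambda>_. g" k] by (simp add: Ck_on_iff_Cp)

context compact_topological_group
begin

lemma cont_slice:
  assumes "continuous_map (param_top T S) euclideanreal (\<lambda>(g, x). f g x)" "x \<in> S"
  shows "cont (\<lambda>g. f g x)"
proof -
  have "continuous_map T (param_top T S) (\<lambda>g. (g, x))"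
    using assms(2) by (auto simp: continuous_map_pairwise o_def)
  from continuous_map_compose[OF this assms(1)] show ?thesis by (simp add: o_def cont_def)
qed

lemma mean_diff: "cont f \<Longrightarrow> cont h \<Longrightarrow> mean (\<lambda>x. f x - h x) = mean f - mean h"
  using mean_add[of f "\<lambda>x. -1 * h x"] mean_cmult[of h "-1"] cont_cmult[of h "-1"] by simp

lemma cont_diff: "cont f \<Longrightarrow> cont h \<Longrightarrow> cont (\<lambda>x. f x - h x)"
  unfolding cont_def by (rule continuous_map_diff)

text \<open>The remainder estimate of \<open>Cp_uniformly_differentiable\<close> holds with one
  \<open>d\<close> for all group elements, and by \<open>mean_abs_le\<close> a uniform bound passes
  to the mean.\<close>

lemma has_derivative_mean:
  fixes f :: "'a \<Rightarrow> 'x::euclidean_space \<Rightarrow> real"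
  assumes S: "open S" and f: "Cp T (Suc 0) f S" and x: "x \<in> S"
  shows "((\<lambda>x. mean (\<lambda>g. f g x)) has_derivative
    (\<lambda>v. mean (\<lambda>g. frechet_derivative (f g) (at x) v))) (at x)"
  unfolding has_derivative_at_alt
proof (intro conjI allI impI)
  let ?f' = "\<lambda>g. frechet_derivative (f g) (at x)"
  have cf: "cont (\<lambda>g. f g y)" if "y \<in> S" for y
    by (rule cont_slice[OF Cp_continuous[OF f] that])
  have cf': "cont (\<lambda>g. ?f' g v)" for v
    using cont_slice[OF Cp_continuous[OF Cp_SucD(1)[OF f]] x] .
  have lin: "linear (?f' g)" if "g \<in> carrier G" for g
    using Cp_SucD(2)[OF f _ x, of g] that has_derivative_linear topspace_T by blast
  have "linear (\<lambda>v. mean (\<lambda>g. ?f' g v))"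
  proof (rule linearI)
    fix v w
    have "mean (\<lambda>g. ?f' g (v + w)) = mean (\<lambda>g. ?f' g v + ?f' g w)"
      by (rule mean_cong) (use lin linear_add in blast)
    then show "mean (\<lambda>g. ?f' g (v + w)) = mean (\<lambda>g. ?f' g v) + mean (\<lambda>g. ?f' g w)"
      using mean_add[OF cf' cf'] by simp
  next
    fix c v
    have "mean (\<lambda>g. ?f' g (c *\<^sub>R v)) = mean (\<lambda>g. c * ?f' g v)"
      by (rule mean_cong) (use lin linear_scale in fastforce)
    then show "mean (\<lambda>g. ?f' g (c *\<^sub>R v)) = c *\<^sub>R mean (\<lambda>g. ?f' g v)"
      using mean_cmult[OF cf'] by simp
  qed
  then show "bounded_linear (\<lambda>v. mean (\<lambda>g. ?f' g v))" using linear_conv_bounded_linear by blast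
  fix e :: real assume e: "e > 0"
  obtain r where r: "r > 0" "ball x r \<subseteq> S" using S x open_contains_ball by blast
  obtain d where d: "d > 0" "\<And>g y. g \<in> topspace T \<Longrightarrow> norm y < d \<Longrightarrow>
      norm (f g (x + y) - f g x - ?f' g y) \<le> e * norm y"
    by (rule Cp_uniformly_differentiable[OF compact_T S f x e]) blast
  show "\<exists>d>0. \<forall>y. norm (y - x) < d \<longrightarrow>
      norm (mean (\<lambda>g. f g y) - mean (\<lambda>g. f g x) - mean (\<lambda>g. ?f' g (y - x))) \<le> e * norm (y - x)"
  proof (intro exI[of _ "min d r"] conjI allI impI)
    fix y assume y: "norm (y - x) < min d r"
    then have yS: "y \<in> S" using r(2) by (auto simp: dist_norm norm_minus_commute)
    have "mean (\<lambda>g. f g y - f g x - ?f' g (y - x)) = mean (\<lambda>g. f g y) - mean (\<lambda>g. f g x) - mean (\<lambda>g. ?f' g (y - x))"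
      by (simp add: mean_diff cont_diff cf cf' yS x)
    moreover have "\<bar>mean (\<lambda>g. f g y - f g x - ?f' g (y - x))\<bar> \<le> e * norm (y - x)"
    proof (rule mean_abs_le)
      show "cont (\<lambda>g. f g y - f g x - ?f' g (y - x))" by (intro cont_diff cf cf' yS x)
      fix g assume "g \<in> carrier G"
      then show "\<bar>f g y - f g x - ?f' g (y - x)\<bar> \<le> e * norm (y - x)"
        using d(2)[of g "y - x"] y topspace_T by simp
    qed
    ultimately show "norm (mean (\<lambda>g. f g y) - mean (\<lambda>g. f g x) - mean (\<lambda>g. ?f' g (y - x))) \<le> e * norm (y - x)"
      by simp
  qed (use d(1) r(1) in auto)
qed

lemma Ck_on_mean:
  fixes f :: "'a \<Rightarrow> 'x::euclidean_space \<Rightarrow> real"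
  assumes S: "open S" and f: "Cp T k f S"
  shows "Ck_on k (\<lambda>x. mean (\<lambda>g. f g x)) S"
  using f
proof (induction k arbitrary: f)
  case 0
  have cf: "cont (\<lambda>g. f g y)" if "y \<in> S" for y
    by (rule cont_slice[OF Cp_continuous[OF 0] that])
  have "continuous_on S (\<lambda>x. mean (\<lambda>g. f g x))"
    unfolding continuous_on_iff
  proof (intro ballI allI impI)
    fix x and e :: real assume x: "x \<in> S" and e: "e > 0"
    have e2: "e / 2 > 0" using e by simp
    obtain d where d: "d > 0" "\<And>g y. g \<in> topspace T \<Longrightarrow> y \<in> S \<Longrightarrow> dist y x < d \<Longrightarrow> norm (f g y - f g x) < e / 2"
      by (rule compact_param_uniform[OF compact_T Cp_continuous[OF 0] x e2]) blast
    have "dist (mean (\<lambda>g. f g y)) (mean (\<lambda>g. f g x)) < e" if y: "y \<in> S" "dist y x < d" for y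
    proof -
      have "\<bar>mean (\<lambda>g. f g y - f g x)\<bar> \<le> e / 2"
        by (rule mean_abs_le) (use d(2)[OF _ y] topspace_T in \<open>auto intro!: cont_diff cf x y less_imp_le\<close>)
      then show ?thesis using e by (simp add: mean_diff cf x y dist_real_def)
    qed
    then show "\<exists>d>0. \<forall>y\<in>S. dist y x < d \<longrightarrow> dist (mean (\<lambda>g. f g y)) (mean (\<lambda>g. f g x)) < e"
      using d(1) by blast
  qed
  then show ?case by simp
next
  case (Suc k)
  have f1: "Cp T (Suc 0) f S" by (rule Cp_mono[OF Suc.prems]) simp
  show ?case
    by (rule Ck_on_SucI[OF S has_derivative_mean[OF S f1] Suc.IH[OF Cp_SucD(1)[OF Suc.prems]]])
qed

end

section \<open>Smooth maps on open sets\<close>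

lemma smooth_on_iff_Cp: "open S \<Longrightarrow> smooth_on f S \<longleftrightarrow> (\<forall>k. Cp (discrete_topology {()}) k (\<lambda>_. f) S)"
  by (simp add: smooth_on_def Ck_on_iff_Cp)

lemma smooth_on_sum: "open S \<Longrightarrow> (\<And>i. i \<in> I \<Longrightarrow> smooth_on (f i) S) \<Longrightarrow> smooth_on (\<lambda>x. \<Sum>i\<in>I. f i x) S"
  by (simp add: smooth_on_iff_Cp Cp_sum)

lemma smooth_on_scaleR: "open S \<Longrightarrow> smooth_on f S \<Longrightarrow> smooth_on g S \<Longrightarrow> smooth_on (\<lambda>x. f x *\<^sub>R g x) S"
  by (simp add: smooth_on_iff_Cp Cp_scaleR)

lemma smooth_on_mult:
  fixes f g :: "'a::real_normed_vector \<Rightarrow> real"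
  shows "open S \<Longrightarrow> smooth_on f S \<Longrightarrow> smooth_on g S \<Longrightarrow> smooth_on (\<lambda>x. f x * g x) S"
  by (simp add: smooth_on_iff_Cp Cp_mult)

lemma smooth_on_const: "open S \<Longrightarrow> smooth_on (\<lambda>x. c) S"
  by (simp add: smooth_on_iff_Cp Cp_const)

lemma smooth_on_linear: "open S \<Longrightarrow> bounded_linear L \<Longrightarrow> smooth_on L S"
  by (simp add: smooth_on_iff_Cp Cp_linear_fun)

lemma smooth_on_bounded_linear: "open S \<Longrightarrow> bounded_linear L \<Longrightarrow> smooth_on f S \<Longrightarrow> smooth_on (\<lambda>x. L (f x)) S"
  by (auto simp: smooth_on_iff_Cp intro: Cp_bounded_linear)

lemma smooth_on_subset: "smooth_on f S \<Longrightarrow> S' \<subseteq> S \<Longrightarrow> smooth_on f S'"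
  unfolding smooth_on_def using Ck_on_subset by blast

lemma smooth_on_cong: "open S \<Longrightarrow> (\<And>x. x \<in> S \<Longrightarrow> f x = g x) \<Longrightarrow> smooth_on f S \<Longrightarrow> smooth_on g S"
  unfolding smooth_on_def using Ck_on_cong by blast

lemma smooth_on_compose:
  fixes f :: "'a::real_normed_vector \<Rightarrow> 'b::euclidean_space"
  assumes "open S" "open R" "smooth_on h R" "smooth_on f S" "\<And>x. x \<in> S \<Longrightarrow> f x \<in> R"
  shows "smooth_on (\<lambda>x. h (f x)) S"
  using assms Cp_compose[of S R "discrete_topology {()}" _ "\<lambda>_. h" "\<lambda>_. f"] by (simp add: smooth_on_iff_Cp)

lemma smooth_on_Suc:
  assumes "smooth_on f S"
  shows "smooth_on (\<lambda>x. frechet_derivative f (at x) v) S"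
  using assms unfolding smooth_on_def by (metis Ck_on.simps(2))

lemma smooth_on_has_derivative:
  "smooth_on f S \<Longrightarrow> x \<in> S \<Longrightarrow> (f has_derivative frechet_derivative f (at x)) (at x)"
  using smooth_on_differentiable frechet_derivative_works by blast

lemma smooth_on_continuous: "smooth_on f S \<Longrightarrow> continuous_on S f"
  unfolding smooth_on_def by (metis Ck_on.simps(1))

lemma smooth_on_vec_nth:
  fixes f :: "'a::real_normed_vector \<Rightarrow> 'b::real_normed_vector ^ 'n"
  assumes "open S" "smooth_on f S"
  shows "smooth_on (\<lambda>x. f x $ i) S"
  by (rule smooth_on_bounded_linear[OF assms(1) bounded_linear_vec_nth assms(2)])

lemma axis_expansion:
  fixes x :: "real ^ 'n"
  shows "(\<Sum>i\<in>UNIV. x $ i *\<^sub>R axis i 1) = x"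
  unfolding scalar_mult_eq_scaleR[symmetric] by (rule basis_expansion)

lemma smooth_on_vecI:
  fixes f :: "'a::real_normed_vector \<Rightarrow> real ^ 'n"
  assumes S: "open S" and f: "\<And>i. smooth_on (\<lambda>x. f x $ i) S"
  shows "smooth_on f S"
proof -
  have "smooth_on (\<lambda>x. \<Sum>i\<in>UNIV. f x $ i *\<^sub>R axis i 1) S"
    by (intro smooth_on_sum smooth_on_scaleR smooth_on_const f S)
  then show ?thesis by (rule smooth_on_cong[OF S axis_expansion])
qed

lemma smooth_on_inner_const:
  fixes f :: "'a::real_normed_vector \<Rightarrow> 'b::real_inner"
  shows "open S \<Longrightarrow> smooth_on f S \<Longrightarrow> smooth_on (\<lambda>x. f x \<bullet> c) S"
  by (rule smooth_on_bounded_linear[OF _ bounded_linear_inner_left])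

lemma linear_axis_expansion:
  fixes f :: "real ^ 'n \<Rightarrow> 'b::real_vector"
  assumes "linear f"
  shows "f v = (\<Sum>j\<in>UNIV. v $ j *\<^sub>R f (axis j 1))"
proof -
  have "f v = f (\<Sum>j\<in>UNIV. v $ j *\<^sub>R axis j 1)"
    by (simp only: axis_expansion)
  then show ?thesis using assms by (simp add: linear_sum linear_scale)
qed

lemma smooth_on_derivative_apply:
  fixes f :: "real ^ 'n \<Rightarrow> 'b::real_normed_vector"
  assumes S: "open S" and f: "smooth_on f S" and X: "smooth_on X S"
  shows "smooth_on (\<lambda>x. frechet_derivative f (at x) (X x)) S"
proof -
  have "smooth_on (\<lambda>x. \<Sum>j\<in>UNIV. X x $ j *\<^sub>R frechet_derivative f (at x) (axis j 1)) S"
    by (intro smooth_on_sum smooth_on_scaleR smooth_on_vec_nth smooth_on_Suc S f X)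
  then show ?thesis
    by (rule smooth_on_cong[OF S, rotated])
       (simp add: linear_axis_expansion[OF linear_frechet_derivative[OF smooth_on_differentiable[OF f]], symmetric])
qed

lemma Cp_det:
  fixes M :: "'p \<Rightarrow> 'a::real_normed_vector \<Rightarrow> real ^ 'n ^ 'n"
  assumes S: "open S" and "\<And>i j. Cp A k (\<lambda>a x. (M a x $ i) $ j) S"
  shows "Cp A k (\<lambda>a x. det (M a x)) S"
  unfolding det_def by (intro Cp_sum Cp_mult Cp_prod Cp_const assms)

subsection \<open>The inverse function theorem\<close>

text \<open>Bootstrapping: if \<open>g\<close> is of class \<open>k\<close>, so are the entries of
  the Jacobian of \<open>f\<close> at \<open>g y\<close>, and Cramer's rule expresses
  \<open>g' y v\<close> through determinants of such entries. So the derivative of \<open>g\<close>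
  is of class \<open>k\<close>, and \<open>g\<close> gains one order.\<close>

lemma Ck_on_inverse_map:
  fixes f :: "real ^ 'n \<Rightarrow> real ^ 'n"
  assumes U: "open U" and V: "open V" and f: "smooth_on f U" and gU: "\<And>y. y \<in> V \<Longrightarrow> g y \<in> U"
    and g: "\<And>y. y \<in> V \<Longrightarrow> (g has_derivative g' y) (at y)"
    and inv: "\<And>y v. y \<in> V \<Longrightarrow> frechet_derivative f (at (g y)) (g' y v) = v"
  shows "smooth_on g V"
proof -
  have "Ck_on k g V" for k
  proof (induction k)
    case 0
    show ?case using g by (auto intro!: continuous_at_imp_continuous_on has_derivative_continuous)
  next
    case (Suc k)
    let ?One = "discrete_topology {()}"
    define M where "M y = matrix (frechet_derivative f (at (g y)))" for y
    have lin: "linear (frechet_derivative f (at (g y)))" if "y \<in> V" for y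
      using smooth_on_has_derivative[OF f gU[OF that]] has_derivative_linear by blast
    have Mv: "M y *v v = frechet_derivative f (at (g y)) v" if "y \<in> V" for y v
      using lin[OF that] by (simp add: M_def matrix_works)
    have Mk: "Cp ?One k (\<lambda>_ y. (M y $ i) $ j) V" for i j
    proof -
      have "Cp ?One k (\<lambda>_ x. frechet_derivative f (at x) (axis j 1) $ i) U"
        using smooth_on_vec_nth[OF U smooth_on_Suc[OF f]] unfolding smooth_on_iff_Cp[OF U] by blast
      then have "Cp ?One k (\<lambda>_ y. frechet_derivative f (at (g y)) (axis j 1) $ i) V"
        by (rule Cp_compose[OF V U]) (use Suc gU in \<open>auto simp: Ck_on_iff_Cp[OF V]\<close>)
      then show ?thesis by (simp add: M_def matrix_def)
    qed
    have surj: "M y *v (g' y v) = v" if "y \<in> V" for y v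
      using inv[OF that] Mv[OF that] by simp
    have dM: "det (M y) \<noteq> 0" if y: "y \<in> V" for y
    proof -
      have "surj ((*v) (M y))" using surj[OF y] by (metis surjI)
      then show ?thesis
        using matrix_right_invertible_surjective invertible_right_inverse invertible_det_nz by blast
    qed
    have eq: "g' y v = (\<chi> k. det (\<chi> i j. if j = k then v $ i else (M y $ i) $ j) / det (M y))" if y: "y \<in> V" for y v
      using cramer[OF dM[OF y], of "g' y v" v] surj[OF y] by blast
    have "Cp ?One k (\<lambda>_ y. det (\<chi> i j. if j = l then v $ i else (M y $ i) $ j) * inverse (det (M y))) V" for l v
    proof (intro Cp_mult Cp_inverse Cp_det V Mk)
      fix i j
      show "Cp ?One k (\<lambda>_ y. ((\<chi> i j. if j = l then v $ i else (M y $ i) $ j) $ i) $ j) V"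
        by (cases "j = l") (simp_all add: Cp_const[OF V] Mk)
    qed (use dM in auto)
    then have c: "Cp ?One k (\<lambda>_ y. \<Sum>l\<in>UNIV. (det (\<chi> i j. if j = l then v $ i else (M y $ i) $ j) * inverse (det (M y))) *\<^sub>R axis l 1) V" for v
      by (intro Cp_sum Cp_scaleR Cp_const V)
    have gk: "Ck_on k (\<lambda>y. g' y v) V" for v
      unfolding Ck_on_iff_Cp[OF V]
    proof (rule Cp_cong[OF V _ c[of v]])
      fix y assume y: "y \<in> V"
      have "det (\<chi> i j. if j = l then v $ i else (M y $ i) $ j) * inverse (det (M y)) = g' y v $ l" for l
        unfolding eq[OF y] by (simp add: divide_inverse)
      then show "(\<Sum>l\<in>UNIV. (det (\<chi> i j. if j = l then v $ i else (M y $ i) $ j) * inverse (det (M y))) *\<^sub>R axis l 1) = g' y v"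
        by (simp only: axis_expansion)
    qed
    show ?case by (rule Ck_on_SucI[OF V g gk])
  qed
  then show ?thesis by (simp add: smooth_on_def)
qed

text \<open>In finite dimension the derivative depends continuously on the point as an operator as
  soon as it does so in each direction, so the theorem for continuously differentiable maps applies;
  \<open>Ck_on_inverse_map\<close> raises the regularity of the inverse.\<close>

theorem smooth_inverse_function:
  fixes f :: "real ^ 'n \<Rightarrow> real ^ 'n"
  assumes S: "open S" and f: "smooth_on f S" and x0: "x0 \<in> S"
    and inj: "\<And>v. frechet_derivative f (at x0) v = 0 \<Longrightarrow> v = 0"
  obtains U V g where "open U" "U \<subseteq> S" "x0 \<in> U" "open V" "homeomorphism U V f g" "smooth_on g V"
    "\<And>x v. x \<in> U \<Longrightarrow> frechet_derivative f (at x) v = 0 \<Longrightarrow> v = 0"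
proof -
  define f' where "f' x = Blinfun (frechet_derivative f (at x))" for x
  have f': "blinfun_apply (f' x) = frechet_derivative f (at x)" if "x \<in> S" for x
    unfolding f'_def using smooth_on_has_derivative[OF f that] has_derivative_bounded_linear
    by (intro bounded_linear_Blinfun_apply) blast
  have c: "continuous_on S f'"
  proof (rule continuous_on_blinfun_componentwise)
    fix i :: "real ^ 'n"
    show "continuous_on S (\<lambda>x. blinfun_apply (f' x) i)"
      using smooth_on_continuous[OF smooth_on_Suc[OF f, of i]] by (rule continuous_on_eq) (simp add: f')
  qed
  have lin: "linear (frechet_derivative f (at x0))"
    using smooth_on_has_derivative[OF f x0] has_derivative_linear by blast
  then have "inj (frechet_derivative f (at x0))"
    using inj by (simp add: linear_injective_0)
  then obtain h where h: "linear h" "h \<circ> frechet_derivative f (at x0) = id"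
    using linear_injective_left_inverse[OF lin] by blast
  have "Blinfun h o\<^sub>L f' x0 = id_blinfun"
    using h(2) bounded_linear_Blinfun_apply[of h] h(1)
    by (intro blinfun_eqI) (simp add: f'[OF x0] linear_conv_bounded_linear pointfree_idE)
  then obtain U V g g' where UV: "open U" "U \<subseteq> S" "x0 \<in> U" "open V" "homeomorphism U V f g"
    "\<And>y. y \<in> V \<Longrightarrow> (g has_derivative g' y) (at y)"
    "\<And>y. y \<in> V \<Longrightarrow> g' y = inv_into UNIV (blinfun_apply (f' (g y)))" "\<And>y. y \<in> V \<Longrightarrow> bij (blinfun_apply (f' (g y)))"
    using inverse_function_theorem[OF S _ c x0, of f "Blinfun h"] smooth_on_has_derivative[OF f] f' by (metis (no_types, lifting))
  have gU: "g y \<in> U" if "y \<in> V" for y using UV(5) that by (auto simp: homeomorphism_def)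
  have "smooth_on g V"
  proof (rule Ck_on_inverse_map[OF UV(1,4) smooth_on_subset[OF f UV(2)] gU UV(6)])
    fix y v assume y: "y \<in> V"
    then have "g y \<in> S" using gU UV(2) by blast
    then show "frechet_derivative f (at (g y)) (g' y v) = v"
      using UV(7,8)[OF y] f' by (metis bij_is_surj surj_f_inv_f)
  qed
  moreover have "v = 0" if x: "x \<in> U" and v: "frechet_derivative f (at x) v = 0" for x v
  proof -
    have fx: "f x \<in> V" "g (f x) = x" using UV(5) x by (auto simp: homeomorphism_def)
    then have "inj (frechet_derivative f (at x))"
      using UV(8)[of "f x"] f' UV(2) x by (metis bij_is_inj subsetD)
    moreover have "linear (frechet_derivative f (at x))"
      using smooth_on_has_derivative[OF f] UV(2) x has_derivative_linear by blast
    ultimately show ?thesis using v by (metis linear_injective_0)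
  qed
  ultimately show ?thesis using that UV(1-5) by blast
qed

section \<open>Straightening commuting vector fields\<close>

text \<open>The functional dual to \<open>b i\<close> is represented by a vector whose orthogonal
  projection to the span has the same inner products with all \<open>b j\<close>. Membership in the
  span is the point: an orthogonal map that fixes the \<open>b j\<close> then fixes the
  \<open>d i\<close>, so \<open>w \<bullet> d i\<close> is invariant under it.\<close>

lemma dual_family:
  fixes b :: "nat \<Rightarrow> 'a::euclidean_space"
  assumes inj: "inj_on b {..<k}" and ind: "independent (b ` {..<k})"
  obtains d where "\<And>i. i < k \<Longrightarrow> d i \<in> span (b ` {..<k})"
    "\<And>i j. i < k \<Longrightarrow> j < k \<Longrightarrow> b j \<bullet> d i = (if i = j then 1 else 0)"
proof -
  have "\<exists>d. d \<in> span (b ` {..<k}) \<and> (\<forall>j<k. b j \<bullet> d = (if i = j then 1 else 0))" if i: "i < k" for i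
  proof -
    obtain g :: "'a \<Rightarrow> real" where g: "linear g" "\<forall>x\<in>b ` {..<k}. g x = (if x = b i then 1 else 0)"
      using linear_independent_extend[OF ind, of "\<lambda>x. if x = b i then 1 else 0"] by blast
    define c where "c = (\<Sum>e\<in>Basis. g e *\<^sub>R e)"
    have gc: "g x = x \<bullet> c" for x
    proof -
      have "g x = g (\<Sum>e\<in>Basis. (x \<bullet> e) *\<^sub>R e)" by (simp add: euclidean_representation)
      also have "\<dots> = (\<Sum>e\<in>Basis. (x \<bullet> e) * g e)" using g(1) by (simp add: linear_sum linear_scale)
      finally show ?thesis by (simp add: c_def inner_sum_right mult.commute)
    qed
    obtain y z where yz: "y \<in> span (b ` {..<k})" "\<And>w. w \<in> span (b ` {..<k}) \<Longrightarrow> real_inner_class.orthogonal z w" "c = y + z"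
      using orthogonal_subspace_decomp_exists[of "b ` {..<k}" c] by metis
    have "b j \<bullet> y = (if i = j then 1 else 0)" if j: "j < k" for j
    proof -
      have "b j \<bullet> z = 0" using yz(2)[of "b j"] j by (simp add: span_base real_inner_class.orthogonal_def inner_commute)
      then have "b j \<bullet> y = g (b j)" using yz(3) by (simp add: gc inner_add_right)
      also have "\<dots> = (if b j = b i then 1 else 0)" using g(2) j by blast
      also have "\<dots> = (if i = j then 1 else 0)" using inj i j by (auto simp: inj_on_def)
      finally show ?thesis .
    qed
    then show ?thesis using yz(1) by blast
  qed
  then show ?thesis using that by metis
qed

lemma smooth_on_Lipschitz_cball:
  fixes f :: "'a::euclidean_space \<Rightarrow> 'b::real_normed_vector"
  assumes f: "smooth_on f S" and sub: "cball x0 \<rho> \<subseteq> S"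
  obtains \<Lambda> where "\<Lambda> \<ge> 0" "\<And>x y. x \<in> cball x0 \<rho> \<Longrightarrow> y \<in> cball x0 \<rho> \<Longrightarrow> norm (f x - f y) \<le> \<Lambda> * norm (x - y)"
proof -
  let ?f' = "\<lambda>x. frechet_derivative f (at x)"
  have "\<exists>m\<ge>0. \<forall>x\<in>cball x0 \<rho>. norm (?f' x b) \<le> m" for b
  proof -
    have "continuous_on (cball x0 \<rho>) (\<lambda>x. ?f' x b)"
      using continuous_on_subset[OF smooth_on_continuous[OF smooth_on_Suc[OF f, of b]] sub] .
    then have "bounded ((\<lambda>x. ?f' x b) ` cball x0 \<rho>)"
      by (intro compact_imp_bounded compact_continuous_image) auto
    then show ?thesis unfolding bounded_pos by (auto intro: less_imp_le)
  qed
  then obtain m where m: "\<And>b. m b \<ge> 0" "\<And>b x. x \<in> cball x0 \<rho> \<Longrightarrow> norm (?f' x b) \<le> m b" by metis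
  define \<Lambda> where "\<Lambda> = (\<Sum>b\<in>Basis. m b)"
  have d: "(f has_derivative ?f' x) (at x)" if "x \<in> cball x0 \<rho>" for x
    using smooth_on_has_derivative[OF f] that sub by blast
  have bd: "norm (?f' x v) \<le> \<Lambda> * norm v" if x: "x \<in> cball x0 \<rho>" for x v
  proof -
    have lin: "linear (?f' x)" using d[OF x] has_derivative_linear by blast
    have "?f' x v = (\<Sum>b\<in>Basis. (v \<bullet> b) *\<^sub>R ?f' x b)"
      using linear_sum[OF lin, of "\<lambda>b. (v \<bullet> b) *\<^sub>R b" Basis] lin
      by (simp add: euclidean_representation linear_scale)
    also have "norm \<dots> \<le> (\<Sum>b\<in>Basis. m b * norm v)"
    proof (rule sum_norm_le)
      fix b :: 'a assume "b \<in> Basis"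
      then show "norm ((v \<bullet> b) *\<^sub>R ?f' x b) \<le> m b * norm v"
        using Basis_le_norm[of b v] m(2)[OF x, of b] m(1)[of b] mult_mono[of "\<bar>v \<bullet> b\<bar>" "norm v" "norm (?f' x b)" "m b"]
        by (simp add: mult.commute)
    qed
    finally show ?thesis by (simp add: \<Lambda>_def sum_distrib_right)
  qed
  show ?thesis
  proof (rule that[of \<Lambda>])
    show "\<Lambda> \<ge> 0" unfolding \<Lambda>_def by (intro sum_nonneg m)
    fix x y assume xy: "x \<in> cball x0 \<rho>" "y \<in> cball x0 \<rho>"
    show "norm (f x - f y) \<le> \<Lambda> * norm (x - y)"
      by (rule differentiable_bound[of "cball x0 \<rho>" f ?f'])
         (use d bd xy \<open>\<Lambda> \<ge> 0\<close> in \<open>auto intro: has_derivative_at_withinI onorm_bound\<close>)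
  qed
qed

text \<open>
  With \<open>b\<^sub>i = Y\<^sub>i(0)\<close> and a dual family \<open>d\<^sub>i\<close> in the span of the \<open>b\<^sub>i\<close>, \<open>\<Phi>(w)\<close> is the value at time 1 of
  the integral curve of \<open>\<Sum>\<^sub>i (w \<bullet> d\<^sub>i) Y\<^sub>i\<close> that starts at \<open>w - \<Sum>\<^sub>i (w \<bullet> d\<^sub>i) b\<^sub>i\<close>. Commutativity makes
  \<open>t Y\<^sub>j(c(t))\<close> the solution of the linearised equation in the direction \<open>b\<^sub>j\<close>.
\<close>

theorem straightening:
  fixes Y :: "nat \<Rightarrow> real ^ 'n \<Rightarrow> real ^ 'n"
  assumes S: "open S" "0 \<in> S" and Y: "\<And>i. i < k \<Longrightarrow> smooth_on (Y i) S"
    and comm: "\<And>i j x. i < k \<Longrightarrow> j < k \<Longrightarrow> x \<in> S \<Longrightarrow>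
      frechet_derivative (Y i) (at x) (Y j x) = frechet_derivative (Y j) (at x) (Y i x)"
    and inj: "inj_on (\<lambda>i. Y i 0) {..<k}" and ind: "independent ((\<lambda>i. Y i 0) ` {..<k})"
  obtains \<Phi> \<eta> where "\<eta> > 0" "smooth_on \<Phi> (ball 0 \<eta>)" "\<Phi> 0 = 0" "\<Phi> ` ball 0 \<eta> \<subseteq> S"
    "\<And>v. frechet_derivative \<Phi> (at 0) v = v"
    "\<And>w j. w \<in> ball 0 \<eta> \<Longrightarrow> j < k \<Longrightarrow> frechet_derivative \<Phi> (at w) (Y j 0) = Y j (\<Phi> w)"
    "\<And>L w. orthogonal_transformation L \<Longrightarrow> (\<And>i x. i < k \<Longrightarrow> x \<in> S \<Longrightarrow> Y i (L x) = L (Y i x)) \<Longrightarrow>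
      w \<in> ball 0 \<eta> \<Longrightarrow> \<Phi> (L w) = L (\<Phi> w)"
proof -
  define b where "b i = Y i 0" for i
  obtain d where d: "\<And>i. i < k \<Longrightarrow> d i \<in> span (b ` {..<k})"
    "\<And>i j. i < k \<Longrightarrow> j < k \<Longrightarrow> b j \<bullet> d i = (if i = j then 1 else 0)"
    using dual_family[of b k] inj ind unfolding b_def by blast

  \<comment> \<open>Bounds on the fields and the size of the parameter ball\<close>
  obtain \<rho> where \<rho>: "\<rho> > 0" "cball 0 \<rho> \<subseteq> S" using S open_contains_cball by blast
  define \<Omega> where "\<Omega> = ball (0::real ^ 'n) \<rho>"
  have \<Omega>S: "\<Omega> \<subseteq> S" using \<rho>(2) by (auto simp: \<Omega>_def)
  have "\<exists>l\<ge>0. \<forall>x\<in>cball 0 \<rho>. \<forall>y\<in>cball 0 \<rho>. norm (Y i x - Y i y) \<le> l * norm (x - y)" if "i < k" for i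
    by (rule smooth_on_Lipschitz_cball[OF Y[OF that] \<rho>(2)]) blast
  then obtain l where l: "\<And>i. i < k \<Longrightarrow> l i \<ge> 0"
    "\<And>i x y. i < k \<Longrightarrow> x \<in> cball 0 \<rho> \<Longrightarrow> y \<in> cball 0 \<rho> \<Longrightarrow> norm (Y i x - Y i y) \<le> l i * norm (x - y)"
    by metis
  have "\<exists>m\<ge>0. \<forall>x\<in>cball 0 \<rho>. norm (Y i x) \<le> m" if "i < k" for i
  proof -
    have "bounded (Y i ` cball 0 \<rho>)"
      by (intro compact_imp_bounded compact_continuous_image
          continuous_on_subset[OF smooth_on_continuous[OF Y[OF that]] \<rho>(2)]) auto
    then show ?thesis unfolding bounded_pos by (auto intro: less_imp_le)
  qed
  then obtain m where m: "\<And>i. i < k \<Longrightarrow> m i \<ge> 0" "\<And>i x. i < k \<Longrightarrow> x \<in> cball 0 \<rho> \<Longrightarrow> norm (Y i x) \<le> m i"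
    by metis
  define \<Lambda> where "\<Lambda> = (\<Sum>i<k. l i)"
  define M where "M = (\<Sum>i<k. m i)"
  have l\<Lambda>: "l i \<le> \<Lambda>" "m i \<le> M" if "i < k" for i
    using that l(1) m(1) by (auto simp: \<Lambda>_def M_def intro!: member_le_sum)
  define N where "N w = (\<Sum>i<k. \<bar>w \<bullet> d i\<bar>)" for w
  define \<beta> where "\<beta> w = w - (\<Sum>i<k. (w \<bullet> d i) *\<^sub>R b i)" for w
  define K where "K w x = (\<Sum>i<k. (w \<bullet> d i) *\<^sub>R Y i x)" for w x
  have lin\<beta>: "linear \<beta>"
    by (rule linearI) (simp_all add: \<beta>_def inner_add_left scaleR_add_left sum.distrib scaleR_sum_right algebra_simps)
  have KL: "norm (K w x - K w y) \<le> N w * \<Lambda> * norm (x - y)" if "x \<in> cball 0 \<rho>" "y \<in> cball 0 \<rho>" for w x y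
  proof -
    have "K w x - K w y = (\<Sum>i<k. (w \<bullet> d i) *\<^sub>R (Y i x - Y i y))"
      by (simp add: K_def sum_subtractf scaleR_diff_right)
    also have "norm \<dots> \<le> (\<Sum>i<k. \<bar>w \<bullet> d i\<bar> * (\<Lambda> * norm (x - y)))"
    proof (rule sum_norm_le)
      fix i assume "i \<in> {..<k}"
      then have "norm (Y i x - Y i y) \<le> \<Lambda> * norm (x - y)"
        using l(2)[of i x y] l\<Lambda>(1)[of i] that mult_right_mono[of "l i" \<Lambda> "norm (x - y)"] by fastforce
      then show "norm ((w \<bullet> d i) *\<^sub>R (Y i x - Y i y)) \<le> \<bar>w \<bullet> d i\<bar> * (\<Lambda> * norm (x - y))"
        by (simp add: mult_left_mono)
    qed
    finally show ?thesis by (simp add: N_def sum_distrib_right mult.assoc)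
  qed
  have KM: "norm (K w x) \<le> N w * M" if "x \<in> cball 0 \<rho>" for w x
  proof -
    have "norm (K w x) \<le> (\<Sum>i<k. \<bar>w \<bullet> d i\<bar> * M)" unfolding K_def
    proof (rule sum_norm_le)
      fix i assume "i \<in> {..<k}"
      then have "norm (Y i x) \<le> M" using m(2)[of i x] l\<Lambda>(2)[of i] that by fastforce
      then show "norm ((w \<bullet> d i) *\<^sub>R Y i x) \<le> \<bar>w \<bullet> d i\<bar> * M" by (simp add: mult_left_mono)
    qed
    then show ?thesis by (simp add: N_def sum_distrib_right)
  qed
  have cont\<beta>: "continuous_on UNIV \<beta>" using lin\<beta> linear_continuous_on linear_conv_bounded_linear by blast
  have contN: "continuous_on UNIV N" unfolding N_def by (intro continuous_intros)
  \<comment> \<open>Small \<open>w\<close> takes the place of short time: the first condition gives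
    \<open>K w\<close> the Lipschitz constant 1/2 on the closed ball of radius
    \<open>\<rho>\<close>, the second keeps all curves in the closed ball of radius
    \<open>\<rho> / 2\<close>, which lies inside the open set \<open>\<Omega>\<close>.\<close>
  let ?Q = "{w. N w * \<Lambda> < 1/2} \<inter> {w. norm (\<beta> w) + N w * M < \<rho> / 2}"
  have "open ?Q" by (intro open_Int open_Collect_less continuous_intros contN cont\<beta>)
  moreover have "0 \<in> ?Q" using \<rho>(1) by (simp add: N_def \<beta>_def)
  ultimately obtain \<eta> where \<eta>: "\<eta> > 0" "ball 0 \<eta> \<subseteq> ?Q" using open_contains_ball by blast
  define W where "W = ball (0::real ^ 'n) \<eta>"
  have W: "open W" by (simp add: W_def)
  have WN: "N w * \<Lambda> \<le> 1/2" "norm (\<beta> w) + N w * M \<le> \<rho> / 2" if "w \<in> W" for w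
    using \<eta>(2) that by (auto simp: W_def less_imp_le)
  have L2: "norm (K w x - K w y) \<le> 1/2 * norm (x - y)" if "w \<in> W" "x \<in> cball 0 \<rho>" "y \<in> cball 0 \<rho>" for w x y
    using KL[OF that(2,3), of w] WN(1)[OF that(1)] mult_right_mono[OF WN(1)[OF that(1)] norm_ge_zero[of "x - y"]] by linarith
  have Kc: "continuous_on {0..1} (\<lambda>s. K w (\<gamma> s))" if "continuous_on {0..1} \<gamma>" "\<gamma> ` {0..1} \<subseteq> S" for w and \<gamma> :: "real \<Rightarrow> real ^ 'n"
    unfolding K_def using that Y
    by (intro continuous_intros continuous_on_compose2[OF smooth_on_continuous[OF Y]]) auto
  have half: "cball 0 (\<rho> / 2) \<subseteq> cball (0::real ^ 'n) \<rho>" "cball 0 (\<rho> / 2) \<subseteq> \<Omega>"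
    using \<rho>(1) by (auto simp: \<Omega>_def)
  have ex: "\<exists>c. volterra_sol (\<lambda>s. K w) (\<beta> w) c \<and> c ` {0..1} \<subseteq> cball 0 (\<rho> / 2)" if w: "w \<in> W" for w
  proof (rule volterra_exists[of "cball 0 (\<rho> / 2)" "\<lambda>s. K w" "\<beta> w"])
    show "continuous_on {0..1} (\<lambda>s. K w (\<gamma> s))" if \<gamma>: "continuous_on {0..1} \<gamma>" "\<gamma> ` {0..1} \<subseteq> cball 0 (\<rho> / 2)" for \<gamma> :: "real \<Rightarrow> real ^ 'n"
      by (rule Kc[OF \<gamma>(1)]) (use \<gamma>(2) half \<rho>(2) in blast)
    show "\<beta> w + integral {0..t} (\<lambda>s. K w (\<gamma> s)) \<in> cball 0 (\<rho> / 2)"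
      if \<gamma>: "continuous_on {0..1} \<gamma>" "\<gamma> ` {0..1} \<subseteq> cball 0 (\<rho> / 2)" and t: "t \<in> {0..1}" for \<gamma> :: "real \<Rightarrow> real ^ 'n" and t :: real
    proof -
      have "norm (integral {0..t} (\<lambda>s. K w (\<gamma> s))) \<le> (N w * M) * (t - 0)"
      proof (rule integral_bound)
        show "continuous_on {0..t} (\<lambda>s. K w (\<gamma> s))"
          by (rule continuous_on_subset[OF Kc[OF \<gamma>(1)]]) (use \<gamma>(2) half \<rho>(2) t in auto)
        show "norm (K w (\<gamma> s)) \<le> N w * M" if "s \<in> {0..t}" for s
        proof (rule KM)
          have "\<gamma> s \<in> \<gamma> ` {0..1}" using t that by auto
          then show "\<gamma> s \<in> cball 0 \<rho>" using \<gamma>(2) half(1) by blast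
        qed
      qed (use t in auto)
      moreover have "N w * M \<ge> 0" using KM[of 0 w] \<rho>(1) norm_ge_zero[of "K w 0"] by (metis centre_in_cball less_imp_le order_trans)
      ultimately have "norm (integral {0..t} (\<lambda>s. K w (\<gamma> s))) \<le> N w * M"
        using t mult_left_le[of t "N w * M"] by auto
      then show ?thesis using WN(2)[OF w] norm_triangle_ineq[of "\<beta> w" "integral {0..t} (\<lambda>s. K w (\<gamma> s))"] by simp
    qed
    show "norm (K w x - K w y) \<le> 1/2 * norm (x - y)" if "x \<in> cball 0 (\<rho> / 2)" "y \<in> cball 0 (\<rho> / 2)" for x y
      using L2[OF w] that half by blast
    show "cball (0::real ^ 'n) (\<rho> / 2) \<noteq> {}" using \<rho>(1) by simp
  qed auto

  \<comment> \<open>Integral curves and their dependence on the parameter\<close>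
  define c where "c t w = (SOME c. volterra_sol (\<lambda>s. K w) (\<beta> w) c \<and> c ` {0..1} \<subseteq> cball 0 (\<rho> / 2)) t" for t w
  have c: "volterra_sol (\<lambda>s. K w) (\<beta> w) (\<lambda>t. c t w)" "(\<lambda>t. c t w) ` {0..1} \<subseteq> cball 0 (\<rho> / 2)" if "w \<in> W" for w
    using someI_ex[OF ex[OF that]] unfolding c_def by blast+
  have c\<Omega>: "c t w \<in> \<Omega>" if "t \<in> {0..1}" "w \<in> W" for t w using c(2)[OF that(2)] that(1) half by blast
  have cS: "c t w \<in> S" if "t \<in> {0..1}" "w \<in> W" for t w using c\<Omega>[OF that] \<Omega>S by blast
  have cc: "continuous_on {0..1} (\<lambda>t. c t w)" if "w \<in> W" for w using c(1)[OF that] by (simp add: volterra_sol_def)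
  have \<Omega>: "open \<Omega>" by (simp add: \<Omega>_def)
  have op: "open (W \<times> \<Omega>)" using W \<Omega> by (rule open_Times)
  have KCp: "Cp unit_time j (\<lambda>s p. K (fst p) (snd p)) (W \<times> \<Omega>)" for j
    unfolding K_def
  proof (rule Cp_sum[OF op], rule Cp_scaleR[OF op])
    fix i assume "i \<in> {..<k}"
    then have "smooth_on (Y i) \<Omega>" using smooth_on_subset[OF Y \<Omega>S] by simp
    then have "Cp unit_time j (\<lambda>_. Y i) \<Omega>" unfolding smooth_on_def by (intro Cp_of_Ck_on[OF \<Omega>]) simp
    then show "Cp unit_time j (\<lambda>_ p. Y i (snd p)) (W \<times> \<Omega>)"
      by (rule Cp_compose[OF op \<Omega> _ Cp_linear_fun[OF op bounded_linear_snd]]) auto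
    show "Cp unit_time j (\<lambda>_ p. fst p \<bullet> d i) (W \<times> \<Omega>)"
      by (intro Cp_inner[OF op] Cp_const op Cp_linear_fun bounded_linear_fst)
  qed
  have \<beta>Cp: "Cp unit_time j (\<lambda>_. \<beta>) W" for j
    using lin\<beta> linear_conv_bounded_linear by (intro Cp_linear_fun[OF W]) blast
  have L\<Omega>: "norm (K w x - K w y) \<le> 1/2 * norm (x - y)" if "w \<in> W" "x \<in> \<Omega>" "y \<in> \<Omega>" for w x y
    using L2[OF that(1), of x y] that by (simp add: \<Omega>_def)
  have cCp: "Cp unit_time j c W" for j
    by (rule volterra_smooth(1)[where K="\<lambda>s. K", OF W \<Omega> KCp \<beta>Cp c(1) c\<Omega> L\<Omega>])
  have vs: "volterra_sol (\<lambda>s u. frechet_derivative (\<lambda>p. K (fst p) (snd p)) (at (w, c s w)) (v, u))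
      (frechet_derivative \<beta> (at w) v) (\<lambda>t. frechet_derivative (c t) (at w) v)" if "w \<in> W" for w v
    by (rule volterra_smooth(2)[where K="\<lambda>s. K", OF W \<Omega> KCp \<beta>Cp c(1) c\<Omega> L\<Omega> that])
  define \<Phi> where "\<Phi> w = c 1 w" for w
  have smooth: "smooth_on \<Phi> W"
    unfolding smooth_on_def \<Phi>_def[abs_def] using Ck_on_of_Cp[OF W cCp, of 1] by simp
  let ?D = "\<lambda>i x. frechet_derivative (Y i) (at x)"
  have YD: "(Y i has_derivative ?D i x) (at x)" "linear (?D i x)" if "i < k" "x \<in> S" for i x
    using smooth_on_has_derivative[OF Y[OF that(1)] that(2)] has_derivative_linear by blast+
  have KD: "frechet_derivative (\<lambda>p. K (fst p) (snd p)) (at (w, x)) (v, u) =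
      (\<Sum>i<k. (v \<bullet> d i) *\<^sub>R Y i x) + (\<Sum>i<k. (w \<bullet> d i) *\<^sub>R ?D i x u)" if x: "x \<in> S" for w x v u
  proof -
    have "((\<lambda>p. K (fst p) (snd p)) has_derivative
       (\<lambda>h. \<Sum>i<k. (fst (w, x) \<bullet> d i) *\<^sub>R ?D i x (snd h) + (fst h \<bullet> d i) *\<^sub>R Y i (snd (w, x)))) (at (w, x))"
      unfolding K_def
    proof (rule has_derivative_sum, rule has_derivative_scaleR)
      fix i assume "i \<in> {..<k}"
      then have "(Y i has_derivative ?D i x) (at (snd (w, x)))" using YD(1) x by simp
      then show "((\<lambda>p. Y i (snd p)) has_derivative (\<lambda>h. ?D i x (snd h))) (at (w, x))"
        by (rule has_derivative_compose[rotated]) (auto intro!: derivative_eq_intros)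
      show "((\<lambda>p. fst p \<bullet> d i) has_derivative (\<lambda>h. fst h \<bullet> d i)) (at (w, x))"
        by (auto intro!: derivative_eq_intros)
    qed
    from frechet_derivative_at[OF this, symmetric] show ?thesis by (simp add: sum.distrib add.commute)
  qed
  have \<beta>D: "frechet_derivative \<beta> (at w) v = \<beta> v" for w v
    using frechet_derivative_at[OF linear_imp_has_derivative[OF lin\<beta>]] by metis
  define B where "B w x u = (\<Sum>i<k. (w \<bullet> d i) *\<^sub>R ?D i x u)" for w x u
  have linB: "linear (B w x)" if "x \<in> S" for w x
    unfolding B_def[abs_def]
    by (intro linear_compose_sum ballI linear_compose_scale_right YD(2) that) auto
  have BL: "norm (B w x u) \<le> 1/2 * norm u" if "w \<in> W" "x \<in> \<Omega>" for w x u
  proof (rule Lipschitz_derivative_bound[OF _ \<Omega> that(2)])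
    have "x \<in> S" using that \<Omega>S by blast
    then show "(K w has_derivative B w x) (at x)"
      unfolding K_def[abs_def] B_def[abs_def] by (intro has_derivative_sum has_derivative_scaleR_right YD(1)) auto
  qed (use L\<Omega> that in auto)
  have sol: "volterra_sol (\<lambda>s u. (\<Sum>i<k. (v \<bullet> d i) *\<^sub>R Y i (c s w)) + B w (c s w) u) (\<beta> v)
      (\<lambda>t. frechet_derivative (c t) (at w) v)" if w: "w \<in> W" for w v
  proof -
    have "integral {0..t} (\<lambda>s. frechet_derivative (\<lambda>p. K (fst p) (snd p)) (at (w, c s w)) (v, frechet_derivative (c s) (at w) v))
      = integral {0..t} (\<lambda>s. (\<Sum>i<k. (v \<bullet> d i) *\<^sub>R Y i (c s w)) + B w (c s w) (frechet_derivative (c s) (at w) v))"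
      if "t \<in> {0..1}" for t
      by (rule integral_cong) (use that cS[OF _ w] in \<open>auto simp: KD B_def\<close>)
    then show ?thesis using vs[OF w, of v] unfolding volterra_sol_def \<beta>D by simp
  qed

  \<comment> \<open>Straightening, normalisation at the origin and equivariance\<close>
  have dsum: "(\<Sum>i<k. (b j \<bullet> d i) *\<^sub>R f i) = f j" if "j < k" for f :: "nat \<Rightarrow> real ^ 'n" and j
  proof -
    have "(\<Sum>i<k. (b j \<bullet> d i) *\<^sub>R f i) = (\<Sum>i<k. if i = j then f i else 0)"
      by (intro sum.cong) (auto simp: d(2) that)
    then show ?thesis using that by simp
  qed
  have straight: "frechet_derivative \<Phi> (at w) (b j) = Y j (\<Phi> w)" if w: "w \<in> W" and j: "j < k" for w j
  proof -
    let ?K = "\<lambda>s u. Y j (c s w) + B w (c s w) u"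
    \<comment> \<open>\<open>\<beta>\<close> annihilates \<open>b j\<close> by duality, so the
      linearised equation starts at 0 and its inhomogeneity is \<open>Y j\<close> along the
      curve.\<close>
    have s1: "volterra_sol ?K 0 (\<lambda>t. frechet_derivative (c t) (at w) (b j))"
      using sol[OF w, of "b j"] dsum[OF j] by (simp add: \<beta>_def)
    have YD': "continuous_on {0..1} (\<lambda>s. ?D i (c s w) (\<gamma> s))" if "continuous_on {0..1} \<gamma>" "i < k" for i \<gamma>
    proof -
      have "continuous_on {0..1} (\<lambda>s. \<Sum>a\<in>UNIV. \<gamma> s $ a *\<^sub>R ?D i (c s w) (axis a 1))"
        by (intro continuous_intros that continuous_on_compose2[OF smooth_on_continuous[OF smooth_on_Suc[OF Y[OF that(2)]]] cc[OF w]])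
           (use cS w in auto)
      then show ?thesis
        by (rule continuous_on_eq) (use linear_axis_expansion[OF YD(2)[OF that(2) cS[OF _ w]]] in auto)
    qed
    have Kc': "continuous_on {0..1} (\<lambda>s. ?K s (\<gamma> s))" if "continuous_on {0..1} \<gamma>" for \<gamma>
      unfolding B_def using that j
      by (intro continuous_intros YD' continuous_on_compose2[OF smooth_on_continuous[OF Y[OF j]] cc[OF w]])
         (use cS w in auto)
    have Yjc: "continuous_on {0..1} (\<lambda>s. Y j (c s w))"
      by (rule continuous_on_compose2[OF smooth_on_continuous[OF Y[OF j]] cc[OF w]]) (use cS w in auto)
    have uc: "continuous_on {0..1} (\<lambda>t. t *\<^sub>R Y j (c t w))"
      by (intro continuous_intros Yjc)
    have der: "((\<lambda>t. t *\<^sub>R Y j (c t w)) has_vector_derivative ?K t (t *\<^sub>R Y j (c t w))) (at t within {0..1})"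
      if t: "t \<in> {0..1}" for t
    proof -
      have "((\<lambda>t. \<beta> w + integral {0..t} (\<lambda>s. K w (c s w))) has_vector_derivative 0 + K w (c t w)) (at t within {0..1})"
        by (intro has_vector_derivative_add has_vector_derivative_const integral_has_vector_derivative Kc cc w t)
           (use cS w in auto)
      then have "((\<lambda>t. c t w) has_vector_derivative K w (c t w)) (at t within {0..1})"
        using c(1)[OF w] t unfolding volterra_sol_def by (auto elim!: has_vector_derivative_transform[rotated -1])
      from vector_derivative_diff_chain_within[OF this has_derivative_at_withinI[OF YD(1)[OF j cS[OF t w]]]]
      have "((\<lambda>t. Y j (c t w)) has_vector_derivative ?D j (c t w) (K w (c t w))) (at t within {0..1})"
        by (simp add: o_def)
      then have "((\<lambda>t. t *\<^sub>R Y j (c t w)) has_vector_derivative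
          t *\<^sub>R ?D j (c t w) (K w (c t w)) + 1 *\<^sub>R Y j (c t w)) (at t within {0..1})"
        by (intro has_vector_derivative_scaleR) (auto intro!: derivative_eq_intros)
      moreover have "t *\<^sub>R ?D j (c t w) (K w (c t w)) = B w (c t w) (t *\<^sub>R Y j (c t w))"
      proof -
        have "?D j (c t w) (K w (c t w)) = (\<Sum>i<k. (w \<bullet> d i) *\<^sub>R ?D j (c t w) (Y i (c t w)))"
          unfolding K_def using YD(2)[OF j cS[OF t w]] by (simp add: linear_sum linear_scale)
        also have "\<dots> = B w (c t w) (Y j (c t w))"
          unfolding B_def by (intro sum.cong refl) (use comm[OF j _ cS[OF t w]] in auto)
        finally show ?thesis using linear_scale[OF linB[OF cS[OF t w]]] by metis
      qed
      ultimately show ?thesis by (simp add: add.commute)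
    qed
    have s2: "volterra_sol ?K 0 (\<lambda>t. t *\<^sub>R Y j (c t w))"
      unfolding volterra_sol_def
    proof (intro conjI uc ballI)
      fix t :: real assume t: "t \<in> {0..1}"
      have "((\<lambda>s. ?K s (s *\<^sub>R Y j (c s w))) has_integral (t *\<^sub>R Y j (c t w) - 0 *\<^sub>R Y j (c 0 w))) {0..t}"
        using t by (intro fundamental_theorem_of_calculus)
          (auto intro!: has_vector_derivative_within_subset[OF der])
      then show "t *\<^sub>R Y j (c t w) = 0 + integral {0..t} (\<lambda>s. ?K s (s *\<^sub>R Y j (c s w)))"
        by (simp add: integral_unique)
    qed
    have "frechet_derivative (c 1) (at w) (b j) = 1 *\<^sub>R Y j (c 1 w)"
    proof (rule volterra_unique[OF s1 s2])
      show "norm (?K s (frechet_derivative (c s) (at w) (b j)) - ?K s (s *\<^sub>R Y j (c s w))) \<le>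
          1/2 * norm (frechet_derivative (c s) (at w) (b j) - s *\<^sub>R Y j (c s w))" if "s \<in> {0..1}" for s
        using BL[OF w c\<Omega>[OF that w], of "frechet_derivative (c s) (at w) (b j) - s *\<^sub>R Y j (c s w)"]
          linear_diff[OF linB[OF cS[OF that w]]] by simp
    qed (use Kc' s1 uc in \<open>auto simp: volterra_sol_def\<close>)
    then show ?thesis by (simp add: \<Phi>_def[abs_def])
  qed
  have W0: "0 \<in> W" using \<eta>(1) by (simp add: W_def)
  have c0: "c t 0 = 0" if t: "t \<in> {0..1}" for t
    using c(1)[OF W0] t by (auto simp: volterra_sol_def \<beta>_def K_def)
  \<comment> \<open>At \<open>w = 0\<close> the curve stays at 0 and the linear part vanishes, so
    the linearised equation integrates to \<open>\<beta> v\<close> plus the sum of the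
    \<open>(v \<bullet> d i) *\<^sub>R b i\<close>, which is \<open>v\<close>.\<close>
  have id0: "frechet_derivative \<Phi> (at 0) v = v" for v
  proof -
    have B0: "B 0 x u = 0" for x u by (simp add: B_def)
    have int: "integral {0..1} (\<lambda>s. (\<Sum>i<k. (v \<bullet> d i) *\<^sub>R Y i (c s 0)) + B 0 (c s 0) (frechet_derivative (c s) (at 0) v))
       = integral {0..1::real} (\<lambda>s. \<Sum>i<k. (v \<bullet> d i) *\<^sub>R b i)"
      by (rule integral_cong) (simp add: c0 B0 b_def)
    have "frechet_derivative (c 1) (at 0) v = \<beta> v + integral {0..1::real} (\<lambda>s. \<Sum>i<k. (v \<bullet> d i) *\<^sub>R b i)"
      using sol[OF W0, of v] unfolding volterra_sol_def int[symmetric] by auto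
    then show ?thesis by (simp add: \<Phi>_def[abs_def] \<beta>_def)
  qed
  \<comment> \<open>\<open>L\<close> fixes the \<open>b i\<close> because it fixes 0, hence also
    their span and the \<open>d i\<close>. So \<open>L\<close> carries the equation for
    \<open>w\<close> to the one for \<open>L w\<close>, and uniqueness identifies the
    solutions.\<close>
  have equi: "\<Phi> (L w) = L (\<Phi> w)"
    if L: "orthogonal_transformation L" and LY: "\<And>i x. i < k \<Longrightarrow> x \<in> S \<Longrightarrow> Y i (L x) = L (Y i x)" and w: "w \<in> W" for L w
  proof -
    have linL: "linear L" and Ln: "\<And>x. norm (L x) = norm x" and Li: "\<And>x y. L x \<bullet> L y = x \<bullet> y"
      using L by (auto simp: orthogonal_transformation_def orthogonal_transformation_norm)
    have bL: "L (b i) = b i" if "i < k" for i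
      using LY[OF that S(2)] linear_0[OF linL] by (simp add: b_def)
    have "L x = x" if "x \<in> span (b ` {..<k})" for x
    proof (rule linear_eq_on[OF linL linear_ident that])
      show "L x = x" if "x \<in> b ` {..<k}" for x using that bL by auto
    qed
    then have dL: "L x \<bullet> d i = x \<bullet> d i" if "i < k" for x i
      using Li[of x "d i"] d(1)[OF that] by metis
    have Lw: "L w \<in> W" using w Ln by (simp add: W_def)
    have \<beta>L: "L (\<beta> w) = \<beta> (L w)"
      unfolding \<beta>_def by (simp add: linear_diff[OF linL] linear_sum[OF linL] linear_scale[OF linL] bL dL)
    have KL: "L (K w x) = K (L w) (L x)" if "x \<in> S" for x
      unfolding K_def by (simp add: linear_sum[OF linL] linear_scale[OF linL] LY that dL)
    have Lbl: "bounded_linear L" using linL linear_conv_bounded_linear by blast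
    have Lc: "continuous_on {0..1} (\<lambda>t. L (c t w))"
      by (rule continuous_on_compose2[OF linear_continuous_on[OF Lbl, of UNIV] cc[OF w]]) auto
    have Lin: "L (c t w) \<in> \<Omega>" if "t \<in> {0..1}" for t using c\<Omega>[OF that w] by (simp add: \<Omega>_def Ln)
    have "volterra_sol (\<lambda>s. K (L w)) (\<beta> (L w)) (\<lambda>t. L (c t w))"
      unfolding volterra_sol_def
    proof (intro conjI Lc ballI)
      fix t :: real assume t: "t \<in> {0..1}"
      have "continuous_on {0..t} (\<lambda>s. K w (c s w))"
        by (rule continuous_on_subset[OF Kc[OF cc[OF w]]]) (use cS w t in auto)
      then have i: "(\<lambda>s. K w (c s w)) integrable_on {0..t}" by (rule integrable_continuous_interval)
      have "L (c t w) = L (\<beta> w + integral {0..t} (\<lambda>s. K w (c s w)))"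
        using c(1)[OF w] t by (simp add: volterra_sol_def)
      also have "\<dots> = \<beta> (L w) + integral {0..t} (\<lambda>s. L (K w (c s w)))"
        using integral_linear[OF i Lbl] by (simp add: linear_add[OF linL] \<beta>L o_def)
      also have "integral {0..t} (\<lambda>s. L (K w (c s w))) = integral {0..t} (\<lambda>s. K (L w) (L (c s w)))"
        by (rule integral_cong) (use t cS w in \<open>auto simp: KL\<close>)
      finally show "L (c t w) = \<beta> (L w) + integral {0..t} (\<lambda>s. K (L w) (L (c s w)))" .
    qed
    then have "L (c 1 w) = c 1 (L w)"
    proof (rule volterra_unique[OF _ c(1)[OF Lw]])
      show "continuous_on {0..1} (\<lambda>s. K (L w) (L (c s w)))" "continuous_on {0..1} (\<lambda>s. K (L w) (c s (L w)))"
        using Kc[OF Lc] Kc[OF cc[OF Lw]] Lin \<Omega>S cS[OF _ Lw] by blast+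
      show "norm (K (L w) (L (c s w)) - K (L w) (c s (L w))) \<le> 1/2 * norm (L (c s w) - c s (L w))" if "s \<in> {0..1}" for s
        by (rule L\<Omega>[OF Lw Lin[OF that] c\<Omega>[OF that Lw]])
    qed simp
    then show ?thesis by (simp add: \<Phi>_def)
  qed
  show ?thesis
  proof (rule that[of \<eta> \<Phi>])
    show "\<Phi> ` ball 0 \<eta> \<subseteq> S" using cS[of 1] by (auto simp: W_def \<Phi>_def)
  qed (use \<eta>(1) smooth c0[of 1] id0 straight equi in \<open>auto simp: W_def b_def \<Phi>_def\<close>)
qed

lemma frechet_derivative_cong_open:
  assumes "open W" "x \<in> W" "\<And>y. y \<in> W \<Longrightarrow> f y = g y" "f differentiable (at x)"
  shows "frechet_derivative g (at x) = frechet_derivative f (at x)"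
proof -
  have "(f has_derivative frechet_derivative f (at x)) (at x)"
    using assms(4) frechet_derivative_works by blast
  then have "(g has_derivative frechet_derivative f (at x)) (at x)"
    by (rule has_derivative_transform_within_open[OF _ assms(1,2)]) (use assms(3) in auto)
  then show ?thesis by (rule frechet_derivative_at[symmetric])
qed

lemma frechet_derivative_compose':
  assumes "f differentiable (at x)" "g differentiable (at (f x))"
  shows "frechet_derivative (\<lambda>x. g (f x)) (at x) v = frechet_derivative g (at (f x)) (frechet_derivative f (at x) v)"
proof -
  have "((\<lambda>x. g (f x)) has_derivative (\<lambda>v. frechet_derivative g (at (f x)) (frechet_derivative f (at x) v))) (at x)"
    using assms by (intro has_derivative_compose[of f _ x UNIV g]) (auto simp: frechet_derivative_works)
  then show ?thesis using frechet_derivative_at by metis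
qed

text \<open>The local inverse of the map from \<open>straightening\<close>. Equivariance passes to
  it because \<open>\<delta>\<close> is chosen so that \<open>\<Psi>\<close> takes values in a ball
  inside \<open>U\<close>: this ball is stable under orthogonal maps, so \<open>L (\<Psi> x)\<close>
  stays where \<open>\<Phi>\<close> is injective.\<close>

lemma rectification:
  fixes Y :: "nat \<Rightarrow> real ^ 'n \<Rightarrow> real ^ 'n"
  assumes S: "open S" "0 \<in> S" and Y: "\<And>i. i < k \<Longrightarrow> smooth_on (Y i) S"
    and comm: "\<And>i j x. i < k \<Longrightarrow> j < k \<Longrightarrow> x \<in> S \<Longrightarrow>
      frechet_derivative (Y i) (at x) (Y j x) = frechet_derivative (Y j) (at x) (Y i x)"
    and inj: "inj_on (\<lambda>i. Y i 0) {..<k}" and ind: "independent ((\<lambda>i. Y i 0) ` {..<k})"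
  obtains \<Psi> \<delta> where "\<delta> > 0" "ball 0 \<delta> \<subseteq> S" "smooth_on \<Psi> (ball 0 \<delta>)" "\<Psi> 0 = 0"
    "\<And>v. frechet_derivative \<Psi> (at 0) v = v"
    "\<And>x j. x \<in> ball 0 \<delta> \<Longrightarrow> j < k \<Longrightarrow> frechet_derivative \<Psi> (at x) (Y j x) = Y j 0"
    "\<And>L x. orthogonal_transformation L \<Longrightarrow> (\<And>i x. i < k \<Longrightarrow> x \<in> S \<Longrightarrow> Y i (L x) = L (Y i x)) \<Longrightarrow>
      x \<in> ball 0 \<delta> \<Longrightarrow> \<Psi> (L x) = L (\<Psi> x)"
proof -
  obtain \<Phi> \<eta> where \<eta>: "\<eta> > 0" and \<Phi>: "smooth_on \<Phi> (ball 0 \<eta>)" "\<Phi> 0 = 0" "\<Phi> ` ball 0 \<eta> \<subseteq> S"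
    and D0: "\<And>v. frechet_derivative \<Phi> (at 0) v = v"
    and DY: "\<And>w j. w \<in> ball 0 \<eta> \<Longrightarrow> j < k \<Longrightarrow> frechet_derivative \<Phi> (at w) (Y j 0) = Y j (\<Phi> w)"
    and equi: "\<And>L w. orthogonal_transformation L \<Longrightarrow> (\<And>i x. i < k \<Longrightarrow> x \<in> S \<Longrightarrow> Y i (L x) = L (Y i x)) \<Longrightarrow>
      w \<in> ball 0 \<eta> \<Longrightarrow> \<Phi> (L w) = L (\<Phi> w)"
    using straightening[OF S Y comm inj ind] by (smt (verit))
  have "0 \<in> ball (0::real ^ 'n) \<eta>" using \<eta> by simp
  then obtain U V \<Psi> where UV: "open U" "U \<subseteq> ball 0 \<eta>" "0 \<in> U" "open V" "homeomorphism U V \<Phi> \<Psi>" "smooth_on \<Psi> V"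
    using smooth_inverse_function[OF open_ball \<Phi>(1), of 0] D0 by (metis (no_types, lifting))
  have \<Psi>\<Phi>: "\<Psi> (\<Phi> w) = w" "\<Phi> w \<in> V" if "w \<in> U" for w using UV(5) that by (auto simp: homeomorphism_def)
  have \<Phi>\<Psi>: "\<Phi> (\<Psi> x) = x" "\<Psi> x \<in> U" if "x \<in> V" for x using UV(5) that by (auto simp: homeomorphism_def)
  have DD: "frechet_derivative \<Psi> (at x) (frechet_derivative \<Phi> (at (\<Psi> x)) v) = v" if x: "x \<in> V" for x v
  proof -
    have w: "\<Psi> x \<in> U" "\<Phi> (\<Psi> x) = x" using \<Phi>\<Psi>[OF x] by auto
    have d: "\<Phi> differentiable (at (\<Psi> x))" "\<Psi> differentiable (at (\<Phi> (\<Psi> x)))"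
      using smooth_on_differentiable[OF \<Phi>(1)] smooth_on_differentiable[OF UV(6)] w x UV(2) by auto
    have "frechet_derivative (\<lambda>w. \<Psi> (\<Phi> w)) (at (\<Psi> x)) = frechet_derivative (\<lambda>w. w) (at (\<Psi> x))"
      by (rule frechet_derivative_cong_open[OF UV(1) w(1)]) (use \<Psi>\<Phi> in auto)
    then show ?thesis using frechet_derivative_compose'[OF d, of v] w(2) by simp
  qed
  obtain \<epsilon> where \<epsilon>: "\<epsilon> > 0" "ball 0 \<epsilon> \<subseteq> U" using UV(1,3) open_contains_ball by blast
  have V0: "0 \<in> V" "\<Psi> 0 = 0" using \<Psi>\<Phi>[OF UV(3)] \<Phi>(2) by auto
  have "continuous_on V \<Psi>" using smooth_on_continuous[OF UV(6)] .
  then have "open (\<Psi> -` ball 0 \<epsilon> \<inter> V)" using UV(4) continuous_on_open_vimage by blast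
  moreover have "0 \<in> \<Psi> -` ball 0 \<epsilon> \<inter> V" using V0 \<epsilon>(1) by simp
  ultimately obtain \<delta> where \<delta>: "\<delta> > 0" "ball 0 \<delta> \<subseteq> \<Psi> -` ball 0 \<epsilon> \<inter> V" using open_contains_ball by blast
  show ?thesis
  proof (rule that[of \<delta> \<Psi>])
    show "ball 0 \<delta> \<subseteq> S"
    proof
      fix x :: "real ^ 'n" assume "x \<in> ball 0 \<delta>"
      then have "x \<in> V" using \<delta>(2) by auto
      then show "x \<in> S" using \<Phi>\<Psi>[of x] UV(2) \<Phi>(3) by (metis image_subset_iff subsetD)
    qed
    show "smooth_on \<Psi> (ball 0 \<delta>)" using smooth_on_subset[OF UV(6)] \<delta>(2) by blast
    show "frechet_derivative \<Psi> (at 0) v = v" for v using DD[OF V0(1), of v] V0(2) D0 by simp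
    show "frechet_derivative \<Psi> (at x) (Y j x) = Y j 0" if "x \<in> ball 0 \<delta>" "j < k" for x j
    proof -
      have x: "x \<in> V" using \<delta>(2) that by auto
      then have "\<Psi> x \<in> ball 0 \<eta>" using \<Phi>\<Psi> UV(2) by blast
      then show ?thesis using DD[OF x, of "Y j 0"] DY[OF _ that(2)] \<Phi>\<Psi>(1)[OF x] by metis
    qed
    fix L :: "real ^ 'n \<Rightarrow> real ^ 'n" and x :: "real ^ 'n"
    assume L: "orthogonal_transformation L" and LY: "\<And>i x. i < k \<Longrightarrow> x \<in> S \<Longrightarrow> Y i (L x) = L (Y i x)" and x: "x \<in> ball 0 \<delta>"
    have n: "norm (L y) = norm y" for y using L by (simp add: orthogonal_transformation_norm)
    have xV: "x \<in> V" "\<Psi> x \<in> ball 0 \<epsilon>" "L x \<in> V" using \<delta>(2) x n by auto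
    have LU: "L (\<Psi> x) \<in> U" using xV(2) \<epsilon>(2) n by auto
    have "\<Psi> x \<in> ball 0 \<eta>" using xV(2) \<epsilon>(2) UV(2) by blast
    from equi[OF L LY this] have "\<Phi> (L (\<Psi> x)) = L (\<Phi> (\<Psi> x))" by blast
    then have "\<Phi> (L (\<Psi> x)) = L x" using \<Phi>\<Psi>(1)[OF xV(1)] by simp
    then show "\<Psi> (L x) = L (\<Psi> x)" using \<Psi>\<Phi>(1)[OF LU] by simp
  qed (use \<delta>(1) V0 in auto)
qed

section \<open>Poisson brackets on open subsets of Euclidean space\<close>

definition grad :: "(real ^ 'n \<Rightarrow> real) \<Rightarrow> real ^ 'n \<Rightarrow> real ^ 'n" where
  "grad f x = (\<chi> k. frechet_derivative f (at x) (axis k 1))"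

definition hvf :: "(real ^ 'n \<Rightarrow> real ^ 'n ^ 'n) \<Rightarrow> (real ^ 'n \<Rightarrow> real) \<Rightarrow> real ^ 'n \<Rightarrow> real ^ 'n" where
  "hvf \<pi> f x = grad f x v* \<pi> x"

definition pbr :: "(real ^ 'n \<Rightarrow> real ^ 'n ^ 'n) \<Rightarrow> (real ^ 'n \<Rightarrow> real) \<Rightarrow> (real ^ 'n \<Rightarrow> real) \<Rightarrow> real ^ 'n \<Rightarrow> real" where
  "pbr \<pi> f h x = frechet_derivative h (at x) (hvf \<pi> f x)"

lemma frechet_derivative_grad:
  fixes f :: "real ^ 'n \<Rightarrow> real"
  assumes "f differentiable (at x)"
  shows "frechet_derivative f (at x) v = grad f x \<bullet> v"
  using linear_axis_expansion[OF linear_frechet_derivative[OF assms], of v]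
  by (simp add: grad_def inner_vec_def mult.commute)

lemma smooth_on_grad: "open W \<Longrightarrow> smooth_on f W \<Longrightarrow> smooth_on (grad f) W"
  by (rule smooth_on_vecI) (simp_all add: grad_def smooth_on_Suc)

lemma smooth_on_hvf:
  assumes W: "open W" and P: "smooth_on \<pi> W" and f: "smooth_on f W"
  shows "smooth_on (hvf \<pi> f) W"
proof (rule smooth_on_vecI[OF W])
  fix l
  have "smooth_on (\<lambda>x. \<Sum>k\<in>UNIV. (\<pi> x $ k) $ l * grad f x $ k) W"
    by (intro smooth_on_sum smooth_on_mult smooth_on_vec_nth W smooth_on_grad P f)
  then show "smooth_on (\<lambda>x. hvf \<pi> f x $ l) W"
    by (simp add: hvf_def vector_matrix_mult_def mult.commute)
qed

lemma pbr_grad: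
  "h differentiable (at x) \<Longrightarrow> pbr \<pi> f h x = grad f x \<bullet> (\<pi> x *v grad h x)"
  unfolding pbr_def hvf_def by (simp add: frechet_derivative_grad dot_lmul_matrix[symmetric] inner_commute)

lemma frechet_derivative_vec_nth: "frechet_derivative (\<lambda>x::real ^ 'n. x $ l) (at x) v = v $ l"
  using frechet_derivative_at[OF linear_imp_has_derivative[of "\<lambda>x::real ^ 'n. x $ l"]]
    bounded_linear_vec_nth[THEN bounded_linear.linear] by metis

lemma frechet_derivative_nth:
  fixes X :: "'a::real_normed_vector \<Rightarrow> real ^ 'n"
  assumes "X differentiable (at x)"
  shows "frechet_derivative (\<lambda>x. X x $ l) (at x) v = frechet_derivative X (at x) v $ l"
proof -
  have "((\<lambda>x. X x $ l) has_derivative (\<lambda>v. frechet_derivative X (at x) v $ l)) (at x)"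
    using assms by (intro bounded_linear.has_derivative[OF bounded_linear_vec_nth]) (simp add: frechet_derivative_works)
  then show ?thesis using frechet_derivative_at by metis
qed

lemma frechet_derivative_locally_const:
  assumes "open W" "x \<in> W" "\<And>y. y \<in> W \<Longrightarrow> f y = c"
  shows "frechet_derivative f (at x) v = 0"
  using frechet_derivative_cong_open[OF assms(1,2), of "\<lambda>_. c" f] assms(3) by simp

text \<open>The Poisson structure read in a linearising chart, with \<open>\<L>\<close> standing for
  the orthogonal maps through which the group acts. The Jacobi identity is stated for functions on
  arbitrary open subsets because the functions constructed below live on ever smaller balls.\<close>

locale invariant_poisson =
  fixes \<pi> :: "real ^ 'n \<Rightarrow> real ^ 'n ^ 'n" and S :: "(real ^ 'n) set" and \<L> :: "(real ^ 'n \<Rightarrow> real ^ 'n) set"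
  assumes S: "open S" and smooth_\<pi>: "smooth_on \<pi> S"
    and skew: "\<And>x. x \<in> S \<Longrightarrow> transpose (\<pi> x) = - \<pi> x"
    and jacobi: "\<And>W f g h x. open W \<Longrightarrow> W \<subseteq> S \<Longrightarrow> smooth_on f W \<Longrightarrow> smooth_on g W \<Longrightarrow> smooth_on h W \<Longrightarrow> x \<in> W \<Longrightarrow>
      pbr \<pi> f (pbr \<pi> g h) x + pbr \<pi> g (pbr \<pi> h f) x + pbr \<pi> h (pbr \<pi> f g) x = 0"
    and orth: "\<And>L. L \<in> \<L> \<Longrightarrow> orthogonal_transformation L"
    and \<pi>_invariant: "\<And>L x. L \<in> \<L> \<Longrightarrow> x \<in> S \<Longrightarrow> \<pi> (L x) = matrix L ** \<pi> x ** transpose (matrix L)"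
begin

lemma pbr_skew:
  assumes "f differentiable (at x)" "h differentiable (at x)" "x \<in> S"
  shows "pbr \<pi> f h x = - pbr \<pi> h f x"
proof -
  have "\<pi> x *v grad h x = grad h x v* transpose (\<pi> x)" by simp
  also have "\<dots> = - (grad h x v* \<pi> x)"
    unfolding skew[OF assms(3)] by (simp add: vector_matrix_mult_def Finite_Cartesian_Product.vec_eq_iff sum_negf)
  finally have "grad f x \<bullet> (\<pi> x *v grad h x) = - (grad f x \<bullet> (grad h x v* \<pi> x))" by simp
  also have "\<dots> = - (grad h x \<bullet> (\<pi> x *v grad f x))"
    by (simp add: dot_lmul_matrix[symmetric] inner_commute)
  finally show ?thesis using assms by (simp add: pbr_grad)
qed

lemma smooth_pbr:
  assumes "open W" "W \<subseteq> S" "smooth_on f W" "smooth_on h W"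
  shows "smooth_on (pbr \<pi> f h) W"
  unfolding pbr_def[abs_def]
  by (intro smooth_on_derivative_apply smooth_on_hvf smooth_on_subset[OF smooth_\<pi>] assms)

text \<open>The Jacobi identity with a coordinate function says that \<open>[X\<^sub>f, X\<^sub>g]\<close> is the Hamiltonian field of \<open>{f, g}\<close>.\<close>

lemma hvf_commute:
  assumes W: "open W" "W \<subseteq> S" and f: "smooth_on f W" and g: "smooth_on g W"
    and c: "\<And>x. x \<in> W \<Longrightarrow> pbr \<pi> f g x = c" and x: "x \<in> W"
  shows "frechet_derivative (hvf \<pi> f) (at x) (hvf \<pi> g x) = frechet_derivative (hvf \<pi> g) (at x) (hvf \<pi> f x)"
proof -
  have PW: "smooth_on \<pi> W" by (rule smooth_on_subset[OF smooth_\<pi> W(2)])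
  have Xf: "smooth_on (hvf \<pi> f) W" and Xg: "smooth_on (hvf \<pi> g) W"
    by (intro smooth_on_hvf W PW f g)+
  have "frechet_derivative (hvf \<pi> f) (at x) (hvf \<pi> g x) $ l = frechet_derivative (hvf \<pi> g) (at x) (hvf \<pi> f x) $ l" for l
  proof -
    let ?e = "\<lambda>x::real ^ 'n. x $ l"
    have e: "smooth_on ?e W" by (rule smooth_on_linear[OF W(1) bounded_linear_vec_nth])
    have ge: "pbr \<pi> g ?e = (\<lambda>x. hvf \<pi> g x $ l)"
      by (rule ext) (simp add: pbr_def frechet_derivative_vec_nth)
    have ef: "pbr \<pi> ?e f y = (-1) *\<^sub>R (hvf \<pi> f y $ l)" if "y \<in> W" for y
      using pbr_skew[of ?e y f] smooth_on_differentiable[OF e that] smooth_on_differentiable[OF f that] that W(2)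
      by (auto simp: pbr_def frechet_derivative_vec_nth)
    have dXf: "hvf \<pi> f differentiable (at x)" and dXg: "hvf \<pi> g differentiable (at x)"
      using smooth_on_differentiable Xf Xg x by blast+
    have t1: "pbr \<pi> f (pbr \<pi> g ?e) x = frechet_derivative (hvf \<pi> g) (at x) (hvf \<pi> f x) $ l"
      unfolding ge by (simp add: pbr_def frechet_derivative_nth[OF dXg])
    have m: "smooth_on (\<lambda>y. (-1) *\<^sub>R (hvf \<pi> f y $ l)) W"
      by (intro smooth_on_scaleR smooth_on_const smooth_on_vec_nth W Xf)
    have "frechet_derivative (pbr \<pi> ?e f) (at x) = frechet_derivative (\<lambda>y. (-1) *\<^sub>R (hvf \<pi> f y $ l)) (at x)"
      by (rule frechet_derivative_cong_open[OF W(1) x _ smooth_on_differentiable[OF m x]]) (simp add: ef)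
    also have "\<dots> = (\<lambda>v. - (frechet_derivative (hvf \<pi> f) (at x) v $ l))"
    proof -
      have "((\<lambda>y. (-1) *\<^sub>R (hvf \<pi> f y $ l)) has_derivative (\<lambda>v. (-1) *\<^sub>R (frechet_derivative (hvf \<pi> f) (at x) v $ l))) (at x)"
        using dXf by (intro has_derivative_scaleR_right bounded_linear.has_derivative[OF bounded_linear_vec_nth])
          (simp add: frechet_derivative_works)
      from frechet_derivative_at[OF this, symmetric] show ?thesis by simp
    qed
    finally have t2: "pbr \<pi> g (pbr \<pi> ?e f) x = - (frechet_derivative (hvf \<pi> f) (at x) (hvf \<pi> g x) $ l)"
      by (simp add: pbr_def)
    have t3: "pbr \<pi> ?e (pbr \<pi> f g) x = 0"
      unfolding pbr_def[of \<pi> ?e] by (rule frechet_derivative_locally_const[OF W(1) x c])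
    show ?thesis using jacobi[OF W f g e x] t1 t2 t3 by simp
  qed
  then show ?thesis by (simp add: Finite_Cartesian_Product.vec_eq_iff)
qed

text \<open>Differentiating \<open>f (L x) = f x\<close> shows that
  \<open>grad f (L x) v* matrix L\<close> equals \<open>grad f x\<close>; the transformation law of
  \<open>\<pi>\<close> supplies the remaining factor \<open>L\<close>.\<close>

lemma hvf_equivariant:
  assumes L: "L \<in> \<L>" and W: "open W" "W \<subseteq> S" "\<And>x. x \<in> W \<Longrightarrow> L x \<in> W" and f: "smooth_on f W"
    and inv: "\<And>x. x \<in> W \<Longrightarrow> f (L x) = f x" and x: "x \<in> W"
  shows "hvf \<pi> f (L x) = L (hvf \<pi> f x)"
proof -
  have lin: "linear L" using orth[OF L] by (simp add: orthogonal_transformation_def)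
  have M: "matrix L *v v = L v" for v using lin by (simp add: matrix_works)
  have dL: "(L has_derivative L) (at x)" using lin by (rule linear_imp_has_derivative)
  have fL: "f differentiable (at (L x))" "f differentiable (at x)" using smooth_on_differentiable[OF f] W(3) x by auto
  have "frechet_derivative (\<lambda>x. f (L x)) (at x) = frechet_derivative f (at x)"
    by (rule frechet_derivative_cong_open[OF W(1) x _ fL(2)]) (use inv in auto)
  then have D: "frechet_derivative f (at (L x)) (L v) = frechet_derivative f (at x) v" for v
    using frechet_derivative_compose'[of L x f v] fL(1) dL frechet_derivative_at[OF dL] by (metis differentiable_def)
  have "(grad f (L x) v* matrix L) $ k = grad f x $ k" for k
  proof -
    have "(grad f (L x) v* matrix L) $ k = (grad f (L x) v* matrix L) \<bullet> axis k 1" by (simp add: inner_axis)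
    also have "\<dots> = grad f (L x) \<bullet> L (axis k 1)" by (simp add: dot_lmul_matrix M)
    also have "\<dots> = frechet_derivative f (at (L x)) (L (axis k 1))" by (simp add: frechet_derivative_grad[OF fL(1)])
    finally show ?thesis by (simp add: D grad_def)
  qed
  then have g: "grad f (L x) v* matrix L = grad f x" by (simp add: Finite_Cartesian_Product.vec_eq_iff)
  have "hvf \<pi> f (L x) = ((grad f (L x) v* matrix L) v* \<pi> x) v* transpose (matrix L)"
  proof -
    have "\<pi> (L x) = matrix L ** \<pi> x ** transpose (matrix L)" using \<pi>_invariant[OF L] x W(2) by blast
    then show ?thesis unfolding hvf_def by (simp only: vector_matrix_mul_assoc)
  qed
  then show ?thesis by (simp add: g hvf_def vector_transpose_matrix M)
qed

end

section \<open>Invariant functions with prescribed constant brackets\<close>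

context invariant_poisson
begin

lemma rectify_hamiltonian:
  fixes f :: "nat \<Rightarrow> real ^ 'n \<Rightarrow> real"
  assumes \<delta>: "\<delta> > 0" "ball 0 \<delta> \<subseteq> S"
    and f: "\<And>i. i < k \<Longrightarrow> smooth_on (f i) (ball 0 \<delta>)"
    and inv: "\<And>i L x. i < k \<Longrightarrow> L \<in> \<L> \<Longrightarrow> x \<in> ball 0 \<delta> \<Longrightarrow> f i (L x) = f i x"
    and br: "\<And>i j x. i < k \<Longrightarrow> j < k \<Longrightarrow> x \<in> ball 0 \<delta> \<Longrightarrow> pbr \<pi> (f i) (f j) x = \<omega> i j"
    and inj: "inj_on (\<lambda>i. hvf \<pi> (f i) 0) {..<k}" and ind: "independent ((\<lambda>i. hvf \<pi> (f i) 0) ` {..<k})"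
  obtains \<Psi> \<delta>' where "\<delta>' > 0" "ball 0 \<delta>' \<subseteq> ball (0::real ^ 'n) \<delta>" "smooth_on \<Psi> (ball 0 \<delta>')" "\<Psi> 0 = 0"
    "\<And>v. frechet_derivative \<Psi> (at 0) v = v"
    "\<And>x j. x \<in> ball 0 \<delta>' \<Longrightarrow> j < k \<Longrightarrow> frechet_derivative \<Psi> (at x) (hvf \<pi> (f j) x) = hvf \<pi> (f j) 0"
    "\<And>L x. L \<in> \<L> \<Longrightarrow> x \<in> ball 0 \<delta>' \<Longrightarrow> \<Psi> (L x) = L (\<Psi> x)"
    "\<And>L i. L \<in> \<L> \<Longrightarrow> i < k \<Longrightarrow> L (hvf \<pi> (f i) 0) = hvf \<pi> (f i) 0"
proof -
  let ?B = "ball (0::real ^ 'n) \<delta>"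
  have B: "open ?B" "0 \<in> ?B" using \<delta> by auto
  have PB: "smooth_on \<pi> ?B" by (rule smooth_on_subset[OF smooth_\<pi> \<delta>(2)])
  have Y: "smooth_on (hvf \<pi> (f i)) ?B" if "i < k" for i
    by (rule smooth_on_hvf[OF B(1) PB f[OF that]])
  have comm: "frechet_derivative (hvf \<pi> (f i)) (at x) (hvf \<pi> (f j) x) =
      frechet_derivative (hvf \<pi> (f j)) (at x) (hvf \<pi> (f i) x)" if "i < k" "j < k" "x \<in> ?B" for i j x
    by (rule hvf_commute[OF B(1) \<delta>(2) f[OF that(1)] f[OF that(2)] br[OF that(1,2)] that(3)])
  have LB: "L x \<in> ?B" if "L \<in> \<L>" "x \<in> ?B" for L x
    using that orth[OF that(1)] by (simp add: orthogonal_transformation_norm)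
  have eqv: "hvf \<pi> (f i) (L x) = L (hvf \<pi> (f i) x)" if "L \<in> \<L>" "i < k" "x \<in> ?B" for L i x
    by (rule hvf_equivariant[OF that(1) B(1) \<delta>(2) LB[OF that(1)] f[OF that(2)] inv[OF that(2,1)] that(3)])
  obtain \<Psi> \<delta>' where R: "\<delta>' > 0" "ball 0 \<delta>' \<subseteq> ?B" "smooth_on \<Psi> (ball 0 \<delta>')" "\<Psi> 0 = 0"
    "\<And>v. frechet_derivative \<Psi> (at 0) v = v"
    "\<And>x j. x \<in> ball 0 \<delta>' \<Longrightarrow> j < k \<Longrightarrow> frechet_derivative \<Psi> (at x) (hvf \<pi> (f j) x) = hvf \<pi> (f j) 0"
    "\<And>L x. orthogonal_transformation L \<Longrightarrow> (\<And>i x. i < k \<Longrightarrow> x \<in> ?B \<Longrightarrow> hvf \<pi> (f i) (L x) = L (hvf \<pi> (f i) x)) \<Longrightarrow>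
      x \<in> ball 0 \<delta>' \<Longrightarrow> \<Psi> (L x) = L (\<Psi> x)"
    by (rule rectification[OF B, where Y="\<lambda>i. hvf \<pi> (f i)" and k=k, OF Y comm inj ind]) blast+
  show ?thesis
  proof (rule that[OF R(1-6)])
    show "\<Psi> (L x) = L (\<Psi> x)" if "L \<in> \<L>" "x \<in> ball 0 \<delta>'" for L x
      by (rule R(7)[OF orth[OF that(1)] eqv[OF that(1)] that(2)])
    show "L (hvf \<pi> (f i) 0) = hvf \<pi> (f i) 0" if "L \<in> \<L>" "i < k" for L i
    proof -
      have "linear L" using orth[OF that(1)] by (simp add: orthogonal_transformation_def)
      then show ?thesis using eqv[OF that B(2)] linear_0 by metis
    qed
  qed
qed

text \<open>\<open>D\<close> is the combination of dual vectors with
  \<open>b i \<bullet> D = a i\<close>. In the rectified coordinates the field of \<open>f i\<close>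
  is constantly \<open>b i\<close>, so \<open>\<Psi> x \<bullet> D\<close> has derivative
  \<open>a i\<close> along it; the function is invariant because \<open>D\<close> lies in a span of
  fixed vectors and each \<open>L\<close> is orthogonal.\<close>

lemma extend_function:
  fixes f :: "nat \<Rightarrow> real ^ 'n \<Rightarrow> real" and a :: "nat \<Rightarrow> real"
  assumes \<delta>: "\<delta> > 0" "ball 0 \<delta> \<subseteq> S"
    and f: "\<And>i. i < k \<Longrightarrow> smooth_on (f i) (ball 0 \<delta>)"
    and inv: "\<And>i L x. i < k \<Longrightarrow> L \<in> \<L> \<Longrightarrow> x \<in> ball 0 \<delta> \<Longrightarrow> f i (L x) = f i x"
    and br: "\<And>i j x. i < k \<Longrightarrow> j < k \<Longrightarrow> x \<in> ball 0 \<delta> \<Longrightarrow> pbr \<pi> (f i) (f j) x = \<omega> i j"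
    and inj: "inj_on (\<lambda>i. hvf \<pi> (f i) 0) {..<k}" and ind: "independent ((\<lambda>i. hvf \<pi> (f i) 0) ` {..<k})"
  obtains h \<delta>' where "\<delta>' > 0" "ball 0 \<delta>' \<subseteq> ball (0::real ^ 'n) \<delta>" "smooth_on h (ball 0 \<delta>')" "h 0 = 0"
    "\<And>L x. L \<in> \<L> \<Longrightarrow> x \<in> ball 0 \<delta>' \<Longrightarrow> h (L x) = h x"
    "\<And>x i. x \<in> ball 0 \<delta>' \<Longrightarrow> i < k \<Longrightarrow> pbr \<pi> (f i) h x = a i"
proof -
  obtain \<Psi> \<delta>' where R: "\<delta>' > 0" "ball 0 \<delta>' \<subseteq> ball (0::real ^ 'n) \<delta>" "smooth_on \<Psi> (ball 0 \<delta>')" "\<Psi> 0 = 0"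
    "\<And>v. frechet_derivative \<Psi> (at 0) v = v"
    "\<And>x j. x \<in> ball 0 \<delta>' \<Longrightarrow> j < k \<Longrightarrow> frechet_derivative \<Psi> (at x) (hvf \<pi> (f j) x) = hvf \<pi> (f j) 0"
    "\<And>L x. L \<in> \<L> \<Longrightarrow> x \<in> ball 0 \<delta>' \<Longrightarrow> \<Psi> (L x) = L (\<Psi> x)"
    "\<And>L i. L \<in> \<L> \<Longrightarrow> i < k \<Longrightarrow> L (hvf \<pi> (f i) 0) = hvf \<pi> (f i) 0"
    by (rule rectify_hamiltonian[where f=f and k=k and \<omega>=\<omega>, OF \<delta> f _ br inj ind]) (use inv in blast)+
  define b where "b i = hvf \<pi> (f i) 0" for i
  obtain d where d: "\<And>i. i < k \<Longrightarrow> d i \<in> span (b ` {..<k})"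
    "\<And>i j. i < k \<Longrightarrow> j < k \<Longrightarrow> b j \<bullet> d i = (if i = j then 1 else 0)"
    using dual_family[of b k] inj ind unfolding b_def by blast
  define D where "D = (\<Sum>i<k. a i *\<^sub>R d i)"
  define h where "h x = \<Psi> x \<bullet> D" for x
  have bD: "b j \<bullet> D = a j" if "j < k" for j
  proof -
    have "b j \<bullet> D = (\<Sum>i<k. if i = j then a i else 0)"
      unfolding D_def inner_sum_right by (intro sum.cong) (auto simp: d(2) that)
    then show ?thesis using that by simp
  qed
  have Dspan: "D \<in> span (b ` {..<k})"
    unfolding D_def by (intro span_sum span_scale d(1)) auto
  show ?thesis
  proof (rule that[OF R(1,2)])
    show "smooth_on h (ball 0 \<delta>')"
      unfolding h_def[abs_def] by (rule smooth_on_inner_const[OF open_ball R(3)])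
    show "h 0 = 0" by (simp add: h_def R(4))
    show "h (L x) = h x" if L: "L \<in> \<L>" and x: "x \<in> ball 0 \<delta>'" for L x
    proof -
      have o: "linear L" "\<And>x y. L x \<bullet> L y = x \<bullet> y" using orth[OF L] by (auto simp: orthogonal_transformation_def)
      have "L D = D"
      proof (rule linear_eq_on[OF o(1) linear_ident Dspan])
        show "L x = x" if "x \<in> b ` {..<k}" for x using that R(8)[OF L] by (auto simp: b_def)
      qed
      then show ?thesis using R(7)[OF L x] o(2)[of "\<Psi> x" D] by (simp add: h_def)
    qed
    show "pbr \<pi> (f i) h x = a i" if x: "x \<in> ball 0 \<delta>'" and i: "i < k" for x i
    proof -
      have "(h has_derivative (\<lambda>v. frechet_derivative \<Psi> (at x) v \<bullet> D)) (at x)"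
        unfolding h_def[abs_def] by (intro bounded_linear.has_derivative[OF bounded_linear_inner_left] smooth_on_has_derivative[OF R(3) x])
      from frechet_derivative_at[OF this, symmetric] show ?thesis
        using R(6)[OF x i] bD[OF i] by (simp add: pbr_def b_def)
    qed
  qed
qed

text \<open>Index \<open>i < r\<close> stands for \<open>p_i\<close> and \<open>r + i\<close> for
  \<open>q_i\<close>; the value 1 at \<open>(r + i, i)\<close> is the bracket of \<open>q_i\<close>
  with \<open>p_i\<close>.\<close>

definition symplectic_const :: "nat \<Rightarrow> nat \<Rightarrow> nat \<Rightarrow> real" where
  "symplectic_const r i j = (if i = j + r then 1 else if j = i + r then -1 else 0)"

text \<open>The induction invariant of \<open>conjugate_functions\<close>: all \<open>p_i\<close>
  and the \<open>q_i\<close> found so far, on one ball. Independence of the fields at 0 is carried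
  along because the next application of \<open>extend_function\<close> relies on it.\<close>

definition canonical_family :: "nat \<Rightarrow> nat \<Rightarrow> (nat \<Rightarrow> real ^ 'n \<Rightarrow> real) \<Rightarrow> real \<Rightarrow> bool" where
  "canonical_family r k F \<delta> \<longleftrightarrow> \<delta> > 0 \<and>
    (\<forall>i<k. smooth_on (F i) (ball 0 \<delta>) \<and> F i 0 = 0 \<and> (\<forall>L\<in>\<L>. \<forall>x\<in>ball 0 \<delta>. F i (L x) = F i x)) \<and>
    (\<forall>i<k. \<forall>j<k. \<forall>x\<in>ball 0 \<delta>. pbr \<pi> (F i) (F j) x = symplectic_const r i j) \<and>
    inj_on (\<lambda>i. hvf \<pi> (F i) 0) {..<k} \<and> independent ((\<lambda>i. hvf \<pi> (F i) 0) ` {..<k})"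

lemma conjugate_functions:
  fixes p :: "nat \<Rightarrow> real ^ 'n \<Rightarrow> real"
  assumes \<delta>: "\<delta> > 0" "ball 0 \<delta> \<subseteq> S"
    and p: "\<And>i. i < r \<Longrightarrow> smooth_on (p i) (ball 0 \<delta>)" "\<And>i. i < r \<Longrightarrow> p i 0 = 0"
    and inv: "\<And>i L x. i < r \<Longrightarrow> L \<in> \<L> \<Longrightarrow> x \<in> ball 0 \<delta> \<Longrightarrow> p i (L x) = p i x"
    and br: "\<And>i j x. i < r \<Longrightarrow> j < r \<Longrightarrow> x \<in> ball 0 \<delta> \<Longrightarrow> pbr \<pi> (p i) (p j) x = 0"
    and inj: "inj_on (\<lambda>i. hvf \<pi> (p i) 0) {..<r}" and ind: "independent ((\<lambda>i. hvf \<pi> (p i) 0) ` {..<r})"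
    and l: "l \<le> r"
  shows "\<exists>F \<delta>'. ball (0::real ^ 'n) \<delta>' \<subseteq> ball 0 \<delta> \<and> (\<forall>i<r. F i = p i) \<and> canonical_family r (r + l) F \<delta>'"
  using l
proof (induction l)
  case 0
  have "pbr \<pi> (p i) (p j) x = symplectic_const r i j" if "i < r" "j < r" "x \<in> ball 0 \<delta>" for i j x
    using br[OF that] that by (simp add: symplectic_const_def)
  then show ?case using \<delta> p inv inj ind by (intro exI[of _ p] exI[of _ \<delta>]) (simp add: canonical_family_def)
next
  case (Suc l)
  then obtain F \<delta>1 where F0: "ball (0::real ^ 'n) \<delta>1 \<subseteq> ball 0 \<delta>" "\<forall>i<r. F i = p i" "canonical_family r (r + l) F \<delta>1"
    by (meson Suc_leD)
  have F: "\<delta>1 > 0" "ball (0::real ^ 'n) \<delta>1 \<subseteq> ball 0 \<delta>" "\<And>i. i < r \<Longrightarrow> F i = p i"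
    "\<And>i. i < r + l \<Longrightarrow> smooth_on (F i) (ball 0 \<delta>1)" "\<And>i. i < r + l \<Longrightarrow> F i 0 = 0"
    "\<And>i L x. i < r + l \<Longrightarrow> L \<in> \<L> \<Longrightarrow> x \<in> ball 0 \<delta>1 \<Longrightarrow> F i (L x) = F i x"
    "\<And>i j x. i < r + l \<Longrightarrow> j < r + l \<Longrightarrow> x \<in> ball 0 \<delta>1 \<Longrightarrow> pbr \<pi> (F i) (F j) x = symplectic_const r i j"
    "inj_on (\<lambda>i. hvf \<pi> (F i) 0) {..<r + l}" "independent ((\<lambda>i. hvf \<pi> (F i) 0) ` {..<r + l})"
    using F0 unfolding canonical_family_def by blast+
  have lr: "l < r" using Suc.prems by simp
  have sub1: "ball (0::real ^ 'n) \<delta>1 \<subseteq> S" using F(2) \<delta>(2) by blast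
  obtain h \<delta>2 where h: "\<delta>2 > 0" "ball 0 \<delta>2 \<subseteq> ball (0::real ^ 'n) \<delta>1" "smooth_on h (ball 0 \<delta>2)" "h 0 = 0"
    "\<And>L x. L \<in> \<L> \<Longrightarrow> x \<in> ball 0 \<delta>2 \<Longrightarrow> h (L x) = h x"
    "\<And>x i. x \<in> ball 0 \<delta>2 \<Longrightarrow> i < r + l \<Longrightarrow> pbr \<pi> (F i) h x = symplectic_const r i (r + l)"
    by (rule extend_function[where f=F and k="r + l" and \<omega>="symplectic_const r" and a="\<lambda>i. symplectic_const r i (r + l)",
          OF F(1) sub1 F(4) _ F(7) F(8,9)]) (use F(6) in blast)+
  have sub2: "ball (0::real ^ 'n) \<delta>2 \<subseteq> S" using h(2) sub1 by blast
  have dh: "h differentiable (at x)" and dF: "i < r + l \<Longrightarrow> F i differentiable (at x)" if "x \<in> ball 0 \<delta>2" for x i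
    using smooth_on_differentiable[OF h(3) that] smooth_on_differentiable[OF F(4)] that h(2) by blast+
  define F' where "F' = F(r + l := h)"
  have F'F: "F' i = F i" if "i < r + l" for i using that by (simp add: F'_def)
  have F'h: "F' (r + l) = h" by (simp add: F'_def)
  have hF: "pbr \<pi> h (F i) x = symplectic_const r (r + l) i" if "x \<in> ball 0 \<delta>2" "i < r + l" for x i
    using pbr_skew[OF dh[OF that(1)] dF[OF that]] h(6)[OF that] that(1) sub2 lr by (auto simp: symplectic_const_def)
  have hh: "pbr \<pi> h h x = 0" if "x \<in> ball 0 \<delta>2" for x
    using pbr_skew[OF dh[OF that] dh[OF that]] that sub2 by auto
  have x0: "0 \<in> ball (0::real ^ 'n) \<delta>2" using h(1) by simp
  have cases: "i < r + l \<or> i = r + l" if "i < r + Suc l" for i using that by auto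
  have br': "pbr \<pi> (F' i) (F' j) x = symplectic_const r i j"
    if ij: "i < r + Suc l" "j < r + Suc l" and x: "x \<in> ball 0 \<delta>2" for i j x
  proof -
    have x1: "x \<in> ball 0 \<delta>1" using x h(2) by blast
    have "symplectic_const r (r + l) (r + l) = 0" using lr by (simp add: symplectic_const_def)
    then show ?thesis
      using cases[OF ij(1)] cases[OF ij(2)] F(7)[OF _ _ x1] h(6)[OF x] hF[OF x] hh[OF x]
      by (auto simp: F'F F'h)
  qed
  let ?b = "\<lambda>i. hvf \<pi> (F' i) 0"
  \<comment> \<open>The differential of \<open>F l\<close> vanishes on all earlier fields but not on
    the new one, since among the indices up to \<open>r + l\<close> only \<open>r + l\<close> is
    conjugate to \<open>l\<close>.\<close>
  have notin: "?b (r + l) \<notin> span (?b ` {..<r + l})"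
  proof
    assume a: "?b (r + l) \<in> span (?b ` {..<r + l})"
    have lin: "linear (frechet_derivative (F l) (at 0))"
      using dF[OF x0, of l] lr by (simp add: linear_frechet_derivative)
    have "frechet_derivative (F l) (at 0) (?b (r + l)) = 0"
    proof (rule linear_eq_0_on_span[OF lin _ a])
      fix x assume "x \<in> ?b ` {..<r + l}"
      then obtain i where i: "i < r + l" "x = hvf \<pi> (F i) 0" by (auto simp: F'F)
      have "0 \<in> ball (0::real ^ 'n) \<delta>1" using F(1) by simp
      then show "frechet_derivative (F l) (at 0) x = 0"
        using F(7)[OF i(1), of l 0] i lr by (simp add: pbr_def symplectic_const_def)
    qed
    then show False using hF[OF x0, of l] lr by (simp add: F'h pbr_def symplectic_const_def)
  qed
  have set: "{..<r + Suc l} = insert (r + l) {..<r + l}" by auto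
  have eq: "?b ` {..<r + l} = (\<lambda>i. hvf \<pi> (F i) 0) ` {..<r + l}" by (auto simp: F'F)
  have "inj_on ?b {..<r + l}" using F(8) by (auto simp: inj_on_def F'F)
  moreover have "?b (r + l) \<notin> ?b ` {..<r + l}" by (rule contrapos_nn[OF notin]) (rule span_base)
  ultimately have inj': "inj_on ?b {..<r + Suc l}" unfolding set by (auto simp: inj_on_insert)
  have ind': "independent (?b ` {..<r + Suc l})"
    unfolding set image_insert using notin F(9) eq by (simp add: independent_insert)
  have sm': "smooth_on (F' i) (ball 0 \<delta>2) \<and> F' i 0 = 0 \<and> (\<forall>L\<in>\<L>. \<forall>x\<in>ball 0 \<delta>2. F' i (L x) = F' i x)"
    if i: "i < r + Suc l" for i
  proof (cases "i < r + l")
    case True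
    show ?thesis unfolding F'F[OF True]
      using smooth_on_subset[OF F(4)[OF True] h(2)] F(5)[OF True] F(6)[OF True] h(2) by blast
  next
    case False
    then have "i = r + l" using i by simp
    then show ?thesis using h(3,4,5) by (simp only: F'h) blast
  qed
  have "\<forall>i<r. F' i = p i" using F(3) by (simp add: F'_def)
  moreover have "ball (0::real ^ 'n) \<delta>2 \<subseteq> ball 0 \<delta>" using h(2) F(2) by blast
  moreover have "canonical_family r (r + Suc l) F' \<delta>2"
    unfolding canonical_family_def using h(1) sm' br' inj' ind' by blast
  ultimately show ?case by blast
qed

end

section \<open>Orthonormal complements and the transverse coordinates\<close>

lemma constant_along_null_direction:
  fixes f :: "'a::real_normed_vector \<Rightarrow> real"
  assumes B: "convex B" and d: "\<And>y. y \<in> B \<Longrightarrow> (f has_derivative f' y) (at y)"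
    and n: "\<And>y. y \<in> B \<Longrightarrow> f' y v = 0" and y: "y \<in> B" "y + v \<in> B"
  shows "f (y + v) = f y"
proof -
  have seg: "y + t *\<^sub>R v \<in> B" if "t \<in> {0..1}" for t
  proof -
    have "(1 - t) *\<^sub>R y + t *\<^sub>R (y + v) \<in> B" using that by (intro convexD_alt[OF B y]) auto
    then show ?thesis by (simp add: algebra_simps)
  qed
  have "((\<lambda>t. f (y + t *\<^sub>R v)) has_derivative (\<lambda>h. 0)) (at t within {0..1})" if t: "t \<in> {0..1}" for t
  proof -
    have lin: "linear (f' (y + t *\<^sub>R v))" using d[OF seg[OF t]] has_derivative_linear by blast
    from d[OF seg[OF t]] have "((\<lambda>t. f (y + t *\<^sub>R v)) has_derivative (\<lambda>h. f' (y + t *\<^sub>R v) (h *\<^sub>R v))) (at t)"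
      by (rule has_derivative_compose[rotated]) (auto intro!: derivative_eq_intros)
    then show ?thesis using n[OF seg[OF t]] by (simp add: linear_scale[OF lin] has_derivative_at_withinI)
  qed
  then obtain c where c: "\<And>t. t \<in> {0..1} \<Longrightarrow> f (y + t *\<^sub>R v) = c"
    using has_derivative_zero_constant[of "{0..1::real}" "\<lambda>t. f (y + t *\<^sub>R v)"] by auto
  show ?thesis using c[of 0] c[of 1] by simp
qed

lemma orthonormal_complement:
  fixes b :: "nat \<Rightarrow> real ^ 'n"
  assumes n: "CARD('n) = k + s" and inj: "inj_on b {..<k}" and ind: "independent (b ` {..<k})"
  obtains v :: "nat \<Rightarrow> real ^ 'n" where
    "\<And>i j. i < s \<Longrightarrow> j < s \<Longrightarrow> v i \<bullet> v j = (if i = j then 1 else 0)"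
    "\<And>i j. i < s \<Longrightarrow> j < k \<Longrightarrow> v i \<bullet> b j = 0"
    "\<And>x. \<exists>f\<in>span (b ` {..<k}). x = (\<Sum>i<s. (v i \<bullet> x) *\<^sub>R v i) + f"
proof -
  define E where "E = {y. \<forall>x\<in>span (b ` {..<k}). real_inner_class.orthogonal x y}"
  have "subspace E" unfolding E_def by (rule subspace_orthogonal_to_vectors)
  have dimb: "dim (span (b ` {..<k})) = k"
    using dim_eq_card_independent[OF ind] card_image[OF inj] by simp
  have dimE: "dim E = s"
    using dim_subspace_orthogonal_to_vectors[OF subspace_span subspace_UNIV subset_UNIV, of "b ` {..<k}"] dimb n
    by (simp add: E_def)
  obtain B where B: "B \<subseteq> E" "pairwise real_inner_class.orthogonal B" "\<And>x. x \<in> B \<Longrightarrow> norm x = 1"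
    "independent B" "card B = dim E" "span B = E"
    using orthonormal_basis_subspace[OF \<open>subspace E\<close>] by metis
  have "finite B" using B(4) independent_imp_finite by blast
  then obtain v where v: "bij_betw v {..<s} B"
    using ex_bij_betw_nat_finite[of B] B(5) dimE by (auto simp: atLeast0LessThan)
  have vB: "v i \<in> B" if "i < s" for i using v that by (auto simp: bij_betw_def)
  have on: "v i \<bullet> v j = (if i = j then 1 else 0)" if "i < s" "j < s" for i j
  proof (cases "i = j")
    case True
    then show ?thesis using B(3)[OF vB[OF that(1)]] by (simp add: norm_eq_1)
  next
    case False
    then have "v i \<noteq> v j" using v that by (auto simp: bij_betw_def inj_on_def)
    then show ?thesis using B(2) vB[OF that(1)] vB[OF that(2)] False
      by (auto simp: pairwise_def real_inner_class.orthogonal_def)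
  qed
  have vb: "v i \<bullet> x = 0" if "i < s" "x \<in> span (b ` {..<k})" for i x
    using vB[OF that(1)] B(1) that(2) by (auto simp: E_def real_inner_class.orthogonal_def inner_commute)
  have "\<exists>f\<in>span (b ` {..<k}). x = (\<Sum>i<s. (v i \<bullet> x) *\<^sub>R v i) + f" for x
  proof -
    obtain y z where yz: "y \<in> span (b ` {..<k})" "\<And>w. w \<in> span (b ` {..<k}) \<Longrightarrow> real_inner_class.orthogonal z w" "x = y + z"
      using orthogonal_subspace_decomp_exists[of "b ` {..<k}" x] by metis
    have "z \<in> E" using yz(2) by (auto simp: E_def real_inner_class.orthogonal_def inner_commute)
    then have "z \<in> span (v ` {..<s})" using B(6) v by (simp add: bij_betw_def)
    then obtain c where c: "z = (\<Sum>i<s. c i *\<^sub>R v i)"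
    proof -
      have "\<exists>c. z = (\<Sum>x\<in>v ` {..<s}. c x *\<^sub>R x)"
        using \<open>z \<in> span (v ` {..<s})\<close> span_finite[of "v ` {..<s}"] by auto
      then obtain c where "z = (\<Sum>x\<in>v ` {..<s}. c x *\<^sub>R x)" by blast
      also have "\<dots> = (\<Sum>i<s. c (v i) *\<^sub>R v i)"
        using v by (subst sum.reindex) (auto simp: bij_betw_def)
      finally show ?thesis by (rule that)
    qed
    have "v j \<bullet> x = c j" if j: "j < s" for j
    proof -
      have "v j \<bullet> z = (\<Sum>i<s. if i = j then c i else 0)"
        unfolding c inner_sum_right by (intro sum.cong refl) (simp add: on[OF j])
      then show ?thesis using yz(3) vb[OF j yz(1)] j by (simp add: inner_add_right)
    qed
    then have "(\<Sum>i<s. (v i \<bullet> x) *\<^sub>R v i) = z" unfolding c by (intro sum.cong) auto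
    then show ?thesis using yz by (intro bexI[of _ y]) auto
  qed
  note dec = this
  show ?thesis
  proof (rule that[OF on _ dec])
    show "v i \<bullet> b j = 0" if "i < s" "j < k" for i j
      by (rule vb[OF that(1) span_base]) (use that in auto)
  qed
qed

lemma coords_finite_card: "finite (coords r s)" "card (coords r s) = 2 * r + s"
proof -
  show "finite (coords r s)" by (simp add: coords_def)
  have "card (coords r s) = card (P ` {..<r} \<union> Q ` {..<r}) + card (Z ` {..<s})"
    unfolding coords_def by (rule card_Un_disjoint) auto
  also have "card (P ` {..<r} \<union> Q ` {..<r}) = card (P ` {..<r}) + card (Q ` {..<r})"
    by (rule card_Un_disjoint) auto
  finally show "card (coords r s) = 2 * r + s"
    by (simp add: card_image inj_on_def)
qed

lemma sum_coords:
  fixes f :: "coord \<Rightarrow> 'a::comm_monoid_add"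
  shows "(\<Sum>a\<in>coords r s. f a) = (\<Sum>i<r. f (P i)) + (\<Sum>i<r. f (Q i)) + (\<Sum>j<s. f (Z j))"
proof -
  have "(\<Sum>a\<in>coords r s. f a) = (\<Sum>a\<in>P ` {..<r} \<union> Q ` {..<r}. f a) + (\<Sum>a\<in>Z ` {..<s}. f a)"
    unfolding coords_def by (rule sum.union_disjoint) auto
  also have "(\<Sum>a\<in>P ` {..<r} \<union> Q ` {..<r}. f a) = (\<Sum>a\<in>P ` {..<r}. f a) + (\<Sum>a\<in>Q ` {..<r}. f a)"
    by (rule sum.union_disjoint) auto
  finally show ?thesis by (simp add: sum.reindex inj_on_def)
qed

primrec coord_fun :: "nat \<Rightarrow> (nat \<Rightarrow> 'm \<Rightarrow> real) \<Rightarrow> (nat \<Rightarrow> 'm \<Rightarrow> real) \<Rightarrow> coord \<Rightarrow> 'm \<Rightarrow> real" where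
  "coord_fun r F z (P i) = F i"
| "coord_fun r F z (Q i) = F (r + i)"
| "coord_fun r F z (Z j) = z j"

context invariant_poisson
begin

text \<open>
  \<open>F\<close> collects \<open>p\<^sub>0, \<dots>, p\<^sub>r\<^sub>-\<^sub>1, q\<^sub>0, \<dots>, q\<^sub>r\<^sub>-\<^sub>1\<close>. The \<open>z\<^sub>j\<close> are orthonormal linear functions of the rectifying
  coordinates, constant along all \<open>X\<^sub>F\<close>; in particular they are acted on linearly.
\<close>

lemma transverse_coordinates:
  assumes n: "CARD('n) = 2 * r + s" and F: "canonical_family r (r + r) F \<delta>" and \<delta>S: "ball 0 \<delta> \<subseteq> S"
  obtains \<delta>' and v :: "nat \<Rightarrow> real ^ 'n" and z :: "nat \<Rightarrow> real ^ 'n \<Rightarrow> real"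
  where "\<delta>' > 0" "ball 0 \<delta>' \<subseteq> ball (0::real ^ 'n) \<delta>"
    "\<And>j. j < s \<Longrightarrow> smooth_on (z j) (ball 0 \<delta>')" "\<And>j. j < s \<Longrightarrow> z j 0 = 0"
    "\<And>i j x. i < r + r \<Longrightarrow> j < s \<Longrightarrow> x \<in> ball 0 \<delta>' \<Longrightarrow> pbr \<pi> (F i) (z j) x = 0"
    "\<And>w. (\<And>i. i < r + r \<Longrightarrow> frechet_derivative (F i) (at 0) w = 0) \<Longrightarrow>
       (\<And>j. j < s \<Longrightarrow> frechet_derivative (z j) (at 0) w = 0) \<Longrightarrow> w = 0"
    "\<And>L x j. L \<in> \<L> \<Longrightarrow> x \<in> ball 0 \<delta>' \<Longrightarrow> j < s \<Longrightarrow> z j (L x) = (\<Sum>i<s. (v j \<bullet> L (v i)) * z i x)"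
    "\<And>L x. L \<in> \<L> \<Longrightarrow> x \<in> ball 0 \<delta>' \<Longrightarrow> (\<Sum>j<s. (z j (L x))\<^sup>2) = (\<Sum>j<s. (z j x)\<^sup>2)"
    "\<And>L i. L \<in> \<L> \<Longrightarrow> i < s \<Longrightarrow> L (v i) = (\<Sum>l<s. (v l \<bullet> L (v i)) *\<^sub>R v l)"
    "\<And>i j. i < s \<Longrightarrow> j < s \<Longrightarrow> v i \<bullet> v j = (if i = j then 1 else 0)"
proof -
  have F': "\<delta> > 0" "\<And>i. i < r + r \<Longrightarrow> smooth_on (F i) (ball 0 \<delta>)"
    "\<And>i L x. i < r + r \<Longrightarrow> L \<in> \<L> \<Longrightarrow> x \<in> ball 0 \<delta> \<Longrightarrow> F i (L x) = F i x"
    "\<And>i j x. i < r + r \<Longrightarrow> j < r + r \<Longrightarrow> x \<in> ball 0 \<delta> \<Longrightarrow> pbr \<pi> (F i) (F j) x = symplectic_const r i j"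
    "inj_on (\<lambda>i. hvf \<pi> (F i) 0) {..<r + r}" "independent ((\<lambda>i. hvf \<pi> (F i) 0) ` {..<r + r})"
    using F unfolding canonical_family_def by blast+
  obtain \<Psi> \<delta>' where R: "\<delta>' > 0" "ball 0 \<delta>' \<subseteq> ball (0::real ^ 'n) \<delta>" "smooth_on \<Psi> (ball 0 \<delta>')" "\<Psi> 0 = 0"
    "\<And>v. frechet_derivative \<Psi> (at 0) v = v"
    "\<And>x j. x \<in> ball 0 \<delta>' \<Longrightarrow> j < r + r \<Longrightarrow> frechet_derivative \<Psi> (at x) (hvf \<pi> (F j) x) = hvf \<pi> (F j) 0"
    "\<And>L x. L \<in> \<L> \<Longrightarrow> x \<in> ball 0 \<delta>' \<Longrightarrow> \<Psi> (L x) = L (\<Psi> x)"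
    "\<And>L i. L \<in> \<L> \<Longrightarrow> i < r + r \<Longrightarrow> L (hvf \<pi> (F i) 0) = hvf \<pi> (F i) 0"
    by (rule rectify_hamiltonian[where f=F and k="r + r" and \<omega>="symplectic_const r", OF F'(1) \<delta>S F'(2) _ F'(4-6)])
       (use F'(3) in blast)+
  define b where "b i = hvf \<pi> (F i) 0" for i
  have n': "CARD('n) = (r + r) + s" using n by simp
  have injb: "inj_on b {..<r + r}" and indb: "independent (b ` {..<r + r})"
    using F'(5,6) by (simp_all add: b_def[abs_def])
  obtain v :: "nat \<Rightarrow> real ^ 'n" where v: "\<And>i j. i < s \<Longrightarrow> j < s \<Longrightarrow> v i \<bullet> v j = (if i = j then 1 else 0)"
    "\<And>i j. i < s \<Longrightarrow> j < r + r \<Longrightarrow> v i \<bullet> b j = 0"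
    "\<And>x. \<exists>f\<in>span (b ` {..<r + r}). x = (\<Sum>i<s. (v i \<bullet> x) *\<^sub>R v i) + f"
    by (rule orthonormal_complement[OF n' injb indb]) blast
  have vspan: "v i \<bullet> f = 0" if "i < s" "f \<in> span (b ` {..<r + r})" for i f
  proof -
    have "linear (\<lambda>f. v i \<bullet> f)" by (simp add: bounded_linear.linear bounded_linear_inner_right)
    then show ?thesis by (rule linear_eq_0_on_span[OF _ _ that(2)]) (use v(2) that(1) in auto)
  qed
  define z where "z j x = \<Psi> x \<bullet> v j" for j x
  have dz: "frechet_derivative (z j) (at x) w = frechet_derivative \<Psi> (at x) w \<bullet> v j" if "x \<in> ball 0 \<delta>'" for j x w
  proof -
    have "(z j has_derivative (\<lambda>w. frechet_derivative \<Psi> (at x) w \<bullet> v j)) (at x)"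
      unfolding z_def[abs_def] by (intro bounded_linear.has_derivative[OF bounded_linear_inner_left] smooth_on_has_derivative[OF R(3) that])
    from frechet_derivative_at[OF this, symmetric] show ?thesis by simp
  qed
  have x0: "0 \<in> ball (0::real ^ 'n) \<delta>'" "0 \<in> ball (0::real ^ 'n) \<delta>" using R(1) F'(1) by auto
  have Lf: "linear L" "\<And>x y. L x \<bullet> L y = x \<bullet> y" if "L \<in> \<L>" for L :: "real ^ 'n \<Rightarrow> real ^ 'n"
    using orth[OF that] by (auto simp: orthogonal_transformation_def)
  have Lspan: "L f = f" if "L \<in> \<L>" "f \<in> span (b ` {..<r + r})" for L f
  proof (rule linear_eq_on[OF Lf(1)[OF that(1)] linear_ident that(2)])
    show "L x = x" if "x \<in> b ` {..<r + r}" for x using that R(8)[OF \<open>L \<in> \<L>\<close>] by (auto simp: b_def)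
  qed
  \<comment> \<open>The component \<open>f\<close> of \<open>L (v i)\<close> in the span of the
    fixed vectors vanishes: its inner product with \<open>L (v i)\<close> equals that of
    \<open>v i\<close> with \<open>f\<close>, because \<open>L\<close> is orthogonal and fixes
    \<open>f\<close>.\<close>
  have Lv: "L (v i) = (\<Sum>l<s. (v l \<bullet> L (v i)) *\<^sub>R v l)" if L: "L \<in> \<L>" and i: "i < s" for L i
  proof -
    obtain f where f: "f \<in> span (b ` {..<r + r})" "L (v i) = (\<Sum>l<s. (v l \<bullet> L (v i)) *\<^sub>R v l) + f" using v(3) by blast
    have "L (v i) \<bullet> f = 0" using Lf(2)[OF L, of "v i" f] Lspan[OF L f(1)] vspan[OF i f(1)] by simp
    moreover have "(\<Sum>l<s. (v l \<bullet> L (v i)) *\<^sub>R v l) \<bullet> f = 0"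
      unfolding inner_sum_left by (intro sum.neutral) (simp add: vspan[OF _ f(1)])
    moreover have "L (v i) \<bullet> f = (\<Sum>l<s. (v l \<bullet> L (v i)) *\<^sub>R v l) \<bullet> f + f \<bullet> f"
      by (subst f(2)) (rule inner_add_left)
    ultimately have "f \<bullet> f = 0" by simp
    then show ?thesis using f(2) by simp
  qed
  have zv: "z j x = v j \<bullet> \<Psi> x" for j x by (simp add: z_def inner_commute)
  have zL: "z j (L x) = (\<Sum>i<s. (v j \<bullet> L (v i)) * z i x)" if L: "L \<in> \<L>" and x: "x \<in> ball 0 \<delta>'" and j: "j < s" for L x j
  proof -
    obtain f where f: "f \<in> span (b ` {..<r + r})" "\<Psi> x = (\<Sum>i<s. (v i \<bullet> \<Psi> x) *\<^sub>R v i) + f" using v(3) by blast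
    have "L (\<Psi> x) = L ((\<Sum>i<s. (v i \<bullet> \<Psi> x) *\<^sub>R v i) + f)" using f(2) by simp
    also have "\<dots> = (\<Sum>i<s. (v i \<bullet> \<Psi> x) *\<^sub>R L (v i)) + f"
      by (simp add: linear_add[OF Lf(1)[OF L]] linear_sum[OF Lf(1)[OF L]] linear_scale[OF Lf(1)[OF L]] Lspan[OF L f(1)])
    finally show ?thesis
      unfolding zv R(7)[OF L x] by (simp add: inner_add_right inner_sum_right vspan[OF j f(1)] mult.commute)
  qed
  show ?thesis
  proof (rule that[of \<delta>' z v, OF R(1,2)])
    show "z j (L x) = (\<Sum>i<s. (v j \<bullet> L (v i)) * z i x)" if "L \<in> \<L>" "x \<in> ball 0 \<delta>'" "j < s" for L x j
      by (rule zL[OF that])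
    show "L (v i) = (\<Sum>l<s. (v l \<bullet> L (v i)) *\<^sub>R v l)" if "L \<in> \<L>" "i < s" for L i
      by (rule Lv[OF that])
    show "v i \<bullet> v j = (if i = j then 1 else 0)" if "i < s" "j < s" for i j
      by (rule v(1)[OF that])
    show "smooth_on (z j) (ball 0 \<delta>')" for j
      unfolding z_def[abs_def] by (rule smooth_on_inner_const[OF open_ball R(3)])
    show "z j 0 = 0" for j by (simp add: z_def R(4))
    show "pbr \<pi> (F i) (z j) x = 0" if "i < r + r" "j < s" "x \<in> ball 0 \<delta>'" for i j x
      using dz[OF that(3)] R(6)[OF that(3,1)] v(2)[OF that(2,1)] by (simp add: pbr_def b_def inner_commute)
    show "w = 0" if DF: "\<And>i. i < r + r \<Longrightarrow> frechet_derivative (F i) (at 0) w = 0"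
      and Dz: "\<And>j. j < s \<Longrightarrow> frechet_derivative (z j) (at 0) w = 0" for w
    proof -
      have "v j \<bullet> w = 0" if "j < s" for j using Dz[OF that] dz[OF x0(1)] R(5) by (simp add: inner_commute)
      then have "w \<in> span (b ` {..<r + r})" using v(3)[of w] by auto
      then have "\<exists>c. w = (\<Sum>x\<in>b ` {..<r + r}. c x *\<^sub>R x)" using span_finite[of "b ` {..<r + r}"] by auto
      then obtain c where "w = (\<Sum>x\<in>b ` {..<r + r}. c x *\<^sub>R x)" by blast
      then have w: "w = (\<Sum>i<r + r. c (b i) *\<^sub>R b i)" using injb by (subst (asm) sum.reindex) auto
      have c: "(\<Sum>i<r + r. c (b i) * symplectic_const r i j) = 0" if j: "j < r + r" for j
      proof -
        have lin: "linear (frechet_derivative (F j) (at 0))"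
          using smooth_on_differentiable[OF F'(2)[OF j] x0(2)] by (simp add: linear_frechet_derivative)
        have "frechet_derivative (F j) (at 0) (b i) = symplectic_const r i j" if "i < r + r" for i
          using F'(4)[OF that j x0(2)] by (simp add: pbr_def b_def)
        then have "frechet_derivative (F j) (at 0) w = (\<Sum>i<r + r. c (b i) * symplectic_const r i j)"
          unfolding w by (simp add: linear_sum[OF lin] linear_scale[OF lin])
        then show ?thesis using DF[OF j] by simp
      qed
      \<comment> \<open>Testing with the conjugate index, \<open>l + r\<close> or
        \<open>l - r\<close>, isolates a single coefficient: the bracket table is a nondegenerate
        matrix.\<close>
      have "c (b l) = 0" if l: "l < r + r" for l
      proof (cases "l < r")
        case True
        have "(\<Sum>i<r + r. c (b i) * symplectic_const r i (l + r)) = (\<Sum>i<r + r. if i = l then - c (b i) else 0)"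
          by (intro sum.cong) (auto simp: symplectic_const_def)
        then show ?thesis using c[of "l + r"] True by simp
      next
        case False
        have "(\<Sum>i<r + r. c (b i) * symplectic_const r i (l - r)) = (\<Sum>i<r + r. if i = l then c (b i) else 0)"
          using False l by (intro sum.cong) (auto simp: symplectic_const_def)
        then show ?thesis using c[of "l - r"] False l by simp
      qed
      then show ?thesis unfolding w by (intro sum.neutral) auto
    qed
    \<comment> \<open>The \<open>z l (L x)\<close> are the coordinates of \<open>L e\<close> in the
      orthonormal family \<open>v\<close>, so orthogonality of \<open>L\<close> preserves the sum of
      squares. This makes the norm in the final coordinates invariant.\<close>
    show "(\<Sum>j<s. (z j (L x))\<^sup>2) = (\<Sum>j<s. (z j x)\<^sup>2)" if L: "L \<in> \<L>" and x: "x \<in> ball 0 \<delta>'" for L x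
    proof -
      define e where "e = (\<Sum>i<s. z i x *\<^sub>R v i)"
      have ip: "v j \<bullet> (\<Sum>i<s. c i *\<^sub>R v i) = c j" if "j < s" for c j
      proof -
        have "v j \<bullet> (\<Sum>i<s. c i *\<^sub>R v i) = (\<Sum>i<s. if i = j then c i else 0)"
          unfolding inner_sum_right by (intro sum.cong) (auto simp: v(1) that)
        then show ?thesis using that by simp
      qed
      have nrm: "(\<Sum>i<s. c i *\<^sub>R v i) \<bullet> (\<Sum>i<s. c i *\<^sub>R v i) = (\<Sum>i<s. (c i)\<^sup>2)" for c
      proof -
        have "(\<Sum>i<s. c i *\<^sub>R v i) \<bullet> (\<Sum>i<s. c i *\<^sub>R v i) = (\<Sum>j<s. c j * (v j \<bullet> (\<Sum>i<s. c i *\<^sub>R v i)))"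
          by (subst inner_sum_left) simp
        also have "\<dots> = (\<Sum>j<s. c j * c j)" by (intro sum.cong) (simp_all add: ip)
        finally show ?thesis by (simp add: power2_eq_square)
      qed
      have "L e = (\<Sum>i<s. z i x *\<^sub>R L (v i))"
        unfolding e_def by (simp add: linear_sum[OF Lf(1)[OF L]] linear_scale[OF Lf(1)[OF L]])
      also have "\<dots> = (\<Sum>i<s. z i x *\<^sub>R (\<Sum>l<s. (v l \<bullet> L (v i)) *\<^sub>R v l))"
        by (intro sum.cong refl) (use Lv[OF L] in auto)
      also have "\<dots> = (\<Sum>i<s. \<Sum>l<s. ((v l \<bullet> L (v i)) * z i x) *\<^sub>R v l)"
        by (simp add: scaleR_sum_right mult.commute)
      also have "\<dots> = (\<Sum>l<s. \<Sum>i<s. ((v l \<bullet> L (v i)) * z i x) *\<^sub>R v l)" by (rule sum.swap)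
      also have "\<dots> = (\<Sum>l<s. z l (L x) *\<^sub>R v l)"
        by (intro sum.cong refl) (simp add: zL[OF L x] scaleR_sum_left)
      finally have Le: "L e = (\<Sum>l<s. z l (L x) *\<^sub>R v l)" .
      show ?thesis using nrm[of "\<lambda>i. z i (L x)"] nrm[of "\<lambda>i. z i x"] Lf(2)[OF L, of e e] Le by (simp add: e_def)
    qed
  qed
qed

end

text \<open>Sets the \<open>p\<close> and \<open>q\<close> coordinates to 0. A function that depends
  on \<open>z\<close> alone takes the same value at the projected point, which is how such
  dependence is expressed.\<close>

definition z_projection :: "nat \<Rightarrow> (coord \<Rightarrow> 'n::finite) \<Rightarrow> real ^ 'n \<Rightarrow> real ^ 'n" where
  "z_projection s e y = (\<chi> k. if k \<in> (\<lambda>j. e (Z j)) ` {..<s} then y $ k else 0)"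

lemma norm_z_projection_le: "norm (z_projection s e y) \<le> norm y"
  by (rule norm_le_componentwise_cart) (simp add: z_projection_def)

lemma coordsE:
  assumes "a \<in> coords r s"
  obtains i where "i < r" "a = P i" | i where "i < r" "a = Q i" | j where "j < s" "a = Z j"
  using assms by (auto simp: coords_def)

lemma coords_intros: "i < r \<Longrightarrow> P i \<in> coords r s" "i < r \<Longrightarrow> Q i \<in> coords r s" "j < s \<Longrightarrow> Z j \<in> coords r s"
  by (auto simp: coords_def)

section \<open>Adapted coordinates on an invariant domain\<close>

context invariant_poisson
begin

text \<open>Two requirements shape \<open>U\<close>: it has to be stable under the group, and its
  coordinate image has to be convex and closed under \<open>z_projection\<close>, because
  independence from \<open>p\<close> and \<open>q\<close> is derived along the segment from a point
  to its projection. A ball as coordinate image meets both, since the action preserves the norm of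
  \<open>\<Theta>\<close>.\<close>

theorem local_normal_form:
  fixes p :: "nat \<Rightarrow> real ^ 'n \<Rightarrow> real"
  assumes n: "CARD('n) = 2 * r + s" and \<delta>: "\<delta> > 0" "ball 0 \<delta> \<subseteq> S"
    and p: "\<And>i. i < r \<Longrightarrow> smooth_on (p i) (ball 0 \<delta>)" "\<And>i. i < r \<Longrightarrow> p i 0 = 0"
    and inv: "\<And>i L x. i < r \<Longrightarrow> L \<in> \<L> \<Longrightarrow> x \<in> ball 0 \<delta> \<Longrightarrow> p i (L x) = p i x"
    and br: "\<And>i j x. i < r \<Longrightarrow> j < r \<Longrightarrow> x \<in> ball 0 \<delta> \<Longrightarrow> pbr \<pi> (p i) (p j) x = 0"
    and inj: "inj_on (\<lambda>i. hvf \<pi> (p i) 0) {..<r}" and ind: "independent ((\<lambda>i. hvf \<pi> (p i) 0) ` {..<r})"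
  obtains U and F z :: "nat \<Rightarrow> real ^ 'n \<Rightarrow> real" and v :: "nat \<Rightarrow> real ^ 'n" and e :: "coord \<Rightarrow> 'n" and \<Theta> \<Theta>' \<eta>
  where "open U" "0 \<in> U" "U \<subseteq> ball 0 \<delta>" "\<And>L x. L \<in> \<L> \<Longrightarrow> x \<in> U \<Longrightarrow> L x \<in> U"
    "\<And>i. i < r \<Longrightarrow> F i = p i" "\<And>i. i < r + r \<Longrightarrow> smooth_on (F i) U" "\<And>i. i < r + r \<Longrightarrow> F i 0 = 0"
    "\<And>i L x. i < r + r \<Longrightarrow> L \<in> \<L> \<Longrightarrow> x \<in> U \<Longrightarrow> F i (L x) = F i x"
    "\<And>j. j < s \<Longrightarrow> smooth_on (z j) U" "\<And>j. j < s \<Longrightarrow> z j 0 = 0"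
    "bij_betw e (coords r s) UNIV" "\<And>a x. a \<in> coords r s \<Longrightarrow> \<Theta> x $ e a = coord_fun r F z a x"
    "\<eta> > 0" "homeomorphism U (ball 0 \<eta>) \<Theta> \<Theta>'" "smooth_on \<Theta> U" "smooth_on \<Theta>' (ball 0 \<eta>)"
    "\<And>i j x. i < r + r \<Longrightarrow> j < r + r \<Longrightarrow> x \<in> U \<Longrightarrow> pbr \<pi> (F i) (F j) x = symplectic_const r i j"
    "\<And>i j x. i < r + r \<Longrightarrow> j < s \<Longrightarrow> x \<in> U \<Longrightarrow> pbr \<pi> (F i) (z j) x = 0"
    "\<And>a b x. a < s \<Longrightarrow> b < s \<Longrightarrow> x \<in> U \<Longrightarrow> pbr \<pi> (z a) (z b) (\<Theta>' (z_projection s e (\<Theta> x))) = pbr \<pi> (z a) (z b) x"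
    "\<And>L x j. L \<in> \<L> \<Longrightarrow> x \<in> U \<Longrightarrow> j < s \<Longrightarrow> z j (L x) = (\<Sum>i<s. (v j \<bullet> L (v i)) * z i x)"
    "\<And>L i. L \<in> \<L> \<Longrightarrow> i < s \<Longrightarrow> L (v i) = (\<Sum>l<s. (v l \<bullet> L (v i)) *\<^sub>R v l)"
    "\<And>i j. i < s \<Longrightarrow> j < s \<Longrightarrow> v i \<bullet> v j = (if i = j then 1 else 0)"
proof -

  \<comment> \<open>The canonical functions and the coordinate map\<close>
  have "\<exists>F \<delta>'. ball (0::real ^ 'n) \<delta>' \<subseteq> ball 0 \<delta> \<and> (\<forall>i<r. F i = p i) \<and> canonical_family r (r + r) F \<delta>'"
    by (rule conjugate_functions[OF \<delta> p _ br inj ind order_refl]) (use inv in blast)+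
  then obtain F \<delta>1 where F1: "ball (0::real ^ 'n) \<delta>1 \<subseteq> ball 0 \<delta>" "\<forall>i<r. F i = p i" "canonical_family r (r + r) F \<delta>1"
    by blast
  have F: "\<delta>1 > 0" "\<And>i. i < r + r \<Longrightarrow> smooth_on (F i) (ball 0 \<delta>1)" "\<And>i. i < r + r \<Longrightarrow> F i 0 = 0"
    "\<And>i L x. i < r + r \<Longrightarrow> L \<in> \<L> \<Longrightarrow> x \<in> ball 0 \<delta>1 \<Longrightarrow> F i (L x) = F i x"
    "\<And>i j x. i < r + r \<Longrightarrow> j < r + r \<Longrightarrow> x \<in> ball 0 \<delta>1 \<Longrightarrow> pbr \<pi> (F i) (F j) x = symplectic_const r i j"
    using F1(3) unfolding canonical_family_def by blast+
  have \<delta>1S: "ball (0::real ^ 'n) \<delta>1 \<subseteq> S" using F1(1) \<delta>(2) by blast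
  obtain \<delta>2 and v :: "nat \<Rightarrow> real ^ 'n" and z :: "nat \<Rightarrow> real ^ 'n \<Rightarrow> real"
  where z: "\<delta>2 > 0" "ball 0 \<delta>2 \<subseteq> ball (0::real ^ 'n) \<delta>1"
    "\<And>j. j < s \<Longrightarrow> smooth_on (z j) (ball 0 \<delta>2)" "\<And>j. j < s \<Longrightarrow> z j 0 = 0"
    "\<And>i j x. i < r + r \<Longrightarrow> j < s \<Longrightarrow> x \<in> ball 0 \<delta>2 \<Longrightarrow> pbr \<pi> (F i) (z j) x = 0"
    "\<And>w. (\<And>i. i < r + r \<Longrightarrow> frechet_derivative (F i) (at 0) w = 0) \<Longrightarrow>
       (\<And>j. j < s \<Longrightarrow> frechet_derivative (z j) (at 0) w = 0) \<Longrightarrow> w = 0"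
    "\<And>L x j. L \<in> \<L> \<Longrightarrow> x \<in> ball 0 \<delta>2 \<Longrightarrow> j < s \<Longrightarrow> z j (L x) = (\<Sum>i<s. (v j \<bullet> L (v i)) * z i x)"
    "\<And>L x. L \<in> \<L> \<Longrightarrow> x \<in> ball 0 \<delta>2 \<Longrightarrow> (\<Sum>j<s. (z j (L x))\<^sup>2) = (\<Sum>j<s. (z j x)\<^sup>2)"
    "\<And>L i. L \<in> \<L> \<Longrightarrow> i < s \<Longrightarrow> L (v i) = (\<Sum>l<s. (v l \<bullet> L (v i)) *\<^sub>R v l)"
    "\<And>i j. i < s \<Longrightarrow> j < s \<Longrightarrow> v i \<bullet> v j = (if i = j then 1 else 0)"
    by (rule transverse_coordinates[OF n F1(3) \<delta>1S]) blast
  let ?B = "ball (0::real ^ 'n) \<delta>2"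
  have BS: "?B \<subseteq> S" using z(2) \<delta>1S by blast
  have x0: "0 \<in> ?B" using z(1) by simp
  have Fs: "smooth_on (F i) ?B" if "i < r + r" for i by (rule smooth_on_subset[OF F(2)[OF that] z(2)])
  obtain e :: "coord \<Rightarrow> 'n" where e: "bij_betw e (coords r s) UNIV"
    using finite_same_card_bij[OF coords_finite_card(1)[of r s], of "UNIV :: 'n set"] coords_finite_card(2)[of r s] n by auto
  define e' where "e' = the_inv_into (coords r s) e"
  have e'e: "e' (e a) = a" if "a \<in> coords r s" for a
    unfolding e'_def using e that by (intro the_inv_into_f_f) (auto simp: bij_betw_def)
  have surj_e: "\<exists>a\<in>coords r s. k = e a" for k using e by (auto simp: bij_betw_def)
  let ?C = "coord_fun r F z"
  define \<Theta> where "\<Theta> x = (\<chi> k. ?C (e' k) x)" for x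
  have \<Theta>e: "\<Theta> x $ e a = ?C a x" if "a \<in> coords r s" for a x by (simp add: \<Theta>_def e'e[OF that])
  have Cs: "smooth_on (?C a) ?B" if "a \<in> coords r s" for a
    using that by (rule coordsE) (auto intro: Fs z(3))
  have \<Theta>s: "smooth_on \<Theta> ?B"
  proof (rule smooth_on_vecI[OF open_ball])
    fix k obtain a where a: "a \<in> coords r s" "k = e a" using surj_e by blast
    show "smooth_on (\<lambda>x. \<Theta> x $ k) ?B" unfolding a(2) \<Theta>e[OF a(1)] by (rule Cs[OF a(1)])
  qed
  have D\<Theta>: "frechet_derivative \<Theta> (at x) w $ e a = frechet_derivative (?C a) (at x) w"
    if "a \<in> coords r s" "x \<in> ?B" for a x w
    using frechet_derivative_nth[OF smooth_on_differentiable[OF \<Theta>s that(2)], of "e a" w] \<Theta>e[OF that(1)] by simp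
  have injD: "w = 0" if w: "frechet_derivative \<Theta> (at 0) w = 0" for w
  proof (rule z(6))
    have C0: "frechet_derivative (?C a) (at 0) w = 0" if "a \<in> coords r s" for a
      using D\<Theta>[OF that x0, of w] w by simp
    show "frechet_derivative (F i) (at 0) w = 0" if "i < r + r" for i
    proof (cases "i < r")
      case True
      then show ?thesis using C0[OF coords_intros(1)[OF True]] by simp
    next
      case False
      then have "i - r < r" using that by simp
      then show ?thesis using C0[OF coords_intros(2)[of "i - r" r s]] False by simp
    qed
    show "frechet_derivative (z j) (at 0) w = 0" if "j < s" for j
      using C0[OF coords_intros(3)[OF that]] by simp
  qed
  obtain U0 V0 \<Theta>' where UV: "open U0" "U0 \<subseteq> ?B" "0 \<in> U0" "open V0" "homeomorphism U0 V0 \<Theta> \<Theta>'" "smooth_on \<Theta>' V0"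
    by (rule smooth_inverse_function[OF open_ball \<Theta>s x0 injD]) blast
  have \<Theta>'\<Theta>: "\<Theta>' (\<Theta> x) = x" "\<Theta> x \<in> V0" if "x \<in> U0" for x using UV(5) that by (auto simp: homeomorphism_def)
  have \<Theta>\<Theta>': "\<Theta> (\<Theta>' y) = y" "\<Theta>' y \<in> U0" if "y \<in> V0" for y using UV(5) that by (auto simp: homeomorphism_def)
  have \<Theta>0: "\<Theta> 0 = 0"
  proof -
    have "\<Theta> 0 $ k = 0" for k
    proof -
      obtain a where a: "a \<in> coords r s" "k = e a" using surj_e by blast
      show ?thesis unfolding a(2) \<Theta>e[OF a(1)] using a(1) by (rule coordsE) (auto simp: F(3) z(4))
    qed
    then show ?thesis by (simp add: Finite_Cartesian_Product.vec_eq_iff)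
  qed

  \<comment> \<open>Choice of the domain\<close>
  obtain \<epsilon> where \<epsilon>: "\<epsilon> > 0" "ball 0 \<epsilon> \<subseteq> U0" using UV(1,3) open_contains_ball by blast
  have "open (\<Theta>' -` ball 0 \<epsilon> \<inter> V0)"
    using UV(4) continuous_on_open_vimage smooth_on_continuous[OF UV(6)] by blast
  moreover have "0 \<in> \<Theta>' -` ball 0 \<epsilon> \<inter> V0" using \<Theta>'\<Theta>[OF UV(3)] \<Theta>0 \<epsilon>(1) by simp
  ultimately obtain \<eta> where \<eta>: "\<eta> > 0" "ball 0 \<eta> \<subseteq> \<Theta>' -` ball 0 \<epsilon> \<inter> V0" using open_contains_ball by blast
  \<comment> \<open>\<open>\<eta>\<close> is so small that \<open>\<Theta>'\<close> maps the ball of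
    radius \<open>\<eta>\<close> into the ball of radius \<open>\<epsilon>\<close>; hence the image
    of \<open>U\<close> is the full ball and not just a part of it.\<close>
  define U where "U = \<Theta> -` ball 0 \<eta> \<inter> ball 0 \<epsilon>"
  have \<epsilon>B: "ball (0::real ^ 'n) \<epsilon> \<subseteq> ?B" using \<epsilon>(2) UV(2) by blast
  have UB: "U \<subseteq> ?B" using \<epsilon>B by (auto simp: U_def)
  have oU: "open U"
    unfolding U_def using continuous_on_subset[OF smooth_on_continuous[OF \<Theta>s] \<epsilon>B]
    by (simp add: continuous_on_open_vimage)
  have UU0: "U \<subseteq> U0" using \<epsilon>(2) by (auto simp: U_def)
  have img: "\<Theta> ` U = ball 0 \<eta>"
  proof
    show "\<Theta> ` U \<subseteq> ball 0 \<eta>" by (auto simp: U_def)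
    show "ball 0 \<eta> \<subseteq> \<Theta> ` U"
    proof
      fix y :: "real ^ 'n" assume y: "y \<in> ball 0 \<eta>"
      then have "\<Theta>' y \<in> ball 0 \<epsilon>" "y \<in> V0" using \<eta>(2) by auto
      then show "y \<in> \<Theta> ` U" using \<Theta>\<Theta>'(1)[of y] y by (intro image_eqI[of _ _ "\<Theta>' y"]) (auto simp: U_def)
    qed
  qed
  have hom: "homeomorphism U (ball 0 \<eta>) \<Theta> \<Theta>'"
    using homeomorphism_of_subsets[OF UV(5) UU0 _ img] \<eta>(2) by auto
  have \<Theta>'U: "\<Theta>' y \<in> U" if "y \<in> ball 0 \<eta>" for y using hom that by (auto simp: homeomorphism_def)
  have \<eta>V: "ball 0 \<eta> \<subseteq> V0" using \<eta>(2) by blast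
  have norm\<Theta>: "norm (\<Theta> (L x)) = norm (\<Theta> x)" if L: "L \<in> \<L>" and x: "x \<in> ?B" for L x
  proof -
    have sq: "(norm (\<Theta> y))\<^sup>2 = (\<Sum>i<r. (F i y)\<^sup>2) + (\<Sum>i<r. (F (r + i) y)\<^sup>2) + (\<Sum>j<s. (z j y)\<^sup>2)" for y
    proof -
      have "(norm (\<Theta> y))\<^sup>2 = (\<Sum>k\<in>UNIV. (\<Theta> y $ k)\<^sup>2)"
        unfolding power2_norm_eq_inner inner_vec_def by (simp add: power2_eq_square)
      also have "\<dots> = (\<Sum>a\<in>coords r s. (\<Theta> y $ e a)\<^sup>2)"
        by (rule sum.reindex_bij_betw[OF e, symmetric])
      also have "\<dots> = (\<Sum>a\<in>coords r s. (?C a y)\<^sup>2)"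
        by (intro sum.cong refl) (simp add: \<Theta>e)
      finally show ?thesis by (simp add: sum_coords)
    qed
    have "(norm (\<Theta> (L x)))\<^sup>2 = (norm (\<Theta> x))\<^sup>2"
    proof -
      have x1: "x \<in> ball 0 \<delta>1" using x z(2) by blast
      have "(\<Sum>i<r. (F i (L x))\<^sup>2) = (\<Sum>i<r. (F i x)\<^sup>2)" "(\<Sum>i<r. (F (r + i) (L x))\<^sup>2) = (\<Sum>i<r. (F (r + i) x)\<^sup>2)"
        by (intro sum.cong refl; simp add: F(4)[OF _ L x1])+
      then show ?thesis unfolding sq z(8)[OF L x] by simp
    qed
    then show ?thesis by simp
  qed
  have LU: "L x \<in> U" if "L \<in> \<L>" "x \<in> U" for L x
  proof -
    have "norm (L x) = norm x" using orth[OF that(1)] by (simp add: orthogonal_transformation_norm)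
    then show ?thesis using norm\<Theta>[OF that(1), of x] that(2) UB by (auto simp: U_def)
  qed
  have dC: "?C a differentiable (at x)" if "a \<in> coords r s" "x \<in> ?B" for a x
    using smooth_on_differentiable[OF Cs] that by blast

  \<comment> \<open>Brackets of transverse coordinates depend on these coordinates alone\<close>
  have zF0: "pbr \<pi> (z j) (F i) x = 0" if "i < r + r" "j < s" "x \<in> ?B" for i j x
    using pbr_skew[OF smooth_on_differentiable[OF z(3)[OF that(2)] that(3)] smooth_on_differentiable[OF Fs[OF that(1)] that(3)]]
      z(5)[OF that] BS that(3) by auto
  have const: "pbr \<pi> (z a) (z b) (\<Theta>' (z_projection s e (\<Theta> x))) = pbr \<pi> (z a) (z b) x"
    if ab: "a < s" "b < s" and x: "x \<in> U" for a b x
  proof -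
    let ?g = "pbr \<pi> (z a) (z b)"
    have gs: "smooth_on ?g ?B" by (rule smooth_pbr[OF open_ball BS z(3)[OF ab(1)] z(3)[OF ab(2)]])
    have gF: "frechet_derivative ?g (at x) (hvf \<pi> (F i) x) = 0" if i: "i < r + r" and x: "x \<in> ?B" for i x
    proof -
      have "pbr \<pi> (F i) ?g x + pbr \<pi> (z a) (pbr \<pi> (z b) (F i)) x + pbr \<pi> (z b) (pbr \<pi> (F i) (z a)) x = 0"
        by (rule jacobi[OF open_ball BS Fs[OF i] z(3)[OF ab(1)] z(3)[OF ab(2)] x])
      moreover have "pbr \<pi> (z a) (pbr \<pi> (z b) (F i)) x = 0"
        unfolding pbr_def[of \<pi> "z a"] by (rule frechet_derivative_locally_const[OF open_ball x zF0[OF i ab(2)]])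
      moreover have "pbr \<pi> (z b) (pbr \<pi> (F i) (z a)) x = 0"
        unfolding pbr_def[of \<pi> "z b"] by (rule frechet_derivative_locally_const[OF open_ball x z(5)[OF i ab(1)]])
      ultimately show ?thesis by (simp add: pbr_def)
    qed
    let ?f = "\<lambda>y. ?g (\<Theta>' y)" and ?W = "ball (0::real ^ 'n) \<eta>"
    have \<Theta>'s: "smooth_on \<Theta>' ?W" by (rule smooth_on_subset[OF UV(6) \<eta>V])
    have fs: "smooth_on ?f ?W"
      by (rule smooth_on_compose[OF open_ball open_ball gs \<Theta>'s]) (use \<Theta>'U UB in blast)
    let ?f' = "\<lambda>y. frechet_derivative ?f (at y)"
    have f't: "?f' y (frechet_derivative \<Theta> (at (\<Theta>' y)) w) = frechet_derivative ?g (at (\<Theta>' y)) w" if y: "y \<in> ?W" for y w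
    proof -
      have x: "\<Theta>' y \<in> U" "\<Theta> (\<Theta>' y) = y" using \<Theta>'U[OF y] \<Theta>\<Theta>'(1)[of y] y \<eta>V by auto
      have xB: "\<Theta>' y \<in> ?B" using x(1) UB by blast
      have d: "\<Theta> differentiable (at (\<Theta>' y))" "?f differentiable (at (\<Theta> (\<Theta>' y)))"
        using smooth_on_differentiable[OF \<Theta>s xB] smooth_on_differentiable[OF fs y] x(2) by simp_all
      have "frechet_derivative (\<lambda>x. ?f (\<Theta> x)) (at (\<Theta>' y)) = frechet_derivative ?g (at (\<Theta>' y))"
        by (rule frechet_derivative_cong_open[OF oU x(1) _ smooth_on_differentiable[OF gs xB]])
           (use \<Theta>'\<Theta> UU0 in auto)
      then show ?thesis using frechet_derivative_compose'[OF d, of w] x(2) by simp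
    qed
    have axisI: "frechet_derivative \<Theta> (at x) (hvf \<pi> (F i) x) = c *\<^sub>R axis (e a0) 1"
      if "i < r + r" "x \<in> ?B" "a0 \<in> coords r s"
        "\<And>a. a \<in> coords r s \<Longrightarrow> pbr \<pi> (F i) (?C a) x = (if a = a0 then c else 0)" for i x a0 c
    proof -
      have "frechet_derivative \<Theta> (at x) (hvf \<pi> (F i) x) $ k = (c *\<^sub>R axis (e a0) 1) $ k" for k
      proof -
        obtain a where a: "a \<in> coords r s" "k = e a" using surj_e by blast
        have "e a = e a0 \<longleftrightarrow> a = a0" using e a(1) that(3) by (auto simp: bij_betw_def inj_on_def)
        then show ?thesis
          unfolding a(2) D\<Theta>[OF a(1) that(2)] using that(4)[OF a(1)] by (simp add: pbr_def axis_def)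
      qed
      then show ?thesis by (simp add: Finite_Cartesian_Product.vec_eq_iff)
    qed
    \<comment> \<open>In the coordinates \<open>\<Theta>\<close> the Hamiltonian field of
      \<open>q_i\<close> is the coordinate field of \<open>p_i\<close>, and that of
      \<open>p_i\<close> is minus the coordinate field of \<open>q_i\<close>; by \<open>gF\<close>
      the bracket has derivative 0 along both.\<close>
    have f'0: "?f' y (axis (e (P i)) 1) = 0" "?f' y (axis (e (Q i)) 1) = 0" if y: "y \<in> ?W" and i: "i < r" for y i
    proof -
      have xB: "\<Theta>' y \<in> ?B" using \<Theta>'U[OF y] UB by blast
      then have x1: "\<Theta>' y \<in> ball 0 \<delta>1" using z(2) by blast
      have lin: "linear (?f' y)" using smooth_on_differentiable[OF fs y] by (rule linear_frechet_derivative)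
      have "frechet_derivative \<Theta> (at (\<Theta>' y)) (hvf \<pi> (F (r + i)) (\<Theta>' y)) = 1 *\<^sub>R axis (e (P i)) 1"
      proof (rule axisI[OF _ xB coords_intros(1)[OF i]])
        fix a assume "a \<in> coords r s"
        then show "pbr \<pi> (F (r + i)) (?C a) (\<Theta>' y) = (if a = P i then 1 else 0)"
          by (rule coordsE) (use i in \<open>auto simp: F(5)[OF _ _ x1] z(5)[OF _ _ xB] symplectic_const_def\<close>)
      qed (use i in auto)
      then show "?f' y (axis (e (P i)) 1) = 0"
        using f't[OF y, of "hvf \<pi> (F (r + i)) (\<Theta>' y)"] gF[OF _ xB, of "r + i"] i by simp
      have "frechet_derivative \<Theta> (at (\<Theta>' y)) (hvf \<pi> (F i) (\<Theta>' y)) = (-1) *\<^sub>R axis (e (Q i)) 1"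
      proof (rule axisI[OF _ xB coords_intros(2)[OF i]])
        fix a assume "a \<in> coords r s"
        then show "pbr \<pi> (F i) (?C a) (\<Theta>' y) = (if a = Q i then -1 else 0)"
          by (rule coordsE) (use i in \<open>auto simp: F(5)[OF _ _ x1] z(5)[OF _ _ xB] symplectic_const_def\<close>)
      qed (use i in auto)
      then have "?f' y ((-1) *\<^sub>R axis (e (Q i)) 1) = 0"
        using f't[OF y, of "hvf \<pi> (F i) (\<Theta>' y)"] gF[OF _ xB, of i] i by simp
      then show "?f' y (axis (e (Q i)) 1) = 0" using linear_scale[OF lin, of "-1" "axis (e (Q i)) 1"] by simp
    qed
    let ?y = "\<Theta> x"
    have y: "?y \<in> ?W" using x img by blast
    \<comment> \<open>The displacement to the projected point has only \<open>p\<close> and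
      \<open>q\<close> components, so the derivative vanishes in its direction.\<close>
    define u where "u = z_projection s e ?y - ?y"
    have u0: "u $ e (Z j) = 0" if "j < s" for j using that by (simp add: u_def z_projection_def)
    have "?f (?y + u) = ?f ?y"
    proof (rule constant_along_null_direction[OF convex_ball smooth_on_has_derivative[OF fs] _ y])
      show "?f' y u = 0" if y: "y \<in> ?W" for y
      proof -
        have lin: "linear (?f' y)" using smooth_on_differentiable[OF fs y] by (rule linear_frechet_derivative)
        have "?f' y u = (\<Sum>k\<in>UNIV. u $ k *\<^sub>R ?f' y (axis k 1))" by (rule linear_axis_expansion[OF lin])
        also have "\<dots> = (\<Sum>a\<in>coords r s. u $ e a *\<^sub>R ?f' y (axis (e a) 1))"
          by (rule sum.reindex_bij_betw[OF e, symmetric])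
        also have "\<dots> = 0"
        proof (rule sum.neutral, rule ballI)
          fix a assume "a \<in> coords r s"
          then show "u $ e a *\<^sub>R ?f' y (axis (e a) 1) = 0"
            by (rule coordsE) (simp_all add: f'0[OF y] u0)
        qed
        finally show ?thesis .
      qed
      show "?y + u \<in> ?W" using y norm_z_projection_le[of s e ?y] by (simp add: u_def)
    qed
    then show ?thesis using \<Theta>'\<Theta>(1)[of x] x UU0 by (auto simp: u_def)
  qed
  show ?thesis
  proof (rule that[where U=U and F=F and z=z and v=v and e=e and \<Theta>=\<Theta> and \<eta>=\<eta> and \<Theta>'=\<Theta>'])
    show "0 \<in> U" using \<epsilon>(1) \<eta>(1) \<Theta>0 by (simp add: U_def)
    show "U \<subseteq> ball 0 \<delta>" using UB z(2) F1(1) by blast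
    show "F i (L x) = F i x" if "i < r + r" "L \<in> \<L>" "x \<in> U" for i L x
      by (rule F(4)[OF that(1,2)]) (use that(3) UB z(2) in blast)
    show "pbr \<pi> (F i) (F j) x = symplectic_const r i j" if "i < r + r" "j < r + r" "x \<in> U" for i j x
      by (rule F(5)[OF that(1,2)]) (use that(3) UB z(2) in blast)
    show "pbr \<pi> (F i) (z j) x = 0" if "i < r + r" "j < s" "x \<in> U" for i j x
      by (rule z(5)[OF that(1,2)]) (use that(3) UB in blast)
    show "z j (L x) = (\<Sum>i<s. (v j \<bullet> L (v i)) * z i x)" if "L \<in> \<L>" "x \<in> U" "j < s" for L x j
      by (rule z(7)[OF that(1) _ that(3)]) (use that(2) UB in blast)
    show "L x \<in> U" if "L \<in> \<L>" "x \<in> U" for L x by (rule LU[OF that])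
    show "L (v i) = (\<Sum>l<s. (v l \<bullet> L (v i)) *\<^sub>R v l)" if "L \<in> \<L>" "i < s" for L i by (rule z(9)[OF that])
    show "smooth_on (F i) U" if "i < r + r" for i by (rule smooth_on_subset[OF Fs[OF that] UB])
    show "smooth_on (z j) U" if "j < s" for j by (rule smooth_on_subset[OF z(3)[OF that] UB])
    show "pbr \<pi> (z a) (z b) (\<Theta>' (z_projection s e (\<Theta> x))) = pbr \<pi> (z a) (z b) x" if "a < s" "b < s" "x \<in> U" for a b x
      by (rule const[OF that])
    show "smooth_on \<Theta> U" by (rule smooth_on_subset[OF \<Theta>s UB])
    show "smooth_on \<Theta>' (ball 0 \<eta>)" by (rule smooth_on_subset[OF UV(6) \<eta>V])
  qed (use oU F1(2) F(3) z(4) e \<Theta>e \<eta>(1) hom z(10) in blast)+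
qed

end

section \<open>Charts\<close>

lemma chart_openin_preimage:
  assumes c: "is_chart X c" and S: "open S"
  shows "openin X {x \<in> fst c. snd c x \<in> S}"
proof -
  have X: "openin X (fst c)" using c by (simp add: is_chart_def)
  have "continuous_map (subtopology X (fst c)) (top_of_set (snd c ` fst c)) (snd c)"
    using c unfolding is_chart_def by (blast intro: homeomorphic_imp_continuous_map)
  then have "continuous_map (subtopology X (fst c)) euclidean (snd c)"
    using continuous_map_into_fulltopology by blast
  then have "openin (subtopology X (fst c)) {x \<in> topspace (subtopology X (fst c)). snd c x \<in> S}"
    by (rule openin_continuous_map_preimage) (use S in simp)
  moreover have "{x \<in> topspace (subtopology X (fst c)). snd c x \<in> S} = {x \<in> fst c. snd c x \<in> S}"
    using openin_subset[OF X] by auto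
  ultimately show ?thesis using openin_trans_full[OF _ X] by metis
qed

lemma chart_image_inv:
  assumes "y \<in> snd c ` fst c"
  shows "chart_inv c y \<in> fst c" "snd c (chart_inv c y) = y"
  using assms by (auto intro: inv_into_into f_inv_into_f)

text \<open>Maximality of the atlas admits the new chart once it is compatible with every old one;
  its transition maps are those of \<open>c\<close>, preceded by \<open>g\<close> or followed by
  \<open>f\<close>.\<close>

lemma chart_compose:
  fixes c :: "('m, real ^ 'n) chart"
  assumes M: "smooth_manifold X \<A>" and c: "c \<in> \<A>"
    and S: "open S" "S \<subseteq> snd c ` fst c" and R: "open R" and h: "homeomorphism S R f g"
    and f: "smooth_on f S" and g: "smooth_on g R"
  defines "U \<equiv> {x \<in> fst c. snd c x \<in> S}"
  shows "(U, f \<circ> snd c) \<in> \<A>" and "(f \<circ> snd c) ` U = R"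
    and "\<And>y. y \<in> R \<Longrightarrow> chart_inv (U, f \<circ> snd c) y = chart_inv c (g y)"
proof -
  have ch: "is_chart X d" if "d \<in> \<A>" for d using M that by (simp add: smooth_manifold_def)
  have oU: "openin X U" unfolding U_def by (rule chart_openin_preimage[OF ch[OF c] S(1)])
  have cU: "snd c ` U = S"
    using S(2) by (auto simp: U_def)
  have gf: "g (f y) = y" "f y \<in> R" if "y \<in> S" for y using h that by (auto simp: homeomorphism_def)
  have fg: "f (g y) = y" "g y \<in> S" if "y \<in> R" for y using h that by (auto simp: homeomorphism_def)
  have fS: "f ` S = R" using h by (simp add: homeomorphism_def)
  show img: "(f \<circ> snd c) ` U = R" unfolding image_comp[symmetric] cU by (rule fS)
  have inj: "inj_on (f \<circ> snd c) U"
  proof (rule inj_onI)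
    fix x y assume "x \<in> U" "y \<in> U" "(f \<circ> snd c) x = (f \<circ> snd c) y"
    then show "x = y" using gf(1) chart_inv_chart[OF ch[OF c]] unfolding U_def
      by (metis (no_types, lifting) comp_apply mem_Collect_eq)
  qed
  show inv: "chart_inv (U, f \<circ> snd c) y = chart_inv c (g y)" if y: "y \<in> R" for y
  proof -
    have gy: "g y \<in> snd c ` fst c" using fg(2)[OF y] S(2) by blast
    define x where "x = chart_inv c (g y)"
    have x: "x \<in> fst c" "snd c x = g y" using chart_image_inv[OF gy] by (auto simp: x_def)
    then have xU: "x \<in> U" and xy: "(f \<circ> snd c) x = y" using fg[OF y] by (auto simp: U_def)
    have "inv_into U (f \<circ> snd c) y = x" unfolding xy[symmetric] by (rule inv_into_f_f[OF inj xU])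
    then show ?thesis by (simp add: x_def)
  qed
  let ?d = "(U, f \<circ> snd c)"
  have sub: "subtopology (subtopology X (fst c)) U = subtopology X U"
    by (simp add: subtopology_subtopology Int_absorb1 U_def inf_absorb2)
  have "homeomorphic_map (subtopology (subtopology X (fst c)) U) (subtopology (top_of_set (snd c ` fst c)) S) (snd c)"
  proof (rule homeomorphic_map_subtopologies)
    show "homeomorphic_map (subtopology X (fst c)) (top_of_set (snd c ` fst c)) (snd c)"
      using ch[OF c] by (simp add: is_chart_def)
    show "snd c ` (topspace (subtopology X (fst c)) \<inter> U) = topspace (top_of_set (snd c ` fst c)) \<inter> S"
      using cU S(2) openin_subset[OF oU] by (auto simp: U_def)
  qed
  then have h1: "homeomorphic_map (subtopology X U) (top_of_set S) (snd c)"
    unfolding sub using S(2) by (simp add: subtopology_subtopology Int_absorb1)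
  have h2: "homeomorphic_map (top_of_set S) (top_of_set R) f"
    unfolding homeomorphic_map_maps homeomorphic_maps_def
    using h by (intro exI[of _ g]) (auto simp: homeomorphism_def)
  have ic: "is_chart X ?d"
    unfolding is_chart_def using oU img R homeomorphic_map_compose[OF h1 h2] by simp
  have comp: "compatible_charts ?d d" if d: "d \<in> \<A>" for d
    unfolding compatible_charts_def
  proof
    have cd: "smooth_on (snd d \<circ> chart_inv c) (snd c ` (fst c \<inter> fst d))" "smooth_on (snd c \<circ> chart_inv d) (snd d ` (fst c \<inter> fst d))"
      using M c d unfolding smooth_manifold_def compatible_charts_def by blast+
    have od: "openin X (fst d)" using ch[OF d] by (simp add: is_chart_def)
    have o1: "open (snd ?d ` (fst ?d \<inter> fst d))" by (rule open_chart_image[OF ic od])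
    have o2: "open (snd c ` (fst c \<inter> fst d))" by (rule open_chart_image[OF ch[OF c] od])
    have sub1: "snd ?d ` (fst ?d \<inter> fst d) \<subseteq> R" using img by auto
    have "smooth_on (\<lambda>y. (snd d \<circ> chart_inv c) (g y)) (snd ?d ` (fst ?d \<inter> fst d))"
    proof (rule smooth_on_compose[OF o1 o2 cd(1) smooth_on_subset[OF g sub1]])
      fix y assume "y \<in> snd ?d ` (fst ?d \<inter> fst d)"
      then show "g y \<in> snd c ` (fst c \<inter> fst d)" using gf by (auto simp: U_def)
    qed
    then show "smooth_on (snd d \<circ> chart_inv ?d) (snd ?d ` (fst ?d \<inter> fst d))"
      by (rule smooth_on_cong[OF o1, rotated]) (use sub1 inv in auto)
    have o3: "open (snd d ` (fst ?d \<inter> fst d))"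
      using open_chart_image[OF ch[OF d] oU] by (simp add: Int_commute)
    have "smooth_on (\<lambda>y. f ((snd c \<circ> chart_inv d) y)) (snd d ` (fst ?d \<inter> fst d))"
    proof (rule smooth_on_compose[OF o3 S(1) f])
      show "smooth_on (snd c \<circ> chart_inv d) (snd d ` (fst ?d \<inter> fst d))"
        by (rule smooth_on_subset[OF cd(2)]) (auto simp: U_def)
      fix y assume "y \<in> snd d ` (fst ?d \<inter> fst d)"
      then show "(snd c \<circ> chart_inv d) y \<in> S" using chart_inv_chart[OF ch[OF d]] by (auto simp: U_def)
    qed
    then show "smooth_on (snd ?d \<circ> chart_inv d) (snd d ` (fst ?d \<inter> fst d))"
      by (simp add: o_def)
  qed
  show "?d \<in> \<A>"
    using M ic comp unfolding smooth_manifold_def by blast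
qed

lemma smooth_fun_onI:
  fixes c :: "('m, real ^ 'n) chart" and h :: "'m \<Rightarrow> 'b::real_normed_vector"
  assumes M: "smooth_manifold X \<A>" and c: "c \<in> \<A>" and W: "openin X W" "W \<subseteq> fst c"
    and h: "smooth_on (h \<circ> chart_inv c) (snd c ` W)"
  shows "smooth_fun_on \<A> W h"
  unfolding smooth_fun_on_def
proof
  fix d assume d: "d \<in> \<A>"
  have ch: "is_chart X d" if "d \<in> \<A>" for d using M that by (simp add: smooth_manifold_def)
  have od: "openin X (fst d)" using ch[OF d] by (simp add: is_chart_def)
  have o1: "open (snd d ` (fst d \<inter> W))" by (rule open_chart_image[OF ch[OF d] W(1)])
  have o2: "open (snd c ` W)" using open_chart_image[OF ch[OF c] W(1)] W(2) by (simp add: Int_absorb1)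
  have "smooth_on (snd c \<circ> chart_inv d) (snd d ` (fst c \<inter> fst d))"
    using M c d unfolding smooth_manifold_def compatible_charts_def by blast
  then have t: "smooth_on (snd c \<circ> chart_inv d) (snd d ` (fst d \<inter> W))"
    by (rule smooth_on_subset) (use W(2) in auto)
  have "smooth_on (\<lambda>y. (h \<circ> chart_inv c) ((snd c \<circ> chart_inv d) y)) (snd d ` (fst d \<inter> W))"
  proof (rule smooth_on_compose[OF o1 o2 h t])
    fix y assume "y \<in> snd d ` (fst d \<inter> W)"
    then show "(snd c \<circ> chart_inv d) y \<in> snd c ` W" using chart_inv_chart[OF ch[OF d]] by auto
  qed
  then show "smooth_on (h \<circ> chart_inv d) (snd d ` (fst d \<inter> W))"
    by (rule smooth_on_cong[OF o1, rotated])
       (use chart_inv_chart[OF ch[OF d]] chart_inv_chart[OF ch[OF c]] W(2) in auto)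
qed

lemma smooth_fun_onD: "smooth_fun_on \<A> W h \<Longrightarrow> c \<in> \<A> \<Longrightarrow> smooth_on (h \<circ> chart_inv c) (snd c ` (fst c \<inter> W))"
  by (simp add: smooth_fun_on_def)

lemma differential_grad: "differential c f x = grad (f \<circ> chart_inv c) (snd c x)"
  by (simp add: differential_def grad_def)

lemma poisson_bracket_pbr:
  assumes M: "smooth_manifold X \<A>" and B: "bivector_field \<A> \<pi>" and c: "c \<in> \<A>" "x \<in> fst c"
    and f: "smooth_fun_on \<A> W f" and h: "smooth_fun_on \<A> W h" and x: "x \<in> W"
  shows "poisson_bracket \<A> \<pi> f h x =
    pbr (\<pi> c \<circ> chart_inv c) (f \<circ> chart_inv c) (h \<circ> chart_inv c) (snd c x)"
proof -
  have ch: "is_chart X c" using M c by (simp add: smooth_manifold_def)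
  have "(h \<circ> chart_inv c) differentiable (at (snd c x))"
    using smooth_fun_onD[OF h c(1)] c(2) x by (blast intro: smooth_on_differentiable)
  then show ?thesis
    unfolding poisson_bracket_chart[OF M B c f h x]
    by (simp add: pbr_def hvf_def differential_grad sharp_def frechet_derivative_grad chart_inv_chart[OF ch c(2)])
qed

lemma pbr_cong_open:
  assumes "open W" "x \<in> W" "\<And>y. y \<in> W \<Longrightarrow> f y = f' y" "\<And>y. y \<in> W \<Longrightarrow> h y = h' y"
    and "f differentiable (at x)" "h differentiable (at x)"
  shows "pbr \<pi> f' h' x = pbr \<pi> f h x"
  using frechet_derivative_cong_open[OF assms(1,2,3,5)] frechet_derivative_cong_open[OF assms(1,2,4,6)]
  by (simp add: pbr_def hvf_def grad_def)

text \<open>Functions on the chart image are lifted to the manifold along \<open>snd c\<close>. The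
  inner brackets agree with their coordinate expressions on the whole open set \<open>V\<close>,
  which is what the outer differentiation requires.\<close>

lemma chart_jacobi:
  fixes c :: "('m, real ^ 'n) chart"
  assumes PM: "poisson_manifold X \<A> \<pi>" and c: "c \<in> \<A>"
    and W: "open W" "W \<subseteq> snd c ` fst c" and s: "smooth_on f W" "smooth_on g W" "smooth_on h W" and y: "y \<in> W"
  defines "\<Pi>c \<equiv> \<pi> c \<circ> chart_inv c"
  shows "pbr \<Pi>c f (pbr \<Pi>c g h) y + pbr \<Pi>c g (pbr \<Pi>c h f) y + pbr \<Pi>c h (pbr \<Pi>c f g) y = 0"
proof -
  have M: "smooth_manifold X \<A>" and B: "bivector_field \<A> \<pi>" using PM by (auto simp: poisson_manifold_def)
  have ch: "is_chart X c" using M c by (simp add: smooth_manifold_def)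
  define V where "V = {x \<in> fst c. snd c x \<in> W}"
  have oV: "openin X V" unfolding V_def by (rule chart_openin_preimage[OF ch W(1)])
  have Vc: "V \<subseteq> fst c" by (auto simp: V_def)
  have cV: "snd c ` V = W" using W(2) by (auto simp: V_def)
  have inv: "chart_inv c w \<in> V" "snd c (chart_inv c w) = w" if "w \<in> W" for w
    using chart_image_inv[of w c] W(2) that by (auto simp: V_def)
  have sm: "smooth_fun_on \<A> V k" if "smooth_on k' W" "\<And>x. x \<in> V \<Longrightarrow> k x = k' (snd c x)" for k and k' :: "real ^ 'n \<Rightarrow> real"
  proof (rule smooth_fun_onI[OF M c oV Vc])
    show "smooth_on (k \<circ> chart_inv c) (snd c ` V)"
      unfolding cV by (rule smooth_on_cong[OF W(1) _ that(1)]) (use inv that(2) in auto)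
  qed
  have br: "poisson_bracket \<A> \<pi> k l x = pbr \<Pi>c k' l' (snd c x)"
    if "smooth_on k' W" "\<And>x. x \<in> V \<Longrightarrow> k x = k' (snd c x)" "smooth_on l' W" "\<And>x. x \<in> V \<Longrightarrow> l x = l' (snd c x)" "x \<in> V"
    for k l x and k' l' :: "real ^ 'n \<Rightarrow> real"
  proof -
    have cx: "snd c x \<in> W" "x \<in> fst c" using that(5) by (auto simp: V_def)
    have "pbr \<Pi>c (k \<circ> chart_inv c) (l \<circ> chart_inv c) (snd c x) = pbr \<Pi>c k' l' (snd c x)"
      by (rule pbr_cong_open[OF W(1) cx(1)])
         (use inv that smooth_on_differentiable[OF that(1) cx(1)] smooth_on_differentiable[OF that(3) cx(1)] in auto)
    then show ?thesis
      using poisson_bracket_pbr[OF M B c cx(2) sm[OF that(1,2)] sm[OF that(3,4)] that(5)] by (simp add: \<Pi>c_def)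
  qed
  have "smooth_on (\<pi> c \<circ> chart_inv c) (snd c ` (fst c \<inter> fst c))"
    using B c smooth_fun_onD unfolding bivector_field_def by blast
  then have Ps: "smooth_on \<Pi>c W" unfolding \<Pi>c_def using W(2) by (auto intro: smooth_on_subset)
  have spb: "smooth_on (pbr \<Pi>c k l) W" if "smooth_on k W" "smooth_on l W" for k l :: "real ^ 'n \<Rightarrow> real"
    unfolding pbr_def[abs_def] by (intro smooth_on_derivative_apply smooth_on_hvf W(1) Ps that)
  let ?f = "f \<circ> snd c" and ?g = "g \<circ> snd c" and ?h = "h \<circ> snd c"
  define x where "x = chart_inv c y"
  have x: "x \<in> V" "snd c x = y" using inv[OF y] by (auto simp: x_def)
  have b2: "poisson_bracket \<A> \<pi> (k \<circ> snd c) (poisson_bracket \<A> \<pi> (l \<circ> snd c) (q \<circ> snd c)) x = pbr \<Pi>c k (pbr \<Pi>c l q) y"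
    if "smooth_on k W" "smooth_on l W" "smooth_on q W" for k l q :: "real ^ 'n \<Rightarrow> real"
    unfolding x(2)[symmetric]
    by (rule br[OF that(1) _ spb[OF that(2,3)] _ x(1)]) (simp_all add: br[OF that(2) _ that(3)])
  have "poisson_bracket \<A> \<pi> ?f (poisson_bracket \<A> \<pi> ?g ?h) x + poisson_bracket \<A> \<pi> ?g (poisson_bracket \<A> \<pi> ?h ?f) x
     + poisson_bracket \<A> \<pi> ?h (poisson_bracket \<A> \<pi> ?f ?g) x = 0"
  proof -
    have "smooth_fun_on \<A> V ?f" "smooth_fun_on \<A> V ?g" "smooth_fun_on \<A> V ?h"
      by (rule sm[OF s(1)] sm[OF s(2)] sm[OF s(3)]; simp)+
    then show ?thesis using PM oV x(1) unfolding poisson_manifold_def by blast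
  qed
  then show ?thesis using b2[OF s(1,2,3)] b2[OF s(2,3,1)] b2[OF s(3,1,2)] by simp
qed

section \<open>Families of maps given by a smooth action\<close>

text \<open>Charts are taken in the parameter only, since the second variable already ranges over an
  open set of a vector space. There the derivative in \<open>x\<close> is the joint derivative in
  the direction \<open>(0, v)\<close>, and joint continuity is glued together over the chart
  domains.\<close>

lemma Cp_of_charts:
  fixes f :: "'g \<Rightarrow> 'a::real_normed_vector \<Rightarrow> 'b::real_normed_vector" and \<C> :: "('g, 'e::real_normed_vector) chart set"
  assumes S: "open S" and ch: "\<And>c. c \<in> \<C> \<Longrightarrow> is_chart T c" and cov: "\<And>g. g \<in> topspace T \<Longrightarrow> \<exists>c\<in>\<C>. g \<in> fst c"
    and F: "\<And>c. c \<in> \<C> \<Longrightarrow> \<exists>F. Ck_on k F ((snd c ` fst c) \<times> S) \<and> (\<forall>h\<in>fst c. \<forall>x\<in>S. f h x = F (snd c h, x))"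
  shows "Cp T k f S"
proof -
  have cont: "continuous_map (param_top T S) euclidean (\<lambda>(g, x). f g x)"
    if F: "\<And>c. c \<in> \<C> \<Longrightarrow> \<exists>F. continuous_on ((snd c ` fst c) \<times> S) F \<and> (\<forall>h\<in>fst c. \<forall>x\<in>S. f h x = F (snd c h, x))" for f :: "'g \<Rightarrow> 'a \<Rightarrow> 'b"
  proof (rule pasting_lemma[where I=\<C> and T="\<lambda>c. fst c \<times> S" and f="\<lambda>_. \<lambda>(g, x). f g x"])
    fix c assume c: "c \<in> \<C>"
    have oc: "openin T (fst c)" using ch[OF c] by (simp add: is_chart_def)
    then show "openin (param_top T S) (fst c \<times> S)" by (simp add: openin_prod_Times_iff)
    obtain F where F': "continuous_on ((snd c ` fst c) \<times> S) F" "\<And>h x. h \<in> fst c \<Longrightarrow> x \<in> S \<Longrightarrow> f h x = F (snd c h, x)"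
      using F[OF c] by blast
    have sub: "subtopology (param_top T S) (fst c \<times> S) = prod_topology (subtopology T (fst c)) (top_of_set S)"
      by (simp add: subtopology_Times subtopology_subtopology)
    have "continuous_map (subtopology T (fst c)) (top_of_set (snd c ` fst c)) (snd c)"
      using ch[OF c] unfolding is_chart_def by (blast intro: homeomorphic_imp_continuous_map)
    from continuous_map_compose[OF continuous_map_fst this, of "top_of_set S"]
    have "continuous_map (prod_topology (subtopology T (fst c)) (top_of_set S))
        (prod_topology (top_of_set (snd c ` fst c)) (top_of_set S)) (\<lambda>p. (snd c (fst p), snd p))"
      unfolding continuous_map_pairwise using continuous_map_snd[of "subtopology T (fst c)" "top_of_set S"] by (simp add: o_def)
    moreover have "continuous_map (prod_topology (top_of_set (snd c ` fst c)) (top_of_set S)) euclidean F"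
      unfolding prod_topology_subtopology_eu using F'(1) by simp
    ultimately have "continuous_map (prod_topology (subtopology T (fst c)) (top_of_set S)) euclidean (F \<circ> (\<lambda>p. (snd c (fst p), snd p)))"
      by (rule continuous_map_compose)
    then show "continuous_map (subtopology (param_top T S) (fst c \<times> S)) euclidean (\<lambda>(g, x). f g x)"
      unfolding sub by (rule continuous_map_eq) (use F'(2) in auto)
  next
    fix p assume "p \<in> topspace (param_top T S)"
    then show "\<exists>c. c \<in> \<C> \<and> p \<in> fst c \<times> S \<and> (case p of (g, x) \<Rightarrow> f g x) = (case p of (g, x) \<Rightarrow> f g x)"
      using cov by fastforce
  qed auto
  show ?thesis using F
  proof (induction k arbitrary: f)
    case 0
    then show ?case using cont[of f] by simp
  next
    case (Suc k)
    have oc: "open (snd c ` fst c)" if "c \<in> \<C>" for c using ch[OF that] by (simp add: is_chart_def)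
    have Fd: "\<exists>F. Ck_on k F ((snd c ` fst c) \<times> S) \<and> (\<forall>h\<in>fst c. \<forall>x\<in>S. f h differentiable (at x) \<and> frechet_derivative (f h) (at x) v = F (snd c h, x))"
      if c: "c \<in> \<C>" for c v
    proof -
      obtain F where F: "Ck_on (Suc k) F ((snd c ` fst c) \<times> S)" "\<And>h x. h \<in> fst c \<Longrightarrow> x \<in> S \<Longrightarrow> f h x = F (snd c h, x)"
        using Suc.prems[OF c] by blast
      have "(f h has_derivative (\<lambda>v. frechet_derivative F (at (snd c h, x)) (0, v))) (at x)" if "h \<in> fst c" "x \<in> S" for h x
      proof -
        have "(F has_derivative frechet_derivative F (at (snd c h, x))) (at (snd c h, x))"
          using F(1) that by (simp add: frechet_derivative_works[symmetric])
        then have "((\<lambda>x. F (snd c h, x)) has_derivative (\<lambda>v. frechet_derivative F (at (snd c h, x)) (0, v))) (at x)"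
          by (rule has_derivative_compose[rotated]) (auto intro!: derivative_eq_intros)
        then show ?thesis
          by (rule has_derivative_transform_within_open[OF _ S that(2)]) (use F(2) that(1) in auto)
      qed
      then have "f h differentiable (at x) \<and> frechet_derivative (f h) (at x) v = frechet_derivative F (at (snd c h, x)) (0, v)"
        if "h \<in> fst c" "x \<in> S" for h x
        using that by (metis differentiable_def frechet_derivative_at)
      then show ?thesis using F(1) by (intro exI[of _ "\<lambda>p. frechet_derivative F (at p) (0, v)"]) auto
    qed
    have d: "f h differentiable (at x)" if "h \<in> topspace T" "x \<in> S" for h x
      using cov[OF that(1)] Fd[of _ 0] that(2) by blast
    have "Cp T k (\<lambda>h x. frechet_derivative (f h) (at x) v) S" for v
      by (rule Suc.IH) (use Fd[of _ v] in blast)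
    moreover have "continuous_map (param_top T S) euclidean (\<lambda>(g, x). f g x)"
    proof (rule cont)
      fix c assume c: "c \<in> \<C>"
      obtain F where F: "Ck_on (Suc k) F ((snd c ` fst c) \<times> S)" "\<forall>h\<in>fst c. \<forall>x\<in>S. f h x = F (snd c h, x)"
        using Suc.prems[OF c] by blast
      have "continuous_on ((snd c ` fst c) \<times> S) F"
        using F(1) by (auto intro!: continuous_at_imp_continuous_on differentiable_imp_continuous_within)
      then show "\<exists>F. continuous_on ((snd c ` fst c) \<times> S) F \<and> (\<forall>h\<in>fst c. \<forall>x\<in>S. f h x = F (snd c h, x))" using F(2) by blast
    qed
    ultimately show ?case using d by simp
  qed
qed

section \<open>Inner products\<close>

text \<open>Gram-Schmidt with respect to \<open>\<beta>\<close>: \<open>T'\<close> sends the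
  standard basis to a \<open>\<beta>\<close>-orthonormal family, and \<open>T\<close> is its
  inverse.\<close>

lemma inner_product_isometry:
  fixes \<beta> :: "real ^ 'n \<Rightarrow> real ^ 'n \<Rightarrow> real"
  assumes l: "\<And>y. linear (\<lambda>x. \<beta> x y)" and sym: "\<And>x y. \<beta> x y = \<beta> y x" and pos: "\<And>x. x \<noteq> 0 \<Longrightarrow> \<beta> x x > 0"
  obtains T T' :: "real ^ 'n \<Rightarrow> real ^ 'n" where "linear T" "linear T'" "\<And>x. T (T' x) = x" "\<And>x. T' (T x) = x"
    "\<And>x y. T x \<bullet> T y = \<beta> x y"
proof -
  have lin: "\<beta> (\<Sum>i\<in>I. c i *\<^sub>R x i) y = (\<Sum>i\<in>I. c i * \<beta> (x i) y)" for I :: "'i set" and c x y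
    by (simp add: linear_sum[OF l] linear_scale[OF l])
  have "\<exists>E. \<forall>i<k. \<forall>j<k. \<beta> (E i) (E j) = (if i = j then 1 else 0)" if "k \<le> CARD('n)" for k :: nat
    using that
  proof (induction k)
    case (Suc k)
    then obtain E where E: "\<And>i j. i < k \<Longrightarrow> j < k \<Longrightarrow> \<beta> (E i) (E j) = (if i = j then 1 else 0)" by auto
    have "dim (span (E ` {..<k})) \<le> k"
      using dim_le_card'[of "E ` {..<k}"] card_image_le[of "{..<k}" E] by simp
    then have "span (E ` {..<k}) \<noteq> UNIV"
      using Suc.prems dim_UNIV[where 'a="real ^ 'n"] by (metis DIM_cart DIM_real mult.right_neutral not_less_eq_eq)
    then obtain x where x: "x \<notin> span (E ` {..<k})" by blast
    define w where "w = x - (\<Sum>i<k. \<beta> x (E i) *\<^sub>R E i)"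
    have "(\<Sum>i<k. \<beta> x (E i) *\<^sub>R E i) \<in> span (E ` {..<k})"
      by (intro span_sum span_scale span_base) auto
    then have "w \<noteq> 0" using x by (auto simp: w_def)
    then have bw: "\<beta> w w > 0" by (rule pos)
    have wE: "\<beta> w (E j) = 0" if "j < k" for j
    proof -
      have "\<beta> w (E j) = \<beta> x (E j) - (\<Sum>i<k. \<beta> x (E i) * \<beta> (E i) (E j))"
        unfolding w_def by (simp add: linear_diff[OF l] lin)
      also have "(\<Sum>i<k. \<beta> x (E i) * \<beta> (E i) (E j)) = (\<Sum>i<k. if i = j then \<beta> x (E i) else 0)"
        by (intro sum.cong) (auto simp: E that)
      finally show ?thesis using that by simp
    qed
    define u where "u = (1 / sqrt (\<beta> w w)) *\<^sub>R w"
    have uE: "\<beta> u (E j) = 0" if "j < k" for j using wE[OF that] by (simp add: u_def linear_scale[OF l])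
    have "\<beta> u u = (1 / sqrt (\<beta> w w)) * ((1 / sqrt (\<beta> w w)) * \<beta> w w)"
      unfolding u_def by (simp add: linear_scale[OF l] sym[of w "_ *\<^sub>R w"])
    then have uu: "\<beta> u u = 1" using bw by (simp add: field_simps)
    have "\<beta> ((E(k := u)) i) ((E(k := u)) j) = (if i = j then 1 else 0)" if "i < Suc k" "j < Suc k" for i j
      using that E[of i j] uE[of i] uE[of j] uu sym[of "E i" u] by (auto simp: less_Suc_eq)
    then show ?case by blast
  qed auto
  then obtain E where E: "\<And>i j. i < CARD('n) \<Longrightarrow> j < CARD('n) \<Longrightarrow> \<beta> (E i) (E j) = (if i = j then 1 else 0)"
    by blast
  obtain \<iota> :: "'n \<Rightarrow> nat" where \<iota>: "bij_betw \<iota> UNIV {..<CARD('n)}"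
    using ex_bij_betw_finite_nat[of "UNIV :: 'n set"] by (auto simp: atLeast0LessThan)
  have \<iota>': "\<iota> k < CARD('n)" "\<iota> k = \<iota> l \<longleftrightarrow> k = l" for k l using \<iota> by (auto simp: bij_betw_def inj_on_def)
  define T' where "T' y = (\<Sum>k\<in>UNIV. y $ k *\<^sub>R E (\<iota> k))" for y
  have lT': "linear T'"
    by (rule linearI) (simp_all add: T'_def scaleR_add_left sum.distrib scaleR_sum_right)
  have iso: "\<beta> (T' x) (T' y) = x \<bullet> y" for x y
  proof -
    have "\<beta> (T' x) (E (\<iota> l)) = x $ l" for l
    proof -
      have "\<beta> (T' x) (E (\<iota> l)) = (\<Sum>k\<in>UNIV. if k = l then x $ k else 0)"
        unfolding T'_def lin by (intro sum.cong) (auto simp: E \<iota>')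
      then show ?thesis by simp
    qed
    then have "\<beta> (T' y) (T' x) = (\<Sum>k\<in>UNIV. y $ k * x $ k)"
      unfolding T'_def[of y] lin by (simp add: sym[of "E _"])
    then show ?thesis by (simp add: inner_vec_def sym[of "T' x"] mult.commute)
  qed
  have "inj T'"
    unfolding linear_injective_0[OF lT']
  proof (intro allI impI)
    fix x assume x: "T' x = 0"
    have "\<beta> 0 0 = 0" using linear_0[OF l] by simp
    then show "x = 0" using iso[of x x] x by simp
  qed
  then obtain T where "linear T" "\<And>x. T (T' x) = x" "\<And>x. T' (T x) = x"
    using linear_injective_isomorphism[OF lT'] by blast
  then show ?thesis using that lT' iso by metis
qed

section \<open>Linearisation of a compact group action at a fixed point\<close>

context compact_topological_group
begin

lemma cont_mult: "cont f \<Longrightarrow> cont h \<Longrightarrow> cont (\<lambda>x. f x * h x)"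
  unfolding cont_def by (rule continuous_map_real_mult)

lemma cont_sum: "(\<And>i. i \<in> I \<Longrightarrow> cont (f i)) \<Longrightarrow> cont (\<lambda>x. \<Sum>i\<in>I. f i x)"
  by (induction I rule: infinite_finite_induct) (auto intro: cont_const cont_add)

lemma mean_sum:
  assumes "\<And>i. i \<in> I \<Longrightarrow> cont (f i)"
  shows "mean (\<lambda>x. \<Sum>i\<in>I. c i * f i x) = (\<Sum>i\<in>I. c i * mean (f i))"
  using assms
proof (induction I rule: infinite_finite_induct)
  case (insert i I)
  have "mean (\<lambda>x. c i * f i x + (\<Sum>i\<in>I. c i * f i x)) = mean (\<lambda>x. c i * f i x) + mean (\<lambda>x. \<Sum>i\<in>I. c i * f i x)"
    using insert.prems by (intro mean_add cont_sum cont_cmult) auto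
  then show ?case using insert mean_cmult[of "f i" "c i"] by simp
qed (simp_all add: mean_const)

text \<open>Strict positivity survives averaging because a continuous function attains its minimum
  on the compact group.\<close>

lemma mean_pos:
  assumes f: "cont f" and pos: "\<And>x. x \<in> carrier G \<Longrightarrow> f x > 0"
  shows "mean f > 0"
proof -
  have "compactin euclideanreal (f ` topspace T)"
    by (rule image_compactin[OF _ f[unfolded cont_def]]) (use compact_T in \<open>simp add: compact_space_def\<close>)
  then have "compact (f ` carrier G)" by (simp add: topspace_T)
  moreover have "f ` carrier G \<noteq> {}" by auto
  ultimately obtain x where x: "x \<in> carrier G" "\<And>y. y \<in> carrier G \<Longrightarrow> f x \<le> f y"
    using compact_attains_inf[of "f ` carrier G"] by auto
  then show ?thesis using mean_ge[OF f x(2)] pos[OF x(1)] by linarith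
qed

end

text \<open>By the tube lemma over the compact \<open>T\<close>, an orbit inside \<open>W\<close>
  has only orbits inside \<open>W\<close> near it. For a group action the set is the largest
  invariant subset of \<open>W\<close>; in this way non-invariant chart domains are replaced by
  invariant ones.\<close>

lemma stable_subset_openin:
  assumes T: "compact_space T" and c: "continuous_map (prod_topology T X) X (\<lambda>(g, x). \<rho> g x)" and W: "openin X W"
  shows "openin X {x \<in> W. \<forall>g\<in>topspace T. \<rho> g x \<in> W}"
proof (subst openin_subopen, intro ballI)
  fix x assume x: "x \<in> {x \<in> W. \<forall>g\<in>topspace T. \<rho> g x \<in> W}"
  let ?P = "{p \<in> topspace (prod_topology T X). (\<lambda>(g, x). \<rho> g x) p \<in> W}"
  have P: "openin (prod_topology T X) ?P" by (rule openin_continuous_map_preimage[OF c W])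
  have xX: "x \<in> topspace X" using x openin_subset[OF W] by auto
  have "\<exists>U V. openin T U \<and> openin X V \<and> topspace T \<subseteq> U \<and> x \<in> V \<and> U \<times> V \<subseteq> ?P"
    by (rule tube_lemma_left[OF P]) (use T x xX in \<open>auto simp: compact_space_def\<close>)
  then obtain U V where UV: "openin X V" "topspace T \<subseteq> U" "x \<in> V" "U \<times> V \<subseteq> ?P" by blast
  have "\<rho> g y \<in> W" if "g \<in> topspace T" "y \<in> V" for g y
  proof -
    have "(g, y) \<in> ?P" using UV(2,4) that by blast
    then show ?thesis by simp
  qed
  then have "V \<inter> W \<subseteq> {x \<in> W. \<forall>g\<in>topspace T. \<rho> g x \<in> W}" by blast
  then show "\<exists>V. openin X V \<and> x \<in> V \<and> V \<subseteq> {x \<in> W. \<forall>g\<in>topspace T. \<rho> g x \<in> W}"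
    using UV(1,3) W x by (intro exI[of _ "V \<inter> W"]) auto
qed

lemma compact_lie_group_topological:
  assumes "compact_lie_group G T \<G>"
  shows "compact_topological_group G T"
proof -
  have "group G" using assms by (simp add: compact_lie_group_def lie_group_def)
  moreover have "compact_topological_group_axioms G T"
    using assms by unfold_locales (auto simp: compact_lie_group_def lie_group_def smooth_map_def)
  ultimately show ?thesis by (simp add: compact_topological_group_def)
qed

text \<open>
  Averaging \<open>D\<rho>\<^sub>g(m)\<^sup>-\<^sup>1 \<circ> \<rho>\<^sub>g\<close> over the group gives a chart in which the action is linear; a linear change
  of coordinates turns the averaged inner product into the standard one.
\<close>

theorem linearizing_chart:
  fixes X :: "'m topology" and \<A> :: "('m, real ^ 'n) chart set"
    and G :: "('g, 'b) monoid_scheme" (structure) and \<G> :: "('g, 'e::real_normed_vector) chart set"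
  assumes M: "smooth_manifold X \<A>" and CG: "compact_lie_group G T \<G>" and act: "smooth_action G T \<G> X \<A> \<rho>"
    and m: "m \<in> topspace X" and fixm: "\<And>g. g \<in> carrier G \<Longrightarrow> \<rho> g m = m" and V: "openin X V" "m \<in> V"
  obtains c L where "c \<in> \<A>" "m \<in> fst c" "fst c \<subseteq> V" "snd c m = 0"
    "\<And>g x. g \<in> carrier G \<Longrightarrow> x \<in> fst c \<Longrightarrow> \<rho> g x \<in> fst c"
    "\<And>g. g \<in> carrier G \<Longrightarrow> orthogonal_transformation (L g)"
    "\<And>g x. g \<in> carrier G \<Longrightarrow> x \<in> fst c \<Longrightarrow> snd c (\<rho> g x) = L g (snd c x)"
proof -
  interpret compact_topological_group G T by (rule compact_lie_group_topological[OF CG])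
  have MT: "smooth_manifold T \<G>" using CG by (simp add: compact_lie_group_def lie_group_def)
  have ga: "group_action G (topspace X) \<rho>"
    and sm: "smooth_map (prod_topology T X) (prod_atlas \<G> \<A>) X \<A> (\<lambda>(g, x). \<rho> g x)"
    using act by (auto simp: smooth_action_def)
  have cont\<rho>: "continuous_map (prod_topology T X) X (\<lambda>(g, x). \<rho> g x)" using sm by (simp add: smooth_map_def)
  have \<rho>mult: "\<rho> (g \<otimes> h) x = \<rho> g (\<rho> h x)" if "g \<in> carrier G" "h \<in> carrier G" "x \<in> topspace X" for g h x
    using group_action.composition_rule[OF ga that(3,1,2)] .
  have \<rho>one: "\<rho> \<one> x = x" if "x \<in> topspace X" for x
    using group_action.id_eq_one[OF ga] that by (metis restrict_apply')
  have ch: "is_chart X c" if "c \<in> \<A>" for c using M that by (simp add: smooth_manifold_def)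
  obtain c0 where c0: "c0 \<in> \<A>" "m \<in> fst c0" using M m unfolding smooth_manifold_def by blast
  have oc0: "openin X (fst c0)" using ch[OF c0(1)] by (simp add: is_chart_def)
  have inv0: "chart_inv c0 (snd c0 x) = x" if "x \<in> fst c0" for x by (rule chart_inv_chart[OF ch[OF c0(1)] that])

  \<comment> \<open>The action in a chart on an invariant domain\<close>
  define W1 where "W1 = V \<inter> fst c0"
  have oW1: "openin X W1" unfolding W1_def using V(1) oc0 by blast
  have stable: "x \<in> topspace X" "\<And>g. g \<in> carrier G \<Longrightarrow> \<rho> g x \<in> {x \<in> W. \<forall>g\<in>topspace T. \<rho> g x \<in> W}"
    if W: "openin X W" and x: "x \<in> {x \<in> W. \<forall>g\<in>topspace T. \<rho> g x \<in> W}" for W x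
  proof -
    show xX: "x \<in> topspace X" using x openin_subset[OF W] by auto
    show "\<rho> g x \<in> {x \<in> W. \<forall>g\<in>topspace T. \<rho> g x \<in> W}" if g: "g \<in> carrier G" for g
    proof -
      have "\<rho> h (\<rho> g x) \<in> W" if "h \<in> carrier G" for h
        using x \<rho>mult[OF that g xX] m_closed[OF that g] by (auto simp: topspace_T)
      then show ?thesis using x g by (auto simp: topspace_T)
    qed
  qed
  define U1 where "U1 = {x \<in> W1. \<forall>g\<in>topspace T. \<rho> g x \<in> W1}"
  have oU1: "openin X U1" unfolding U1_def by (rule stable_subset_openin[OF compact_T cont\<rho> oW1])
  have mU1: "m \<in> U1" using c0(2) V(2) fixm by (auto simp: U1_def W1_def topspace_T)
  have U1c: "U1 \<subseteq> fst c0" "U1 \<subseteq> V" by (auto simp: U1_def W1_def)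
  have U1\<rho>: "\<rho> g x \<in> U1" if "g \<in> carrier G" "x \<in> U1" for g x
    using stable(2)[OF oW1] that unfolding U1_def by blast
  have U1X: "x \<in> topspace X" if "x \<in> U1" for x using stable(1)[OF oW1] that unfolding U1_def by blast
  define S1 where "S1 = snd c0 ` U1"
  have oS1: "open S1"
    unfolding S1_def using open_chart_image[OF ch[OF c0(1)] oU1] U1c(1) by (simp add: Int_absorb1)
  define R where "R g y = snd c0 (\<rho> g (chart_inv c0 y))" for g y
  define y0 where "y0 = snd c0 m"
  have y0: "y0 \<in> S1" using mU1 by (simp add: S1_def y0_def)
  have Rx: "R g (snd c0 x) = snd c0 (\<rho> g x)" if "x \<in> U1" for g x
    using inv0[of x] that U1c(1) by (auto simp: R_def)
  have RS: "R g y \<in> S1" if "g \<in> carrier G" "y \<in> S1" for g y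
    using that Rx U1\<rho> by (auto simp: S1_def)
  have Rmult: "R (g \<otimes> h) y = R g (R h y)" if "g \<in> carrier G" "h \<in> carrier G" "y \<in> S1" for g h y
    using that Rx U1\<rho> \<rho>mult U1X by (auto simp: S1_def)
  have Rone: "R \<one> y = y" if "y \<in> S1" for y using that Rx \<rho>one U1X by (auto simp: S1_def)
  have Ry0: "R g y0 = y0" if "g \<in> carrier G" for g using Rx[OF mU1] fixm[OF that] by (simp add: y0_def)
  have CR: "Cp T k R S1" for k
  proof (rule Cp_of_charts[OF oS1, where \<C>=\<G>])
    show "is_chart T c" if "c \<in> \<G>" for c using MT that by (simp add: smooth_manifold_def)
    show "\<exists>c\<in>\<G>. g \<in> fst c" if "g \<in> topspace T" for g using MT that unfolding smooth_manifold_def by blast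
    fix c assume c: "c \<in> \<G>"
    have chc: "is_chart T c" using MT c by (simp add: smooth_manifold_def)
    let ?p = "(fst c \<times> fst c0, map_prod (snd c) (snd c0))"
    let ?F = "snd c0 \<circ> (\<lambda>(g, x). \<rho> g x) \<circ> chart_inv ?p"
    have "?p \<in> prod_atlas \<G> \<A>" using c c0(1) unfolding prod_atlas_def by blast
    then have F: "smooth_on ?F (snd ?p ` (fst ?p \<inter> (\<lambda>(g, x). \<rho> g x) -` fst c0))"
      using sm c0(1) unfolding smooth_map_def by blast
    have pinv: "chart_inv ?p (snd c h, snd c0 x) = (h, x)" if "h \<in> fst c" "x \<in> fst c0" for h x
    proof -
      have "inj_on (map_prod (snd c) (snd c0)) (fst c \<times> fst c0)"
      proof (rule inj_onI)
        fix p q assume pq: "p \<in> fst c \<times> fst c0" "q \<in> fst c \<times> fst c0" "map_prod (snd c) (snd c0) p = map_prod (snd c) (snd c0) q"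
        then have "snd c (fst p) = snd c (fst q)" "snd c0 (snd p) = snd c0 (snd q)" by (auto simp: map_prod_def split_beta)
        then have "fst p = fst q" "snd p = snd q"
          using pq(1,2) chart_inv_chart[OF chc] inv0 by (metis mem_Times_iff)+
        then show "p = q" by (rule prod_eqI)
      qed
      from inv_into_f_f[OF this, of "(h, x)"] show ?thesis using that by simp
    qed
    have "snd c ` fst c \<times> S1 \<subseteq> snd ?p ` (fst ?p \<inter> (\<lambda>(g, x). \<rho> g x) -` fst c0)"
    proof
      fix q assume "q \<in> snd c ` fst c \<times> S1"
      then obtain h x where q: "q = (snd c h, snd c0 x)" "h \<in> fst c" "x \<in> U1" by (auto simp: S1_def)
      have "h \<in> carrier G" using q(2) chc openin_subset topspace_T unfolding is_chart_def by blast
      then have "\<rho> h x \<in> fst c0" using U1\<rho>[OF _ q(3)] U1c(1) by blast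
      then show "q \<in> snd ?p ` (fst ?p \<inter> (\<lambda>(g, x). \<rho> g x) -` fst c0)"
        using q U1c(1) by (intro image_eqI[of _ _ "(h, x)"]) auto
    qed
    then have "Ck_on k ?F (snd c ` fst c \<times> S1)" using F unfolding smooth_on_def by (blast intro: Ck_on_subset)
    moreover have "R h y = ?F (snd c h, y)" if hc: "h \<in> fst c" and y: "y \<in> S1" for h y
    proof -
      obtain x where x: "x \<in> U1" "y = snd c0 x" using y by (auto simp: S1_def)
      then have "x \<in> fst c0" using U1c(1) by blast
      from pinv[OF hc this] show ?thesis unfolding x(2) Rx[OF x(1)] by simp
    qed
    ultimately show "\<exists>F. Ck_on k F (snd c ` fst c \<times> S1) \<and> (\<forall>h\<in>fst c. \<forall>x\<in>S1. R h x = F (snd c h, x))" by blast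
  qed

  \<comment> \<open>The isotropy representation\<close>
  define L0 where "L0 g = frechet_derivative (R g) (at y0)" for g
  have dR: "(R g has_derivative L0 g) (at y0)" if "g \<in> carrier G" for g
    unfolding L0_def using Cp_SucD(2)[OF CR[of "Suc 0"] _ y0] that by (simp add: topspace_T)
  have linL0: "linear (L0 g)" if "g \<in> carrier G" for g using dR[OF that] has_derivative_linear by blast
  have L0mult: "L0 (g \<otimes> h) v = L0 g (L0 h v)" if g: "g \<in> carrier G" and h: "h \<in> carrier G" for g h v
  proof -
    have d: "R h differentiable (at y0)" "R g differentiable (at (R h y0))"
      using dR[OF h] dR[OF g] Ry0[OF h] by (auto simp: differentiable_def)
    have "R (g \<otimes> h) differentiable (at y0)" using dR[of "g \<otimes> h"] g h by (auto simp: differentiable_def)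
    then have "frechet_derivative (\<lambda>y. R g (R h y)) (at y0) = L0 (g \<otimes> h)"
      unfolding L0_def by (intro frechet_derivative_cong_open[OF oS1 y0]) (use Rmult[OF g h] in auto)
    then show ?thesis using frechet_derivative_compose'[OF d, of v] Ry0[OF h] by (simp add: L0_def)
  qed
  have L0one: "L0 \<one> v = v" for v
  proof -
    have "R \<one> differentiable (at y0)" using dR[of \<one>] by (auto simp: differentiable_def)
    then have "frechet_derivative (\<lambda>y. y) (at y0) = L0 \<one>"
      unfolding L0_def by (intro frechet_derivative_cong_open[OF oS1 y0]) (use Rone in auto)
    then show ?thesis by (metis frechet_derivative_ident)
  qed
  have L0inv: "L0 (inv g) (L0 g v) = v" if "g \<in> carrier G" for g v
    using L0mult[of "inv g" g v] that L0one by simp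
  have contL0: "cont (\<lambda>g. L0 g v $ i)" for v i
  proof -
    have "Cp T 0 (\<lambda>g y. frechet_derivative (R g) (at y) v $ i) S1"
      by (rule Cp_bounded_linear[OF oS1 bounded_linear_vec_nth Cp_SucD(1)[OF CR]])
    from cont_slice[OF Cp_continuous[OF this] y0] show ?thesis by (simp add: L0_def)
  qed

  \<comment> \<open>The averaged equivariant map\<close>
  define E where "E h y = L0 (inv h) (R h y - y0)" for h y
  have E: "E h y $ i = (\<Sum>j\<in>UNIV. (R h y - y0) $ j * L0 (inv h) (axis j 1) $ i)" if "h \<in> carrier G" for h y i
    using linear_axis_expansion[OF linL0[OF inv_closed[OF that]], of "R h y - y0"] by (simp add: E_def sum_component)
  have CE: "Cp T k (\<lambda>h y. E h y $ i) S1" for k i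
  proof -
    have "Cp T k (\<lambda>h y. \<Sum>j\<in>UNIV. (R h y - y0) $ j * L0 (inv h) (axis j 1) $ i) S1"
    proof (intro Cp_sum Cp_mult oS1)
      fix j
      show "Cp T k (\<lambda>h y. (R h y - y0) $ j) S1"
        by (rule Cp_bounded_linear[OF oS1 bounded_linear_vec_nth Cp_diff[OF oS1 CR Cp_const[OF oS1]]])
      show "Cp T k (\<lambda>h y. L0 (inv h) (axis j 1) $ i) S1"
        by (rule Cp_param_const[OF oS1]) (use cont_inv[OF contL0[of "axis j 1" i]] in \<open>simp add: cont_def\<close>)
    qed
    then show ?thesis by (rule Cp_cong[OF oS1, rotated]) (simp add: E topspace_T)
  qed
  have contE: "cont (\<lambda>h. E h y $ i)" if "y \<in> S1" for y i
    by (rule cont_slice[OF Cp_continuous[OF CE[of 0]] that])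
  define B where "B y = (\<chi> i. mean (\<lambda>h. E h y $ i))" for y
  have sB: "smooth_on B S1"
  proof (rule smooth_on_vecI[OF oS1])
    show "smooth_on (\<lambda>y. B y $ i) S1" for i
      unfolding smooth_on_def B_def using Ck_on_mean[OF oS1 CE] by simp
  qed
  have B0: "B y0 = 0"
  proof -
    have "mean (\<lambda>h. E h y0 $ i) = mean (\<lambda>_. 0)" for i
      by (rule mean_cong) (simp add: E Ry0)
    then show ?thesis by (simp add: B_def mean_const Finite_Cartesian_Product.vec_eq_iff)
  qed
  \<comment> \<open>\<open>E h (R g y)\<close> is \<open>L0 g\<close> applied to
    \<open>E (h \<otimes> g) y\<close>, so right invariance of the mean removes the shift by
    \<open>g\<close> and \<open>L0 g\<close> moves outside. Its matrix entries appear because the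
    mean is defined for real functions, one component at a time.\<close>
  have BR: "B (R g y) = L0 g (B y)" if g: "g \<in> carrier G" and y: "y \<in> S1" for g y
  proof -
    have ER: "E h (R g y) $ i = (\<Sum>j\<in>UNIV. L0 g (axis j 1) $ i * E (h \<otimes> g) y $ j)" if h: "h \<in> carrier G" for h i
    proof -
      have "E h (R g y) = L0 (inv h) (R (h \<otimes> g) y - y0)" by (simp add: E_def Rmult[OF h g y])
      also have "inv h = g \<otimes> inv (h \<otimes> g)" using g h by (simp add: inv_mult_group m_assoc[symmetric])
      also have "L0 (g \<otimes> inv (h \<otimes> g)) (R (h \<otimes> g) y - y0) = L0 g (E (h \<otimes> g) y)"
        unfolding E_def by (rule L0mult) (use g h in auto)
      finally show ?thesis
        using linear_axis_expansion[OF linL0[OF g], of "E (h \<otimes> g) y"] by (simp add: sum_component mult.commute)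
    qed
    have "B (R g y) $ i = L0 g (B y) $ i" for i
    proof -
      have "B (R g y) $ i = mean (\<lambda>h. \<Sum>j\<in>UNIV. L0 g (axis j 1) $ i * E (h \<otimes> g) y $ j)"
        unfolding B_def vec_lambda_beta by (rule mean_cong[OF ER])
      also have "\<dots> = (\<Sum>j\<in>UNIV. L0 g (axis j 1) $ i * mean (\<lambda>h. E (h \<otimes> g) y $ j))"
        by (rule mean_sum) (rule cont_right[OF contE[OF y] g])
      also have "\<dots> = (\<Sum>j\<in>UNIV. L0 g (axis j 1) $ i * B y $ j)"
        by (intro sum.cong refl) (simp add: B_def mean_right_invariant[OF contE[OF y] g])
      also have "\<dots> = L0 g (B y) $ i"
        using linear_axis_expansion[OF linL0[OF g], of "B y"] by (simp add: sum_component mult.commute)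
      finally show ?thesis .
    qed
    then show ?thesis by (simp add: Finite_Cartesian_Product.vec_eq_iff)
  qed
  \<comment> \<open>Each averaged map has the derivative \<open>L0 (inv h)\<close> after
    \<open>L0 h\<close>, which is the identity; hence so has the mean.\<close>
  have DB: "frechet_derivative B (at y0) v = v" for v
  proof -
    have "frechet_derivative B (at y0) v $ i = v $ i" for i
    proof -
      have dE: "frechet_derivative (\<lambda>y. E h y $ i) (at y0) v = v $ i" if h: "h \<in> carrier G" for h
      proof -
        have bl: "bounded_linear (L0 (inv h))" using linL0[OF inv_closed[OF h]] linear_conv_bounded_linear by blast
        have "((\<lambda>y. R h y - y0) has_derivative L0 h) (at y0)"
          using has_derivative_diff[OF dR[OF h] has_derivative_const[of y0]] by simp
        then have "((\<lambda>y. E h y $ i) has_derivative (\<lambda>v. L0 (inv h) (L0 h v) $ i)) (at y0)"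
          unfolding E_def by (intro bounded_linear.has_derivative[OF bounded_linear_vec_nth] bounded_linear.has_derivative[OF bl])
        from frechet_derivative_at[OF this, symmetric] show ?thesis by (simp add: L0inv[OF h])
      qed
      have "((\<lambda>y. mean (\<lambda>h. E h y $ i)) has_derivative (\<lambda>v. mean (\<lambda>h. frechet_derivative (\<lambda>y. E h y $ i) (at y0) v))) (at y0)"
        by (rule has_derivative_mean[OF oS1 CE y0])
      from frechet_derivative_at[OF this, symmetric]
      have "frechet_derivative (\<lambda>y. mean (\<lambda>h. E h y $ i)) (at y0) v = mean (\<lambda>h. frechet_derivative (\<lambda>y. E h y $ i) (at y0) v)" by simp
      also have "\<dots> = mean (\<lambda>_. v $ i)" by (rule mean_cong) (rule dE)
      finally have "frechet_derivative (\<lambda>y. B y $ i) (at y0) v = v $ i" by (simp add: B_def mean_const)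
      then show ?thesis using frechet_derivative_nth[OF smooth_on_differentiable[OF sB y0], of i v] by simp
    qed
    then show ?thesis by (simp add: Finite_Cartesian_Product.vec_eq_iff)
  qed

  \<comment> \<open>An invariant inner product\<close>
  define \<beta> where "\<beta> x y = mean (\<lambda>g. \<Sum>i\<in>UNIV. L0 g x $ i * L0 g y $ i)" for x y
  have cont\<beta>: "cont (\<lambda>g. \<Sum>i\<in>UNIV. L0 g x $ i * L0 g y $ i)" for x y
    by (intro cont_sum cont_mult contL0)
  have \<beta>inv: "\<beta> (L0 h x) (L0 h y) = \<beta> x y" if h: "h \<in> carrier G" for h x y
  proof -
    have "\<beta> (L0 h x) (L0 h y) = mean (\<lambda>g. \<Sum>i\<in>UNIV. L0 (g \<otimes> h) x $ i * L0 (g \<otimes> h) y $ i)"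
      unfolding \<beta>_def by (rule mean_cong) (simp add: L0mult h)
    also have "\<dots> = \<beta> x y" unfolding \<beta>_def by (rule mean_right_invariant[OF cont\<beta> h])
    finally show ?thesis .
  qed
  have \<beta>lin: "linear (\<lambda>x. \<beta> x y)" for y
  proof (rule linearI)
    fix a b
    have "\<beta> (a + b) y = mean (\<lambda>g. (\<Sum>i\<in>UNIV. L0 g a $ i * L0 g y $ i) + (\<Sum>i\<in>UNIV. L0 g b $ i * L0 g y $ i))"
      unfolding \<beta>_def by (rule mean_cong) (simp add: linear_add[OF linL0] distrib_right sum.distrib)
    then show "\<beta> (a + b) y = \<beta> a y + \<beta> b y" unfolding \<beta>_def by (simp add: mean_add cont\<beta>)
  next
    fix r a
    have "\<beta> (r *\<^sub>R a) y = mean (\<lambda>g. r * (\<Sum>i\<in>UNIV. L0 g a $ i * L0 g y $ i))"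
      unfolding \<beta>_def by (rule mean_cong) (simp add: linear_scale[OF linL0] sum_distrib_left mult.assoc)
    then show "\<beta> (r *\<^sub>R a) y = r *\<^sub>R \<beta> a y" unfolding \<beta>_def by (simp add: mean_cmult cont\<beta>)
  qed
  have \<beta>sym: "\<beta> x y = \<beta> y x" for x y by (simp add: \<beta>_def mult.commute)
  have \<beta>pos: "\<beta> x x > 0" if "x \<noteq> 0" for x
    unfolding \<beta>_def
  proof (rule mean_pos[OF cont\<beta>])
    fix g assume g: "g \<in> carrier G"
    have "L0 g x \<noteq> 0" using L0inv[OF g, of x] that linear_0[OF linL0[OF inv_closed[OF g]]] by metis
    then have "L0 g x \<bullet> L0 g x > 0" by simp
    then show "(\<Sum>i\<in>UNIV. L0 g x $ i * L0 g x $ i) > 0" by (simp only: inner_vec_def inner_real_def)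
  qed
  obtain A A' :: "real ^ 'n \<Rightarrow> real ^ 'n" where A: "linear A" "linear A'" "\<And>x. A (A' x) = x" "\<And>x. A' (A x) = x"
    "\<And>x y. A x \<bullet> A y = \<beta> x y"
  proof (rule inner_product_isometry[OF \<beta>lin \<beta>sym \<beta>pos])
    fix S S' :: "real ^ 'n \<Rightarrow> real ^ 'n"
    assume S: "linear S" "linear S'" "\<And>x. S (S' x) = x" "\<And>x. S' (S x) = x" "\<And>x y. S x \<bullet> S y = \<beta> x y"
    show thesis by (rule that[OF S])
  qed
  have blA: "bounded_linear A" using A(1) linear_conv_bounded_linear by blast

  \<comment> \<open>The linearising chart\<close>
  define \<psi> where "\<psi> y = A (B y)" for y
  have s\<psi>: "smooth_on \<psi> S1" unfolding \<psi>_def[abs_def] by (rule smooth_on_bounded_linear[OF oS1 blA sB])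
  have D\<psi>: "frechet_derivative \<psi> (at y0) v = A v" for v
  proof -
    have "(\<psi> has_derivative (\<lambda>v. A (frechet_derivative B (at y0) v))) (at y0)"
      unfolding \<psi>_def[abs_def] by (intro bounded_linear.has_derivative[OF blA] smooth_on_has_derivative[OF sB y0])
    from frechet_derivative_at[OF this, symmetric] show ?thesis by (simp add: DB)
  qed
  have "v = 0" if "frechet_derivative \<psi> (at y0) v = 0" for v
    using that A(4)[of v] linear_0[OF A(2)] by (simp add: D\<psi>)
  then obtain U' V' \<psi>' where UV: "open U'" "U' \<subseteq> S1" "y0 \<in> U'" "open V'" "homeomorphism U' V' \<psi> \<psi>'" "smooth_on \<psi>' V'"
    by (rule smooth_inverse_function[OF oS1 s\<psi> y0]) blast
  \<comment> \<open>The domain on which \<open>\<psi>\<close> is invertible need not be invariant,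
    so the passage to the stable part is made a second time.\<close>
  define W2 where "W2 = {x \<in> fst c0. snd c0 x \<in> U'} \<inter> U1"
  have oW2: "openin X W2" unfolding W2_def using chart_openin_preimage[OF ch[OF c0(1)] UV(1)] oU1 by blast
  define U2 where "U2 = {x \<in> W2. \<forall>g\<in>topspace T. \<rho> g x \<in> W2}"
  have oU2: "openin X U2" unfolding U2_def by (rule stable_subset_openin[OF compact_T cont\<rho> oW2])
  have mU2: "m \<in> U2" using c0(2) mU1 UV(3) fixm by (auto simp: U2_def W2_def topspace_T y0_def)
  have U21: "U2 \<subseteq> U1" "U2 \<subseteq> fst c0" using U1c by (auto simp: U2_def W2_def)
  have U2\<rho>: "\<rho> g x \<in> U2" if "g \<in> carrier G" "x \<in> U2" for g x
    using stable(2)[OF oW2] that unfolding U2_def by blast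
  define S2 where "S2 = snd c0 ` U2"
  have oS2: "open S2"
    unfolding S2_def using open_chart_image[OF ch[OF c0(1)] oU2] U21(2) by (simp add: Int_absorb1)
  have S2U: "S2 \<subseteq> U'" by (auto simp: S2_def U2_def W2_def)
  have "\<psi> ` S2 = \<psi>' -` S2 \<inter> V'"
  proof
    show "\<psi> ` S2 \<subseteq> \<psi>' -` S2 \<inter> V'" using UV(5) S2U by (auto simp: homeomorphism_def subset_iff)
    show "\<psi>' -` S2 \<inter> V' \<subseteq> \<psi> ` S2"
    proof
      fix y assume "y \<in> \<psi>' -` S2 \<inter> V'"
      then show "y \<in> \<psi> ` S2" using UV(5) by (intro image_eqI[of _ _ "\<psi>' y"]) (auto simp: homeomorphism_def)
    qed
  qed
  moreover have "open (\<psi>' -` S2 \<inter> V')"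
    using UV(4) oS2 continuous_on_open_vimage smooth_on_continuous[OF UV(6)] by blast
  ultimately have oR: "open (\<psi> ` S2)" by simp
  have RV: "\<psi> ` S2 \<subseteq> V'" using UV(5) S2U by (auto simp: homeomorphism_def)
  have hom: "homeomorphism S2 (\<psi> ` S2) \<psi> \<psi>'"
    by (rule homeomorphism_of_subsets[OF UV(5) S2U RV refl])
  have S2c: "S2 \<subseteq> snd c0 ` fst c0" using U21(2) by (auto simp: S2_def)
  have S2S1: "S2 \<subseteq> S1" using S2U UV(2) by blast
  note cc = chart_compose[OF M c0(1) oS2 S2c oR hom smooth_on_subset[OF s\<psi> S2S1] smooth_on_subset[OF UV(6) RV]]
  have dom: "{x \<in> fst c0. snd c0 x \<in> S2} = U2"
  proof
    show "{x \<in> fst c0. snd c0 x \<in> S2} \<subseteq> U2"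
    proof clarify
      fix x assume "x \<in> fst c0" "snd c0 x \<in> S2"
      then obtain x' where "x' \<in> U2" "snd c0 x = snd c0 x'" by (auto simp: S2_def)
      then show "x \<in> U2" using inv0[OF \<open>x \<in> fst c0\<close>] inv0[of x'] U21(2) by (metis subsetD)
    qed
  qed (use U21(2) in \<open>auto simp: S2_def\<close>)
  show ?thesis
  \<comment> \<open>Conjugation by \<open>A\<close> turns the isotropy representation, which
    preserves \<open>\<beta>\<close>, into orthogonal maps.\<close>
  proof (rule that[of "(U2, \<psi> \<circ> snd c0)" "\<lambda>g x. A (L0 g (A' x))"])
    show "(U2, \<psi> \<circ> snd c0) \<in> \<A>" using cc(1) unfolding dom .
    show "snd (U2, \<psi> \<circ> snd c0) m = 0" using B0 linear_0[OF A(1)] by (simp add: \<psi>_def y0_def)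
    show "orthogonal_transformation (\<lambda>x. A (L0 g (A' x)))" if g: "g \<in> carrier G" for g
      unfolding orthogonal_transformation_def
    proof
      show "linear (\<lambda>x. A (L0 g (A' x)))"
        using linear_compose[OF linear_compose[OF A(2) linL0[OF g]] A(1)] by (simp add: o_def)
      have "A (L0 g (A' x)) \<bullet> A (L0 g (A' y)) = A (A' x) \<bullet> A (A' y)" for x y
        by (simp only: A(5) \<beta>inv[OF g])
      then show "\<forall>x y. A (L0 g (A' x)) \<bullet> A (L0 g (A' y)) = x \<bullet> y" by (simp add: A(3))
    qed
    show "snd (U2, \<psi> \<circ> snd c0) (\<rho> g x) = A (L0 g (A' (snd (U2, \<psi> \<circ> snd c0) x)))"
      if "g \<in> carrier G" "x \<in> fst (U2, \<psi> \<circ> snd c0)" for g x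
    proof -
      have x: "x \<in> U1" "snd c0 x \<in> S1" using that(2) U21(1) by (auto simp: S1_def)
      show ?thesis using BR[OF that(1) x(2)] Rx[OF x(1), of g] A(4) by (simp add: \<psi>_def)
    qed
  qed (use mU2 U21(1) U1c(2) U2\<rho> in auto)
qed

section \<open>The normal form of the bivector\<close>

definition normal_form :: "nat \<Rightarrow> nat \<Rightarrow> (coord \<Rightarrow> 'n::finite) \<Rightarrow> (nat \<Rightarrow> nat \<Rightarrow> real) \<Rightarrow> real ^ 'n ^ 'n" where
  "normal_form r s e \<gamma> = (\<Sum>i<r. wedge (coord_vf e (Q i)) (coord_vf e (P i))) +
     (\<Sum>i<s. \<Sum>j<s. \<gamma> i j *\<^sub>R wedge (coord_vf e (Z i)) (coord_vf e (Z j)))"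

definition pq_coeff :: "coord \<Rightarrow> coord \<Rightarrow> real" where
  "pq_coeff a b = (if \<exists>i. a = Q i \<and> b = P i then 1 else if \<exists>i. a = P i \<and> b = Q i then -1 else 0)"

text \<open>The double sum in \<open>normal_form\<close> runs over both orders of \<open>i\<close>
  and \<open>j\<close>, so an entry collects \<open>\<gamma> i j - \<gamma> j i\<close>, which is
  \<open>2 * \<gamma> i j\<close> for skew \<open>\<gamma>\<close>.\<close>

definition z_coeff :: "(nat \<Rightarrow> nat \<Rightarrow> real) \<Rightarrow> coord \<Rightarrow> coord \<Rightarrow> real" where
  "z_coeff \<gamma> a b = (case a of Z i \<Rightarrow> (case b of Z j \<Rightarrow> \<gamma> i j - \<gamma> j i | _ \<Rightarrow> 0) | _ \<Rightarrow> 0)"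

definition normal_coeff :: "(nat \<Rightarrow> nat \<Rightarrow> real) \<Rightarrow> coord \<Rightarrow> coord \<Rightarrow> real" where
  "normal_coeff \<gamma> a b = pq_coeff a b + z_coeff \<gamma> a b"

lemma normal_coeff_simps:
  "normal_coeff \<gamma> (P i) (P j) = 0" "normal_coeff \<gamma> (P i) (Q j) = (if i = j then -1 else 0)" "normal_coeff \<gamma> (P i) (Z j) = 0"
  "normal_coeff \<gamma> (Q i) (P j) = (if i = j then 1 else 0)" "normal_coeff \<gamma> (Q i) (Q j) = 0" "normal_coeff \<gamma> (Q i) (Z j) = 0"
  "normal_coeff \<gamma> (Z i) (P j) = 0" "normal_coeff \<gamma> (Z i) (Q j) = 0" "normal_coeff \<gamma> (Z i) (Z j) = \<gamma> i j - \<gamma> j i"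
  by (auto simp: normal_coeff_def pq_coeff_def z_coeff_def)

lemma wedge_axis_entry:
  fixes e :: "coord \<Rightarrow> 'n::finite"
  assumes e: "inj_on e C" and abcd: "a \<in> C" "b \<in> C" "c \<in> C" "d \<in> C"
  shows "(wedge (coord_vf e c) (coord_vf e d) $ e a) $ e b =
    (if a = c \<and> b = d then 1 else 0) - (if a = d \<and> b = c then 1 else 0)"
proof -
  have eq: "e x = e y \<longleftrightarrow> x = y" if "x \<in> C" "y \<in> C" for x y using e that by (auto simp: inj_on_def)
  have ax: "axis (e x) (1::real) $ e y = (if y = x then 1 else 0)" if "x \<in> C" "y \<in> C" for x y
    using eq[OF that(2,1)] by (simp add: axis_def)
  have w: "(wedge v w $ k) $ l = v $ k * w $ l - w $ k * v $ l" for v w :: "real ^ 'n" and k l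
    by (simp add: wedge_def)
  show ?thesis
    unfolding w ax[OF abcd(3,1)] ax[OF abcd(3,2)] ax[OF abcd(4,1)] ax[OF abcd(4,2)]
    by (cases "a = c"; cases "b = d"; cases "a = d"; cases "b = c") simp_all
qed

lemma normal_form_entry:
  assumes e: "bij_betw e (coords r s) UNIV" and ab: "a \<in> coords r s" "b \<in> coords r s"
  shows "(normal_form r s e \<gamma> $ e a) $ e b = normal_coeff \<gamma> a b"
proof -
  have inj: "inj_on e (coords r s)" using e by (simp add: bij_betw_def)
  note w = wedge_axis_entry[OF inj ab]
  have 1: "(\<Sum>i<r. (wedge (coord_vf e (Q i)) (coord_vf e (P i)) $ e a) $ e b) =
      (\<Sum>i<r. (if a = Q i \<and> b = P i then 1 else 0) - (if a = P i \<and> b = Q i then 1 else 0))"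
    by (intro sum.cong refl w) (auto intro: coords_intros)
  have 2: "(\<Sum>i<s. \<Sum>j<s. \<gamma> i j * (wedge (coord_vf e (Z i)) (coord_vf e (Z j)) $ e a) $ e b) =
      (\<Sum>i<s. \<Sum>j<s. \<gamma> i j * ((if a = Z i \<and> b = Z j then 1 else 0) - (if a = Z j \<and> b = Z i then 1 else 0)))"
    by (intro sum.cong refl arg_cong2[where f="(*)"] w) (auto intro: coords_intros)
  have "(normal_form r s e \<gamma> $ e a) $ e b =
      (\<Sum>i<r. (if a = Q i \<and> b = P i then 1 else 0) - (if a = P i \<and> b = Q i then 1 else 0)) +
      (\<Sum>i<s. \<Sum>j<s. \<gamma> i j * ((if a = Z i \<and> b = Z j then 1 else 0) - (if a = Z j \<and> b = Z i then 1 else 0)))"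
    unfolding 1[symmetric] 2[symmetric] by (simp add: normal_form_def sum_component)
  also have "(\<Sum>i<r. (if a = Q i \<and> b = P i then 1 else 0) - (if a = P i \<and> b = Q i then 1 else 0)) = pq_coeff a b"
  proof -
    consider i where "a = Q i" "b = P i" "i < r" | i where "a = P i" "b = Q i" "i < r"
      | "\<not> (\<exists>i. a = Q i \<and> b = P i)" "\<not> (\<exists>i. a = P i \<and> b = Q i)"
      using ab by (fastforce simp: coords_def)
    then show ?thesis
    proof cases
      case (1 i)
      have "(\<Sum>k<r. (if Q i = Q k \<and> P i = P k then 1 else 0) - (if Q i = P k \<and> P i = Q k then 1 else (0::real))) = (\<Sum>k<r. if k = i then 1 else 0)"
        by (intro sum.cong refl) auto
      then show ?thesis using 1 by (simp add: pq_coeff_def)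
    next
      case (2 i)
      have "(\<Sum>k<r. (if P i = Q k \<and> Q i = P k then 1 else 0) - (if P i = P k \<and> Q i = Q k then 1 else (0::real))) = (\<Sum>k<r. if k = i then -1 else 0)"
        by (intro sum.cong refl) auto
      then show ?thesis using 2 by (simp add: pq_coeff_def)
    next
      case 3
      have "(\<Sum>i<r. (if a = Q i \<and> b = P i then 1 else 0) - (if a = P i \<and> b = Q i then 1 else (0::real))) = 0"
        using 3 by (intro sum.neutral ballI) auto
      then show ?thesis using 3 by (simp only: pq_coeff_def if_False)
    qed
  qed
  also have "(\<Sum>i<s. \<Sum>j<s. \<gamma> i j * ((if a = Z i \<and> b = Z j then 1 else 0) - (if a = Z j \<and> b = Z i then 1 else 0))) = z_coeff \<gamma> a b"
  proof (cases "\<exists>i j. a = Z i \<and> b = Z j")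
    case True
    then obtain i j where a: "a = Z i" and b: "b = Z j" by blast
    have ij: "i < s" "j < s" using ab a b by (auto simp: coords_def)
    have "(\<Sum>k<s. \<Sum>l<s. \<gamma> k l * ((if Z i = Z k \<and> Z j = Z l then 1 else 0) - (if Z i = Z l \<and> Z j = Z k then 1 else 0))) =
        (\<Sum>k<s. \<Sum>l<s. (if l = j then (if k = i then \<gamma> k l else 0) else 0)) -
        (\<Sum>k<s. \<Sum>l<s. (if l = i then (if k = j then \<gamma> k l else 0) else 0))"
      unfolding sum_subtractf[symmetric] by (intro sum.cong refl) auto
    also have "\<dots> = \<gamma> i j - \<gamma> j i" using ij by simp
    finally show ?thesis unfolding a b by (simp add: z_coeff_def)
  next
    case False
    have "(\<Sum>i<s. \<Sum>j<s. \<gamma> i j * ((if a = Z i \<and> b = Z j then 1 else 0) - (if a = Z j \<and> b = Z i then 1 else 0))) = 0"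
    proof -
      have "\<not> (a = Z i \<and> b = Z j)" for i j using False by blast
      then show ?thesis by (simp only: if_False) simp
    qed
    moreover have "z_coeff \<gamma> a b = 0"
      using False by (auto simp: z_coeff_def split: coord.splits)
    ultimately show ?thesis by simp
  qed
  also have "pq_coeff a b + z_coeff \<gamma> a b = normal_coeff \<gamma> a b" by (simp add: normal_coeff_def)
  finally show ?thesis .
qed

lemma matrix_eq_entriesI:
  fixes M N :: "real ^ 'n ^ 'n"
  assumes e: "bij_betw e C UNIV" and eq: "\<And>a b. a \<in> C \<Longrightarrow> b \<in> C \<Longrightarrow> (M $ e a) $ e b = (N $ e a) $ e b"
  shows "M = N"
proof -
  have "(M $ k) $ l = (N $ k) $ l" for k l
  proof -
    obtain a b where "a \<in> C" "k = e a" "b \<in> C" "l = e b" using e by (metis UNIV_I bij_betw_imp_surj_on imageE)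
    then show ?thesis using eq by simp
  qed
  then show ?thesis by (simp add: Finite_Cartesian_Product.vec_eq_iff)
qed

lemma axis_vector_matrix_mult: "axis k (1::real) v* M = M $ k"
proof -
  have "(axis k (1::real) v* M) $ l = (M $ k) $ l" for l
  proof -
    have "(axis k (1::real) v* M) $ l = (\<Sum>i\<in>UNIV. if i = k then (M $ i) $ l else 0)"
      unfolding vector_matrix_mult_def vec_lambda_beta by (intro sum.cong refl) (simp add: axis_def)
    then show ?thesis by simp
  qed
  then show ?thesis by (simp add: Finite_Cartesian_Product.vec_eq_iff)
qed

text \<open>The rows with index \<open>P\<close> or \<open>Q\<close> are, up to sign, the coordinate
  vectors of the conjugate directions, so the image always contains their span, of dimension
  \<open>2 * r\<close>. It is no larger exactly when the \<open>Z\<close> rows vanish, whose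
  \<open>Z\<close> entries are \<open>2 * \<gamma> i j\<close>.\<close>

lemma normal_form_rank:
  fixes e :: "coord \<Rightarrow> 'n::finite"
  assumes e: "bij_betw e (coords r s) UNIV" and skew: "\<And>i j. i < s \<Longrightarrow> j < s \<Longrightarrow> \<gamma> i j = - \<gamma> j i"
  shows "dim (range (\<lambda>\<xi>. \<xi> v* normal_form r s e \<gamma>)) = 2 * r \<longleftrightarrow> (\<forall>i<s. \<forall>j<s. \<gamma> i j = 0)"
proof -
  let ?N = "normal_form r s e \<gamma>"
  let ?H = "range (\<lambda>\<xi>::real ^ 'n. \<xi> v* ?N)"
  define C where "C = P ` {..<r} \<union> Q ` {..<r}"
  define B :: "(real ^ 'n) set" where "B = (\<lambda>a. axis (e a) 1) ` C"
  have inj: "inj_on e (coords r s)" using e by (simp add: bij_betw_def)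
  have CC: "C \<subseteq> coords r s" by (auto simp: C_def coords_def)
  have injC: "inj_on (\<lambda>a. axis (e a) (1::real)) C"
  proof (rule inj_onI)
    fix x y assume "x \<in> C" "y \<in> C" "axis (e x) (1::real) = axis (e y) 1"
    then show "x = y" using inj CC by (auto simp: axis_eq_axis inj_on_def)
  qed
  have "card C = 2 * r"
  proof -
    have "card C = card (P ` {..<r}) + card (Q ` {..<r})" unfolding C_def by (rule card_Un_disjoint) auto
    then show ?thesis by (simp add: card_image inj_on_def)
  qed
  then have cardB: "card B = 2 * r" unfolding B_def by (simp add: card_image[OF injC])
  have indB: "independent B"
    by (rule independent_mono[OF independent_Basis]) (auto simp: B_def Basis_vec_def)
  have dimB: "dim (span B) = 2 * r" using dim_eq_card_independent[OF indB] cardB by simp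
  have linN: "linear (\<lambda>\<xi>::real ^ 'n. \<xi> v* ?N)"
    by (rule linearI) (simp_all add: vector_matrix_mult_def Finite_Cartesian_Product.vec_eq_iff distrib_left sum.distrib sum_distrib_left algebra_simps)
  have subH: "subspace ?H" using linear_subspace_image[OF linN subspace_UNIV] .
  have row: "axis (e a) 1 v* ?N = (\<Sum>b\<in>coords r s. normal_coeff \<gamma> a b *\<^sub>R axis (e b) 1)" if "a \<in> coords r s" for a
  proof -
    have "axis (e a) 1 v* ?N = (\<Sum>k\<in>UNIV. (?N $ e a) $ k *\<^sub>R axis k 1)"
      by (simp only: axis_vector_matrix_mult axis_expansion)
    also have "\<dots> = (\<Sum>b\<in>coords r s. (?N $ e a) $ e b *\<^sub>R axis (e b) 1)"
      by (rule sum.reindex_bij_betw[OF e, symmetric])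
    also have "\<dots> = (\<Sum>b\<in>coords r s. normal_coeff \<gamma> a b *\<^sub>R axis (e b) 1)"
      by (intro sum.cong refl) (simp add: normal_form_entry[OF e that])
    finally show ?thesis .
  qed
  have fin: "finite (coords r s)" by (rule coords_finite_card(1))
  have rowQ: "axis (e (Q i)) 1 v* ?N = axis (e (P i)) 1" if "i < r" for i
  proof -
    have "(\<Sum>b\<in>coords r s. normal_coeff \<gamma> (Q i) b *\<^sub>R axis (e b) 1) = (\<Sum>b\<in>coords r s. if b = P i then axis (e b) 1 else 0)"
      by (intro sum.cong refl) (rename_tac b, case_tac b, simp_all add: normal_coeff_simps)
    then show ?thesis using row[OF coords_intros(2)[OF that]] fin coords_intros(1)[OF that] by simp
  qed
  have rowP: "axis (e (P i)) 1 v* ?N = - axis (e (Q i)) 1" if "i < r" for i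
  proof -
    have "(\<Sum>b\<in>coords r s. normal_coeff \<gamma> (P i) b *\<^sub>R axis (e b) 1) = (\<Sum>b\<in>coords r s. if b = Q i then - axis (e b) 1 else 0)"
      by (intro sum.cong refl) (rename_tac b, case_tac b, simp_all add: normal_coeff_simps)
    then show ?thesis using row[OF coords_intros(1)[OF that]] fin coords_intros(2)[OF that] by simp
  qed
  have rowZ: "(axis (e (Z i)) 1 v* ?N) $ e (Z j) = 2 * \<gamma> i j" if "i < s" "j < s" for i j
    using normal_form_entry[OF e coords_intros(3)[OF that(1)] coords_intros(3)[OF that(2)]] skew[OF that]
    by (simp add: axis_vector_matrix_mult normal_coeff_simps)
  have BH: "B \<subseteq> ?H"
  proof
    fix x assume "x \<in> B"
    then obtain i where i: "i < r" "x = axis (e (P i)) 1 \<or> x = axis (e (Q i)) 1" by (auto simp: B_def C_def)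
    have "axis (e (P i)) 1 \<in> ?H" using rowQ[OF i(1)] by (metis rangeI)
    moreover have "- axis (e (Q i)) 1 \<in> ?H" using rowP[OF i(1)] by (metis rangeI)
    then have "axis (e (Q i)) 1 \<in> ?H" using subspace_neg[OF subH] by (metis minus_minus)
    ultimately show "x \<in> ?H" using i(2) by blast
  qed
  have spanH: "span B \<subseteq> ?H" by (rule span_minimal[OF BH subH])
  show ?thesis
  proof
    assume "dim ?H = 2 * r"
    then have HB: "span B = ?H"
      using subspace_dim_equal[OF subspace_span subH spanH] dimB by simp
    have B0: "x $ e (Z j) = 0" if "x \<in> span B" "j < s" for x j
    proof -
      have lin: "linear (\<lambda>x::real ^ 'n. x $ e (Z j))" by (simp add: bounded_linear.linear bounded_linear_vec_nth)
      show ?thesis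
      proof (rule linear_eq_0_on_span[OF lin _ that(1)])
        fix y assume "y \<in> B"
        then obtain a where a: "a \<in> C" "y = axis (e a) 1" by (auto simp: B_def)
          have "e (Z j) \<noteq> e a"
          proof
            assume "e (Z j) = e a"
            then have "Z j = a" using inj_onD[OF inj] coords_intros(3)[OF that(2)] CC a(1) by blast
            then show False using a(1) by (auto simp: C_def)
          qed
        then show "y $ e (Z j) = 0" using a(2) by (simp add: axis_def)
      qed
    qed
    show "\<forall>i<s. \<forall>j<s. \<gamma> i j = 0"
    proof (intro allI impI)
      fix i j assume ij: "i < s" "j < s"
      have "axis (e (Z i)) 1 v* ?N \<in> span B" unfolding HB by blast
      from B0[OF this ij(2)] show "\<gamma> i j = 0" using rowZ[OF ij] by simp
    qed
  next
    assume g0: "\<forall>i<s. \<forall>j<s. \<gamma> i j = 0"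
    have "?H \<subseteq> span B"
    proof clarify
      fix \<xi> :: "real ^ 'n"
      have "\<xi> v* ?N = (\<Sum>k\<in>UNIV. \<xi> $ k *\<^sub>R (axis k 1 v* ?N))" by (rule linear_axis_expansion[OF linN])
      also have "\<dots> = (\<Sum>a\<in>coords r s. \<xi> $ e a *\<^sub>R (axis (e a) 1 v* ?N))"
        by (rule sum.reindex_bij_betw[OF e, symmetric])
      also have "\<dots> \<in> span B"
      proof (rule span_sum, rule span_scale)
        fix a assume a: "a \<in> coords r s"
        then show "axis (e a) 1 v* ?N \<in> span B"
        proof (rule coordsE)
          fix i assume i: "i < r" "a = P i"
          have "axis (e (Q i)) 1 \<in> B" using i(1) by (auto simp: B_def C_def)
          then show ?thesis unfolding i(2) rowP[OF i(1)] by (intro span_neg span_base)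
        next
          fix i assume i: "i < r" "a = Q i"
          have "axis (e (P i)) 1 \<in> B" using i(1) by (auto simp: B_def C_def)
          then show ?thesis unfolding i(2) rowQ[OF i(1)] by (rule span_base)
        next
          fix i assume i: "i < s" "a = Z i"
          have "normal_coeff \<gamma> (Z i) b = 0" if "b \<in> coords r s" for b
            using that by (rule coordsE) (use g0 i(1) in \<open>auto simp: normal_coeff_simps\<close>)
          then have "axis (e (Z i)) 1 v* ?N = 0" using row[OF a] i(2) by simp
          then show ?thesis unfolding i(2) by (simp add: span_zero)
        qed
      qed
      finally show "\<xi> v* ?N \<in> span B" .
    qed
    then have "?H = span B" using spanH by blast
    then show "dim ?H = 2 * r" using dimB by simp
  qed
qed

lemma conjugate_entry:
  fixes J N :: "real ^ 'n ^ 'n"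
  shows "vec_nth (vec_nth (J ** N ** transpose J) k) l = inner (vec_nth J k) (N *v vec_nth J l)"
proof -
  have "vec_nth (vec_nth (J ** N ** transpose J) k) l =
      (\<Sum>m\<in>UNIV. (\<Sum>n\<in>UNIV. vec_nth (vec_nth J k) n * vec_nth (vec_nth N n) m) * vec_nth (vec_nth J l) m)"
    by (simp add: matrix_matrix_mult_def transpose_def)
  also have "\<dots> = (\<Sum>m\<in>UNIV. \<Sum>n\<in>UNIV. vec_nth (vec_nth J k) n * (vec_nth (vec_nth N n) m * vec_nth (vec_nth J l) m))"
    by (simp add: sum_distrib_right mult.assoc)
  also have "\<dots> = (\<Sum>n\<in>UNIV. \<Sum>m\<in>UNIV. vec_nth (vec_nth J k) n * (vec_nth (vec_nth N n) m * vec_nth (vec_nth J l) m))"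
    by (rule sum.swap)
  finally show ?thesis
    by (simp add: inner_vec_def matrix_vector_mult_def sum_distrib_left)
qed

text \<open>The \<open>r\<close> independent images force the span of the \<open>h i\<close> to have
  dimension at least \<open>r\<close>, so \<open>r\<close> generators of it are independent.\<close>

lemma independent_family_of_image:
  fixes J :: "'a::euclidean_space \<Rightarrow> 'b::euclidean_space" and h :: "nat \<Rightarrow> 'a"
  assumes J: "linear J" and inj: "inj_on (\<lambda>i. J (h i)) {..<r}" and ind: "independent ((\<lambda>i. J (h i)) ` {..<r})"
  shows "inj_on h {..<r}" and "independent (h ` {..<r})"
proof -
  show ih: "inj_on h {..<r}" using inj by (auto simp: inj_on_def)
  have "r = card ((\<lambda>i. J (h i)) ` {..<r})" using card_image[OF inj] by simp
  also have "\<dots> = dim (J ` (h ` {..<r}))" using dim_eq_card_independent[OF ind] by (simp add: image_image)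
  also have "\<dots> \<le> dim (h ` {..<r})" by (rule dim_image_le[OF J])
  finally have "card (h ` {..<r}) \<le> dim (span (h ` {..<r}))" using card_image[OF ih] by simp
  then show "independent (h ` {..<r})"
    by (intro card_le_dim_spanning[of _ "span (h ` {..<r})"]) (auto intro: span_base)
qed

text \<open>Invertibility of \<open>A g\<close> comes from multiplicativity, the inverse being the
  value of \<open>A\<close> at the inverse of \<open>g\<close>.\<close>

lemma hom_GL_I:
  assumes G: "group G" and A: "\<And>g. g \<in> carrier G \<Longrightarrow> A g \<in> carrier_mat s s"
    and one: "A \<one>\<^bsub>G\<^esub> = 1\<^sub>m s"
    and mult: "\<And>g h. g \<in> carrier G \<Longrightarrow> h \<in> carrier G \<Longrightarrow> A (g \<otimes>\<^bsub>G\<^esub> h) = A g * A h"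
  shows "A \<in> hom G (GL s)"
proof -
  interpret group G by (rule G)
  let ?R = "ring_mat TYPE(real) s ()"
  have u: "A g \<in> Units ?R" if g: "g \<in> carrier G" for g
  proof -
    have "A (inv\<^bsub>G\<^esub> g) * A g = 1\<^sub>m s" "A g * A (inv\<^bsub>G\<^esub> g) = 1\<^sub>m s"
      using mult[of "inv\<^bsub>G\<^esub> g" g] mult[of g "inv\<^bsub>G\<^esub> g"] g one by simp_all
    then show ?thesis using A[OF g] A[of "inv\<^bsub>G\<^esub> g"] g by (auto simp: Units_def ring_mat_simps)
  qed
  show ?thesis
    using u mult by (auto simp: hom_def units_of_def ring_mat_simps)
qed

section \<open>Comparison of the chart with the manifold\<close>

lemma tangent_matrix_eq_matrix:
  fixes c d :: "('m, real ^ 'n) chart"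
  assumes W: "open W" "snd c x \<in> W" and f: "f differentiable (at (snd c x))"
    and eq: "\<And>y. y \<in> W \<Longrightarrow> snd d (F (chart_inv c y)) = f y"
  shows "tangent_matrix c d F x = matrix (frechet_derivative f (at (snd c x)))"
proof -
  have "frechet_derivative (snd d \<circ> F \<circ> chart_inv c) (at (snd c x)) = frechet_derivative f (at (snd c x))"
    by (rule frechet_derivative_cong_open[OF W _ f]) (use eq in auto)
  then show ?thesis by (simp add: tangent_matrix_def jacobian_def)
qed

text \<open>In the chart \<open>c\<close> the map \<open>\<rho> g\<close> is a restriction of the
  linear map \<open>L g\<close>, so its tangent matrix is the constant matrix of \<open>L g\<close>,
  and preservation of the bivector becomes the transformation law that the locale asks for.\<close>

lemma invariant_poisson_chart:
  fixes c :: "('m, real ^ 'n) chart"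
  assumes PM: "poisson_manifold X \<A> \<pi>" and c: "c \<in> \<A>"
    and orth: "\<And>g. g \<in> H \<Longrightarrow> orthogonal_transformation (L g)"
    and inv: "\<And>g x. g \<in> H \<Longrightarrow> x \<in> fst c \<Longrightarrow> \<rho> g x \<in> fst c"
    and lin: "\<And>g x. g \<in> H \<Longrightarrow> x \<in> fst c \<Longrightarrow> snd c (\<rho> g x) = L g (snd c x)"
    and pres: "\<And>g. g \<in> H \<Longrightarrow> preserves_bivector \<A> \<pi> (\<rho> g)"
  shows "invariant_poisson (\<pi> c \<circ> chart_inv c) (snd c ` fst c) (L ` H)"
proof -
  have M: "smooth_manifold X \<A>" and B: "bivector_field \<A> \<pi>" using PM by (auto simp: poisson_manifold_def)
  have ch: "is_chart X c" using M c by (simp add: smooth_manifold_def)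
  have inv_c: "chart_inv c (snd c x) = x" if "x \<in> fst c" for x by (rule chart_inv_chart[OF ch that])
  have oc: "open (snd c ` fst c)" using ch by (simp add: is_chart_def)
  show ?thesis
  proof (rule invariant_poisson.intro)
    show "open (snd c ` fst c)" by (rule oc)
    have "smooth_fun_on \<A> (fst c) (\<pi> c)" using B c by (simp add: bivector_field_def)
    from smooth_fun_onD[OF this c] show "smooth_on (\<pi> c \<circ> chart_inv c) (snd c ` fst c)" by simp
    show "transpose ((\<pi> c \<circ> chart_inv c) y) = - (\<pi> c \<circ> chart_inv c) y" if "y \<in> snd c ` fst c" for y
    proof -
      have "transpose (\<pi> c x) = - \<pi> c x" if "x \<in> fst c" for x using B c that unfolding bivector_field_def by blast
      from this[OF chart_image_inv(1)[OF that]] show ?thesis by simp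
    qed
    show "orthogonal_transformation L'" if "L' \<in> L ` H" for L' using that orth by blast
    show "(\<pi> c \<circ> chart_inv c) (L' y) = matrix L' ** (\<pi> c \<circ> chart_inv c) y ** transpose (matrix L')"
      if L': "L' \<in> L ` H" and y: "y \<in> snd c ` fst c" for L' y
    proof -
      obtain g x where g: "g \<in> H" "L' = L g" and x: "x \<in> fst c" "y = snd c x" using L' y by blast
      have lg: "linear (L g)" using orth[OF g(1)] by (simp add: orthogonal_transformation_def)
      have D: "frechet_derivative (L g) (at y) = L g" for y
        using frechet_derivative_at[OF linear_imp_has_derivative[OF lg]] by metis
      have "tangent_matrix c c (\<rho> g) x = matrix (frechet_derivative (L g) (at (snd c x)))"
        by (rule tangent_matrix_eq_matrix[OF oc])
           (use x inv_c lin[OF g(1)] linear_imp_differentiable[OF lg] in auto)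
      then have T: "tangent_matrix c c (\<rho> g) x = matrix (L g)" by (simp only: D)
      have "\<pi> c (\<rho> g x) = tangent_matrix c c (\<rho> g) x ** \<pi> c x ** transpose (tangent_matrix c c (\<rho> g) x)"
        using pres[OF g(1)] c x(1) inv[OF g(1) x(1)] unfolding preserves_bivector_def by blast
      moreover have "chart_inv c (L g (snd c x)) = \<rho> g x"
        using inv_c[OF inv[OF g(1) x(1)]] lin[OF g(1) x(1)] by simp
      ultimately show ?thesis unfolding g(2) x(2) T by (simp add: inv_c[OF x(1)])
    qed
    show "pbr (\<pi> c \<circ> chart_inv c) f (pbr (\<pi> c \<circ> chart_inv c) g h) y + pbr (\<pi> c \<circ> chart_inv c) g (pbr (\<pi> c \<circ> chart_inv c) h f) y
        + pbr (\<pi> c \<circ> chart_inv c) h (pbr (\<pi> c \<circ> chart_inv c) f g) y = 0"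
      if "open W" "W \<subseteq> snd c ` fst c" "smooth_on f W" "smooth_on g W" "smooth_on h W" "y \<in> W" for W f g h y
      by (rule chart_jacobi[OF PM c that])
  qed
qed

text \<open>\<open>hamiltonian_vf\<close> is computed in an arbitrarily selected chart. The tangent
  matrix of the chart change carries the vectors computed in \<open>c\<close> to it, and
  independence of the images gives independence of the originals.\<close>

lemma independent_hamiltonian_vf_chart:
  fixes c :: "('m, real ^ 'n) chart" and p :: "nat \<Rightarrow> 'm \<Rightarrow> real"
  assumes M: "smooth_manifold X \<A>" and B: "bivector_field \<A> \<pi>" and c: "c \<in> \<A>" "m \<in> fst c"
    and p: "\<And>i. i < r \<Longrightarrow> smooth_fun_on \<A> V (p i)" and m: "m \<in> V"
    and inj: "inj_on (\<lambda>i. hamiltonian_vf \<A> \<pi> (p i) m) {..<r}"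
    and ind: "independent ((\<lambda>i. hamiltonian_vf \<A> \<pi> (p i) m) ` {..<r})"
  defines "h \<equiv> (\<lambda>i. hvf (\<pi> c \<circ> chart_inv c) (p i \<circ> chart_inv c) (snd c m))"
  shows "inj_on h {..<r}" and "independent (h ` {..<r})"
proof -
  let ?d = "chart_at \<A> m"
  define J where "J = tangent_matrix c ?d id m"
  have d: "?d \<in> \<A>" "m \<in> fst ?d" using chart_at[OF c] by auto
  have ch: "is_chart X c" using M c by (simp add: smooth_manifold_def)
  have eq: "hamiltonian_vf \<A> \<pi> (p i) m = J *v h i" if "i < r" for i
  proof -
    have "hamiltonian_vf \<A> \<pi> (p i) m = J *v sharp \<pi> c m (differential c (p i) m)"
      unfolding hamiltonian_vf_def sharp_change[OF B c d] J_def differential_change[OF M c d p[OF that] m] ..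
    then show ?thesis
      by (simp add: h_def hvf_def sharp_def differential_grad chart_inv_chart[OF ch c(2)])
  qed
  have "inj_on (\<lambda>i. J *v h i) {..<r}"
    using inj inj_on_cong[of "{..<r}" "\<lambda>i. J *v h i" "\<lambda>i. hamiltonian_vf \<A> \<pi> (p i) m"] eq by auto
  moreover have "(\<lambda>i. J *v h i) ` {..<r} = (\<lambda>i. hamiltonian_vf \<A> \<pi> (p i) m) ` {..<r}"
    by (rule image_cong) (use eq in auto)
  then have "independent ((\<lambda>i. J *v h i) ` {..<r})" using ind by simp
  ultimately show "inj_on h {..<r}" "independent (h ` {..<r})"
    using independent_family_of_image[where J="(*v) J" and h=h and r=r, OF matrix_vector_mul_linear] by auto
qed

text \<open>The rows of the Jacobian of the chart change are the gradients of the new coordinates,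
  so the tensor law expresses the components in \<open>d\<close> as brackets of these
  coordinates.\<close>

lemma bivector_field_entry:
  fixes c d :: "('m, real ^ 'n) chart"
  assumes M: "smooth_manifold X \<A>" and B: "bivector_field \<A> \<pi>" and c: "c \<in> \<A>" "x \<in> fst c" and d: "d \<in> \<A>" "x \<in> fst d"
    and W: "open W" "snd c x \<in> W" and f: "f differentiable (at (snd c x))"
    and eq: "\<And>y. y \<in> W \<Longrightarrow> snd d (chart_inv c y) = f y"
  shows "vec_nth (vec_nth (\<pi> d x) k) l = pbr (\<pi> c \<circ> chart_inv c) (\<lambda>y. vec_nth (f y) k) (\<lambda>y. vec_nth (f y) l) (snd c x)"
proof -
  define J where "J = tangent_matrix c d id x"
  have ch: "is_chart X c" using M c by (simp add: smooth_manifold_def)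
  have J: "J = matrix (frechet_derivative f (at (snd c x)))"
    unfolding J_def by (rule tangent_matrix_eq_matrix[OF W f]) (simp add: eq)
  have row: "vec_nth J k = grad (\<lambda>y. vec_nth (f y) k) (snd c x)" for k
    by (simp add: J matrix_def grad_def frechet_derivative_nth[OF f])
  have df: "(\<lambda>y. vec_nth (f y) l) differentiable (at (snd c x))"
    using f bounded_linear.has_derivative[OF bounded_linear_vec_nth] unfolding differentiable_def by blast
  have "\<pi> d x = J ** \<pi> c x ** transpose J"
    using B c d unfolding bivector_field_def J_def by blast
  then show ?thesis
    unfolding pbr_grad[OF df] by (simp only: conjugate_entry row comp_apply chart_inv_chart[OF ch c(2)])
qed

section \<open>The linear action on the transverse coordinates\<close>

text \<open>The action determines \<open>L g\<close> only on the image of the chart, which contains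
  a ball around 0; the group laws for \<open>L\<close> are verified there and extended by
  scaling.\<close>

lemma linear_eq_on_ball:
  fixes f g :: "'a::real_normed_vector \<Rightarrow> 'b::real_vector"
  assumes f: "linear f" and g: "linear g" and \<delta>: "\<delta> > 0" and eq: "\<And>x. x \<in> ball 0 \<delta> \<Longrightarrow> f x = g x"
  shows "f = g"
proof
  fix x :: 'a
  define t where "t = \<delta> / (norm x + 1)"
  have t: "t > 0" unfolding t_def using \<delta> by (simp add: add_nonneg_pos)
  have n1: "norm x + 1 > 0" by (simp add: add_nonneg_pos)
  have "\<delta> * norm x / (norm x + 1) < \<delta>" unfolding pos_divide_less_eq[OF n1] using \<delta> by (simp add: algebra_simps)
  then have "norm (t *\<^sub>R x) < \<delta>" using \<delta> t by (simp add: t_def)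
  then have "t *\<^sub>R f x = t *\<^sub>R g x" using eq[of "t *\<^sub>R x"] by (simp add: linear_scale[OF f] linear_scale[OF g])
  then show "f x = g x" using t by simp
qed

text \<open>These are the matrices of \<open>L g\<close> on the span of the orthonormal
  \<open>v i\<close>. Stability of the span makes them multiplicative, for then the expansion of
  \<open>L h (v i)\<close> in the \<open>v l\<close> is complete.\<close>

lemma compression_hom_GL:
  fixes v :: "nat \<Rightarrow> 'a::real_inner"
  assumes G: "group G" and lin: "\<And>g. g \<in> carrier G \<Longrightarrow> linear (L g)"
    and mult: "\<And>g h. g \<in> carrier G \<Longrightarrow> h \<in> carrier G \<Longrightarrow> L (g \<otimes>\<^bsub>G\<^esub> h) = L g \<circ> L h"
    and one: "L \<one>\<^bsub>G\<^esub> = id"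
    and v: "\<And>i j. i < s \<Longrightarrow> j < s \<Longrightarrow> inner (v i) (v j) = (if i = j then 1 else 0)"
    and stable: "\<And>g i. g \<in> carrier G \<Longrightarrow> i < s \<Longrightarrow> L g (v i) = (\<Sum>l<s. inner (v l) (L g (v i)) *\<^sub>R v l)"
  shows "(\<lambda>g. Matrix.mat s s (\<lambda>(j, i). inner (v j) (L g (v i)))) \<in> hom G (GL s)"
proof (rule hom_GL_I[OF G])
  show "Matrix.mat s s (\<lambda>(j, i). inner (v j) (L \<one>\<^bsub>G\<^esub> (v i))) = 1\<^sub>m s"
    by (rule eq_matI) (simp_all add: one v)
  fix g h assume g: "g \<in> carrier G" and h: "h \<in> carrier G"
  have "inner (v j) (L (g \<otimes>\<^bsub>G\<^esub> h) (v i)) = (\<Sum>l<s. inner (v j) (L g (v l)) * inner (v l) (L h (v i)))"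
    if "i < s" for i j
  proof -
    have "L (g \<otimes>\<^bsub>G\<^esub> h) (v i) = L g (L h (v i))" by (simp add: mult[OF g h])
    also have "\<dots> = L g (\<Sum>l<s. inner (v l) (L h (v i)) *\<^sub>R v l)" by (rule arg_cong[OF stable[OF h that]])
    also have "\<dots> = (\<Sum>l<s. inner (v l) (L h (v i)) *\<^sub>R L g (v l))"
      by (simp add: linear_sum[OF lin[OF g]] linear_scale[OF lin[OF g]])
    finally show ?thesis by (simp add: inner_sum_right mult.commute)
  qed
  then show "Matrix.mat s s (\<lambda>(j, i). inner (v j) (L (g \<otimes>\<^bsub>G\<^esub> h) (v i))) =
      Matrix.mat s s (\<lambda>(j, i). inner (v j) (L g (v i))) * Matrix.mat s s (\<lambda>(j, i). inner (v j) (L h (v i)))"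
    by (intro eq_matI) (simp_all add: scalar_prod_def atLeast0LessThan)
qed simp

section \<open>Functions of the transverse coordinates\<close>

text \<open>The point of coordinate space with \<open>p = q = 0\<close> and the given
  \<open>z\<close>.\<close>

definition z_embed :: "nat \<Rightarrow> (coord \<Rightarrow> 'n::finite) \<Rightarrow> real Matrix.vec \<Rightarrow> real ^ 'n" where
  "z_embed s e w = (\<Sum>j<s. vec_index w j *\<^sub>R axis (e (Z j)) 1)"

lemma z_embed_vec:
  fixes e :: "coord \<Rightarrow> 'n::finite"
  assumes e: "inj_on e (coords r s)"
  shows "z_embed s e (Matrix.vec s (\<lambda>j. vec_nth y (e (Z j)))) = z_projection s e y"
proof -
  have "(\<Sum>j<s. vec_nth y (e (Z j)) * vec_nth (axis (e (Z j)) 1) k) = vec_nth (z_projection s e y) k" for k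
  proof (cases "k \<in> (\<lambda>j. e (Z j)) ` {..<s}")
    case True
    then obtain j where j: "j < s" "k = e (Z j)" by auto
    have "(\<Sum>i<s. vec_nth y (e (Z i)) * vec_nth (axis (e (Z i)) 1) k) = (\<Sum>i<s. if i = j then vec_nth y k else 0)"
    proof (rule sum.cong[OF refl])
      fix i assume "i \<in> {..<s}"
      then have "e (Z i) = k \<longleftrightarrow> i = j"
        using inj_on_eq_iff[OF e coords_intros(3) coords_intros(3)[OF j(1)], of i] j(2) by auto
      then show "vec_nth y (e (Z i)) * vec_nth (axis (e (Z i)) 1) k = (if i = j then vec_nth y k else 0)"
        using j(2) by (auto simp: axis_def)
    qed
    then show ?thesis using True j(1) by (simp add: z_projection_def)
  next
    case False
    then have "(\<Sum>i<s. vec_nth y (e (Z i)) * vec_nth (axis (e (Z i)) 1) k) = (\<Sum>i<s. 0)"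
      by (intro sum.cong refl) (auto simp: axis_def)
    then show ?thesis using False by (simp add: z_projection_def)
  qed
  then show ?thesis
    unfolding z_embed_def Finite_Cartesian_Product.vec_eq_iff by (simp add: sum_component)
qed

lemma bounded_linear_z_projection: "bounded_linear (z_projection s e)"
  by (rule linear_conv_bounded_linear[THEN iffD1], rule linearI)
     (auto simp: z_projection_def Finite_Cartesian_Product.vec_eq_iff)

text \<open>On coordinate space, taking the \<open>z\<close> components and embedding them again is
  the linear map \<open>z_projection\<close>, so the function in question is a composition of smooth
  maps.\<close>

lemma smooth_in_z_embed:
  fixes e :: "coord \<Rightarrow> 'n::finite"
  assumes e: "inj_on e (coords r s)" and R: "open R" and f: "smooth_on f R" and D: "\<And>w. w \<in> D \<Longrightarrow> z_embed s e w \<in> R"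
  shows "smooth_in_z s e D (\<lambda>w. f (z_embed s e w))"
proof -
  have cont: "continuous_on UNIV (z_projection s e)"
    by (rule linear_continuous_on[OF bounded_linear_z_projection])
  have Y: "open (z_projection s e -` R)"
    using open_vimage[OF R cont] .
  have "smooth_on (\<lambda>y. f (z_projection s e y)) (z_projection s e -` R)"
    by (rule smooth_on_compose[OF Y R f smooth_on_linear[OF Y bounded_linear_z_projection]]) simp
  moreover have "{y. Matrix.vec s (\<lambda>j. vec_nth y (e (Z j))) \<in> D} \<subseteq> z_projection s e -` R"
    using D unfolding z_embed_vec[OF e, symmetric] by blast
  ultimately show ?thesis
    unfolding smooth_in_z_def z_embed_vec[OF e] by (rule smooth_on_subset)
qed

theorem theorem2p3:
  fixes X :: "'m topology"
    and \<A> :: "('m, real ^ 'n) chart set"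
    and \<pi> :: "('m, 'n) bivector_field"
    and G :: "('g, 'b) monoid_scheme"
    and T :: "'g topology"
    and \<G> :: "('g, 'e::real_normed_vector) chart set"
    and \<rho> :: "'g \<Rightarrow> 'm \<Rightarrow> 'm"
    and m :: 'm
    and r s :: nat
    and V :: "'m set"
    and p :: "nat \<Rightarrow> 'm \<Rightarrow> real"
  assumes "poisson_manifold X \<A> \<pi>"
    and "CARD('n) = 2 * r + s"
    and "compact_lie_group G T \<G>"
    and "smooth_action G T \<G> X \<A> \<rho>"
    and "\<forall>g\<in>carrier G. preserves_bivector \<A> \<pi> (\<rho> g)"
    and "m \<in> topspace X"
    and "\<forall>g\<in>carrier G. \<rho> g m = m"
    and "invariant_nbhd G \<rho> X m V"
    and "\<forall>i<r. smooth_fun_on \<A> V (p i)"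
    and "\<forall>i<r. \<forall>g\<in>carrier G. \<forall>x\<in>V. p i (\<rho> g x) = p i x"
    and "\<forall>i<r. p i m = 0"
    and "\<forall>i<r. \<forall>j<r. \<forall>x\<in>V. poisson_bracket \<A> \<pi> (p i) (p j) x = 0"
    and "inj_on (\<lambda>i. hamiltonian_vf \<A> \<pi> (p i) m) {..<r}"
    and "independent ((\<lambda>i. hamiltonian_vf \<A> \<pi> (p i) m) ` {..<r})"
  shows "\<exists>U q z \<phi> e \<gamma> A.
    invariant_nbhd G \<rho> X m U \<and> U \<subseteq> V \<and>
    (\<forall>i<r. smooth_fun_on \<A> U (q i)) \<and> (\<forall>j<s. smooth_fun_on \<A> U (z j)) \<and>
    local_coordinates \<A> r s p q z U \<phi> e \<and>
    (\<forall>i<r. p i m = 0 \<and> q i m = 0) \<and> (\<forall>j<s. z j m = 0) \<and>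
    (\<forall>i<s. \<forall>j<s. smooth_in_z s e (z_vec s z ` U) (\<gamma> i j)) \<and>
    (\<forall>i<s. \<forall>j<s. \<forall>w\<in>z_vec s z ` U. \<gamma> i j w = - \<gamma> j i w) \<and>
    (\<forall>x\<in>U. \<pi> (U, \<phi>) x =
       (\<Sum>i<r. wedge (coord_vf e (Q i)) (coord_vf e (P i))) +
       (\<Sum>i<s. \<Sum>j<s. \<gamma> i j (z_vec s z x) *\<^sub>R wedge (coord_vf e (Z i)) (coord_vf e (Z j)))) \<and>
    A \<in> hom G (GL s) \<and>
    (\<forall>g\<in>carrier G. \<forall>x\<in>U.
       (\<forall>i<r. p i (\<rho> g x) = p i x \<and> q i (\<rho> g x) = q i x) \<and>
       z_vec s z (\<rho> g x) = A g *\<^sub>v z_vec s z x) \<and>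
    (bivector_rank \<A> \<pi> m = 2 * r \<longleftrightarrow> (\<forall>i<s. \<forall>j<s. \<gamma> i j (0\<^sub>v s) = 0))"
proof -
  have M: "smooth_manifold X \<A>" and B: "bivector_field \<A> \<pi>" using assms(1) by (auto simp: poisson_manifold_def)
  have ch: "is_chart X c" if "c \<in> \<A>" for c using M that by (simp add: smooth_manifold_def)
  have V: "openin X V" "m \<in> V" using assms(8) by (auto simp: invariant_nbhd_def)
  have G: "group G" using assms(3) by (simp add: compact_lie_group_def lie_group_def)
  interpret G: group G by (rule G)
  have ga: "group_action G (topspace X) \<rho>" using assms(4) by (simp add: smooth_action_def)
  have fixm: "\<rho> g m = m" if "g \<in> carrier G" for g using assms(7) that by blast

  \<comment> \<open>The Poisson structure and the group law in a linearising chart\<close>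
  obtain c L where c: "c \<in> \<A>" "m \<in> fst c" and cV: "fst c \<subseteq> V" and cm: "snd c m = 0"
    and \<rho>c: "\<And>g x. g \<in> carrier G \<Longrightarrow> x \<in> fst c \<Longrightarrow> \<rho> g x \<in> fst c"
    and orth: "\<And>g. g \<in> carrier G \<Longrightarrow> orthogonal_transformation (L g)"
    and \<rho>L: "\<And>g x. g \<in> carrier G \<Longrightarrow> x \<in> fst c \<Longrightarrow> snd c (\<rho> g x) = L g (snd c x)"
    using linearizing_chart[OF M assms(3,4,6) fixm V] by blast
  define O1 where "O1 = snd c ` fst c"
  define \<pi>c where "\<pi>c = \<pi> c \<circ> chart_inv c"
  interpret ip: invariant_poisson \<pi>c O1 "L ` carrier G"
    unfolding \<pi>c_def O1_def
    by (rule invariant_poisson_chart[OF assms(1) c(1) orth \<rho>c \<rho>L]) (use assms(5) in auto)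
  have inv_c: "chart_inv c (snd c x) = x" if "x \<in> fst c" for x by (rule chart_inv_chart[OF ch[OF c(1)] that])
  have in_c: "chart_inv c y \<in> fst c" "snd c (chart_inv c y) = y" if "y \<in> O1" for y
    using chart_image_inv[of y c] that unfolding O1_def by auto
  have fcX: "fst c \<subseteq> topspace X" using ch[OF c(1)] openin_subset by (auto simp: is_chart_def)
  have "0 \<in> O1" using cm c(2) unfolding O1_def by force
  then obtain \<delta> where \<delta>: "\<delta> > 0" "ball 0 \<delta> \<subseteq> O1" using ip.S open_contains_ball by blast
  have linL: "linear (L g)" if "g \<in> carrier G" for g using orth[OF that] by (simp add: orthogonal_transformation_def)
  have Lmult: "L (g \<otimes>\<^bsub>G\<^esub> h) = L g \<circ> L h" if g: "g \<in> carrier G" and h: "h \<in> carrier G" for g h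
  proof (rule linear_eq_on_ball[OF linL linear_compose[OF linL[OF h] linL[OF g]] \<delta>(1)])
    show "g \<otimes>\<^bsub>G\<^esub> h \<in> carrier G" using g h by simp
    fix y :: "real ^ 'n" assume "y \<in> ball 0 \<delta>"
    then obtain x where x: "x \<in> fst c" "y = snd c x" using \<delta>(2) by (auto simp: O1_def)
    have "\<rho> (g \<otimes>\<^bsub>G\<^esub> h) x = \<rho> g (\<rho> h x)"
      using group_action.composition_rule[OF ga _ g h] x(1) fcX by blast
    then have "snd c (\<rho> (g \<otimes>\<^bsub>G\<^esub> h) x) = L g (L h y)"
      using \<rho>L[OF g \<rho>c[OF h x(1)]] \<rho>L[OF h x(1)] x(2) by simp
    then show "L (g \<otimes>\<^bsub>G\<^esub> h) y = (L g \<circ> L h) y"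
      using \<rho>L[OF G.m_closed[OF g h] x(1)] x(2) by simp
  qed
  have Lone: "L \<one>\<^bsub>G\<^esub> = id"
  proof (rule linear_eq_on_ball[OF linL[OF G.one_closed] linear_id \<delta>(1)])
    fix y :: "real ^ 'n" assume "y \<in> ball 0 \<delta>"
    then obtain x where x: "x \<in> fst c" "y = snd c x" using \<delta>(2) by (auto simp: O1_def)
    have "x \<in> topspace X" using x(1) fcX by blast
    then have "\<rho> \<one>\<^bsub>G\<^esub> x = x" using group_action.id_eq_one[OF ga] by (metis restrict_apply')
    then show "L \<one>\<^bsub>G\<^esub> y = id y" using \<rho>L[OF G.one_closed x(1)] x(2) by simp
  qed

  \<comment> \<open>The given functions in this chart\<close>
  define p' where "p' i = p i \<circ> chart_inv c" for i
  have p's: "smooth_on (p' i) (ball 0 \<delta>)" if "i < r" for i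
  proof -
    have "smooth_fun_on \<A> V (p i)" using assms(9) that by blast
    from smooth_fun_onD[OF this c(1)] have "smooth_on (p' i) O1"
      using cV by (simp add: p'_def O1_def Int_absorb2)
    then show ?thesis by (rule smooth_on_subset[OF _ \<delta>(2)])
  qed
  have p'0: "p' i 0 = 0" if "i < r" for i
    using assms(11) that inv_c[OF c(2)] cm by (simp add: p'_def)
  have p'inv: "p' i (L' y) = p' i y" if i: "i < r" and L': "L' \<in> L ` carrier G" and y: "y \<in> ball 0 \<delta>" for i L' y
  proof -
    obtain g where g: "g \<in> carrier G" "L' = L g" using L' by blast
    obtain x where x: "x \<in> fst c" "y = snd c x" using \<delta>(2) y by (auto simp: O1_def)
    have "chart_inv c (L g y) = \<rho> g x" using inv_c[OF \<rho>c[OF g(1) x(1)]] \<rho>L[OF g(1) x(1)] x(2) by simp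
    then show ?thesis using assms(10) i g x cV by (auto simp: p'_def inv_c)
  qed
  have p'br: "pbr \<pi>c (p' i) (p' j) y = 0" if "i < r" "j < r" "y \<in> ball 0 \<delta>" for i j y
  proof -
    have "y \<in> O1" using that(3) \<delta>(2) by blast
    then obtain x where x: "x \<in> fst c" "y = snd c x" by (auto simp: O1_def)
    have pij: "smooth_fun_on \<A> V (p i)" "smooth_fun_on \<A> V (p j)" "x \<in> V" using assms(9) that(1,2) x(1) cV by blast+
    show ?thesis using poisson_bracket_pbr[OF M B c(1) x(1) pij] assms(12) that(1,2) pij(3)
      unfolding x(2) \<pi>c_def p'_def by simp
  qed
  have p'ind: "inj_on (\<lambda>i. hvf \<pi>c (p' i) 0) {..<r}" "independent ((\<lambda>i. hvf \<pi>c (p' i) 0) ` {..<r})"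
    using independent_hamiltonian_vf_chart[OF M B c _ V(2) assms(13,14)] assms(9) unfolding \<pi>c_def p'_def cm by blast+

  \<comment> \<open>The normal form in Euclidean space\<close>
  obtain U and F z :: "nat \<Rightarrow> real ^ 'n \<Rightarrow> real" and v :: "nat \<Rightarrow> real ^ 'n" and e :: "coord \<Rightarrow> 'n" and \<Theta> \<Theta>' \<eta>
  where U: "open U" "0 \<in> U" "U \<subseteq> ball 0 \<delta>" and UL: "\<And>L' x. L' \<in> L ` carrier G \<Longrightarrow> x \<in> U \<Longrightarrow> L' x \<in> U"
    and Fp: "\<And>i. i < r \<Longrightarrow> F i = p' i" and Fs: "\<And>i. i < r + r \<Longrightarrow> smooth_on (F i) U"
    and F0: "\<And>i. i < r + r \<Longrightarrow> F i 0 = 0"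
    and FL: "\<And>i L' x. i < r + r \<Longrightarrow> L' \<in> L ` carrier G \<Longrightarrow> x \<in> U \<Longrightarrow> F i (L' x) = F i x"
    and zs: "\<And>j. j < s \<Longrightarrow> smooth_on (z j) U" and z0: "\<And>j. j < s \<Longrightarrow> z j 0 = 0"
    and e: "bij_betw e (coords r s) UNIV" and \<Theta>e: "\<And>a x. a \<in> coords r s \<Longrightarrow> \<Theta> x $ e a = coord_fun r F z a x"
    and \<eta>: "\<eta> > 0" and \<Theta>: "homeomorphism U (ball 0 \<eta>) \<Theta> \<Theta>'" "smooth_on \<Theta> U" "smooth_on \<Theta>' (ball 0 \<eta>)"
    and FF: "\<And>i j x. i < r + r \<Longrightarrow> j < r + r \<Longrightarrow> x \<in> U \<Longrightarrow> pbr \<pi>c (F i) (F j) x = ip.symplectic_const r i j"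
    and Fz: "\<And>i j x. i < r + r \<Longrightarrow> j < s \<Longrightarrow> x \<in> U \<Longrightarrow> pbr \<pi>c (F i) (z j) x = 0"
    and zz: "\<And>a b x. a < s \<Longrightarrow> b < s \<Longrightarrow> x \<in> U \<Longrightarrow> pbr \<pi>c (z a) (z b) (\<Theta>' (z_projection s e (\<Theta> x))) = pbr \<pi>c (z a) (z b) x"
    and zL: "\<And>L' x j. L' \<in> L ` carrier G \<Longrightarrow> x \<in> U \<Longrightarrow> j < s \<Longrightarrow> z j (L' x) = (\<Sum>i<s. inner (v j) (L' (v i)) * z i x)"
    and vL: "\<And>L' i. L' \<in> L ` carrier G \<Longrightarrow> i < s \<Longrightarrow> L' (v i) = (\<Sum>l<s. inner (v l) (L' (v i)) *\<^sub>R v l)"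
    and v: "\<And>i j. i < s \<Longrightarrow> j < s \<Longrightarrow> inner (v i) (v j) = (if i = j then 1 else 0)"
  proof (rule ip.local_normal_form[where p=p' and r=r and s=s and \<delta>=\<delta>, OF assms(2) \<delta> p's p'0], goal_cases)
    case (3 i L' y)
    then show ?case using p'inv by blast
  next
    case (4 i j y)
    then show ?case using p'br by blast
  next
    case (7 U F z v e \<Theta> \<Theta>' \<eta>)
    show ?case by (rule that) (fact 7)+
  qed (use p'ind in auto)
  have inj_e: "inj_on e (coords r s)" using e by (simp add: bij_betw_def)
  have UO: "U \<subseteq> O1" using U(3) \<delta>(2) by blast

  \<comment> \<open>Transport back to the manifold\<close>
  define UU where "UU = {x \<in> fst c. snd c x \<in> U}"
  define \<phi> where "\<phi> = \<Theta> \<circ> snd c"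
  have UUc: "x \<in> fst c" "snd c x \<in> U" if "x \<in> UU" for x using that by (auto simp: UU_def)
  have chart: "(UU, \<phi>) \<in> \<A>" "\<phi> ` UU = ball 0 \<eta>"
    unfolding UU_def \<phi>_def by (rule chart_compose[OF M c(1) U(1) UO[unfolded O1_def] open_ball \<Theta>])+
  have oUU: "openin X UU" unfolding UU_def by (rule chart_openin_preimage[OF ch[OF c(1)] U(1)])
  have mUU: "m \<in> UU" using c(2) U(2) cm by (simp add: UU_def)
  have \<rho>UU: "\<rho> g x \<in> UU" if "g \<in> carrier G" "x \<in> UU" for g x
    using that \<rho>c \<rho>L UL by (simp add: UU_def)
  have UUV: "UU \<subseteq> V" using cV by (auto simp: UU_def)
  have smooth_UU: "smooth_fun_on \<A> UU (f \<circ> snd c)" if "smooth_on f U" for f :: "real ^ 'n \<Rightarrow> real"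
  proof (rule smooth_fun_onI[OF M c(1) oUU])
    have "snd c ` UU = U" using UO by (auto simp: UU_def O1_def)
    moreover have "smooth_on ((f \<circ> snd c) \<circ> chart_inv c) U"
      by (rule smooth_on_cong[OF U(1) _ that]) (use in_c(2) UO in auto)
    ultimately show "smooth_on ((f \<circ> snd c) \<circ> chart_inv c) (snd c ` UU)" by simp
  qed (auto simp: UU_def)
  define q' where "q' i = F (r + i) \<circ> snd c" for i
  define z' where "z' j = z j \<circ> snd c" for j
  \<comment> \<open>The bracket is evaluated at the point with \<open>p = q = 0\<close>, which makes
    it a function of \<open>z\<close> by definition; \<open>zz\<close> says that its values on
    \<open>U\<close> are not changed by this.\<close>
  define \<gamma> where "\<gamma> i j w = (1 / 2) *\<^sub>R pbr \<pi>c (z i) (z j) (\<Theta>' (z_embed s e w))" for i j w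
  define A where "A = (\<lambda>g. Matrix.mat s s (\<lambda>(j, i). inner (v j) (L g (v i))))"
  have z_vec_\<phi>: "z_vec s z' x = Matrix.vec s (\<lambda>j. vec_nth (\<phi> x) (e (Z j)))" for x
    by (rule eq_vecI) (simp_all add: z_vec_def z'_def \<phi>_def \<Theta>e[OF coords_intros(3)])
  have embed: "z_embed s e (z_vec s z' x) = z_projection s e (\<phi> x)" for x
    unfolding z_vec_\<phi> by (rule z_embed_vec[OF inj_e])
  have embed_ball: "z_embed s e (z_vec s z' x) \<in> ball 0 \<eta>" if "x \<in> UU" for x
  proof -
    have "\<phi> x \<in> ball 0 \<eta>" using chart(2) that by blast
    then show ?thesis unfolding embed using norm_z_projection_le[of s e "\<phi> x"] by simp
  qed
  have \<gamma>z: "\<gamma> i j (z_vec s z' x) = (1 / 2) * pbr \<pi>c (z i) (z j) (snd c x)" if "i < s" "j < s" "x \<in> UU" for i j x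
    unfolding \<gamma>_def embed using zz[OF that(1,2) UUc(2)[OF that(3)]] by (simp add: \<phi>_def)
  have dF: "F i differentiable (at y)" if "i < r + r" "y \<in> U" for i y by (rule smooth_on_differentiable[OF Fs[OF that(1)] that(2)])
  have dz: "z j differentiable (at y)" if "j < s" "y \<in> U" for j y by (rule smooth_on_differentiable[OF zs[OF that(1)] that(2)])
  have zF: "pbr \<pi>c (z j) (F i) y = 0" if "i < r + r" "j < s" "y \<in> U" for i j y
    using ip.pbr_skew[OF dz[OF that(2,3)] dF[OF that(1,3)]] Fz[OF that] that(3) UO by auto
  have z_skew: "pbr \<pi>c (z i) (z j) y = - pbr \<pi>c (z j) (z i) y" if "i < s" "j < s" "y \<in> U" for i j y
    using ip.pbr_skew[OF dz[OF that(1,3)] dz[OF that(2,3)]] that(3) UO by auto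
  have \<gamma>skew: "\<gamma> i j (z_vec s z' x) = - \<gamma> j i (z_vec s z' x)" if "i < s" "j < s" "x \<in> UU" for i j x
    using \<gamma>z[OF that] \<gamma>z[OF that(2,1,3)] z_skew[OF that(1,2) UUc(2)[OF that(3)]] by simp
  \<comment> \<open>The two matrices are compared entry by entry: an entry on the left is the
    bracket of two of the adapted coordinates, which is known from \<open>FF\<close>,
    \<open>Fz\<close>, \<open>zF\<close> and \<open>\<gamma>z\<close>.\<close>
  have normal: "\<pi> (UU, \<phi>) x = normal_form r s e (\<lambda>i j. \<gamma> i j (z_vec s z' x))" if x: "x \<in> UU" for x
  proof (rule matrix_eq_entriesI[OF e])
    fix a b assume a: "a \<in> coords r s" and b: "b \<in> coords r s"
    let ?y = "snd c x" and ?\<gamma> = "\<lambda>i j. \<gamma> i j (z_vec s z' x)"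
    have y: "?y \<in> U" "?y \<in> O1" using UUc(2)[OF x] UO by auto
    have coord: "(\<lambda>y. vec_nth (\<Theta> y) (e a)) = coord_fun r F z a" if "a \<in> coords r s" for a
      using \<Theta>e[OF that] by blast
    have "vec_nth (vec_nth (\<pi> (UU, \<phi>) x) (e a)) (e b) =
        pbr (\<pi> c \<circ> chart_inv c) (\<lambda>y. vec_nth (\<Theta> y) (e a)) (\<lambda>y. vec_nth (\<Theta> y) (e b)) ?y"
      by (rule bivector_field_entry[OF M B c(1) UUc(1)[OF x] chart(1) _ U(1) y(1)])
         (use x y smooth_on_differentiable[OF \<Theta>(2)] in_c UO in \<open>auto simp: \<phi>_def\<close>)
    also have "\<dots> = pbr \<pi>c (coord_fun r F z a) (coord_fun r F z b) ?y"
      unfolding coord[OF a] coord[OF b] \<pi>c_def ..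
    also have "\<dots> = normal_coeff ?\<gamma> a b"
      using a
    proof (rule coordsE)
      fix i assume i: "i < r" "a = P i"
      show ?thesis
        using b by (rule coordsE) (use i y(1) in \<open>auto simp: normal_coeff_simps FF Fz ip.symplectic_const_def\<close>)
    next
      fix i assume i: "i < r" "a = Q i"
      show ?thesis
        using b by (rule coordsE) (use i y(1) in \<open>auto simp: normal_coeff_simps FF Fz ip.symplectic_const_def\<close>)
    next
      fix i assume i: "i < s" "a = Z i"
      show ?thesis
        using b
      proof (rule coordsE)
        fix j assume j: "j < s" "b = Z j"
        show ?thesis
          unfolding i(2) j(2) normal_coeff_simps
          using \<gamma>skew[OF j(1) i(1) x] \<gamma>z[OF i(1) j(1) x] by simp
      qed (use i y(1) in \<open>auto simp: normal_coeff_simps zF\<close>)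
    qed
    finally show "vec_nth (vec_nth (\<pi> (UU, \<phi>) x) (e a)) (e b) = vec_nth (vec_nth (normal_form r s e ?\<gamma>) (e a)) (e b)"
      unfolding normal_form_entry[OF e a b] .
  qed
  have zm: "z_vec s z' m = 0\<^sub>v s"
    by (rule eq_vecI) (simp_all add: z_vec_def z'_def cm z0)
  have p_eq: "F i (snd c x) = p i x" if "i < r" "x \<in> UU" for i x
    using Fp[OF that(1)] inv_c[OF UUc(1)[OF that(2)]] by (simp add: p'_def)
  show ?thesis
  proof (rule exI[of _ UU], rule exI[of _ q'], rule exI[of _ z'], rule exI[of _ \<phi>], rule exI[of _ e],
      rule exI[of _ \<gamma>], rule exI[of _ A], intro conjI)
    show "invariant_nbhd G \<rho> X m UU" using oUU mUU \<rho>UU by (auto simp: invariant_nbhd_def)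
    show "UU \<subseteq> V" by (rule UUV)
    show "\<forall>i<r. smooth_fun_on \<A> UU (q' i)" using smooth_UU Fs by (simp add: q'_def)
    show "\<forall>j<s. smooth_fun_on \<A> UU (z' j)" using smooth_UU zs by (simp add: z'_def)
    show "local_coordinates \<A> r s p q' z' UU \<phi> e"
      unfolding local_coordinates_def
      using chart(1) e p_eq by (auto simp: \<phi>_def q'_def z'_def \<Theta>e coords_intros)
    show "\<forall>i<r. p i m = 0 \<and> q' i m = 0" using assms(11) F0 by (simp add: q'_def cm)
    show "\<forall>j<s. z' j m = 0" by (simp add: z'_def cm z0)
    show "\<forall>i<s. \<forall>j<s. smooth_in_z s e (z_vec s z' ` UU) (\<gamma> i j)"
    proof (intro allI impI)
      fix i j assume ij: "i < s" "j < s"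
      have \<Theta>'U: "\<Theta>' y \<in> U" if "y \<in> ball 0 \<eta>" for y using \<Theta>(1) that by (auto simp: homeomorphism_def)
      have "smooth_on (\<lambda>y. pbr \<pi>c (z i) (z j) (\<Theta>' y)) (ball 0 \<eta>)"
        by (rule smooth_on_compose[OF open_ball U(1) ip.smooth_pbr[OF U(1) UO zs[OF ij(1)] zs[OF ij(2)]] \<Theta>(3) \<Theta>'U])
      then have "smooth_on (\<lambda>y. (1 / 2) *\<^sub>R pbr \<pi>c (z i) (z j) (\<Theta>' y)) (ball 0 \<eta>)"
        by (intro smooth_on_scaleR smooth_on_const open_ball)
      from smooth_in_z_embed[OF inj_e open_ball this, of "z_vec s z' ` UU"]
      show "smooth_in_z s e (z_vec s z' ` UU) (\<gamma> i j)"
        unfolding \<gamma>_def[abs_def] using embed_ball by blast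
    qed
    show "\<forall>i<s. \<forall>j<s. \<forall>w\<in>z_vec s z' ` UU. \<gamma> i j w = - \<gamma> j i w" using \<gamma>skew by blast
    show "\<forall>x\<in>UU. \<pi> (UU, \<phi>) x = (\<Sum>i<r. wedge (coord_vf e (Q i)) (coord_vf e (P i))) +
        (\<Sum>i<s. \<Sum>j<s. \<gamma> i j (z_vec s z' x) *\<^sub>R wedge (coord_vf e (Z i)) (coord_vf e (Z j)))"
      using normal unfolding normal_form_def by blast
    show "A \<in> hom G (GL s)"
      unfolding A_def by (rule compression_hom_GL[OF G linL Lmult Lone v]) (use vL in blast)+
    show "\<forall>g\<in>carrier G. \<forall>x\<in>UU. (\<forall>i<r. p i (\<rho> g x) = p i x \<and> q' i (\<rho> g x) = q' i x) \<and>
        z_vec s z' (\<rho> g x) = A g *\<^sub>v z_vec s z' x"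
    proof (intro ballI conjI allI impI)
      fix g x assume g: "g \<in> carrier G" and x: "x \<in> UU"
      have Lg: "L g \<in> L ` carrier G" using g by blast
      have \<rho>x: "snd c (\<rho> g x) = L g (snd c x)" by (rule \<rho>L[OF g UUc(1)[OF x]])
      show "p i (\<rho> g x) = p i x" if "i < r" for i using assms(10) that g x UUV by blast
      show "q' i (\<rho> g x) = q' i x" if "i < r" for i
        using FL[OF _ Lg UUc(2)[OF x], of "r + i"] that by (simp add: q'_def \<rho>x)
      show "z_vec s z' (\<rho> g x) = A g *\<^sub>v z_vec s z' x"
      proof (rule eq_vecI)
        fix j assume "j < dim_vec (A g *\<^sub>v z_vec s z' x)"
        then have j: "j < s" by (simp add: A_def)
        show "vec_index (z_vec s z' (\<rho> g x)) j = vec_index (A g *\<^sub>v z_vec s z' x) j"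
          using j zL[OF Lg UUc(2)[OF x] j] by (simp add: z_vec_def z'_def \<rho>x A_def scalar_prod_def atLeast0LessThan)
      qed (simp add: z_vec_def A_def)
    qed
    \<comment> \<open>The rank may be computed in the adapted chart, where the bivector at
      \<open>m\<close> is the normal form with \<open>z = 0\<close>.\<close>
    have "bivector_rank \<A> \<pi> m = dim (range (\<lambda>\<xi>. \<xi> v* normal_form r s e (\<lambda>i j. \<gamma> i j (0\<^sub>v s))))"
      using bivector_rank_chart[OF M B chart(1), of m] mUU normal[OF mUU] by (simp add: zm sharp_def[abs_def])
    moreover have "dim (range (\<lambda>\<xi>. \<xi> v* normal_form r s e (\<lambda>i j. \<gamma> i j (0\<^sub>v s)))) = 2 * r \<longleftrightarrow> (\<forall>i<s. \<forall>j<s. \<gamma> i j (0\<^sub>v s) = 0)"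
      by (rule normal_form_rank[OF e]) (rule \<gamma>skew[OF _ _ mUU, unfolded zm])
    ultimately show "bivector_rank \<A> \<pi> m = 2 * r \<longleftrightarrow> (\<forall>i<s. \<forall>j<s. \<gamma> i j (0\<^sub>v s) = 0)" by simp
  qed
qed

end
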